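(* Let $\mathbb{H}$ be a separable complex Hilbert space, $N$ a bounded normal operator on $\mathbb{H}$, and let $(\mathbb{S},\mathcal{S},\mu)$, $U$, $d$ be a spectral representation of $N$: $(\mathbb{S},\mathcal{S},\mu)$ is a $\sigma$-finite measure space, $U:\mathbb{H}\to L_2(\mu,\mathbb{C})$ is unitary, $d:\mathbb{S}\to\mathbb{C}$ is bounded and measurable, and $UNU^*=D$, where $Df=d\cdot f$. Let $(\varepsilon_k)_{k\in\mathbb{Z}}$ be i.i.d. $\mathbb{H}$-valued random variables with $E\varepsilon_0=0$ and $E\|\varepsilon_0\|^2<\infty$. Put $X_k=\sum_{j=0}^\infty (j+1)^{-N}\varepsilon_{k-j}$ and $S_n=\sum_{k=1}^n X_k$. Let $h(s)=\operatorname{Re} d(s)$ and $\sigma_U^2(s)=E|(U\varepsilon_0)(s)|^2$. Suppose that $h(s)\in(\tfrac12,1)$ for each $s\in\mathbb{S}$ and that the integrals $$\int_{\mathbb{S}}\frac{\sigma_U^2(s)}{(1-h(s))^2}\,\mu(ds)\quad\text{and}\quad\int_{\mathbb{S}}\frac{\sigma_U^2(s)}{(1-h(s))(2h(s)-1)}\,\mu(ds)$$ are finite. Then, with $H=\tfrac32 I-N$, $$n^{-H}S_n\xrightarrow{\;D\;}G\qquad (n\to\infty)$$ in $\mathbb{H}$, where $G$ is a zero-mean Gaussian $\mathbb{H}$-valued random variable with covariance operator $C_G:\mathbb{H}\to\mathbb{H}$, $$C_G(x)=U^*\left(r\mapsto\int_{\mathbb{S}}\frac{c(r,s)+\overline{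c(s,r)}}{(2-d(r,s))(3-d(r,s))}\,\sigma_U(r,s)\,(Ux)(s)\,\mu(ds)\right).$$
   Context: For a bounded operator $A$ and $a>0$, $a^{A}=\exp(A\log a)=\sum_{k\ge0}(A\log a)^k/k!$. The inner product $\langle\cdot,\cdot\rangle$ is linear in its first argument; $\langle f,g\rangle=\int f\overline g\,d\mu$ on $L_2(\mu,\mathbb{C})$. Notation: $d(r,s)=d(r)+\overline{d(s)}$; $\sigma_U(r,s)=E\big((U\varepsilon_0)(r)\overline{(U\varepsilon_0)(s)}\big)$; $c(r,s)=\operatorname{Beta}(1-d(r),d(r,s)-1)=\int_0^\infty x^{-d(r)}(x+1)^{-\overline{d(s)}}\,dx$. The series defining $X_k$ converges in $\mathbb{H}$ (in mean square and almost surely) under the hypotheses. An $\mathbb{H}$-valued random variable $Y$ is Gaussian if $f(Y)$ is a complex Gaussian random variable (real and imaginary parts jointly Gaussian, possibly degenerate) for every continuous linear $f:\mathbb{H}\to\mathbb{C}$. The covariance operator $C_G$ of a zero-mean $G$ is characterized by $E(\langle x,G\rangle\langle G,y\rangle)=\langle x,C_Gy\rangle$ for all $x,y\in\mathbb{H}$. $\xrightarrow{D}$ denotes convergence in distribution. *)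

theory Defs
  imports "HOL-Probability.Probability"
begin

section \<open>Complex Hilbert spaces\<close>

text \<open>
  A complex Hilbert space is given as a complete real inner product space with a complex scalar
  multiplication extending the real one and a complex inner product, linear in its first argument,
  whose real part is the real inner product; by \<open>cinner_self\<close> below the norm is the one induced by
  \<open>cinner\<close>.  Separability is the additional sort \<open>second_countable_topology\<close>.
\<close>

class complex_hilbert = banach + real_inner +
  fixes scaleC :: "complex \<Rightarrow> 'a \<Rightarrow> 'a"  (infixr \<open>*\<^sub>C\<close> 75)
    and cinner :: "'a \<Rightarrow> 'a \<Rightarrow> complex"
  assumes scaleC_add_right: "c *\<^sub>C (x + y) = c *\<^sub>C x + c *\<^sub>C y"
    and scaleC_add_left: "(b + c) *\<^sub>C x = b *\<^sub>C x + c *\<^sub>C x"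
    and scaleC_scaleC: "b *\<^sub>C c *\<^sub>C x = (b * c) *\<^sub>C x"
    and scaleC_of_real: "complex_of_real r *\<^sub>C x = r *\<^sub>R x"
    and cinner_add_left: "cinner (x + y) z = cinner x z + cinner y z"
    and cinner_scaleC_left: "cinner (c *\<^sub>C x) y = c * cinner x y"
    and cinner_commute: "cinner x y = cnj (cinner y x)"
    and Re_cinner: "Re (cinner x y) = inner x y"

lemma cinner_self: "cinner x x = complex_of_real ((norm x)\<^sup>2)"
proof (rule complex_eqI)
  show "Re (cinner x x) = Re (complex_of_real ((norm x)\<^sup>2))"
    by (simp add: Re_cinner power2_norm_eq_inner)
  show "Im (cinner x x) = Im (complex_of_real ((norm x)\<^sup>2))"
    using cinner_commute[of x x] by (metis Im_complex_of_real Reals_cnj_iff complex_is_Real_iff)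
qed

instantiation complex :: complex_hilbert
begin
definition scaleC_complex :: "complex \<Rightarrow> complex \<Rightarrow> complex"
  where "scaleC_complex c z = c * z"
definition cinner_complex :: "complex \<Rightarrow> complex \<Rightarrow> complex"
  where "cinner_complex w z = w * cnj z"
instance
  by standard
    (auto simp: scaleC_complex_def cinner_complex_def algebra_simps inner_complex_def scaleR_conv_of_real)
end


section \<open>Bounded operators\<close>

text \<open>
  The type \<open>'a \<Rightarrow>\<^sub>L 'b\<close> consists of the bounded real-linear maps, so complex homogeneity is a
  separate predicate.
\<close>

definition complex_linear :: "('a::complex_hilbert \<Rightarrow>\<^sub>L 'b::complex_hilbert) \<Rightarrow> bool"
  where "complex_linear A \<longleftrightarrow> (\<forall>c x. A (c *\<^sub>C x) = c *\<^sub>C A x)"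

definition op_adjoint :: "('a::complex_hilbert \<Rightarrow>\<^sub>L 'a) \<Rightarrow> ('a \<Rightarrow>\<^sub>L 'a)"
  where "op_adjoint A = (THE B :: 'a \<Rightarrow>\<^sub>L 'a. \<forall>x y. cinner (A x) y = cinner x (B y))"

definition normal_op :: "('a::complex_hilbert \<Rightarrow>\<^sub>L 'a) \<Rightarrow> bool"
  where "normal_op A \<longleftrightarrow> complex_linear A \<and> A o\<^sub>L op_adjoint A = op_adjoint A o\<^sub>L A"

text \<open>\<open>((o\<^sub>L) A ^^ k) id_blinfun\<close> is the \<open>k\<close>-th power of \<open>A\<close>; the series is taken in operator norm.\<close>

definition op_exp :: "('a::banach \<Rightarrow>\<^sub>L 'a) \<Rightarrow> ('a \<Rightarrow>\<^sub>L 'a)"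
  where "op_exp A = (\<Sum>k. ((o\<^sub>L) A ^^ k) id_blinfun /\<^sub>R fact k)"

definition op_powr :: "real \<Rightarrow> ('a::banach \<Rightarrow>\<^sub>L 'a) \<Rightarrow> ('a \<Rightarrow>\<^sub>L 'a)"
  where "op_powr a A = op_exp (ln a *\<^sub>R A)"


section \<open>Spectral representations on \<open>L\<^sub>2(\<mu>, \<complex>)\<close>\<close>

text \<open>
  Elements of \<open>L\<^sub>2\<close> are represented by functions, with equality in \<open>L\<^sub>2\<close> being equality almost
  everywhere.  Thus an operator \<open>U\<close> into \<open>L\<^sub>2\<close> is a map choosing, for each \<open>x\<close>, some representative
  \<open>U x\<close>, and all its properties are required only up to null sets.
\<close>

definition L2 :: "'s measure \<Rightarrow> ('s \<Rightarrow> complex) set"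
  where "L2 \<mu> = {f \<in> borel_measurable \<mu>. integrable \<mu> (\<lambda>s. (cmod (f s))\<^sup>2)}"

definition L2_inner :: "'s measure \<Rightarrow> ('s \<Rightarrow> complex) \<Rightarrow> ('s \<Rightarrow> complex) \<Rightarrow> complex"
  where "L2_inner \<mu> f g = (\<integral>s. f s * cnj (g s) \<partial>\<mu>)"

definition unitary_L2 :: "'s measure \<Rightarrow> ('a::complex_hilbert \<Rightarrow> 's \<Rightarrow> complex) \<Rightarrow> bool"
  where "unitary_L2 \<mu> U \<longleftrightarrow>
    (\<forall>x. U x \<in> L2 \<mu>) \<and>
    (\<forall>x y. AE s in \<mu>. U (x + y) s = U x s + U y s) \<and>
    (\<forall>c x. AE s in \<mu>. U (c *\<^sub>C x) s = c * U x s) \<and>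
    (\<forall>x y. L2_inner \<mu> (U x) (U y) = cinner x y) \<and>
    (\<forall>f\<in>L2 \<mu>. \<exists>x. AE s in \<mu>. U x s = f s)"

definition L2_adjoint :: "'s measure \<Rightarrow> ('a::complex_hilbert \<Rightarrow> 's \<Rightarrow> complex) \<Rightarrow> ('s \<Rightarrow> complex) \<Rightarrow> 'a"
  where "L2_adjoint \<mu> U f = (THE x. \<forall>y. L2_inner \<mu> (U y) f = cinner y x)"

definition spectral_representation ::
    "'s measure \<Rightarrow> ('a::complex_hilbert \<Rightarrow> 's \<Rightarrow> complex) \<Rightarrow> ('s \<Rightarrow> complex) \<Rightarrow> ('a \<Rightarrow>\<^sub>L 'a) \<Rightarrow> bool"
  where "spectral_representation \<mu> U d N \<longleftrightarrow>
    sigma_finite_measure \<mu> \<and> unitary_L2 \<mu> U \<and>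
    d \<in> borel_measurable \<mu> \<and> (\<exists>B. \<forall>s\<in>space \<mu>. cmod (d s) \<le> B) \<and>
    (\<forall>f\<in>L2 \<mu>. AE s in \<mu>. U (N (L2_adjoint \<mu> U f)) s = d s * f s)"


section \<open>Pointwise evaluation of \<open>L\<^sub>2\<close>-valued random variables\<close>

text \<open>
  The value \<open>(U \<epsilon>) (s)\<close> of the random element \<open>U \<epsilon>\<close> of \<open>L\<^sub>2\<close> at a point \<open>s\<close> makes sense as a random
  variable only for a jointly measurable version of \<open>U \<epsilon>\<close>: an arbitrary choice of representatives
  need not be measurable in \<open>\<omega>\<close>.  A version always exists (\<open>measurable_version_exists\<close>), and
  two versions agree almost everywhere for the product measure.
\<close>

definition measurable_version ::
    "'w measure \<Rightarrow> 's measure \<Rightarrow> ('w \<Rightarrow> 's \<Rightarrow> complex) \<Rightarrow> ('w \<Rightarrow> 's \<Rightarrow> complex) \<Rightarrow> bool"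
  where "measurable_version M \<mu> Y u \<longleftrightarrow>
    (\<lambda>(\<omega>, s). u \<omega> s) \<in> borel_measurable (M \<Otimes>\<^sub>M \<mu>) \<and>
    (AE \<omega> in M. AE s in \<mu>. u \<omega> s = Y \<omega> s)"

definition cross_moment :: "'w measure \<Rightarrow> ('w \<Rightarrow> 's \<Rightarrow> complex) \<Rightarrow> 's \<Rightarrow> 's \<Rightarrow> complex"
  where "cross_moment M u r s = (\<integral>\<omega>. u \<omega> r * cnj (u \<omega> s) \<partial>M)"

definition second_moment :: "'w measure \<Rightarrow> ('w \<Rightarrow> 's \<Rightarrow> complex) \<Rightarrow> 's \<Rightarrow> real"
  where "second_moment M u s = (\<integral>\<omega>. (cmod (u \<omega> s))\<^sup>2 \<partial>M)"

lemma unitary_L2_diff: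
  fixes U :: "'a::complex_hilbert \<Rightarrow> 's \<Rightarrow> complex"
  assumes U: "unitary_L2 \<mu> U"
  shows "integrable \<mu> (\<lambda>s. (cmod (U x s - U y s))\<^sup>2)"
    and "(\<integral>s. (cmod (U x s - U y s))\<^sup>2 \<partial>\<mu>) = (norm (x - y))\<^sup>2"
proof -
  have meas: "U z \<in> borel_measurable \<mu>" and int: "integrable \<mu> (\<lambda>s. (cmod (U z s))\<^sup>2)" for z
    using U by (auto simp: unitary_L2_def L2_def)
  have "AE s in \<mu>. U ((x - y) + y) s = U (x - y) s + U y s"
    using U unfolding unitary_L2_def by blast
  then have eq: "AE s in \<mu>. (cmod (U (x - y) s))\<^sup>2 = (cmod (U x s - U y s))\<^sup>2"
    by eventually_elim simp
  show "integrable \<mu> (\<lambda>s. (cmod (U x s - U y s))\<^sup>2)"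
    by (rule integrable_cong_AE_imp[OF int[of "x - y"]]) (use meas eq in auto)
  have "(\<integral>s. (cmod (U x s - U y s))\<^sup>2 \<partial>\<mu>) = (\<integral>s. (cmod (U (x - y) s))\<^sup>2 \<partial>\<mu>)"
    by (rule integral_cong_AE) (use meas eq in auto)
  also have "complex_of_real \<dots> = L2_inner \<mu> (U (x - y)) (U (x - y))"
    unfolding L2_inner_def by (simp add: complex_norm_square[symmetric] flip: integral_complex_of_real)
  also have "\<dots> = complex_of_real ((norm (x - y))\<^sup>2)"
    using U by (simp add: unitary_L2_def cinner_self)
  finally show "(\<integral>s. (cmod (U x s - U y s))\<^sup>2 \<partial>\<mu>) = (norm (x - y))\<^sup>2"
    by (simp only: of_real_eq_iff)
qed

lemma measurable_version_exists:
  fixes U :: "'a::{complex_hilbert, second_countable_topology} \<Rightarrow> 's \<Rightarrow> complex"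
  assumes U: "unitary_L2 \<mu> U" and \<epsilon>: "\<epsilon> \<in> borel_measurable M"
  shows "\<exists>u. measurable_version M \<mu> (\<lambda>\<omega>. U (\<epsilon> \<omega>)) u"
proof -
  obtain D :: "'a set" where D: "countable D" "\<And>X. open X \<Longrightarrow> X \<noteq> {} \<Longrightarrow> \<exists>d\<in>D. d \<in> X"
    using countable_dense_exists[where 'a = 'a] by blast
  then have "D \<noteq> {}" using open_UNIV by fastforce
  define a where "a = from_nat_into D"
  define r :: "nat \<Rightarrow> real" where "r k = (1/2) ^ k" for k
  have r: "r k > 0" for k by (simp add: r_def)
  have ex: "\<exists>i. dist (a i) x < r k" for x k
  proof -
    have "\<exists>d\<in>D. d \<in> ball x (r k)"
      by (rule D(2)) (use r in \<open>auto simp: ball_eq_empty not_le\<close>)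
    then show ?thesis
      unfolding a_def using from_nat_into_surj[OF D(1)] by (metis dist_commute mem_ball)
  qed
  define i where "i k x = (LEAST i. dist (a i) x < r k)" for k x
  have i: "dist (a (i k x)) x < r k" for k x
    unfolding i_def by (rule LeastI_ex) (rule ex)
  have [measurable]: "\<epsilon> \<in> borel_measurable M" by fact
  have [measurable]: "(\<lambda>\<omega>. i k (\<epsilon> \<omega>)) \<in> measurable M (count_space UNIV)" for k
    unfolding i_def by measurable
  have [measurable]: "U z \<in> borel_measurable \<mu>" for z
    using U by (auto simp: unitary_L2_def L2_def)
  define v where "v k p = U (a (i k (\<epsilon> (fst p)))) (snd p)" for k p
  have v: "v k \<in> borel_measurable (M \<Otimes>\<^sub>M \<mu>)" for k
    unfolding v_def
    by (rule measurable_compose_countable[where f = "\<lambda>j p. U (a j) (snd p)"]) measurable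
  define u where "u \<omega> s = lim (\<lambda>k. v k (\<omega>, s))" for \<omega> s
  have "(\<lambda>p. lim (\<lambda>k. v k p)) \<in> borel_measurable (M \<Otimes>\<^sub>M \<mu>)"
    by (rule borel_measurable_lim_metric) (rule v)
  then have 1: "(\<lambda>(\<omega>, s). u \<omega> s) \<in> borel_measurable (M \<Otimes>\<^sub>M \<mu>)"
    by (simp add: u_def case_prod_unfold)
  have 2: "AE s in \<mu>. u \<omega> s = U (\<epsilon> \<omega>) s" for \<omega>
  proof -
    define g where "g k s = (cmod (U (a (i k (\<epsilon> \<omega>))) s - U (\<epsilon> \<omega>) s))\<^sup>2" for k s
    have [measurable]: "g k \<in> borel_measurable \<mu>" for k unfolding g_def by measurable
    have gb: "(\<integral>\<^sup>+s. ennreal (g k s) \<partial>\<mu>) \<le> ennreal ((1/4) ^ k)" for k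
    proof -
      have "(\<integral>\<^sup>+s. ennreal (g k s) \<partial>\<mu>) = ennreal (\<integral>s. g k s \<partial>\<mu>)"
        unfolding g_def by (rule nn_integral_eq_integral) (use unitary_L2_diff(1)[OF U] in auto)
      also have "(\<integral>s. g k s \<partial>\<mu>) = (dist (a (i k (\<epsilon> \<omega>))) (\<epsilon> \<omega>))\<^sup>2"
        unfolding g_def by (simp add: unitary_L2_diff(2)[OF U] dist_norm)
      also have "\<dots> \<le> (r k)\<^sup>2" by (rule power_mono) (use i less_imp_le in auto)
      also have "\<dots> = (1/4) ^ k"
        by (simp add: r_def power2_eq_square flip: power_mult_distrib)
      finally show ?thesis by (simp add: ennreal_leI)
    qed
    have "(\<integral>\<^sup>+s. (\<Sum>k. ennreal (g k s)) \<partial>\<mu>) = (\<Sum>k. \<integral>\<^sup>+s. ennreal (g k s) \<partial>\<mu>)"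
      by (rule nn_integral_suminf) measurable
    also have "\<dots> \<le> (\<Sum>k. ennreal ((1/4) ^ k))"
      by (rule suminf_le) (use gb in auto)
    also have "\<dots> = ennreal (\<Sum>k. (1/4) ^ k)"
      by (rule suminf_ennreal2) (auto intro: summable_geometric)
    finally have "(\<integral>\<^sup>+s. (\<Sum>k. ennreal (g k s)) \<partial>\<mu>) \<noteq> \<infinity>"
      by (auto simp: top_unique)
    then have "AE s in \<mu>. (\<Sum>k. ennreal (g k s)) \<noteq> \<infinity>"
      by (intro nn_integral_PInf_AE) measurable
    then show ?thesis
    proof eventually_elim
      case (elim s)
      then have "summable (\<lambda>k. g k s)"
        by (intro summable_suminf_not_top) (auto simp: g_def)
      then have "(\<lambda>k. g k s) \<longlonglongrightarrow> 0" by (rule summable_LIMSEQ_zero)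
      then have "(\<lambda>k. sqrt (g k s)) \<longlonglongrightarrow> sqrt 0" by (rule tendsto_real_sqrt)
      then have "(\<lambda>k. U (a (i k (\<epsilon> \<omega>))) s) \<longlonglongrightarrow> U (\<epsilon> \<omega>) s"
        by (simp add: g_def tendsto_norm_zero_iff LIM_zero_iff)
      then show ?case unfolding u_def v_def by (simp add: limI)
    qed
  qed
  show ?thesis unfolding measurable_version_def using 1 2 by blast
qed


section \<open>Gaussian elements and convergence in distribution\<close>

text \<open>Gaussian laws on the reals may be degenerate.\<close>

definition real_gaussian :: "'w measure \<Rightarrow> ('w \<Rightarrow> real) \<Rightarrow> bool"
  where "real_gaussian M X \<longleftrightarrow> X \<in> borel_measurable M \<and>
    (\<exists>m \<sigma>. (\<sigma> > 0 \<and> distr M borel X = density lborel (normal_density m \<sigma>))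
         \<or> distr M borel X = return borel m)"

text \<open>Joint Gaussianity of the real and imaginary parts: all their linear combinations are Gaussian.\<close>

definition complex_gaussian :: "'w measure \<Rightarrow> ('w \<Rightarrow> complex) \<Rightarrow> bool"
  where "complex_gaussian M Z \<longleftrightarrow>
    (\<forall>a b. real_gaussian M (\<lambda>\<omega>. a * Re (Z \<omega>) + b * Im (Z \<omega>)))"

definition hilbert_gaussian :: "'w measure \<Rightarrow> ('w \<Rightarrow> 'a::complex_hilbert) \<Rightarrow> bool"
  where "hilbert_gaussian M Y \<longleftrightarrow> Y \<in> borel_measurable M \<and>
    (\<forall>f :: 'a \<Rightarrow>\<^sub>L complex. complex_linear f \<longrightarrow> complex_gaussian M (\<lambda>\<omega>. f (Y \<omega>)))"

definition has_covariance_operator ::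
    "'w measure \<Rightarrow> ('w \<Rightarrow> 'a::complex_hilbert) \<Rightarrow> ('a \<Rightarrow> 'a) \<Rightarrow> bool"
  where "has_covariance_operator M G C \<longleftrightarrow>
    (\<forall>x y. integrable M (\<lambda>\<omega>. cinner x (G \<omega>) * cinner (G \<omega>) y) \<and>
           (\<integral>\<omega>. cinner x (G \<omega>) * cinner (G \<omega>) y \<partial>M) = cinner x (C y))"

definition converges_in_distribution ::
    "'w measure \<Rightarrow> (nat \<Rightarrow> 'w \<Rightarrow> 'a::metric_space) \<Rightarrow> 'v measure \<Rightarrow> ('v \<Rightarrow> 'a) \<Rightarrow> bool"
  where "converges_in_distribution M Y M' G \<longleftrightarrow>
    (\<forall>n. Y n \<in> borel_measurable M) \<and> G \<in> borel_measurable M' \<and>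
    (\<forall>f :: 'a \<Rightarrow> real. continuous_on UNIV f \<and> bounded (range f) \<longrightarrow>
      (\<lambda>n. \<integral>\<omega>. f (Y n \<omega>) \<partial>M) \<longlonglongrightarrow> (\<integral>\<omega>. f (G \<omega>) \<partial>M'))"


section \<open>The linear process and the limiting covariance\<close>

definition lin_process ::
    "('a::complex_hilbert \<Rightarrow>\<^sub>L 'a) \<Rightarrow> (int \<Rightarrow> 'w \<Rightarrow> 'a) \<Rightarrow> int \<Rightarrow> 'w \<Rightarrow> 'a"
  where "lin_process N \<epsilon> k \<omega> = (\<Sum>j. op_powr (real j + 1) (- N) (\<epsilon> (k - int j) \<omega>))"

definition partial_sum ::
    "('a::complex_hilbert \<Rightarrow>\<^sub>L 'a) \<Rightarrow> (int \<Rightarrow> 'w \<Rightarrow> 'a) \<Rightarrow> nat \<Rightarrow> 'w \<Rightarrow> 'a"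
  where "partial_sum N \<epsilon> n \<omega> = (\<Sum>k=1..n. lin_process N \<epsilon> (int k) \<omega>)"

definition dsum :: "('s \<Rightarrow> complex) \<Rightarrow> 's \<Rightarrow> 's \<Rightarrow> complex"
  where "dsum d r s = d r + cnj (d s)"

definition c_coeff :: "('s \<Rightarrow> complex) \<Rightarrow> 's \<Rightarrow> 's \<Rightarrow> complex"
  where "c_coeff d r s = Beta (1 - d r) (dsum d r s - 1)"

definition limit_covariance ::
    "'w measure \<Rightarrow> 's measure \<Rightarrow> ('a::complex_hilbert \<Rightarrow> 's \<Rightarrow> complex) \<Rightarrow> ('s \<Rightarrow> complex) \<Rightarrow>
     ('w \<Rightarrow> 's \<Rightarrow> complex) \<Rightarrow> 'a \<Rightarrow> 'a"
  where "limit_covariance M \<mu> U d u x = L2_adjoint \<mu> U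
    (\<lambda>r. \<integral>s. (c_coeff d r s + cnj (c_coeff d s r)) / ((2 - dsum d r s) * (3 - dsum d r s))
              * cross_moment M u r s * U x s \<partial>\<mu>)"

end

theory Submission
  imports Defs
begin

text \<open>In the spectral representation every operator power acts by multiplication, so
  \<open>n\<^sup>-\<^sup>H S\<^sub>n\<close> is the sum over \<open>i \<ge> 0\<close> of independent terms in which \<open>\<epsilon>\<^bsub>n-i\<^esub>\<close> is multiplied by
  \<open>n\<^sup>-\<^sup>1\<^sup>/\<^sup>2 g\<^sub>n(i/n, d)\<close>, where the step functions \<open>g\<^sub>n\<close> converge to
  \<open>g(\<tau>, d) = (\<tau>\<^bsup>1-d\<^esup> - (\<tau>-1)\<^sub>+\<^bsup>1-d\<^esup>) / (1 - d)\<close> and are dominated by a function whose squared \<open>L\<^sub>2\<close> norm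
  in \<open>\<tau>\<close> is \<open>2/(1-h)\<^sup>2 + 1/(2h-1)\<close>. The two integrability hypotheses therefore make dominated convergence
  applicable to all second moments and to the Lindeberg sums. Characteristic functions then converge to the
  Gaussian ones and the traces converge as well, which excludes loss of mass in infinite dimensions.
  The limiting covariance kernel is \<open>\<integral> g(\<tau>, d(r)) cnj g(\<tau>, d(s)) d\<tau>\<close> times \<open>\<sigma>\<^sub>U(r, s)\<close>; the integral is evaluated
  by writing \<open>g\<close> as the integral of \<open>(\<tau>-v)\<^sub>+\<^bsup>-d\<^esup>\<close> over \<open>0 \<le> v \<le> 1\<close>.\<close>

section \<open>Orthonormal bases of separable Hilbert spaces\<close>

text \<open>The values d(s) may come arbitrarily close to 1/2 and to 1, so operator norms of the
  coefficients need not be square summable and no bound uniform in s is at hand. Estimates are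
  therefore made pointwise in s and averaged over the law of the innovation before they are summed
  over i; one integrable function of (\<tau>, \<omega>) then serves for all n. The almost sure
  convergence of the series for X_k comes from the same bound, as the row n = 1. The constants in
  the dominating norm come from a cut at \<tau> = 2: up to there the kernel is at most 1/(1-h),
  beyond it at most (\<tau>-1)^(-h). The limit need not be circularly symmetric, so the complex
  covariance operator alone does not determine its law. The space is thus also treated as a real
  Hilbert space: the law is fixed by the real form \<open>limit_form\<close>, and the complex
  covariance is recovered from the values of that form on x, y and their multiples by \<i>.\<close>

text \<open>Basis vectors may vanish, so finite-dimensional spaces are covered; Gram-Schmidt uses \<open>sgn 0 = 0\<close>.\<close>

definition orth_basis :: "(nat \<Rightarrow> 'a::real_inner) \<Rightarrow> bool"
  where "orth_basis e \<longleftrightarrow> (\<forall>i j. i \<noteq> j \<longrightarrow> inner (e i) (e j) = 0) \<and> (\<forall>i. e i = 0 \<or> norm (e i) = 1) \<and>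
    (\<forall>x. (\<lambda>m. \<Sum>i<m. inner x (e i) *\<^sub>R e i) \<longlonglongrightarrow> x)"

definition proj_upto :: "(nat \<Rightarrow> 'a::real_inner) \<Rightarrow> nat \<Rightarrow> 'a \<Rightarrow> 'a"
  where "proj_upto e m x = (\<Sum>i<m. inner x (e i) *\<^sub>R e i)"

function gram_schmidt :: "(nat \<Rightarrow> 'a::real_inner) \<Rightarrow> nat \<Rightarrow> 'a"
  where "gram_schmidt a n =
    sgn (a n - (\<Sum>i<n. inner (a n) (gram_schmidt a i) *\<^sub>R gram_schmidt a i))"
  by pat_completeness auto
termination
  by (relation "Wellfounded.measure snd") auto

declare gram_schmidt.simps [simp del]

text \<open>Both sides keep the factor \<open>e k\<close> so that a vanishing basis vector is
  allowed: its coefficient cannot be recovered, but it does not matter either.\<close>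

lemma inner_sum_orthogonal:
  fixes e :: "nat \<Rightarrow> 'a::real_inner"
  assumes orth: "\<And>i. i \<in> A \<Longrightarrow> i \<noteq> k \<Longrightarrow> inner (e i) (e k) = 0" and A: "finite A" "k \<in> A"
    and unit: "e k = 0 \<or> norm (e k) = 1"
  shows "inner (\<Sum>i\<in>A. c i *\<^sub>R e i) (e k) *\<^sub>R e k = c k *\<^sub>R e k"
proof -
  have "inner (\<Sum>i\<in>A. c i *\<^sub>R e i) (e k) = (\<Sum>i\<in>A. if i = k then c k * inner (e k) (e k) else 0)"
    unfolding inner_sum_left by (intro sum.cong) (use orth in auto)
  also have "\<dots> = c k * inner (e k) (e k)"
    using A by simp
  finally show ?thesis
    using unit by (auto simp: dot_square_norm)
qed

lemma gram_schmidt_norm: "gram_schmidt a n = 0 \<or> norm (gram_schmidt a n) = 1"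
  by (subst (1 2) gram_schmidt.simps) (auto simp: norm_sgn sgn_zero_iff)

lemma gram_schmidt_orthogonal_less:
  "i < n \<Longrightarrow> inner (gram_schmidt a n) (gram_schmidt a i) = 0"
proof (induction n arbitrary: i rule: less_induct)
  case (less n)
  let ?e = "gram_schmidt a"
  have orth: "inner (?e j) (?e i) = 0" if "j < n" "j \<noteq> i" for j
    using less.IH[of j i] less.IH[of i j] that less.prems by (cases "j < i") (auto simp: inner_commute)
  have "inner (\<Sum>j<n. inner (a n) (?e j) *\<^sub>R ?e j) (?e i) *\<^sub>R ?e i = inner (a n) (?e i) *\<^sub>R ?e i"
    by (rule inner_sum_orthogonal) (use orth less.prems gram_schmidt_norm in auto)
  then have "inner (\<Sum>j<n. inner (a n) (?e j) *\<^sub>R ?e j) (?e i) = inner (a n) (?e i)"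
    by auto
  then have "inner (a n - (\<Sum>j<n. inner (a n) (?e j) *\<^sub>R ?e j)) (?e i) = 0"
    by (simp add: inner_diff_left)
  then show ?case
    by (subst gram_schmidt.simps) (simp add: sgn_div_norm)
qed

lemma gram_schmidt_orthogonal:
  "i \<noteq> j \<Longrightarrow> inner (gram_schmidt a i) (gram_schmidt a j) = 0"
  using gram_schmidt_orthogonal_less[of i j a] gram_schmidt_orthogonal_less[of j i a]
  by (cases "i < j") (auto simp: inner_commute)

text \<open>The residual of the projection is orthogonal to the span of the first m vectors, so by
  Pythagoras any other combination is at least as far from x.\<close>

lemma proj_upto_best:
  assumes orth: "\<And>i j. i \<noteq> j \<Longrightarrow> inner (e i) (e j) = 0" and unit: "\<And>i. e i = 0 \<or> norm (e i) = 1"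
  shows "norm (x - proj_upto e m x) \<le> norm (x - (\<Sum>i<m. c i *\<^sub>R e i))"
proof -
  let ?p = "proj_upto e m x" and ?y = "\<Sum>i<m. c i *\<^sub>R e i"
  have res: "inner (x - ?p) (e k) = 0" if "k < m" for k
  proof -
    have "inner ?p (e k) *\<^sub>R e k = inner x (e k) *\<^sub>R e k"
      unfolding proj_upto_def by (rule inner_sum_orthogonal) (use that orth unit in auto)
    then show ?thesis by (auto simp: inner_diff_left)
  qed
  have "?p - ?y = (\<Sum>i<m. (inner x (e i) - c i) *\<^sub>R e i)"
    by (simp add: proj_upto_def sum_subtractf scaleR_diff_left)
  then have "inner (x - ?p) (?p - ?y) = 0"
    using res by (simp add: inner_sum_right)
  then have "(norm ((x - ?p) + (?p - ?y)))\<^sup>2 = (norm (x - ?p))\<^sup>2 + (norm (?p - ?y))\<^sup>2"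
    unfolding power2_norm_eq_inner
    by (simp only: inner_add_left inner_add_right inner_commute[of "?p - ?y" "x - ?p"])
  then have "(norm (x - ?p))\<^sup>2 \<le> (norm (x - ?y))\<^sup>2"
    by simp
  then show ?thesis by (rule power2_le_imp_le) simp
qed

text \<open>The span of the first k + 1 Gram-Schmidt vectors contains the first k + 1 points of a
  dense sequence, and the projection is the best approximation from that span. The error is thus at
  most the distance of x to a dense point, for all large m.\<close>

lemma orth_basis_exists:
  "\<exists>e :: nat \<Rightarrow> 'a::{real_inner, second_countable_topology}. orth_basis e"
proof -
  obtain D :: "'a set" where D: "countable D" "\<And>X. open X \<Longrightarrow> X \<noteq> {} \<Longrightarrow> \<exists>d\<in>D. d \<in> X"
    using countable_dense_exists by blast
  then have "D \<noteq> {}" using open_UNIV by fastforce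
  define a where "a = from_nat_into D"
  have dense: "\<exists>i. dist (a i) x < r" if "r > 0" for x r
  proof -
    have "\<exists>d\<in>D. d \<in> ball x r"
      by (rule D(2)) (use that in \<open>auto simp: ball_eq_empty not_le\<close>)
    then show ?thesis
      unfolding a_def using from_nat_into_surj[OF D(1)] by (metis dist_commute mem_ball)
  qed
  let ?e = "gram_schmidt a"
  have span: "\<exists>c. a k = (\<Sum>i<m. c i *\<^sub>R ?e i)" if "k < m" for k m
  proof -
    define v where "v = a k - (\<Sum>i<k. inner (a k) (?e i) *\<^sub>R ?e i)"
    \<comment> \<open>Undoes the normalisation by \<open>sgn\<close>; for v = 0 both sides
      vanish.\<close>
    have v: "v = norm v *\<^sub>R ?e k"
      by (cases "v = 0"; subst gram_schmidt.simps) (auto simp: v_def[symmetric] sgn_div_norm)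
    define c where "c i = (if i < k then inner (a k) (?e i) else if i = k then norm v else 0)" for i
    have "(\<Sum>i<m. c i *\<^sub>R ?e i) = (\<Sum>i<Suc k. c i *\<^sub>R ?e i)"
      by (rule sum.mono_neutral_right) (use that in \<open>auto simp: c_def\<close>)
    also have "\<dots> = (\<Sum>i<k. inner (a k) (?e i) *\<^sub>R ?e i) + norm v *\<^sub>R ?e k"
      by (simp add: c_def)
    also have "\<dots> = a k"
      by (subst v[symmetric]) (simp add: v_def)
    finally show ?thesis by metis
  qed
  have "(\<lambda>m. proj_upto ?e m x) \<longlonglongrightarrow> x" for x
  proof (rule metric_LIMSEQ_I)
    fix r :: real assume "r > 0"
    then obtain k where k: "dist (a k) x < r" using dense by blast
    have "dist (proj_upto ?e m x) x < r" if "m \<ge> Suc k" for m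
    proof -
      obtain c where c: "a k = (\<Sum>i<m. c i *\<^sub>R ?e i)" using span[of k m] \<open>m \<ge> Suc k\<close> by auto
      have "norm (x - proj_upto ?e m x) \<le> norm (x - a k)"
        unfolding c by (rule proj_upto_best) (use gram_schmidt_orthogonal[of _ _ a] gram_schmidt_norm[of a] in \<open>blast+\<close>)
      then show ?thesis using k by (simp add: dist_norm norm_minus_commute)
    qed
    then show "\<exists>no. \<forall>n\<ge>no. dist (proj_upto ?e n x) x < r" by blast
  qed
  then have "orth_basis ?e"
    unfolding orth_basis_def using gram_schmidt_orthogonal[of _ _ a] gram_schmidt_norm[of a]
    by (simp add: proj_upto_def)
  then show ?thesis by blast
qed

section \<open>Parseval identity, orthogonal series and Riesz representation\<close>

lemma orth_basisD:
  assumes "orth_basis e"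
  shows "i \<noteq> j \<Longrightarrow> inner (e i) (e j) = 0" "e i = 0 \<or> norm (e i) = 1" "(\<lambda>m. proj_upto e m x) \<longlonglongrightarrow> x"
  using assms by (auto simp: orth_basis_def proj_upto_def)

text \<open>Equality can fail when some \<open>e i\<close> vanishes, since its coefficient is then
  lost; the later estimates are upper bounds.\<close>

lemma norm_sum_orth_basis:
  assumes e: "orth_basis e" and "finite A"
  shows "(norm (\<Sum>i\<in>A. c i *\<^sub>R e i))\<^sup>2 \<le> (\<Sum>i\<in>A. (c i)\<^sup>2)"
proof -
  have "(norm (\<Sum>i\<in>A. c i *\<^sub>R e i))\<^sup>2 = (\<Sum>i\<in>A. norm (c i *\<^sub>R e i) ^ 2)"
    by (rule norm_sum_Pythagorean) (use orth_basisD[OF e] assms in \<open>auto simp: pairwise_def orthogonal_def\<close>)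
  also have "\<dots> \<le> (\<Sum>i\<in>A. (c i)\<^sup>2)"
  proof (rule sum_mono)
    show "(norm (c i *\<^sub>R e i))\<^sup>2 \<le> (c i)\<^sup>2" for i
      using orth_basisD(2)[OF e, of i] by (auto simp: power_mult_distrib)
  qed
  finally show ?thesis .
qed

lemma norm_proj_upto:
  assumes e: "orth_basis e"
  shows "(norm (proj_upto e m x))\<^sup>2 = (\<Sum>i<m. (inner x (e i))\<^sup>2)"
proof -
  have "(norm (proj_upto e m x))\<^sup>2 = (\<Sum>i<m. norm (inner x (e i) *\<^sub>R e i) ^ 2)"
    unfolding proj_upto_def
    by (rule norm_sum_Pythagorean) (use orth_basisD[OF e] in \<open>auto simp: pairwise_def orthogonal_def\<close>)
  also have "\<dots> = (\<Sum>i<m. (inner x (e i))\<^sup>2)"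
  proof (rule sum.cong)
    show "(norm (inner x (e i) *\<^sub>R e i))\<^sup>2 = (inner x (e i))\<^sup>2" for i
      using orth_basisD(2)[OF e, of i] by (auto simp: power_mult_distrib)
  qed simp
  finally show ?thesis .
qed

lemma norm_proj_upto_compl:
  assumes e: "orth_basis e"
  shows "(norm (x - proj_upto e m x))\<^sup>2 = (norm x)\<^sup>2 - (\<Sum>i<m. (inner x (e i))\<^sup>2)"
proof -
  have "inner (proj_upto e m x) x = (norm (proj_upto e m x))\<^sup>2"
    unfolding norm_proj_upto[OF e]
    by (simp add: proj_upto_def inner_sum_right power2_eq_square inner_commute[of _ x])
  then show ?thesis
    unfolding power2_norm_eq_inner norm_proj_upto[OF e, symmetric]
    by (simp add: inner_diff_left inner_diff_right inner_commute power2_norm_eq_inner)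
qed

lemma parseval:
  assumes e: "orth_basis e"
  shows "(\<lambda>i. (inner x (e i))\<^sup>2) sums (norm x)\<^sup>2"
  unfolding sums_def norm_proj_upto[OF e, symmetric]
  by (intro tendsto_intros orth_basisD(3)[OF e])

lemma norm_proj_upto_le:
  assumes e: "orth_basis e"
  shows "norm (proj_upto e m x) \<le> norm x"
  by (rule power2_le_imp_le)
    (use norm_proj_upto_compl[OF e, of x m] norm_proj_upto[OF e, of m x]
      zero_le_power2[of "norm (x - proj_upto e m x)"] in auto)

lemma orth_series_convergent:
  fixes e :: "nat \<Rightarrow> 'a::{real_inner, banach}"
  assumes e: "orth_basis e" and c: "summable (\<lambda>i. (c i)\<^sup>2)"
  shows "summable (\<lambda>i. c i *\<^sub>R e i)"
  unfolding summable_Cauchy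
proof (intro allI impI)
  fix r :: real assume "r > 0"
  then obtain N where N: "\<And>m n. m \<ge> N \<Longrightarrow> norm (\<Sum>i=m..<n. (c i)\<^sup>2) < r\<^sup>2"
    using c unfolding summable_Cauchy by (meson zero_less_power)
  have "norm (\<Sum>i=m..<n. c i *\<^sub>R e i) < r" if "m \<ge> N" for m n
  proof -
    have "(norm (\<Sum>i=m..<n. c i *\<^sub>R e i))\<^sup>2 < r\<^sup>2"
      using norm_sum_orth_basis[OF e, of "{m..<n}" c] N[OF that, of n] by (simp add: sum_nonneg)
    then show ?thesis using \<open>r > 0\<close> by (simp add: power2_less_imp_less)
  qed
  then show "\<exists>N. \<forall>m\<ge>N. \<forall>n. norm (sum (\<lambda>i. c i *\<^sub>R e i) {m..<n}) < r" by blast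
qed

text \<open>Testing F on its own partial sum \<open>\<Sum>i<m. F (e i) *\<^sub>R e i\<close> bounds
  the sum s of squared coefficients by K * sqrt s, hence by K^2. So the series that must be the
  representing vector converges.\<close>

lemma riesz_representation:
  fixes F :: "'a::{real_inner, banach, second_countable_topology} \<Rightarrow> real"
  assumes F: "bounded_linear F"
  shows "\<exists>x. \<forall>y. F y = inner y x"
proof -
  obtain e :: "nat \<Rightarrow> 'a" where e: "orth_basis e" using orth_basis_exists by blast
  interpret F: bounded_linear F by fact
  obtain K where K: "K > 0" "\<And>x. norm (F x) \<le> norm x * K" using F.pos_bounded by blast
  have "(\<Sum>i<m. (F (e i))\<^sup>2) \<le> K\<^sup>2" for m
  proof -
    define s where "s = (\<Sum>i<m. (F (e i))\<^sup>2)"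
    have s0: "s \<ge> 0" by (simp add: s_def sum_nonneg)
    have "s = F (\<Sum>i<m. F (e i) *\<^sub>R e i)"
      by (simp add: s_def F.sum F.scaleR power2_eq_square)
    also have "\<dots> \<le> norm (\<Sum>i<m. F (e i) *\<^sub>R e i) * K"
      using K(2)[of "\<Sum>i<m. F (e i) *\<^sub>R e i"] by simp
    also have "\<dots> \<le> sqrt s * K"
      using norm_sum_orth_basis[OF e, of "{..<m}" "\<lambda>i. F (e i)"] K(1)
      by (intro mult_right_mono real_le_rsqrt) (auto simp: s_def)
    finally have "sqrt s * sqrt s \<le> sqrt s * K" using s0 by simp
    then have "sqrt s * sqrt s \<le> sqrt s * K" using s0 by simp
    then have "sqrt s \<le> K" using s0 K(1) mult_le_cancel_left_pos[of "sqrt s" "sqrt s" K]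
      by (cases "s = 0") (auto simp del: real_sqrt_mult_self)
    then show ?thesis
      unfolding s_def[symmetric] using s0 real_sqrt_le_iff sqrt_le_D by blast
  qed
  then have "summable (\<lambda>i. (F (e i))\<^sup>2)"
    by (intro summableI_nonneg_bounded) auto
  then have sm: "summable (\<lambda>i. F (e i) *\<^sub>R e i)" by (rule orth_series_convergent[OF e])
  have "F y = inner y (\<Sum>i. F (e i) *\<^sub>R e i)" for y
  proof (rule LIMSEQ_unique)
    show "(\<lambda>m. F (proj_upto e m y)) \<longlonglongrightarrow> F y"
      by (intro F.tendsto orth_basisD(3)[OF e])
    have "F (proj_upto e m y) = inner y (\<Sum>i<m. F (e i) *\<^sub>R e i)" for m
      by (simp add: proj_upto_def F.sum F.scaleR inner_sum_right mult.commute)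
    then show "(\<lambda>m. F (proj_upto e m y)) \<longlonglongrightarrow> inner y (\<Sum>i. F (e i) *\<^sub>R e i)"
      using tendsto_inner[OF tendsto_const summable_LIMSEQ[OF sm]] by simp
  qed
  then show ?thesis by blast
qed

section \<open>Convergence in distribution from characteristic functions\<close>

text \<open>Imaginary part of the first-order Taylor estimate for \<open>iexp\<close>. A quadratic
  error is wanted, although a cubic one holds, because only second moments are available.\<close>

lemma abs_sin_minus_self_le: "\<bar>x - sin x\<bar> \<le> x\<^sup>2 / 2" for x :: real
proof -
  have "cmod (iexp x - (\<Sum>k\<le>1. (\<i> * x) ^ k / fact k)) \<le> \<bar>x\<bar> ^ Suc 1 / fact (Suc 1)"
    by (rule iexp_approx1)
  then have "cmod (iexp x - (1 + \<i> * x)) \<le> x\<^sup>2 / 2"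
    by (simp add: numeral_2_eq_2)
  moreover have "\<bar>Im (iexp x - (1 + \<i> * x))\<bar> \<le> cmod (iexp x - (1 + \<i> * x))"
    by (rule abs_Im_le_cmod)
  moreover have "Im (iexp x - (1 + \<i> * x)) = sin x - x"
    by (simp add: Im_exp)
  ultimately show ?thesis by (simp add: abs_minus_commute)
qed

text \<open>The Pasch-Hausdorff envelope: for bounded f, the largest minorant of f with Lipschitz
  constant k.\<close>

definition inf_conv :: "('a::metric_space \<Rightarrow> real) \<Rightarrow> nat \<Rightarrow> 'a \<Rightarrow> real"
  where "inf_conv f k x = (INF y. f y + real k * dist x y)"

lemma inf_conv:
  fixes f :: "'a::metric_space \<Rightarrow> real"
  assumes f: "continuous_on UNIV f" and B: "\<And>x. \<bar>f x\<bar> \<le> B"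
  shows inf_conv_le: "inf_conv f k x \<le> f x"
    and inf_conv_abs_le: "\<bar>inf_conv f k x\<bar> \<le> B"
    and inf_conv_lipschitz: "\<bar>inf_conv f k x - inf_conv f k y\<bar> \<le> real k * dist x y"
    and inf_conv_tendsto: "(\<lambda>k. inf_conv f k x) \<longlonglongrightarrow> f x"
proof -
  have bdd: "bdd_below (range (\<lambda>y. f y + real k * dist x y))" for k x
  proof (rule bdd_belowI2)
    show "- B \<le> f y + real k * dist x y" for y
      using B[of y] zero_le_dist[of x y] by (smt (verit) mult_nonneg_nonneg of_nat_0_le_iff)
  qed
  show le: "inf_conv f k x \<le> f x" for k x
    using cINF_lower[OF bdd, of x k x] by (simp add: inf_conv_def)
  have ge: "- B \<le> inf_conv f k x" for k x
    unfolding inf_conv_def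
  proof (rule cINF_greatest)
    show "- B \<le> f y + real k * dist x y" for y
      using B[of y] zero_le_dist[of x y] by (smt (verit) mult_nonneg_nonneg of_nat_0_le_iff)
  qed simp
  show "\<bar>inf_conv f k x\<bar> \<le> B"
    using le[of k x] ge[of k x] B[of x] by linarith
  have half: "inf_conv f k x - real k * dist x y \<le> inf_conv f k y" for x y
    unfolding inf_conv_def[of f k y]
  proof (rule cINF_greatest)
    fix z
    have "inf_conv f k x \<le> f z + real k * dist x z"
      unfolding inf_conv_def by (rule cINF_lower[OF bdd]) simp
    moreover have "real k * dist x z \<le> real k * (dist x y + dist y z)"
      by (intro mult_left_mono dist_triangle) simp
    ultimately show "inf_conv f k x - real k * dist x y \<le> f z + real k * dist y z"
      by (simp add: algebra_simps)
  qed simp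
  show "\<bar>inf_conv f k x - inf_conv f k y\<bar> \<le> real k * dist x y"
    using half[of x y] half[of y x] by (simp add: dist_commute)
  show "(\<lambda>k. inf_conv f k x) \<longlonglongrightarrow> f x"
  proof (rule metric_LIMSEQ_I)
    fix r :: real assume r: "r > 0"
    have "isCont f x" using f by (simp add: continuous_on_eq_continuous_at)
    then obtain \<delta> where \<delta>: "\<delta> > 0" "\<And>y. dist y x < \<delta> \<Longrightarrow> dist (f y) (f x) < r / 2"
      using r unfolding continuous_at_eps_delta by (meson half_gt_zero)
    \<comment> \<open>Beyond distance \<delta> the penalty exceeds 2 * B, the largest possible drop
      of f, so only points near x compete in the infimum.\<close>
    obtain K :: nat where K: "2 * B / \<delta> < real K" using reals_Archimedean2 by blast
    have "dist (inf_conv f k x) (f x) < r" if "k \<ge> K" for k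
    proof -
      have "f x - r / 2 \<le> inf_conv f k x"
        unfolding inf_conv_def
      proof (rule cINF_greatest)
        fix y
        show "f x - r / 2 \<le> f y + real k * dist x y"
        proof (cases "dist x y < \<delta>")
          case True
          then have "f x - r / 2 < f y"
            using \<delta>(2)[of y] by (auto simp: dist_real_def dist_commute abs_if split: if_splits)
          moreover have "real k * dist x y \<ge> 0" by simp
          ultimately show ?thesis by linarith
        next
          case False
          have "2 * B < real K * \<delta>" using K \<delta>(1) by (simp add: field_simps)
          also have "\<dots> \<le> real k * dist x y"
            using that False \<delta>(1) by (intro mult_mono) auto
          finally show ?thesis using B[of x] B[of y] r by linarith
        qed
      qed simp
      then show ?thesis using le[of k x] r by (simp add: dist_real_def)
    qed
    then show "\<exists>no. \<forall>n\<ge>no. dist (inf_conv f n x) (f x) < r" by blast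
  qed
qed

text \<open>Lipschitz functions converging to f from below bound the lower limit of the integrals;
  the same bound for - f gives the upper limit.\<close>

lemma integral_tendsto_of_lipschitz:
  fixes Y :: "nat \<Rightarrow> 'w \<Rightarrow> 'a::metric_space" and G :: "'v \<Rightarrow> 'a" and f :: "'a \<Rightarrow> real"
  assumes M: "prob_space M" and P: "prob_space P"
    and Y: "\<And>n. Y n \<in> borel_measurable M" and G: "G \<in> borel_measurable P"
    and lip: "\<And>f K. (\<And>x y. \<bar>f x - f y\<bar> \<le> K * dist x y) \<Longrightarrow> bounded (range f) \<Longrightarrow>
      (\<lambda>n. \<integral>\<omega>. f (Y n \<omega>) \<partial>M) \<longlonglongrightarrow> (\<integral>\<omega>. f (G \<omega>) \<partial>P)"
    and f: "continuous_on UNIV f" "bounded (range f)"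
  shows "(\<lambda>n. \<integral>\<omega>. f (Y n \<omega>) \<partial>M) \<longlonglongrightarrow> (\<integral>\<omega>. f (G \<omega>) \<partial>P)"
proof -
  interpret M: prob_space M by fact
  interpret P: prob_space P by fact
  note [measurable] = Y G
  have lower: "\<forall>\<^sub>F n in sequentially. (\<integral>\<omega>. g (Y n \<omega>) \<partial>M) > (\<integral>\<omega>. g (G \<omega>) \<partial>P) - r"
    if g: "continuous_on UNIV g" "bounded (range g)" and r: "r > 0" for g :: "'a \<Rightarrow> real" and r
  proof -
    obtain B where B: "\<And>x. \<bar>g x\<bar> \<le> B" using g(2) by (auto simp: bounded_iff)
    have [measurable]: "g \<in> borel_measurable borel"
      by (rule borel_measurable_continuous_onI) fact
    have c: "continuous_on UNIV (inf_conv g k)" for k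
      by (rule lipschitz_on_continuous_on[of "real k"])
        (auto simp: lipschitz_on_def dist_real_def intro!: inf_conv_lipschitz[OF g(1) B])
    have [measurable]: "inf_conv g k \<in> borel_measurable borel" for k
      by (rule borel_measurable_continuous_onI) (rule c)
    have "(\<lambda>k. \<integral>\<omega>. inf_conv g k (G \<omega>) \<partial>P) \<longlonglongrightarrow> (\<integral>\<omega>. g (G \<omega>) \<partial>P)"
      by (rule integral_dominated_convergence[where w = "\<lambda>_. B"])
        (auto intro!: inf_conv_tendsto[OF g(1) B] inf_conv_abs_le[OF g(1) B])
    then have "\<forall>\<^sub>F k in sequentially. (\<integral>\<omega>. g (G \<omega>) \<partial>P) - r < (\<integral>\<omega>. inf_conv g k (G \<omega>) \<partial>P)"
      by (rule order_tendstoD) (use r in simp)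
    then obtain k where k: "(\<integral>\<omega>. g (G \<omega>) \<partial>P) - r < (\<integral>\<omega>. inf_conv g k (G \<omega>) \<partial>P)"
      by (auto simp: eventually_sequentially)
    have "(\<lambda>n. \<integral>\<omega>. inf_conv g k (Y n \<omega>) \<partial>M) \<longlonglongrightarrow> (\<integral>\<omega>. inf_conv g k (G \<omega>) \<partial>P)"
      by (rule lip[of _ "real k"])
        (use inf_conv_abs_le[OF g(1) B] inf_conv_lipschitz[OF g(1) B] in \<open>auto simp: bounded_iff\<close>)
    then have "\<forall>\<^sub>F n in sequentially. (\<integral>\<omega>. g (G \<omega>) \<partial>P) - r < (\<integral>\<omega>. inf_conv g k (Y n \<omega>) \<partial>M)"
      by (rule order_tendstoD) (rule k)
    then show ?thesis
    proof eventually_elim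
      case (elim n)
      have "(\<integral>\<omega>. inf_conv g k (Y n \<omega>) \<partial>M) \<le> (\<integral>\<omega>. g (Y n \<omega>) \<partial>M)"
      proof (rule integral_mono)
        show "integrable M (\<lambda>\<omega>. inf_conv g k (Y n \<omega>))"
          by (rule M.integrable_const_bound[where B = B]) (auto intro!: inf_conv_abs_le[OF g(1) B])
        show "integrable M (\<lambda>\<omega>. g (Y n \<omega>))"
          by (rule M.integrable_const_bound[where B = B]) (use B in auto)
      qed (rule inf_conv_le[OF g(1) B])
      then show ?case using elim by linarith
    qed
  qed
  show ?thesis
    unfolding order_tendsto_iff
  proof (intro conjI allI impI)
    fix a assume "a < (\<integral>\<omega>. f (G \<omega>) \<partial>P)"
    then show "\<forall>\<^sub>F n in sequentially. a < (\<integral>\<omega>. f (Y n \<omega>) \<partial>M)"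
      using lower[OF f, of "(\<integral>\<omega>. f (G \<omega>) \<partial>P) - a"] by simp
  next
    fix a assume a: "(\<integral>\<omega>. f (G \<omega>) \<partial>P) < a"
    have "bounded (range (\<lambda>x. - f x))"
      using f(2) by (simp add: bounded_iff)
    then show "\<forall>\<^sub>F n in sequentially. (\<integral>\<omega>. f (Y n \<omega>) \<partial>M) < a"
      using lower[of "\<lambda>x. - f x" "a - (\<integral>\<omega>. f (G \<omega>) \<partial>P)"] a f(1)
      by (simp add: continuous_on_minus)
  qed
qed

section \<open>Trigonometric polynomials and approximation by them\<close>

inductive trig_poly :: "('a::real_inner \<Rightarrow> real) \<Rightarrow> bool"
  where cos: "trig_poly (\<lambda>x. a * cos (inner x t + b))"
  | add: "trig_poly f \<Longrightarrow> trig_poly g \<Longrightarrow> trig_poly (\<lambda>x. f x + g x)"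

lemma trig_poly_const: "trig_poly (\<lambda>_. c)"
  using trig_poly.cos[of c 0 0] by simp

lemma trig_poly_sin: "trig_poly (\<lambda>x. a * sin (inner x t))"
  using trig_poly.cos[of a t "- (pi / 2)"] by (simp add: cos_sin_eq cos_add)

text \<open>Product-to-sum formula. The phase b in the generators makes the class close up, and it
  also supplies constants and sines, which have no constructors of their own.\<close>

lemma trig_poly_cos_mult: "trig_poly g \<Longrightarrow> trig_poly (\<lambda>x. a * cos (inner x t + b) * g x)"
proof (induction rule: trig_poly.induct)
  case (cos a' t' b')
  have "(\<lambda>x. a * cos (inner x t + b) * (a' * cos (inner x t' + b'))) =
    (\<lambda>x. a * a' / 2 * cos (inner x (t - t') + (b - b')) + a * a' / 2 * cos (inner x (t + t') + (b + b')))"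
    by (simp add: fun_eq_iff cos_times_cos inner_diff_right inner_add_right algebra_simps
      add_divide_distrib)
  then show ?case by (simp only: trig_poly.intros)
next
  case (add f g)
  then show ?case using trig_poly.add by (fastforce simp: distrib_left)
qed

lemma trig_poly_mult: "trig_poly f \<Longrightarrow> trig_poly g \<Longrightarrow> trig_poly (\<lambda>x. f x * g x)"
proof (induction rule: trig_poly.induct)
  case (cos a t b)
  then show ?case by (rule trig_poly_cos_mult)
next
  case (add f f')
  then show ?case using trig_poly.add by (fastforce simp: distrib_right)
qed

lemma trig_poly_bounded_continuous:
  "trig_poly f \<Longrightarrow> continuous_on UNIV f \<and> (\<exists>B. \<forall>x. \<bar>f x\<bar> \<le> B)"
proof (induction rule: trig_poly.induct)
  case (cos a t b)
  have "\<bar>a * cos (inner x t + b)\<bar> \<le> \<bar>a\<bar>" for x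
    using mult_left_mono[OF abs_cos_le_one, of "\<bar>a\<bar>"] by (simp add: abs_mult)
  then show ?case by (auto intro!: continuous_intros)
next
  case (add f g)
  then obtain B C where "\<And>x. \<bar>f x\<bar> \<le> B" "\<And>x. \<bar>g x\<bar> \<le> C" by blast
  then have "\<bar>f x + g x\<bar> \<le> B + C" for x by (meson abs_triangle_ineq add_mono order_trans)
  then show ?case using add by (auto intro!: continuous_intros)
qed

text \<open>A cosine with a phase is the real part of a constant times \<open>iexp\<close>, so the
  hypothesis on characteristic functions settles the generators, and linearity settles the
  sums.\<close>

lemma trig_poly_integral_tendsto:
  fixes Y :: "nat \<Rightarrow> 'w \<Rightarrow> 'a::{real_inner, second_countable_topology}" and G :: "'v \<Rightarrow> 'a"
  assumes M: "prob_space M" and P: "prob_space P"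
    and Y: "\<And>n. Y n \<in> borel_measurable M" and G: "G \<in> borel_measurable P"
    and cf: "\<And>x. (\<lambda>n. CLINT \<omega>|M. iexp (inner (Y n \<omega>) x)) \<longlonglongrightarrow> (CLINT \<omega>|P. iexp (inner (G \<omega>) x))"
    and f: "trig_poly f"
  shows "(\<lambda>n. \<integral>\<omega>. f (Y n \<omega>) \<partial>M) \<longlonglongrightarrow> (\<integral>\<omega>. f (G \<omega>) \<partial>P)"
  using f
proof (induction rule: trig_poly.induct)
  interpret M: prob_space M by fact
  interpret P: prob_space P by fact
  note [measurable] = Y G
  {
    case (cos a t b)
    have *: "(\<integral>\<omega>. a * cos (inner (Z \<omega>) t + b) \<partial>Q) = Re (a * iexp b * (CLINT \<omega>|Q. iexp (inner (Z \<omega>) t)))"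
      if "prob_space Q" and [measurable]: "Z \<in> borel_measurable Q" for Q :: "'z measure" and Z :: "'z \<Rightarrow> 'a"
    proof -
      interpret Q: prob_space Q by fact
      have i: "integrable Q (\<lambda>\<omega>. iexp (inner (Z \<omega>) t))"
        by (rule Q.integrable_const_bound[where B = 1]) auto
      have "(\<integral>\<omega>. a * cos (inner (Z \<omega>) t + b) \<partial>Q) = (\<integral>\<omega>. Re (a * iexp b * iexp (inner (Z \<omega>) t)) \<partial>Q)"
        by (intro Bochner_Integration.integral_cong)
          (simp_all add: mult.assoc exp_add[symmetric] Re_exp Im_exp add.commute flip: distrib_left of_real_add)
      also have "\<dots> = Re (CLINT \<omega>|Q. a * iexp b * iexp (inner (Z \<omega>) t))"
        by (rule integral_Re) (use i in simp)
      finally show ?thesis using i by simp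
    qed
    show ?case
      unfolding *[OF M Y] *[OF P G] by (intro tendsto_intros cf)
  next
    case (add f g)
    have "integrable M (\<lambda>\<omega>. h (Y n \<omega>))" "integrable P (\<lambda>\<omega>. h (G \<omega>))" if h: "trig_poly h" for h :: "'a \<Rightarrow> real" and n
    proof -
      obtain B where B: "\<And>x. \<bar>h x\<bar> \<le> B"
        using trig_poly_bounded_continuous[OF h] by blast
      have [measurable]: "h \<in> borel_measurable borel"
        using trig_poly_bounded_continuous[OF h] by (intro borel_measurable_continuous_onI) blast
      show "integrable M (\<lambda>\<omega>. h (Y n \<omega>))" "integrable P (\<lambda>\<omega>. h (G \<omega>))"
        using B by (auto intro!: M.integrable_const_bound[where B = B] P.integrable_const_bound[where B = B])
    qed
    with add show ?case by (simp add: tendsto_add)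
  }
qed

text \<open>The map below compresses the Hilbert space into a compact box of dimension \<open>m\<close>; a polynomial in
  its coordinates is a trigonometric polynomial, and it is close to the identity up to second moments.\<close>

definition sin_compress :: "(nat \<Rightarrow> 'a::real_inner) \<Rightarrow> nat \<Rightarrow> real \<Rightarrow> 'a \<Rightarrow> 'a"
  where "sin_compress e m L x = (\<Sum>j<m. (L * sin (inner x (e j) / L)) *\<^sub>R e j)"

text \<open>Two errors add up: the part of x orthogonal to the first m basis vectors, and for each
  coordinate t the sine error t^2 / (2 * L), whose sum is bounded through Bessel's
  inequality.\<close>

lemma sin_compress_dist:
  assumes e: "orth_basis e" and L: "L > 0"
  shows "norm (x - sin_compress e m L x) \<le> norm (x - proj_upto e m x) + (norm x)\<^sup>2 / (2 * L)"
proof -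
  have t: "\<bar>t - L * sin (t / L)\<bar> \<le> t\<^sup>2 / (2 * L)" for t
  proof -
    have "t - L * sin (t / L) = L * (t / L - sin (t / L))"
      using L by (simp add: field_simps)
    then have "\<bar>t - L * sin (t / L)\<bar> = L * \<bar>t / L - sin (t / L)\<bar>"
      using L by (simp add: abs_mult)
    also have "\<dots> \<le> L * ((t / L)\<^sup>2 / 2)"
      using L abs_sin_minus_self_le[of "t / L"] by (intro mult_left_mono) auto
    finally show ?thesis using L by (simp add: power2_eq_square field_simps)
  qed
  have "norm (proj_upto e m x - sin_compress e m L x)
      = norm (\<Sum>j<m. (inner x (e j) - L * sin (inner x (e j) / L)) *\<^sub>R e j)"
    by (simp add: proj_upto_def sin_compress_def sum_subtractf scaleR_diff_left)
  also have "\<dots> \<le> (\<Sum>j<m. \<bar>inner x (e j) - L * sin (inner x (e j) / L)\<bar>)"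
  proof (rule sum_norm_le)
    show "norm ((inner x (e j) - L * sin (inner x (e j) / L)) *\<^sub>R e j) \<le>
        \<bar>inner x (e j) - L * sin (inner x (e j) / L)\<bar>" for j
      using orth_basisD(2)[OF e, of j] by auto
  qed
  also have "\<dots> \<le> (\<Sum>j<m. (inner x (e j))\<^sup>2 / (2 * L))"
    by (intro sum_mono t)
  also have "\<dots> \<le> (norm x)\<^sup>2 / (2 * L)"
    unfolding sum_divide_distrib[symmetric] norm_proj_upto[OF e, of m x, symmetric]
    using L by (intro divide_right_mono power_mono norm_proj_upto_le[OF e]) auto
  finally show ?thesis
    using norm_triangle_ineq[of "x - proj_upto e m x" "proj_upto e m x - sin_compress e m L x"] by simp
qed

lemma compact_box: "compact {\<Sum>j<m. c j *\<^sub>R e j |c. \<forall>j. \<bar>c j\<bar> \<le> L}"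
  for e :: "nat \<Rightarrow> 'a::real_normed_vector"
proof (induction m)
  case 0
  have "{\<Sum>j<0. c j *\<^sub>R e j |c. \<forall>j. \<bar>c j\<bar> \<le> L} \<subseteq> {0}" by auto
  then show ?case using finite_subset finite_imp_compact by blast
next
  case (Suc m)
  have "{\<Sum>j<Suc m. c j *\<^sub>R e j |c. \<forall>j. \<bar>c j\<bar> \<le> L} =
    {x + y |x y. x \<in> {\<Sum>j<m. c j *\<^sub>R e j |c. \<forall>j. \<bar>c j\<bar> \<le> L} \<and> y \<in> (\<lambda>t. t *\<^sub>R e m) ` {-L..L}}"
    (is "?A = ?B")
  proof
    show "?A \<subseteq> ?B"
    proof
      fix z assume "z \<in> ?A"
      then obtain c where c: "\<forall>j. \<bar>c j\<bar> \<le> L" and z: "z = (\<Sum>j<Suc m. c j *\<^sub>R e j)" by blast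
      have "c m \<in> {-L..L}" using c by (simp add: abs_le_iff minus_le_iff)
      then have "c m *\<^sub>R e m \<in> (\<lambda>t. t *\<^sub>R e m) ` {-L..L}" by (rule imageI)
      moreover have "z = (\<Sum>j<m. c j *\<^sub>R e j) + c m *\<^sub>R e m" using z by simp
      ultimately show "z \<in> ?B" using c by blast
    qed
    show "?B \<subseteq> ?A"
    proof
      fix z assume "z \<in> ?B"
      then obtain c t where c: "\<forall>j. \<bar>c j\<bar> \<le> L" "t \<in> {-L..L}" and z: "z = (\<Sum>j<m. c j *\<^sub>R e j) + t *\<^sub>R e m"
        by blast
      have "z = (\<Sum>j<Suc m. (c(m := t)) j *\<^sub>R e j)"
        unfolding z by simp
      moreover have "\<forall>j. \<bar>(c(m := t)) j\<bar> \<le> L" using c by (simp add: abs_le_iff)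
      ultimately show "z \<in> ?A" by blast
    qed
  qed
  moreover have "compact ((\<lambda>t. t *\<^sub>R e m) ` {-L..L})"
    by (intro compact_continuous_image continuous_intros) auto
  ultimately show ?case using compact_sums[OF Suc.IH] by simp
qed

text \<open>Stone-Weierstrass on the compact box, for the algebra of functions whose composition
  with \<open>sin_compress\<close> is a trigonometric polynomial. Since \<open>sin_compress\<close>
  maps the whole space into the box, the approximation is uniform on the whole space.\<close>

lemma trig_poly_approx:
  fixes f :: "'a::real_inner \<Rightarrow> real"
  assumes e: "orth_basis e" and L: "L > 0" and f: "continuous_on UNIV f" and r: "r > 0"
  shows "\<exists>g. trig_poly g \<and> (\<forall>x. \<bar>f (sin_compress e m L x) - g x\<bar> < r)"
proof -
  define S where "S = {\<Sum>j<m. c j *\<^sub>R e j |c. \<forall>j. \<bar>c j\<bar> \<le> L}"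
  define R where "R = {h :: 'a \<Rightarrow> real. continuous_on S h \<and> trig_poly (\<lambda>x. h (sin_compress e m L x))}"
  have "function_ring_on R S"
  proof
    show "compact S" unfolding S_def by (rule compact_box)
    fix x y assume xy: "x \<in> S" "y \<in> S" "x \<noteq> y"
    have j: "(\<lambda>z. inner z (e j)) \<in> R" for j
    proof -
      have "(\<lambda>x. inner (sin_compress e m L x) (e j)) =
          (\<lambda>x. (\<Sum>i<m. L * inner (e i) (e j) * sin (inner x (e i /\<^sub>R L))))"
        by (simp add: fun_eq_iff sin_compress_def inner_sum_left divide_inverse mult_ac)
      moreover have "trig_poly (\<lambda>x. (\<Sum>i\<in>A. L * inner (e i) (e j) * sin (inner x (e i /\<^sub>R L))))" if "finite A" for A
        using that
      proof (induction A)
        case empty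
        show ?case using trig_poly_const[of 0] by simp
      next
        case (insert a A)
        then show ?case
          using trig_poly.add[OF trig_poly_sin[of "L * inner (e a) (e j)" "e a /\<^sub>R L"] insert.IH] by simp
      qed
      ultimately show ?thesis
        unfolding R_def by (auto intro!: continuous_intros)
    qed
    show "\<exists>h\<in>R. h x \<noteq> h y"
    proof (rule ccontr)
      assume "\<not> ?thesis"
      then have "\<forall>h\<in>R. h x = h y" by blast
      then have "inner x (e j) = inner y (e j)" for j using j by (rule bspec)
      then have z: "inner (x - y) (e j) = 0" for j by (simp add: inner_diff_left)
      \<comment> \<open>Elements of the box are combinations of the \<open>e j\<close>, so x - y
        lies in the span of vectors to which it is orthogonal.\<close>
      obtain c d where "x = (\<Sum>j<m. c j *\<^sub>R e j)" "y = (\<Sum>j<m. d j *\<^sub>R e j)" using xy by (auto simp: S_def)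
      then have "x - y = (\<Sum>j<m. (c j - d j) *\<^sub>R e j)"
        by (simp add: sum_subtractf scaleR_diff_left)
      then have "inner (x - y) (x - y) = (\<Sum>j<m. (c j - d j) * inner (x - y) (e j))"
        by (metis (no_types, lifting) inner_scaleR_right inner_sum_right sum.cong)
      then show False using z xy(3) by simp
    qed
  qed (auto simp: R_def trig_poly.add trig_poly_mult trig_poly_const intro!: continuous_intros)
  then interpret function_ring_on R S .
  obtain g where g: "g \<in> R" "\<And>x. x \<in> S \<Longrightarrow> \<bar>f x - g x\<bar> < r"
    using Stone_Weierstrass_basic[of f r] f r continuous_on_subset by blast
  have "sin_compress e m L x \<in> S" for x
  proof -
    have "\<bar>L * sin (inner x (e j) / L)\<bar> \<le> L" for j
      using mult_left_mono[OF abs_sin_le_one, of L] L by (simp add: abs_mult)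
    then have "\<forall>j. \<bar>L * sin (inner x (e j) / L)\<bar> \<le> L" by blast
    then show ?thesis
      unfolding S_def sin_compress_def
      by (intro CollectI exI[of _ "\<lambda>j. L * sin (inner x (e j) / L)"] conjI refl)
  qed
  then show ?thesis using g by (auto simp: R_def)
qed

lemma (in prob_space) lipschitz_sin_compress_approx:
  fixes Z :: "'a \<Rightarrow> 'b::{real_inner, second_countable_topology}"
  assumes e: "orth_basis e" and L: "L > 0" and K: "\<And>x y. \<bar>f x - f y\<bar> \<le> K * dist x y" "K \<ge> 0"
    and \<eta>: "\<eta> > 0"
    and fg: "\<And>x. \<bar>f (sin_compress e m L x) - g x\<bar> \<le> r"
    and Z[measurable]: "Z \<in> borel_measurable M" and Z2: "integrable M (\<lambda>\<omega>. (norm (Z \<omega>))\<^sup>2)"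
    and fint: "integrable M (\<lambda>\<omega>. f (Z \<omega>))" and gint: "integrable M (\<lambda>\<omega>. g (Z \<omega>))"
  shows "\<bar>expectation (\<lambda>\<omega>. f (Z \<omega>)) - expectation (\<lambda>\<omega>. g (Z \<omega>))\<bar> \<le>
    K * (\<eta> + expectation (\<lambda>\<omega>. (norm (Z \<omega> - proj_upto e m (Z \<omega>)))\<^sup>2) / \<eta>
      + expectation (\<lambda>\<omega>. (norm (Z \<omega>))\<^sup>2) / (2 * L)) + r"
proof -
  have [measurable]: "proj_upto e m \<in> borel_measurable borel"
    unfolding proj_upto_def by measurable
  have T: "integrable M (\<lambda>\<omega>. (norm (Z \<omega> - proj_upto e m (Z \<omega>)))\<^sup>2)"
  proof (rule Bochner_Integration.integrable_bound[OF Z2])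
    show "AE \<omega> in M. norm ((norm (Z \<omega> - proj_upto e m (Z \<omega>)))\<^sup>2) \<le> norm ((norm (Z \<omega>))\<^sup>2)"
      unfolding norm_proj_upto_compl[OF e]
      by (auto simp: sum_nonneg norm_proj_upto[OF e, symmetric] norm_proj_upto_le[OF e] power_mono)
  qed simp
  have pw: "\<bar>f x - g x\<bar> \<le> K * (\<eta> + (norm (x - proj_upto e m x))\<^sup>2 / \<eta> + (norm x)\<^sup>2 / (2 * L)) + r" for x
  proof -
    \<comment> \<open>Trades a first moment for a second one: t \<le> \<eta> + t^2 / \<eta> for
      every t \<ge> 0.\<close>
    have n: "norm (x - proj_upto e m x) \<le> \<eta> + (norm (x - proj_upto e m x))\<^sup>2 / \<eta>"
    proof (cases "norm (x - proj_upto e m x) \<le> \<eta>")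
      case True
      then show ?thesis using \<eta> by (simp add: add_increasing2)
    next
      case False
      then have "norm (x - proj_upto e m x) * \<eta> \<le> (norm (x - proj_upto e m x))\<^sup>2"
        unfolding power2_eq_square by (intro mult_left_mono) auto
      then show ?thesis using \<eta> by (simp add: field_simps add_increasing)
    qed
    have "\<bar>f x - f (sin_compress e m L x)\<bar> \<le> K * norm (x - sin_compress e m L x)"
      using K(1) by (simp add: dist_norm)
    also have "\<dots> \<le> K * (\<eta> + (norm (x - proj_upto e m x))\<^sup>2 / \<eta> + (norm x)\<^sup>2 / (2 * L))"
      using sin_compress_dist[OF e L, of x m] n K(2) by (intro mult_left_mono) auto
    finally show ?thesis using fg[of x] by linarith
  qed
  have "\<bar>expectation (\<lambda>\<omega>. f (Z \<omega>)) - expectation (\<lambda>\<omega>. g (Z \<omega>))\<bar> = \<bar>expectation (\<lambda>\<omega>. f (Z \<omega>) - g (Z \<omega>))\<bar>"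
    using fint gint by simp
  also have "\<dots> \<le> expectation (\<lambda>\<omega>. \<bar>f (Z \<omega>) - g (Z \<omega>)\<bar>)"
    by (rule integral_abs_bound)
  also have "\<dots> \<le> expectation (\<lambda>\<omega>. K * (\<eta> + (norm (Z \<omega> - proj_upto e m (Z \<omega>)))\<^sup>2 / \<eta> + (norm (Z \<omega>))\<^sup>2 / (2 * L)) + r)"
    using fint gint T Z2 by (intro integral_mono pw) auto
  also have "\<dots> = K * (\<eta> + expectation (\<lambda>\<omega>. (norm (Z \<omega> - proj_upto e m (Z \<omega>)))\<^sup>2) / \<eta>
      + expectation (\<lambda>\<omega>. (norm (Z \<omega>))\<^sup>2) / (2 * L)) + r"
    using T Z2 by (simp add: prob_space)
  finally show ?thesis .
qed

text \<open>After compression only a trigonometric polynomial has to be handled. The compression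
  error is controlled by second moments uniformly in all large n: \<open>tail\<close> takes care of
  the directions beyond m, the common bound C with a large L takes care of the sine error.\<close>

lemma lipschitz_integral_tendsto_of_char:
  fixes Y :: "nat \<Rightarrow> 'w \<Rightarrow> 'a::{real_inner, second_countable_topology}" and G :: "'v \<Rightarrow> 'a"
  assumes M: "prob_space M" and P: "prob_space P"
    and Y: "\<And>n. Y n \<in> borel_measurable M" and G: "G \<in> borel_measurable P"
    and e: "orth_basis e"
    and cf: "\<And>x. (\<lambda>n. CLINT \<omega>|M. iexp (inner (Y n \<omega>) x)) \<longlonglongrightarrow> (CLINT \<omega>|P. iexp (inner (G \<omega>) x))"
    and Y2: "\<And>n. integrable M (\<lambda>\<omega>. (norm (Y n \<omega>))\<^sup>2)" "\<And>n. (\<integral>\<omega>. (norm (Y n \<omega>))\<^sup>2 \<partial>M) \<le> C"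
    and G2: "integrable P (\<lambda>\<omega>. (norm (G \<omega>))\<^sup>2)" "(\<integral>\<omega>. (norm (G \<omega>))\<^sup>2 \<partial>P) \<le> C"
    and tail: "\<And>r. r > 0 \<Longrightarrow> \<exists>m. (\<forall>\<^sub>F n in sequentially.
        (\<integral>\<omega>. (norm (Y n \<omega> - proj_upto e m (Y n \<omega>)))\<^sup>2 \<partial>M) < r) \<and>
        (\<integral>\<omega>. (norm (G \<omega> - proj_upto e m (G \<omega>)))\<^sup>2 \<partial>P) < r"
    and K: "\<And>x y. \<bar>f x - f y\<bar> \<le> K * dist x y" and f: "bounded (range f)"
  shows "(\<lambda>n. \<integral>\<omega>. f (Y n \<omega>) \<partial>M) \<longlonglongrightarrow> (\<integral>\<omega>. f (G \<omega>) \<partial>P)"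
proof -
  interpret M: prob_space M by fact
  interpret P: prob_space P by fact
  note [measurable] = Y G
  \<comment> \<open>Enlarged to be positive, since \<eta> is defined by dividing by it.\<close>
  define K' where "K' = \<bar>K\<bar> + 1"
  have K': "\<bar>f x - f y\<bar> \<le> K' * dist x y" "K' > 0" for x y
    using order_trans[OF K[of x y] mult_right_mono[of K K' "dist x y"]] by (auto simp: K'_def)
  have C: "C \<ge> 0" by (rule order_trans[OF _ G2(2)]) simp
  have cont: "continuous_on UNIV f"
    by (rule lipschitz_on_continuous_on[of K'])
      (use K' in \<open>auto simp: lipschitz_on_def dist_real_def less_imp_le\<close>)
  have [measurable]: "f \<in> borel_measurable borel"
    by (rule borel_measurable_continuous_onI) fact
  obtain B where B: "\<And>x. \<bar>f x\<bar> \<le> B" using f by (auto simp: bounded_iff)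
  have fint: "integrable M (\<lambda>\<omega>. f (Y n \<omega>))" "integrable P (\<lambda>\<omega>. f (G \<omega>))" for n
    using B by (auto intro!: M.integrable_const_bound[where B = B] P.integrable_const_bound[where B = B])
  show ?thesis
  proof (rule metric_LIMSEQ_I)
    fix r0 :: real assume "r0 > 0"
    \<comment> \<open>Nine parts: 4 * r for the compression of \<open>Y n\<close>, 4 * r for that of
      G, and r for the trigonometric polynomial.\<close>
    define r where "r = r0 / 9"
    have r: "r > 0" using \<open>r0 > 0\<close> by (simp add: r_def)
    define \<eta> where "\<eta> = r / K'"
    have \<eta>: "\<eta> > 0" using r K'(2) by (simp add: \<eta>_def)
    \<comment> \<open>Chosen so that 2 * L * \<eta> = C + 1, which brings the sine error C / (2 * L)
      below \<eta>.\<close>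
    define L where "L = (C + 1) * K' / (2 * r)"
    have L: "L > 0" using r C K'(2) by (simp add: L_def)
    obtain m where m: "\<forall>\<^sub>F n in sequentially.
        (\<integral>\<omega>. (norm (Y n \<omega> - proj_upto e m (Y n \<omega>)))\<^sup>2 \<partial>M) < \<eta> * \<eta>"
        "(\<integral>\<omega>. (norm (G \<omega> - proj_upto e m (G \<omega>)))\<^sup>2 \<partial>P) < \<eta> * \<eta>"
      using tail[of "\<eta> * \<eta>"] \<eta> by auto
    obtain g where g: "trig_poly g" "\<And>x. \<bar>f (sin_compress e m L x) - g x\<bar> < r"
      using trig_poly_approx[OF e L cont r] by blast
    obtain B' where B': "\<And>x. \<bar>g x\<bar> \<le> B'"
      using trig_poly_bounded_continuous[OF g(1)] by blast
    have [measurable]: "g \<in> borel_measurable borel"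
      using trig_poly_bounded_continuous[OF g(1)] by (intro borel_measurable_continuous_onI) blast
    have gint: "integrable M (\<lambda>\<omega>. g (Y n \<omega>))" "integrable P (\<lambda>\<omega>. g (G \<omega>))" for n
      using B' by (auto intro!: M.integrable_const_bound[where B = B'] P.integrable_const_bound[where B = B'])
    have bd: "K' * (\<eta> + t / \<eta> + c / (2 * L)) + r \<le> 4 * r" if "t < \<eta> * \<eta>" "c \<le> C" for t c
    proof -
      have "t / \<eta> \<le> \<eta>" using that \<eta> by (simp add: field_simps)
      moreover have "c / (2 * L) \<le> \<eta>"
      proof -
        have "2 * L * \<eta> = C + 1" using r K'(2) by (simp add: L_def \<eta>_def)
        then have "c \<le> \<eta> * (2 * L)" using that by (simp add: mult.commute)
        then show ?thesis using L by (simp add: divide_le_eq)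
      qed
      ultimately have "K' * (\<eta> + t / \<eta> + c / (2 * L)) \<le> K' * (3 * \<eta>)"
        using K'(2) by (intro mult_left_mono) auto
      also have "\<dots> = 3 * r" using K'(2) by (simp add: \<eta>_def)
      finally show ?thesis by simp
    qed
    have gG: "\<bar>(\<integral>\<omega>. f (G \<omega>) \<partial>P) - (\<integral>\<omega>. g (G \<omega>) \<partial>P)\<bar> \<le> 4 * r"
      by (rule order_trans[OF P.lipschitz_sin_compress_approx[OF e L K'(1) _ \<eta> _ G G2(1) fint(2) gint(2), where r = r]])
        (use K'(2) g(2) bd[OF m(2) G2(2)] in \<open>auto simp: less_imp_le\<close>)
    have "(\<lambda>n. \<integral>\<omega>. g (Y n \<omega>) \<partial>M) \<longlonglongrightarrow> (\<integral>\<omega>. g (G \<omega>) \<partial>P)"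
      by (rule trig_poly_integral_tendsto[OF M P Y G cf g(1)])
    then have "\<forall>\<^sub>F n in sequentially. dist (\<integral>\<omega>. g (Y n \<omega>) \<partial>M) (\<integral>\<omega>. g (G \<omega>) \<partial>P) < r"
      using r by (rule tendstoD)
    with m(1) have "\<forall>\<^sub>F n in sequentially. dist (\<integral>\<omega>. f (Y n \<omega>) \<partial>M) (\<integral>\<omega>. f (G \<omega>) \<partial>P) < r0"
    proof eventually_elim
      case (elim n)
      have "\<bar>(\<integral>\<omega>. f (Y n \<omega>) \<partial>M) - (\<integral>\<omega>. g (Y n \<omega>) \<partial>M)\<bar> \<le> 4 * r"
        by (rule order_trans[OF M.lipschitz_sin_compress_approx[OF e L K'(1) _ \<eta> _ Y Y2(1) fint(1) gint(1), where r = r]])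
          (use K'(2) g(2) bd[OF elim(1) Y2(2)] in \<open>auto simp: less_imp_le\<close>)
      then show ?case using gG elim(2) \<open>r0 > 0\<close> unfolding r_def dist_real_def by linarith
    qed
    then show "\<exists>no. \<forall>n\<ge>no. dist (\<integral>\<omega>. f (Y n \<omega>) \<partial>M) (\<integral>\<omega>. f (G \<omega>) \<partial>P) < r0"
      by (simp add: eventually_sequentially)
  qed
qed

section \<open>Gaussian measures with a trace class covariance form\<close>

text \<open>By uniqueness of characteristic functions the law of X is that of sqrt v times a
  standard normal variable. This model includes v = 0 as a point mass, and the moments are read off
  from it.\<close>

lemma (in prob_space) normal_of_char:
  fixes X :: "'a \<Rightarrow> real"
  assumes X[measurable]: "random_variable borel X" and v: "v \<ge> 0"
    and ch: "\<And>t. char (distr M borel X) t = exp (- (t\<^sup>2 * v) / 2)"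
  shows normal_of_char_distr: "distr M borel X =
      (if v = 0 then return borel 0 else density lborel (normal_density 0 (sqrt v)))"
    and normal_of_char_integrable: "integrable M X"
    and normal_of_char_expectation: "expectation X = 0"
    and normal_of_char_integrable_square: "integrable M (\<lambda>\<omega>. (X \<omega>)\<^sup>2)"
    and normal_of_char_variance: "expectation (\<lambda>\<omega>. (X \<omega>)\<^sup>2) = v"
proof -
  let ?S = std_normal_distribution
  interpret S: real_distribution ?S by (rule real_dist_normal_dist)
  define D where "D = distr ?S borel (\<lambda>x. sqrt v * x)"
  have "char (distr M borel X) = char D"
  proof
    fix t
    have "char D t = char ?S (t * sqrt v)"
      unfolding D_def char_def by (subst integral_distr) (auto simp: mult.assoc)
    also have "\<dots> = exp (- (t\<^sup>2 * v) / 2)"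
      using v unfolding char_std_normal_distribution by (simp add: power_mult_distrib del: of_real_exp)
    finally show "char (distr M borel X) t = char D t" using ch by simp
  qed
  moreover have "real_distribution D"
    unfolding D_def by (intro S.real_distribution_distr) simp
  ultimately have eq: "distr M borel X = D"
    by (intro Levy_uniqueness real_distribution_distr) auto
  show "distr M borel X = (if v = 0 then return borel 0 else density lborel (normal_density 0 (sqrt v)))"
  proof (cases "v = 0")
    case True
    then have "(\<lambda>x. sqrt v * x) = (\<lambda>_. 0)" by (intro ext) simp
    then have "D = return borel 0" unfolding D_def using S.distr_const[of 0 borel] by (simp del: S.distr_const)
    then show ?thesis using eq True by simp
  next
    case False
    then have s: "sqrt v > 0" using v by simp
    have "distributed ?S lborel (\<lambda>x. x) std_normal_density"
      by (simp add: distributed_def distr_id2)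
    from S.normal_density_affine[OF this _ , of "sqrt v" 0] s
    have "distributed ?S lborel (\<lambda>x. sqrt v * x) (normal_density 0 (sqrt v))"
      by simp
    then have "distr ?S lborel (\<lambda>x. sqrt v * x) = density lborel (normal_density 0 (sqrt v))"
      unfolding distributed_def by (elim conjE)
    moreover have "distr ?S lborel (\<lambda>x. sqrt v * x) = D"
      unfolding D_def by (rule distr_cong) simp_all
    ultimately show ?thesis using False eq by simp
  qed
  have i1: "integrable ?S (\<lambda>x. x)" and i2: "integrable ?S (\<lambda>x. x\<^sup>2)"
    using integrable_std_normal_distribution_moment[of 1] integrable_std_normal_distribution_moment[of 2] by simp_all
  have e1: "(\<integral>x. x \<partial>?S) = 0"
    using integral_std_normal_distribution_moment_odd[of 1] by simp
  have e2: "(\<integral>x. x\<^sup>2 \<partial>?S) = 1"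
    using std_normal_distribution_even_moments(1)[of 1] by (simp add: fact_numeral)
  have D: "integrable D (\<lambda>x. x)" "(\<integral>x. x \<partial>D) = 0" "integrable D (\<lambda>x. x\<^sup>2)" "(\<integral>x. x\<^sup>2 \<partial>D) = v"
  proof -
    have m: "(\<lambda>x. sqrt v * x) \<in> measurable ?S borel" by simp
    have m1: "(\<lambda>x. x :: real) \<in> borel_measurable borel" by simp
    show "integrable D (\<lambda>x. x)"
      unfolding D_def integrable_distr_eq[OF m m1] by (rule integrable_mult_right[OF i1])
    show "(\<integral>x. x \<partial>D) = 0"
      unfolding D_def integral_distr[OF m m1] by (simp only: integral_mult_right_zero e1)
    have m2: "(\<lambda>x. x\<^sup>2 :: real) \<in> borel_measurable borel" by measurable
    have sq: "(sqrt v * x)\<^sup>2 = v * x\<^sup>2" for x using v by (simp add: power_mult_distrib)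
    show "integrable D (\<lambda>x. x\<^sup>2)"
      unfolding D_def integrable_distr_eq[OF m m2] sq by (rule integrable_mult_right[OF i2])
    show "(\<integral>x. x\<^sup>2 \<partial>D) = v"
      unfolding D_def integral_distr[OF m m2] sq integral_mult_right_zero e2 by simp
  qed
  note D' = D[folded eq]
  have m1: "(\<lambda>x. x :: real) \<in> borel_measurable borel" "(\<lambda>x. x\<^sup>2 :: real) \<in> borel_measurable borel"
    by simp_all
  show "integrable M X"
    by (rule integrable_distr_eq[OF X m1(1), THEN iffD1, OF D'(1)])
  show "integrable M (\<lambda>\<omega>. (X \<omega>)\<^sup>2)"
    by (rule integrable_distr_eq[OF X m1(2), THEN iffD1, OF D'(3)])
  show "expectation X = 0"
    by (rule integral_distr[OF X m1(1), symmetric, THEN trans, OF D'(2)])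
  show "expectation (\<lambda>\<omega>. (X \<omega>)\<^sup>2) = v"
    by (rule integral_distr[OF X m1(2), symmetric, THEN trans, OF D'(4)])
qed

section \<open>Cholesky factorisation of positive semidefinite kernels\<close>

definition psd_kernel :: "(nat \<Rightarrow> nat \<Rightarrow> real) \<Rightarrow> bool"
  where "psd_kernel R \<longleftrightarrow> (\<forall>j k. R j k = R k j) \<and> (\<forall>m c. 0 \<le> (\<Sum>j<m. \<Sum>k<m. c j * c k * R j k))"

lemma psd_kernelD:
  assumes "psd_kernel R"
  shows "R j k = R k j" "0 \<le> (\<Sum>j<m. \<Sum>k<m. c j * c k * R j k)"
  using assms by (auto simp: psd_kernel_def)

text \<open>Expansion of the form when t times the l-th unit vector is added to c; completing the
  square in t is what makes Schur complements positive.\<close>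

lemma quadratic_form_shift:
  fixes R :: "nat \<Rightarrow> nat \<Rightarrow> real"
  assumes sym: "\<And>j k. R j k = R k j" and l: "l < m"
  shows "(\<Sum>j<m. \<Sum>k<m. (c j + t * of_bool (j = l)) * (c k + t * of_bool (k = l)) * R j k) =
    (\<Sum>j<m. \<Sum>k<m. c j * c k * R j k) + 2 * t * (\<Sum>j<m. c j * R j l) + t\<^sup>2 * R l l"
proof -
  have inner_sum: "(\<Sum>k<m. (c j + t * of_bool (j = l)) * (c k + t * of_bool (k = l)) * R j k) =
    (\<Sum>k<m. c j * c k * R j k) + t * (c j * R j l) + of_bool (j = l) * (t * (\<Sum>k<m. c k * R k l) + t\<^sup>2 * R l l)" for j
  proof -
    have "(\<Sum>k<m. (c j + t * of_bool (j = l)) * (c k + t * of_bool (k = l)) * R j k) =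
      (\<Sum>k<m. c j * c k * R j k + of_bool (k = l) * (t * c j * R j k) +
        of_bool (j = l) * (t * (c k * R j k)) + of_bool (k = l) * (of_bool (j = l) * t\<^sup>2 * R j k))"
      by (rule sum.cong) (simp_all add: algebra_simps power2_eq_square)
    also have "\<dots> = (\<Sum>k<m. c j * c k * R j k) + t * c j * R j l
        + of_bool (j = l) * (t * (\<Sum>k<m. c k * R j k)) + of_bool (j = l) * t\<^sup>2 * R j l"
    proof -
      have d: "(\<Sum>k<m. of_bool (k = l) * f k) = f l" for f :: "nat \<Rightarrow> real"
        using l by (simp add: of_bool_def if_distrib[of "\<lambda>y. y * _"] cong: if_cong)
      show ?thesis
        unfolding sum.distrib d sum_distrib_left[symmetric] by (simp add: mult.assoc)
    qed
    also have "of_bool (j = l) * (t * (\<Sum>k<m. c k * R j k)) = of_bool (j = l) * (t * (\<Sum>k<m. c k * R k l))"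
      by (cases "j = l") (auto intro!: sum.cong simp: sym)
    finally show ?thesis by (auto simp: algebra_simps)
  qed
  have delta: "(\<Sum>j<m. of_bool (j = l) * x) = x" for x :: real
    using l by (simp add: of_bool_def if_distrib[of "\<lambda>y. y * x"] cong: if_cong)
  show ?thesis
    unfolding inner_sum sum.distrib delta sum_distrib_left[symmetric] by (simp add: algebra_simps)
qed

lemma psd_kernel_zero_row:
  assumes R: "psd_kernel R" and z: "R l l = 0"
  shows "R j l = 0"
proof (rule ccontr)
  assume nz: "R j l \<noteq> 0"
  have sym: "\<And>j k. R j k = R k j" by (rule psd_kernelD(1)[OF R])
  define m where "m = Suc (max j l)"
  define c where "c i = (of_bool (i = j) :: real)" for i
  \<comment> \<open>With a zero pivot the form is affine in t; this t makes its value - 1.\<close>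
  define t where "t = - (R j j + 1) / (2 * R j l)"
  have 1: "(\<Sum>i<m. c i * R i l) = R j l"
    by (simp add: c_def of_bool_def m_def if_distrib[of "\<lambda>y. y * R _ _"] cong: if_cong)
  have "j < m" and lm: "l < m" by (simp_all add: m_def)
  then have d: "(\<Sum>i<m. c i * f i) = f j" for f :: "nat \<Rightarrow> real"
    by (simp add: c_def of_bool_def if_distrib[of "\<lambda>y. y * _"] cong: if_cong)
  then have 2: "(\<Sum>i<m. \<Sum>k<m. c i * c k * R i k) = R j j"
    unfolding mult.assoc sum_distrib_left[symmetric] d by simp
  have "0 \<le> (\<Sum>i<m. \<Sum>k<m. (c i + t * of_bool (i = l)) * (c k + t * of_bool (k = l)) * R i k)"
    by (rule psd_kernelD(2)[OF R])
  also have "\<dots> = R j j + 2 * t * R j l"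
    using quadratic_form_shift[where R = R and m = m and l = l and c = c and t = t, OF sym lm] z
    unfolding 1 2 by simp
  also have "\<dots> = - 1"
    using nz by (simp add: t_def field_simps)
  finally show False by simp
qed

text \<open>A vanishing pivot leaves the matrix unchanged because \<open>x / 0 = 0\<close>; positivity then forces its
  row to vanish, so the elimination step is still correct.\<close>

definition schur_step :: "nat \<Rightarrow> (nat \<Rightarrow> nat \<Rightarrow> real) \<Rightarrow> nat \<Rightarrow> nat \<Rightarrow> real"
  where "schur_step l R j k = R j k - R j l * R k l / R l l"

primrec schur :: "(nat \<Rightarrow> nat \<Rightarrow> real) \<Rightarrow> nat \<Rightarrow> nat \<Rightarrow> nat \<Rightarrow> real"
  where "schur R 0 = R"
  | "schur R (Suc l) = schur_step l (schur R l)"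

text \<open>The reduced form at c equals the original form at c shifted along the l-th unit vector
  by t = - s / R l l. This is the minimiser when the pivot is positive, and 0 when it
  vanishes.\<close>

lemma psd_kernel_schur:
  assumes R: "psd_kernel R"
  shows "psd_kernel (schur_step l R)"
  unfolding psd_kernel_def schur_step_def
proof (intro conjI allI)
  have sym: "\<And>j k. R j k = R k j" and pos: "\<And>m c. 0 \<le> (\<Sum>j<m. \<Sum>k<m. c j * c k * R j k)"
    using psd_kernelD[OF R] by blast+
  show "R j k - R j l * R k l / R l l = R k j - R k l * R j l / R l l" for j k
    using sym[of j k] by (simp add: mult.commute)
  have big: "0 \<le> (\<Sum>j<m. \<Sum>k<m. c j * c k * (R j k - R j l * R k l / R l l))" if l: "l < m" for m c
  proof -
    define s where "s = (\<Sum>j<m. c j * R j l)"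
    define t where "t = - s / R l l"
    have "(\<Sum>j<m. \<Sum>k<m. c j * c k * (R j k - R j l * R k l / R l l)) =
      (\<Sum>j<m. \<Sum>k<m. c j * c k * R j k) - (\<Sum>j<m. \<Sum>k<m. c j * R j l * (c k * R k l)) / R l l"
      by (simp add: right_diff_distrib sum_subtractf sum_divide_distrib mult_ac)
    also have "(\<Sum>j<m. \<Sum>k<m. c j * R j l * (c k * R k l)) = s * s"
      by (simp add: s_def sum_product)
    also have "(\<Sum>j<m. \<Sum>k<m. c j * c k * R j k) - s * s / R l l =
      (\<Sum>j<m. \<Sum>k<m. (c j + t * of_bool (j = l)) * (c k + t * of_bool (k = l)) * R j k)"
      unfolding quadratic_form_shift[where R = R, OF sym l] s_def[symmetric]
      by (cases "R l l = 0") (simp_all add: t_def power2_eq_square)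
    finally show ?thesis using pos by simp
  qed
  fix m and c :: "nat \<Rightarrow> real"
  \<comment> \<open>Padding with zeros enlarges the index range until it contains l.\<close>
  define c' where "c' j = (if j < m then c j else 0)" for j
  have "(\<Sum>j<m. \<Sum>k<m. c j * c k * (R j k - R j l * R k l / R l l)) =
    (\<Sum>j<m. \<Sum>k<m. c' j * c' k * (R j k - R j l * R k l / R l l))"
    by (simp add: c'_def)
  also have "\<dots> = (\<Sum>j<max m (Suc l). \<Sum>k<m. c' j * c' k * (R j k - R j l * R k l / R l l))"
    by (rule sum.mono_neutral_left) (auto simp: c'_def)
  also have "\<dots> = (\<Sum>j<max m (Suc l). \<Sum>k<max m (Suc l). c' j * c' k * (R j k - R j l * R k l / R l l))"
    by (intro sum.cong refl sum.mono_neutral_left) (auto simp: c'_def)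
  finally show "0 \<le> (\<Sum>j<m. \<Sum>k<m. c j * c k * (R j k - R j l * R k l / R l l))"
    using big[of "max m (Suc l)" c'] by simp
qed

text \<open>Step l removes the rank-one matrix of column l of L. After m steps all rows with index
  below m have vanished, so telescoping gives the factorisation. One L serves for all m, as the
  infinite-dimensional construction requires.\<close>

lemma cholesky:
  assumes R: "psd_kernel R"
  shows "\<exists>L. (\<forall>j l. l > j \<longrightarrow> L j l = 0) \<and> (\<forall>m j k. j < m \<longrightarrow> k < m \<longrightarrow> R j k = (\<Sum>l<m. L j l * L k l))"
proof -
  have psd: "psd_kernel (schur R l)" for l
    by (induction l) (simp_all add: R psd_kernel_schur)
  have diag: "schur R l l l \<ge> 0" for l
  proof -
    have "0 \<le> (\<Sum>j<Suc l. \<Sum>k<Suc l. of_bool (j = l) * of_bool (k = l) * schur R l j k)"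
      by (rule psd_kernelD(2)[OF psd])
    also have "\<dots> = schur R l l l"
      by simp
    finally show ?thesis .
  qed
  have sym: "schur R l j k = schur R l k j" for l j k
    by (rule psd_kernelD(1)[OF psd])
  have zero: "schur R l j k = 0" if "j < l" for j k l
    using that
  proof (induction l arbitrary: j k)
    case (Suc l)
    show ?case
    proof (cases "j < l")
      case True
      then show ?thesis using Suc.IH by (simp add: schur_step_def)
    next
      case False
      then have "j = l" using Suc.prems by simp
      then show ?thesis
        using psd_kernel_zero_row[OF psd[of l], of l k] sym[of l k l] by (cases "schur R l l l = 0") (auto simp: schur_step_def)
    qed
  qed simp
  define L where "L j l = schur R l j l / sqrt (schur R l l l)" for j l
  have step: "schur R l j k - schur R (Suc l) j k = L j l * L k l" for l j k
    using diag[of l] by (simp add: L_def schur_step_def)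
  have tele: "schur R 0 j k - schur R m j k = (\<Sum>l<m. L j l * L k l)" for m j k
  proof (induction m)
    case (Suc m)
    then show ?case using step[of m j k] by simp
  qed simp
  have "R j k = (\<Sum>l<m. L j l * L k l)" if "j < m" "k < m" for m j k
    using tele[of j k m] zero[OF that(1), of k] by simp
  moreover have "L j l = 0" if "l > j" for j l
    using zero[OF that] by (simp add: L_def)
  ultimately show ?thesis by blast
qed

section \<open>Construction of the Gaussian measure\<close>

lemma indep_vars_PiM_components:
  assumes "\<And>i. prob_space (D i)"
  shows "prob_space.indep_vars (PiM UNIV D) D (\<lambda>i \<omega>. \<omega> i) UNIV"
proof -
  interpret product_prob_space D UNIV
    using assms by (intro product_prob_spaceI) auto
  have "distr (PiM UNIV D) (D i) (\<lambda>\<omega>. \<omega> i) = D i" for i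
    by (rule PiM_component) simp
  moreover have "(\<lambda>x. restrict x UNIV) = (\<lambda>x :: 'a \<Rightarrow> 'b. x)" by (simp add: fun_eq_iff)
  ultimately show ?thesis
    by (subst P.indep_vars_iff_distr_eq_PiM') (auto simp: distr_id2 restrict_UNIV eta_contract_eq)
qed

text \<open>Triangularity of the Cholesky factor makes each coordinate a finite combination of
  independent standard normal variables. The expected sum of the squared coordinates is the trace
  \<tau>, so the series along the basis converges almost surely, and characteristic functions pass
  to its limit by dominated convergence.\<close>

lemma gaussian_exists:
  fixes B :: "'a::{real_inner, banach, second_countable_topology} \<Rightarrow> 'a \<Rightarrow> real"
  assumes B: "bounded_bilinear B" and sym: "\<And>x y. B x y = B y x" and pos: "\<And>x. B x x \<ge> 0"
    and e: "orth_basis e" and tr: "(\<lambda>j. B (e j) (e j)) sums \<tau>"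
  shows "\<exists>P. prob_space P \<and> sets P = sets borel \<and>
    (\<forall>x. (CLINT y|P. iexp (inner y x)) = exp (- B x x / 2)) \<and>
    integrable P (\<lambda>y. (norm y)\<^sup>2) \<and> (\<integral>y. (norm y)\<^sup>2 \<partial>P) = \<tau>"
proof -
  interpret B: bounded_bilinear B by fact
  define \<Gamma> where "\<Gamma> j k = B (e j) (e k)" for j k
  have form: "(\<Sum>j<m. \<Sum>k<m. c j * c k * \<Gamma> j k) = B (\<Sum>j<m. c j *\<^sub>R e j) (\<Sum>j<m. c j *\<^sub>R e j)" for m c
    unfolding B.sum_left unfolding B.sum_right
    by (simp add: B.scaleR_left B.scaleR_right \<Gamma>_def mult_ac)
  have "psd_kernel \<Gamma>"
    unfolding psd_kernel_def form using sym pos by (simp add: \<Gamma>_def)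
  from cholesky[OF this]
  obtain L where L': "\<forall>j l. l > j \<longrightarrow> L j l = 0"
      "\<forall>m j k. j < m \<longrightarrow> k < m \<longrightarrow> \<Gamma> j k = (\<Sum>l<m. L j l * L k l)"
    by (elim exE conjE)
  have L0: "L j l = 0" if "l > j" for j l using L'(1) that by simp
  have L: "\<Gamma> j k = (\<Sum>l<m. L j l * L k l)" if "j < m" "k < m" for m j k
    by (rule L'(2)[rule_format, OF that])
  define S where "S = std_normal_distribution"
  define \<Omega> where "\<Omega> = PiM (UNIV :: nat set) (\<lambda>_. S)"
  interpret S: real_distribution S unfolding S_def by (rule real_dist_normal_dist)
  interpret PP: product_prob_space "\<lambda>_. S" "UNIV :: nat set" ..
  interpret \<Omega>: prob_space \<Omega> unfolding \<Omega>_def by (rule PP.P.prob_space_axioms)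
  have Sb: "sets S = sets borel" by simp
  have m[measurable]: "(\<lambda>\<omega>. \<omega> i) \<in> borel_measurable \<Omega>" for i
    unfolding \<Omega>_def using measurable_component_singleton[of i UNIV "\<lambda>_. S"] by (simp cong: measurable_cong_sets)
  have ind: "\<Omega>.indep_vars (\<lambda>_. borel) (\<lambda>i \<omega>. \<omega> i) UNIV"
  proof -
    have "\<Omega>.indep_vars (\<lambda>_. S) (\<lambda>i \<omega>. \<omega> i) UNIV"
      unfolding \<Omega>_def by (rule indep_vars_PiM_components) (rule S.prob_space_axioms)
    then have "\<Omega>.indep_vars (\<lambda>_. borel) (\<lambda>i \<omega>. (\<lambda>x. x) (\<omega> i)) UNIV"
      by (rule \<Omega>.indep_vars_compose2) simp
    then show ?thesis by simp
  qed
  have dist: "distr \<Omega> borel (\<lambda>\<omega>. d * \<omega> i) = distr S borel (\<lambda>x. d * x)" for d :: real and i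
  proof -
    have "distr S borel (\<lambda>x. d * x) = distr (distr \<Omega> S (\<lambda>\<omega>. \<omega> i)) borel (\<lambda>x. d * x)"
      unfolding \<Omega>_def by (subst PP.PiM_component) simp_all
    also have "\<dots> = distr \<Omega> borel (\<lambda>\<omega>. d * \<omega> i)"
      unfolding \<Omega>_def by (subst distr_distr) (simp_all add: comp_def)
    finally show ?thesis ..
  qed
  have chS: "char (distr S borel (\<lambda>x. d * x)) 1 = exp (- (d\<^sup>2) / 2)" for d
  proof -
    have "char (distr S borel (\<lambda>x. d * x)) 1 = char S d"
      unfolding char_def by (subst integral_distr) auto
    then show ?thesis by (simp add: S_def char_std_normal_distribution exp_of_real)
  qed
  have lin: "(CLINT \<omega>|\<Omega>. iexp (\<Sum>l<m. d l * \<omega> l)) = exp (- (\<Sum>l<m. (d l)\<^sup>2) / 2)" for d :: "nat \<Rightarrow> real" and m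
  proof -
    have "\<Omega>.indep_vars (\<lambda>_. borel) (\<lambda>l \<omega>. d l * \<omega> l) {..<m}"
      using \<Omega>.indep_vars_subset[OF ind, of "{..<m}"]
      by (intro \<Omega>.indep_vars_compose2[of "\<lambda>_. borel" "\<lambda>i \<omega>. \<omega> i" _ "\<lambda>l x. d l * x"]) auto
    from \<Omega>.char_distr_sum[OF this, of 1]
    have "char (distr \<Omega> borel (\<lambda>\<omega>. \<Sum>l<m. d l * \<omega> l)) 1 = (\<Prod>l<m. exp (- ((d l)\<^sup>2) / 2))"
      by (simp add: dist chS)
    also have "\<dots> = exp (- (\<Sum>l<m. (d l)\<^sup>2) / 2)"
      by (simp add: exp_sum[symmetric] sum_negf sum_divide_distrib flip: exp_of_real)
    finally show ?thesis
      unfolding char_def by (subst (asm) integral_distr) auto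
  qed
  define g where "g j \<omega> = (\<Sum>l\<le>j. L j l * \<omega> l)" for j and \<omega> :: "nat \<Rightarrow> real"
  have [measurable]: "g j \<in> borel_measurable \<Omega>" for j
    unfolding g_def by measurable
  have g_sum: "(\<Sum>j<m. c j * g j \<omega>) = (\<Sum>l<m. (\<Sum>j<m. c j * L j l) * \<omega> l)" for m c \<omega>
  proof -
    have "g j \<omega> = (\<Sum>l<m. L j l * \<omega> l)" if "j < m" for j
      unfolding g_def by (rule sum.mono_neutral_left) (use that L0 in auto)
    then have "(\<Sum>j<m. c j * g j \<omega>) = (\<Sum>j<m. \<Sum>l<m. c j * L j l * \<omega> l)"
      by (simp add: sum_distrib_left mult.assoc)
    also have "\<dots> = (\<Sum>l<m. \<Sum>j<m. c j * L j l * \<omega> l)" by (rule sum.swap)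
    finally show ?thesis by (simp add: sum_distrib_right)
  qed
  have ch: "(CLINT \<omega>|\<Omega>. iexp (\<Sum>j<m. c j * g j \<omega>)) =
    exp (- B (\<Sum>j<m. c j *\<^sub>R e j) (\<Sum>j<m. c j *\<^sub>R e j) / 2)" for m c
  proof -
    have "(\<Sum>l<m. (\<Sum>j<m. c j * L j l)\<^sup>2) = (\<Sum>l<m. \<Sum>j<m. \<Sum>k<m. c j * c k * (L j l * L k l))"
      by (simp add: power2_eq_square sum_product mult_ac)
    also have "\<dots> = (\<Sum>j<m. \<Sum>l<m. \<Sum>k<m. c j * c k * (L j l * L k l))"
      by (rule sum.swap)
    also have "\<dots> = (\<Sum>j<m. \<Sum>k<m. \<Sum>l<m. c j * c k * (L j l * L k l))"
      by (intro sum.cong refl sum.swap)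
    also have "\<dots> = (\<Sum>j<m. \<Sum>k<m. c j * c k * \<Gamma> j k)"
      by (intro sum.cong refl) (simp add: L[of _ m] sum_distrib_left)
    finally show ?thesis unfolding g_sum lin form by simp
  qed
  have g_char: "char (distr \<Omega> borel (g j)) t = exp (- (t\<^sup>2 * \<Gamma> j j) / 2)" for j t
  proof -
    have "char (distr \<Omega> borel (g j)) t = (CLINT \<omega>|\<Omega>. iexp (\<Sum>i<Suc j. (if i = j then t else 0) * g i \<omega>))"
      unfolding char_def by (subst integral_distr) (auto simp: if_distrib[of "\<lambda>x. x * _"] cong: if_cong)
    also have "\<dots> = exp (- B (t *\<^sub>R e j) (t *\<^sub>R e j) / 2)"
      unfolding ch by (simp add: if_distrib[of "\<lambda>x. x *\<^sub>R _"] cong: if_cong)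
    finally show ?thesis
      by (simp add: B.scaleR_left B.scaleR_right \<Gamma>_def power2_eq_square mult.assoc)
  qed
  have \<Gamma>0: "\<Gamma> j j \<ge> 0" for j using pos by (simp add: \<Gamma>_def)
  have \<Gamma>s: "(\<Sum>j. ennreal (\<Gamma> j j)) = ennreal \<tau>"
    using tr \<Gamma>0 by (simp add: \<Gamma>_def suminf_ennreal2 sums_iff)
  have nn: "(\<integral>\<^sup>+\<omega>. ennreal ((Z \<omega>)\<^sup>2) \<partial>\<Omega>) = ennreal v"
    if [measurable]: "Z \<in> borel_measurable \<Omega>" and "v \<ge> 0" "\<And>t. char (distr \<Omega> borel Z) t = exp (- (t\<^sup>2 * v) / 2)" for Z v
    using \<Omega>.normal_of_char_integrable_square[OF that] \<Omega>.normal_of_char_variance[OF that]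
    by (subst nn_integral_eq_integral) auto
  have "(\<integral>\<^sup>+\<omega>. (\<Sum>j. ennreal ((g j \<omega>)\<^sup>2)) \<partial>\<Omega>) = (\<Sum>j. ennreal (\<Gamma> j j))"
    by (subst nn_integral_suminf) (simp_all add: nn[OF _ \<Gamma>0 g_char])
  then have "AE \<omega> in \<Omega>. (\<Sum>j. ennreal ((g j \<omega>)\<^sup>2)) \<noteq> \<infinity>"
    unfolding \<Gamma>s by (intro nn_integral_PInf_AE) auto
  then have conv: "AE \<omega> in \<Omega>. summable (\<lambda>j. g j \<omega> *\<^sub>R e j)"
  proof eventually_elim
    case (elim \<omega>)
    then have "summable (\<lambda>j. (g j \<omega>)\<^sup>2)"
      by (intro summable_suminf_not_top) auto
    then show ?case by (rule orth_series_convergent[OF e])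
  qed
  define G where "G \<omega> = lim (\<lambda>m. \<Sum>j<m. g j \<omega> *\<^sub>R e j)" for \<omega>
  have G[measurable]: "G \<in> borel_measurable \<Omega>"
    unfolding G_def by (rule borel_measurable_lim_metric) measurable
  have Glim: "AE \<omega> in \<Omega>. (\<lambda>m. \<Sum>j<m. g j \<omega> *\<^sub>R e j) \<longlonglongrightarrow> G \<omega>"
    using conv by eventually_elim (simp add: G_def convergent_LIMSEQ_iff[symmetric] summable_iff_convergent)
  have chG: "(CLINT \<omega>|\<Omega>. iexp (inner (G \<omega>) x)) = exp (- B x x / 2)" for x
  proof (rule LIMSEQ_unique)
    show "(\<lambda>m. CLINT \<omega>|\<Omega>. iexp (inner (\<Sum>j<m. g j \<omega> *\<^sub>R e j) x)) \<longlonglongrightarrow> (CLINT \<omega>|\<Omega>. iexp (inner (G \<omega>) x))"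
    proof (rule integral_dominated_convergence[where w = "\<lambda>_. 1"])
      show "AE \<omega> in \<Omega>. (\<lambda>m. iexp (inner (\<Sum>j<m. g j \<omega> *\<^sub>R e j) x)) \<longlonglongrightarrow> iexp (inner (G \<omega>) x)"
        using Glim by eventually_elim (intro tendsto_intros)
    qed auto
    have "(CLINT \<omega>|\<Omega>. iexp (inner (\<Sum>j<m. g j \<omega> *\<^sub>R e j) x)) = exp (- B (proj_upto e m x) (proj_upto e m x) / 2)" for m
    proof -
      have "inner (\<Sum>j<m. g j \<omega> *\<^sub>R e j) x = (\<Sum>j<m. inner x (e j) * g j \<omega>)" for \<omega>
        by (simp add: inner_sum_left inner_commute[of x] mult.commute)
      then show ?thesis unfolding proj_upto_def by (simp only: ch)
    qed
    moreover have "(\<lambda>m. complex_of_real (exp (- B (proj_upto e m x) (proj_upto e m x) / 2))) \<longlonglongrightarrow> exp (- B x x / 2)"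
      by (intro tendsto_of_real tendsto_exp tendsto_divide tendsto_minus tendsto_const
        B.tendsto orth_basisD(3)[OF e]) simp
    ultimately show "(\<lambda>m. CLINT \<omega>|\<Omega>. iexp (inner (\<Sum>j<m. g j \<omega> *\<^sub>R e j) x)) \<longlonglongrightarrow> exp (- B x x / 2)"
      by simp
  qed
  have chGx: "char (distr \<Omega> borel (\<lambda>\<omega>. inner (G \<omega>) x)) t = exp (- (t\<^sup>2 * B x x) / 2)" for t x
  proof -
    have "char (distr \<Omega> borel (\<lambda>\<omega>. inner (G \<omega>) x)) t = (CLINT \<omega>|\<Omega>. iexp (inner (G \<omega>) (t *\<^sub>R x)))"
      unfolding char_def by (subst integral_distr) auto
    then show ?thesis
      unfolding chG by (simp add: B.scaleR_left B.scaleR_right power2_eq_square mult.assoc)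
  qed
  have "(\<integral>\<^sup>+\<omega>. ennreal ((norm (G \<omega>))\<^sup>2) \<partial>\<Omega>) = (\<integral>\<^sup>+\<omega>. (\<Sum>j. ennreal ((inner (G \<omega>) (e j))\<^sup>2)) \<partial>\<Omega>)"
    using parseval[OF e] by (intro nn_integral_cong) (simp add: suminf_ennreal2 sums_iff)
  also have "\<dots> = (\<Sum>j. ennreal (\<Gamma> j j))"
    unfolding \<Gamma>_def by (subst nn_integral_suminf) (simp_all add: nn[OF _ pos chGx])
  finally have nG: "(\<integral>\<^sup>+\<omega>. ennreal ((norm (G \<omega>))\<^sup>2) \<partial>\<Omega>) = ennreal \<tau>" unfolding \<Gamma>s .
  have \<tau>: "\<tau> \<ge> 0" using tr pos sums_le[OF _ sums_zero tr] by simp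
  have iG: "integrable \<Omega> (\<lambda>\<omega>. (norm (G \<omega>))\<^sup>2)"
    by (rule integrableI_bounded) (simp_all add: nG)
  have eG: "(\<integral>\<omega>. (norm (G \<omega>))\<^sup>2 \<partial>\<Omega>) = \<tau>"
    by (rule integral_eq_nn_integral[THEN trans]) (simp_all add: nG \<tau>)
  show ?thesis
  proof (intro exI[of _ "distr \<Omega> borel G"] conjI allI)
    show "prob_space (distr \<Omega> borel G)" by (rule \<Omega>.prob_space_distr) simp
    show "(CLINT y|distr \<Omega> borel G. iexp (inner y x)) = exp (- B x x / 2)" for x
      by (subst integral_distr) (auto simp: chG)
    show "integrable (distr \<Omega> borel G) (\<lambda>y. (norm y)\<^sup>2)"
      by (subst integrable_distr_eq) (auto simp: iG)
    show "(\<integral>y. (norm y)\<^sup>2 \<partial>distr \<Omega> borel G) = \<tau>"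
      by (subst integral_distr) (auto simp: eG)
  qed simp
qed

section \<open>Sums of independent Hilbert space valued variables\<close>

lemma (in prob_space) indep_vars_inj:
  assumes ind: "indep_vars (\<lambda>_. N) X I" and f: "inj_on f L" "f ` L \<subseteq> I"
  shows "indep_vars (\<lambda>_. N) (\<lambda>j. X (f j)) L"
proof -
  have "indep_vars (\<lambda>j. PiM {f j} (\<lambda>_. N)) (\<lambda>j \<omega>. restrict (\<lambda>i. X i \<omega>) {f j}) L"
    by (rule indep_vars_restrict[OF ind])
      (use f in \<open>auto simp: disjoint_family_on_def inj_on_def\<close>)
  then have "indep_vars (\<lambda>_. N) (\<lambda>j \<omega>. (\<lambda>z. z (f j)) (restrict (\<lambda>i. X i \<omega>) {f j})) L"
    by (rule indep_vars_compose2) (rule measurable_component_singleton, simp)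
  then show ?thesis by simp
qed

text \<open>F is arbitrary because the maximal inequality pairs a later block with a partial sum cut
  off by a first-passage event.\<close>

lemma (in prob_space) indep_var_block:
  fixes X :: "nat \<Rightarrow> 'a \<Rightarrow> 'b::{real_normed_vector, second_countable_topology}"
  assumes ind: "indep_vars (\<lambda>_. borel) X UNIV" and F: "F \<in> borel_measurable (PiM {..<k} (\<lambda>_. borel))"
  shows "indep_var borel (\<lambda>\<omega>. \<Sum>i=k..<n. X i \<omega>) borel (\<lambda>\<omega>. F (restrict (\<lambda>i. X i \<omega>) {..<k}))"
proof -
  have "indep_var (PiM {k..<n} (\<lambda>_. borel)) (\<lambda>\<omega>. restrict (\<lambda>i. X i \<omega>) {k..<n})
      (PiM {..<k} (\<lambda>_. borel)) (\<lambda>\<omega>. restrict (\<lambda>i. X i \<omega>) {..<k})"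
    by (rule indep_var_restrict[OF ind]) auto
  moreover have "(\<lambda>z. \<Sum>i=k..<n. z i) \<in> borel_measurable (PiM {k..<n} (\<lambda>_. borel :: 'b measure))"
    by (intro borel_measurable_sum measurable_component_singleton)
  ultimately have "indep_var borel ((\<lambda>z. \<Sum>i=k..<n. z i) \<circ> (\<lambda>\<omega>. restrict (\<lambda>i. X i \<omega>) {k..<n}))
      borel (F \<circ> (\<lambda>\<omega>. restrict (\<lambda>i. X i \<omega>) {..<k}))"
    using F by (rule indep_var_compose)
  then show ?thesis by (simp add: comp_def)
qed

text \<open>The joint law is the product of the marginals, and integrating the centred variable
  first gives zero.\<close>

lemma (in prob_space) indep_var_inner_zero:
  fixes X Z :: "'a \<Rightarrow> 'b::{real_inner, banach, second_countable_topology}"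
  assumes ind: "indep_var borel X borel Z" and X: "integrable M X" "expectation X = 0"
    and X2: "integrable M (\<lambda>\<omega>. (norm (X \<omega>))\<^sup>2)" and Z2: "integrable M (\<lambda>\<omega>. (norm (Z \<omega>))\<^sup>2)"
  shows "integrable M (\<lambda>\<omega>. inner (X \<omega>) (Z \<omega>))" "expectation (\<lambda>\<omega>. inner (X \<omega>) (Z \<omega>)) = 0"
proof -
  have Xm[measurable]: "X \<in> borel_measurable M" and Zm[measurable]: "Z \<in> borel_measurable M"
    using indep_var_rv1[OF ind] indep_var_rv2[OF ind] by auto
  define P where "P = distr M borel X"
  define R where "R = distr M borel Z"
  interpret P: prob_space P unfolding P_def by (rule prob_space_distr) simp
  interpret R: prob_space R unfolding R_def by (rule prob_space_distr) simp
  interpret PR: pair_sigma_finite P R ..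
  have eq: "P \<Otimes>\<^sub>M R = distr M (borel \<Otimes>\<^sub>M borel) (\<lambda>\<omega>. (X \<omega>, Z \<omega>))"
    using ind unfolding indep_var_distribution_eq P_def R_def by simp
  have mp: "(\<lambda>\<omega>. (X \<omega>, Z \<omega>)) \<in> measurable M (borel \<Otimes>\<^sub>M borel)" by measurable
  have mi: "(\<lambda>(x, z). inner x z) \<in> borel_measurable (borel \<Otimes>\<^sub>M (borel :: 'b measure))"
    by measurable
  show int: "integrable M (\<lambda>\<omega>. inner (X \<omega>) (Z \<omega>))"
  proof (rule Bochner_Integration.integrable_bound[OF Bochner_Integration.integrable_add[OF X2 Z2]])
    have "\<bar>inner x z\<bar> \<le> (norm x)\<^sup>2 + (norm z)\<^sup>2" for x z :: 'b
    proof -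
      have "\<bar>inner x z\<bar> \<le> norm x * norm z" by (rule Cauchy_Schwarz_ineq2)
      also have "\<dots> \<le> (norm x)\<^sup>2 + (norm z)\<^sup>2"
      proof -
        have "norm x * norm z \<ge> 0" by simp
        then show ?thesis using sum_squares_bound[of "norm x" "norm z"] by (simp only: mult.assoc)
      qed
      finally show ?thesis .
    qed
    then show "AE \<omega> in M. norm (inner (X \<omega>) (Z \<omega>)) \<le> norm ((norm (X \<omega>))\<^sup>2 + (norm (Z \<omega>))\<^sup>2)"
      by (intro AE_I2) (simp add: order_trans[OF _ abs_ge_self])
  qed measurable
  then have intPR: "integrable (P \<Otimes>\<^sub>M R) (\<lambda>(x, z). inner x z)"
    unfolding eq integrable_distr_eq[OF mp mi] by simp
  have m1: "(\<lambda>x. x :: 'b) \<in> borel_measurable borel" by simp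
  have Pint: "integrable P (\<lambda>x. x)" "(\<integral>x. x \<partial>P) = 0"
    unfolding P_def integrable_distr_eq[OF Xm m1] integral_distr[OF Xm m1] by (rule X)+
  have "expectation (\<lambda>\<omega>. inner (X \<omega>) (Z \<omega>)) = (\<integral>(x, z). inner x z \<partial>(P \<Otimes>\<^sub>M R))"
    unfolding eq integral_distr[OF mp mi] by simp
  also have "\<dots> = (\<integral>z. (\<integral>x. inner x z \<partial>P) \<partial>R)"
    by (rule PR.integral_snd[OF intPR, symmetric])
  also have "(\<lambda>z. \<integral>x. inner x z \<partial>P) = (\<lambda>z. 0)"
  proof
    fix z
    have "(\<integral>x. inner x z \<partial>P) = inner (\<integral>x. x \<partial>P) z" using Pint(1) by (intro integral_inner_left) simp
    then show "(\<integral>x. inner x z \<partial>P) = 0" by (simp add: Pint(2))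
  qed
  finally show "expectation (\<lambda>\<omega>. inner (X \<omega>) (Z \<omega>)) = 0" by simp
qed

lemma norm_add_sq_le: "(norm (a + b))\<^sup>2 \<le> 2 * (norm a)\<^sup>2 + 2 * (norm b)\<^sup>2"
  for a b :: "'a::real_normed_vector"
proof -
  have "(norm (a + b))\<^sup>2 \<le> (norm a + norm b)\<^sup>2"
    by (intro power_mono norm_triangle_ineq) simp
  also have "\<dots> \<le> 2 * (norm a)\<^sup>2 + 2 * (norm b)\<^sup>2"
    using sum_squares_bound[of "norm a" "norm b"] by (simp add: power2_sum)
  finally show ?thesis .
qed

lemma integrable_norm_sq_add:
  fixes X Y :: "'a \<Rightarrow> 'b::{banach, second_countable_topology}"
  assumes [measurable]: "X \<in> borel_measurable M" "Y \<in> borel_measurable M"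
    and "integrable M (\<lambda>\<omega>. (norm (X \<omega>))\<^sup>2)" "integrable M (\<lambda>\<omega>. (norm (Y \<omega>))\<^sup>2)"
  shows "integrable M (\<lambda>\<omega>. (norm (X \<omega> + Y \<omega>))\<^sup>2)"
proof (rule Bochner_Integration.integrable_bound)
  show "integrable M (\<lambda>\<omega>. 2 * (norm (X \<omega>))\<^sup>2 + 2 * (norm (Y \<omega>))\<^sup>2)" using assms by simp
  show "AE \<omega> in M. norm ((norm (X \<omega> + Y \<omega>))\<^sup>2) \<le> norm (2 * (norm (X \<omega>))\<^sup>2 + 2 * (norm (Y \<omega>))\<^sup>2)"
    using norm_add_sq_le by (intro AE_I2) simp
qed simp

lemma (in prob_space) integrable_of_norm_sq:
  fixes X :: "'a \<Rightarrow> 'b::{banach, second_countable_topology}"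
  assumes [measurable]: "X \<in> borel_measurable M" and "integrable M (\<lambda>\<omega>. (norm (X \<omega>))\<^sup>2)"
  shows "integrable M X"
proof -
  have "integrable M (\<lambda>\<omega>. norm (X \<omega>))"
    by (rule square_integrable_imp_integrable) (simp_all add: assms)
  then show ?thesis by (rule integrable_norm_cancel) simp
qed

section \<open>Maximal inequality and almost sure convergence of centred series\<close>

locale indep_centered = prob_space M for M :: "'a measure" +
  fixes X :: "nat \<Rightarrow> 'a \<Rightarrow> 'b::{real_inner, banach, second_countable_topology}"
  assumes indep: "indep_vars (\<lambda>_. borel) X UNIV"
    and centered: "\<And>i. expectation (X i) = 0"
    and square_int: "\<And>i. integrable M (\<lambda>\<omega>. (norm (X i \<omega>))\<^sup>2)"
begin

lemma X_meas[measurable]: "X i \<in> borel_measurable M"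
  using indep by (auto simp: indep_vars_def)

lemma X_int: "integrable M (X i)"
  by (rule integrable_of_norm_sq[OF X_meas square_int])

lemma sum_square_int: "finite A \<Longrightarrow> integrable M (\<lambda>\<omega>. (norm (\<Sum>i\<in>A. X i \<omega>))\<^sup>2)"
proof (induction A rule: finite_induct)
  case (insert i A)
  then show ?case using square_int by (auto intro!: integrable_norm_sq_add)
qed simp

lemma block_inner_zero:
  assumes F: "F \<in> borel_measurable (PiM {..<k} (\<lambda>_. borel))"
    and F2: "integrable M (\<lambda>\<omega>. (norm (F (restrict (\<lambda>i. X i \<omega>) {..<k})))\<^sup>2)"
  shows "integrable M (\<lambda>\<omega>. inner (\<Sum>i=k..<n. X i \<omega>) (F (restrict (\<lambda>i. X i \<omega>) {..<k})))"
    "expectation (\<lambda>\<omega>. inner (\<Sum>i=k..<n. X i \<omega>) (F (restrict (\<lambda>i. X i \<omega>) {..<k}))) = 0"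
proof -
  have "expectation (\<lambda>\<omega>. \<Sum>i=k..<n. X i \<omega>) = 0"
    using X_int centered by simp
  then show "integrable M (\<lambda>\<omega>. inner (\<Sum>i=k..<n. X i \<omega>) (F (restrict (\<lambda>i. X i \<omega>) {..<k})))"
    "expectation (\<lambda>\<omega>. inner (\<Sum>i=k..<n. X i \<omega>) (F (restrict (\<lambda>i. X i \<omega>) {..<k}))) = 0"
    using indep_var_inner_zero[OF indep_var_block[OF indep F, of n] _ _ sum_square_int[of "{k..<n}"] F2]
      X_int by auto
qed

lemma expectation_norm_sum:
  "expectation (\<lambda>\<omega>. (norm (\<Sum>i<n. X i \<omega>))\<^sup>2) = (\<Sum>i<n. expectation (\<lambda>\<omega>. (norm (X i \<omega>))\<^sup>2))"
proof (induction n)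
  case (Suc n)
  define F where "F z = (\<Sum>i<n. z i)" for z :: "nat \<Rightarrow> 'b"
  have F: "F \<in> borel_measurable (PiM {..<n} (\<lambda>_. borel))"
    unfolding F_def by (intro borel_measurable_sum measurable_component_singleton)
  have FX: "F (restrict (\<lambda>i. X i \<omega>) {..<n}) = (\<Sum>i<n. X i \<omega>)" for \<omega>
    by (simp add: F_def)
  have z: "integrable M (\<lambda>\<omega>. inner (X n \<omega>) (\<Sum>i<n. X i \<omega>))"
    "expectation (\<lambda>\<omega>. inner (X n \<omega>) (\<Sum>i<n. X i \<omega>)) = 0"
    using block_inner_zero[OF F, of "Suc n"] sum_square_int[of "{..<n}"] unfolding FX by simp_all
  have "(\<lambda>\<omega>. (norm (\<Sum>i<Suc n. X i \<omega>))\<^sup>2) =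
    (\<lambda>\<omega>. (norm (\<Sum>i<n. X i \<omega>))\<^sup>2 + 2 * inner (X n \<omega>) (\<Sum>i<n. X i \<omega>) + (norm (X n \<omega>))\<^sup>2)"
    unfolding power2_norm_eq_inner
    by (simp add: fun_eq_iff inner_add_left inner_add_right inner_commute)
  then show ?case
    using z square_int sum_square_int[of "{..<n}"] Suc.IH by simp
qed simp

text \<open>Kolmogorov's argument. The event splits according to the first k at which the norm of
  the partial sum reaches \<delta>. On each piece the increment from k to n is orthogonal in mean to
  the partial sum at k, so passing to n cannot lower the second moment there.\<close>

lemma kolmogorov_inequality:
  assumes \<delta>: "\<delta> > 0"
  shows "prob {\<omega>\<in>space M. \<exists>k\<le>n. \<delta> \<le> norm (\<Sum>i<k. X i \<omega>)} \<le>
    (\<Sum>i<n. expectation (\<lambda>\<omega>. (norm (X i \<omega>))\<^sup>2)) / \<delta>\<^sup>2"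
proof -
  define S where "S k \<omega> = (\<Sum>i<k. X i \<omega>)" for k \<omega>
  have [measurable]: "S k \<in> borel_measurable M" for k unfolding S_def by measurable
  define A where "A k = {\<omega>\<in>space M. \<delta> \<le> norm (S k \<omega>) \<and> (\<forall>j<k. norm (S j \<omega>) < \<delta>)}" for k
  have [measurable]: "A k \<in> sets M" for k unfolding A_def by measurable
  have S2: "integrable M (\<lambda>\<omega>. (norm (S k \<omega>))\<^sup>2)" for k
    unfolding S_def by (rule sum_square_int) simp
  have AS2: "integrable M (\<lambda>\<omega>. indicator (A k) \<omega> * (norm (S n \<omega>))\<^sup>2)" for k
    by (rule Bochner_Integration.integrable_bound[OF S2[of n]]) (auto simp: indicator_def)
  have step: "\<delta>\<^sup>2 * prob (A k) \<le> expectation (\<lambda>\<omega>. indicator (A k) \<omega> * (norm (S n \<omega>))\<^sup>2)" if k: "k \<le> n" for k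
  proof -
    \<comment> \<open>Partial sums as functions of the first k coordinates alone; the intersection
      keeps the index set within \<open>{..<k}\<close> for every j.\<close>
    define s where "s j z = (\<Sum>i\<in>{..<j} \<inter> {..<k}. z i)" for j and z :: "nat \<Rightarrow> 'b"
    have [measurable]: "s j \<in> borel_measurable (PiM {..<k} (\<lambda>_. borel))" for j
      unfolding s_def by (intro borel_measurable_sum measurable_component_singleton) simp
    \<comment> \<open>The partial sum at k cut off to the event of first passage at k, written as a
      function of the past.\<close>
    define F where "F z = (if \<delta> \<le> norm (s k z) \<and> (\<forall>j<k. norm (s j z) < \<delta>) then s k z else 0)" for z
    have mF: "F \<in> borel_measurable (PiM {..<k} (\<lambda>_. borel))"
      unfolding F_def by measurable
    have FX: "F (restrict (\<lambda>i. X i \<omega>) {..<k}) = indicator (A k) \<omega> *\<^sub>R S k \<omega>" if "\<omega> \<in> space M" for \<omega>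
    proof -
      have s: "s j (restrict (\<lambda>i. X i \<omega>) {..<k}) = S j \<omega>" if "j \<le> k" for j
        unfolding S_def s_def by (rule sum.cong) (use that in auto)
      show ?thesis
        unfolding F_def using that s by (auto simp: A_def indicator_def)
    qed
    have FXi: "integrable M (\<lambda>\<omega>. (norm (F (restrict (\<lambda>i. X i \<omega>) {..<k})))\<^sup>2)"
    proof -
      have "integrable M (\<lambda>\<omega>. (norm (indicator (A k) \<omega> *\<^sub>R S k \<omega>))\<^sup>2)"
        by (rule Bochner_Integration.integrable_bound[OF S2[of k]]) (auto simp: indicator_def)
      then show ?thesis by (rule Bochner_Integration.integrable_cong[THEN iffD1, rotated -1]) (simp_all add: FX)
    qed
    define T where "T \<omega> = inner (\<Sum>i=k..<n. X i \<omega>) (F (restrict (\<lambda>i. X i \<omega>) {..<k}))" for \<omega>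
    have T: "integrable M T" "expectation T = 0"
      unfolding T_def by (rule block_inner_zero[OF mF FXi])+
    have "\<delta>\<^sup>2 * prob (A k) = expectation (\<lambda>\<omega>. \<delta>\<^sup>2 * indicator (A k) \<omega> + 2 * T \<omega>)"
      using T by (simp add: emeasure_eq_measure)
    also have "\<dots> \<le> expectation (\<lambda>\<omega>. indicator (A k) \<omega> * (norm (S n \<omega>))\<^sup>2)"
    proof (rule integral_mono)
      show "integrable M (\<lambda>\<omega>. \<delta>\<^sup>2 * indicator (A k) \<omega> + 2 * T \<omega>)"
        using T by (simp add: emeasure_eq_measure)
      fix \<omega> assume \<omega>: "\<omega> \<in> space M"
      have Sn: "S n \<omega> = S k \<omega> + (\<Sum>i=k..<n. X i \<omega>)"
        unfolding S_def using k sum.atLeastLessThan_concat[of 0 k n "\<lambda>i. X i \<omega>"]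
        by (simp add: lessThan_atLeast0)
      show "\<delta>\<^sup>2 * indicator (A k) \<omega> + 2 * T \<omega> \<le> indicator (A k) \<omega> * (norm (S n \<omega>))\<^sup>2"
      proof (cases "\<omega> \<in> A k")
        case True
        have "(norm (S n \<omega>))\<^sup>2 = (norm (S k \<omega>))\<^sup>2 + 2 * inner (\<Sum>i=k..<n. X i \<omega>) (S k \<omega>) + (norm (\<Sum>i=k..<n. X i \<omega>))\<^sup>2"
          unfolding Sn power2_norm_eq_inner by (simp add: inner_add_left inner_add_right inner_commute)
        moreover have "\<delta>\<^sup>2 \<le> (norm (S k \<omega>))\<^sup>2"
          using True \<delta> by (intro power_mono) (auto simp: A_def)
        ultimately show ?thesis
          using True FX[OF \<omega>] by (simp add: T_def add_increasing2)
      next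
        case False
        then show ?thesis using FX[OF \<omega>] by (simp add: T_def)
      qed
    qed (rule AS2)
    finally show ?thesis .
  qed
  have disj: "disjoint_family_on A {..n}"
  proof -
    have less: "A j \<inter> A k = {}" if "j < k" for j k
      using that by (fastforce simp: A_def)
    have "A j \<inter> A k = {}" if "j \<noteq> k" for j k
      using less[of j k] less[of k j] that by (cases j k rule: linorder_cases) auto
    then show ?thesis by (simp add: disjoint_family_on_def)
  qed
  have un: "{\<omega>\<in>space M. \<exists>k\<le>n. \<delta> \<le> norm (\<Sum>i<k. X i \<omega>)} = (\<Union>k\<le>n. A k)"
  proof (intro set_eqI iffI)
    fix \<omega> assume "\<omega> \<in> {\<omega>\<in>space M. \<exists>k\<le>n. \<delta> \<le> norm (\<Sum>i<k. X i \<omega>)}"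
    then have \<omega>: "\<omega> \<in> space M" and ex: "\<exists>k. k \<le> n \<and> \<delta> \<le> norm (S k \<omega>)" by (auto simp: S_def)
    define k where "k = (LEAST k. k \<le> n \<and> \<delta> \<le> norm (S k \<omega>))"
    have "k \<le> n \<and> \<delta> \<le> norm (S k \<omega>)" unfolding k_def by (rule LeastI_ex[OF ex])
    moreover have "norm (S j \<omega>) < \<delta>" if "j < k" for j
      using not_less_Least[of j "\<lambda>k. k \<le> n \<and> \<delta> \<le> norm (S k \<omega>)"] that calculation
      unfolding k_def[symmetric] by auto
    ultimately show "\<omega> \<in> (\<Union>k\<le>n. A k)" using \<omega> by (auto simp: A_def)
  qed (auto simp: A_def S_def)
  have "\<delta>\<^sup>2 * prob (\<Union>k\<le>n. A k) = (\<Sum>k\<le>n. \<delta>\<^sup>2 * prob (A k))"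
    using disj by (subst finite_measure_finite_Union) (auto simp: sum_distrib_left)
  also have "\<dots> \<le> (\<Sum>k\<le>n. expectation (\<lambda>\<omega>. indicator (A k) \<omega> * (norm (S n \<omega>))\<^sup>2))"
    by (intro sum_mono step) simp
  also have "\<dots> = expectation (\<lambda>\<omega>. \<Sum>k\<le>n. indicator (A k) \<omega> * (norm (S n \<omega>))\<^sup>2)"
    by (rule Bochner_Integration.integral_sum[symmetric]) (rule AS2)
  also have "\<dots> \<le> expectation (\<lambda>\<omega>. (norm (S n \<omega>))\<^sup>2)"
  proof (rule integral_mono)
    fix \<omega>
    have "(\<Sum>k\<le>n. indicator (A k) \<omega>) = (indicator (\<Union>k\<le>n. A k) \<omega> :: real)"
      by (rule indicator_UN_disjoint[symmetric]) (use disj in auto)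
    also have "\<dots> \<le> 1" by (simp add: indicator_def)
    finally have le1: "(\<Sum>k\<le>n. indicator (A k) \<omega> :: real) \<le> 1" .
    show "(\<Sum>k\<le>n. indicator (A k) \<omega> * (norm (S n \<omega>))\<^sup>2) \<le> (norm (S n \<omega>))\<^sup>2"
      unfolding sum_distrib_right[symmetric] using mult_right_mono[OF le1, of "(norm (S n \<omega>))\<^sup>2"] by simp
  next
    show "integrable M (\<lambda>\<omega>. \<Sum>k\<le>n. indicator (A k) \<omega> * (norm (S n \<omega>))\<^sup>2)"
      by (rule Bochner_Integration.integrable_sum) (rule AS2)
  qed (rule S2)
  also have "\<dots> = (\<Sum>i<n. expectation (\<lambda>\<omega>. (norm (X i \<omega>))\<^sup>2))"
    unfolding S_def by (rule expectation_norm_sum)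
  finally show ?thesis
    unfolding un using \<delta> by (simp add: pos_le_divide_eq mult.commute)
qed

lemma kolmogorov_inequality_infinite:
  assumes \<delta>: "\<delta> > 0" and s: "summable (\<lambda>i. expectation (\<lambda>\<omega>. (norm (X i \<omega>))\<^sup>2))"
  shows "prob {\<omega>\<in>space M. \<exists>k. \<delta> \<le> norm (\<Sum>i<k. X i \<omega>)} \<le>
    (\<Sum>i. expectation (\<lambda>\<omega>. (norm (X i \<omega>))\<^sup>2)) / \<delta>\<^sup>2"
proof -
  define A where "A n = {\<omega>\<in>space M. \<exists>k\<le>n. \<delta> \<le> norm (\<Sum>i<k. X i \<omega>)}" for n
  have [measurable]: "A n \<in> sets M" for n unfolding A_def by measurable
  have "incseq A" by (auto simp: incseq_def A_def) (meson order_trans)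
  then have "(\<lambda>n. prob (A n)) \<longlonglongrightarrow> prob (\<Union>n. A n)"
    by (intro finite_Lim_measure_incseq) auto
  moreover have "(\<Union>n. A n) = {\<omega>\<in>space M. \<exists>k. \<delta> \<le> norm (\<Sum>i<k. X i \<omega>)}"
    by (auto simp: A_def)
  moreover have "prob (A n) \<le> (\<Sum>i. expectation (\<lambda>\<omega>. (norm (X i \<omega>))\<^sup>2)) / \<delta>\<^sup>2" for n
  proof -
    have "(\<Sum>i<n. expectation (\<lambda>\<omega>. (norm (X i \<omega>))\<^sup>2)) \<le> (\<Sum>i. expectation (\<lambda>\<omega>. (norm (X i \<omega>))\<^sup>2))"
      by (rule sum_le_suminf[OF s]) auto
    then show ?thesis
      using kolmogorov_inequality[OF \<delta>, of n] unfolding A_def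
      by (meson divide_right_mono order_trans zero_le_power2)
  qed
  ultimately show ?thesis by (auto intro: LIMSEQ_le_const2)
qed

end

lemma (in indep_centered) shift: "indep_centered M (\<lambda>i. X (N + i))"
proof
  show "indep_vars (\<lambda>_. borel) (\<lambda>i. X (N + i)) UNIV"
    by (rule indep_vars_inj[OF indep]) (auto simp: inj_on_def)
qed (auto simp: centered square_int)

text \<open>If for every N some block starting at N has norm at least \<delta>, the maximal
  inequality bounds the probability of this by each tail of the variance series divided by
  \<delta>^2. Letting \<delta> run through 1 / (q + 1) gives the Cauchy property outside one null
  set.\<close>

lemma (in indep_centered) AE_summable:
  assumes s: "summable (\<lambda>i. expectation (\<lambda>\<omega>. (norm (X i \<omega>))\<^sup>2))"
  shows "AE \<omega> in M. summable (\<lambda>i. X i \<omega>)"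
proof -
  let ?v = "\<lambda>i. expectation (\<lambda>\<omega>. (norm (X i \<omega>))\<^sup>2)"
  have small: "AE \<omega> in M. \<exists>N. \<forall>k. norm (\<Sum>i<k. X (N + i) \<omega>) < \<delta>" if \<delta>: "\<delta> > 0" for \<delta>
  proof -
    define B where "B = {\<omega>\<in>space M. \<forall>N. \<exists>k. \<delta> \<le> norm (\<Sum>i<k. X (N + i) \<omega>)}"
    have [measurable]: "B \<in> sets M" unfolding B_def by measurable
    have le: "prob B \<le> (\<Sum>i. ?v (N + i)) / \<delta>\<^sup>2" for N
    proof -
      interpret sh: indep_centered M "\<lambda>i. X (N + i)" by (rule shift)
      have "prob B \<le> prob {\<omega>\<in>space M. \<exists>k. \<delta> \<le> norm (\<Sum>i<k. X (N + i) \<omega>)}"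
        by (rule finite_measure_mono) (auto simp: B_def)
      also have "\<dots> \<le> (\<Sum>i. ?v (N + i)) / \<delta>\<^sup>2"
        using \<delta> summable_ignore_initial_segment[OF s, of N]
        by (intro sh.kolmogorov_inequality_infinite) (simp_all add: add.commute[of N])
      finally show ?thesis .
    qed
    have "(\<lambda>N. \<Sum>i. ?v (N + i)) \<longlonglongrightarrow> 0"
      using suminf_exist_split2[OF s] by (simp add: add.commute)
    then have "(\<lambda>N. (\<Sum>i. ?v (N + i)) / \<delta>\<^sup>2) \<longlonglongrightarrow> 0"
      by (rule tendsto_divide_zero)
    from LIMSEQ_le_const[OF this, of "prob B"] have "prob B \<le> 0"
      using le by blast
    then have "prob B = 0" by (simp add: measure_le_0_iff)
    then have "B \<in> null_sets M" by (simp add: null_sets_def emeasure_eq_measure)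
    then have "AE \<omega> in M. \<omega> \<notin> B" by (rule AE_not_in)
    then show ?thesis using AE_space by eventually_elim (auto simp: B_def not_le)
  qed
  have "AE \<omega> in M. \<forall>q::nat. \<exists>N. \<forall>k. norm (\<Sum>i<k. X (N + i) \<omega>) < 1 / Suc q"
    unfolding AE_all_countable by (intro allI small) simp
  then show ?thesis
  proof eventually_elim
    case (elim \<omega>)
    show ?case
      unfolding summable_Cauchy
    proof (intro allI impI)
      fix r :: real assume "r > 0"
      then have "r / 2 > 0" by simp
      from reals_Archimedean[OF this] obtain q where q: "1 / Suc q < r / 2"
        by (auto simp: inverse_eq_divide)
      obtain N where N: "\<And>k. norm (\<Sum>i<k. X (N + i) \<omega>) < 1 / Suc q" using elim by blast
      have "norm (\<Sum>i=m..<n. X i \<omega>) < r" if "m \<ge> N" for m n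
      proof (cases "m \<le> n")
        case True
        have sh: "(\<Sum>i=N..<p. X i \<omega>) = (\<Sum>i<p - N. X (N + i) \<omega>)" if "p \<ge> N" for p
          using that sum.shift_bounds_nat_ivl[of "\<lambda>i. X i \<omega>" 0 N "p - N"]
          by (simp add: atLeast0LessThan add.commute)
        have "(\<Sum>i=N..<m. X i \<omega>) + (\<Sum>i=m..<n. X i \<omega>) = (\<Sum>i=N..<n. X i \<omega>)"
          using True that by (intro sum.atLeastLessThan_concat) auto
        then have "(\<Sum>i=m..<n. X i \<omega>) = (\<Sum>i<n - N. X (N + i) \<omega>) - (\<Sum>i<m - N. X (N + i) \<omega>)"
          using sh[of m] sh[of n] True that by (simp add: algebra_simps)
        then show ?thesis
          using N[of "n - N"] N[of "m - N"] q
            norm_triangle_ineq4[of "\<Sum>i<n - N. X (N + i) \<omega>" "\<Sum>i<m - N. X (N + i) \<omega>"] by simp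
      next
        case False
        then show ?thesis using \<open>r > 0\<close> by simp
      qed
      then show "\<exists>N. \<forall>m\<ge>N. \<forall>n. norm (sum (\<lambda>i. X i \<omega>) {m..<n}) < r" by blast
    qed
  qed
qed

text \<open>Fatou's lemma for the partial sums. The upper bound serves both for bounded second
  moments and for small tails of the projections.\<close>

lemma (in indep_centered) second_moment_limit:
  assumes s: "(\<lambda>i. expectation (\<lambda>\<omega>. (norm (X i \<omega>))\<^sup>2)) sums t"
    and Y: "AE \<omega> in M. (\<lambda>i. X i \<omega>) sums Y \<omega>" and Ym[measurable]: "Y \<in> borel_measurable M"
  shows "integrable M (\<lambda>\<omega>. (norm (Y \<omega>))\<^sup>2)" "expectation (\<lambda>\<omega>. (norm (Y \<omega>))\<^sup>2) \<le> t"
proof -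
  have t: "t \<ge> 0" by (rule sums_le[OF _ sums_zero s]) simp
  have "(\<integral>\<^sup>+\<omega>. ennreal ((norm (Y \<omega>))\<^sup>2) \<partial>M) = (\<integral>\<^sup>+\<omega>. liminf (\<lambda>n. ennreal ((norm (\<Sum>i<n. X i \<omega>))\<^sup>2)) \<partial>M)"
  proof (rule nn_integral_cong_AE)
    show "AE \<omega> in M. ennreal ((norm (Y \<omega>))\<^sup>2) = liminf (\<lambda>n. ennreal ((norm (\<Sum>i<n. X i \<omega>))\<^sup>2))"
      using Y
    proof eventually_elim
      case (elim \<omega>)
      then have "(\<lambda>n. ennreal ((norm (\<Sum>i<n. X i \<omega>))\<^sup>2)) \<longlonglongrightarrow> ennreal ((norm (Y \<omega>))\<^sup>2)"
        unfolding sums_def by (intro tendsto_ennrealI tendsto_intros)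
      then show ?case by (rule lim_imp_Liminf[OF sequentially_bot, symmetric])
    qed
  qed
  also have "\<dots> \<le> liminf (\<lambda>n. \<integral>\<^sup>+\<omega>. ennreal ((norm (\<Sum>i<n. X i \<omega>))\<^sup>2) \<partial>M)"
    by (rule nn_integral_liminf) measurable
  also have "\<dots> \<le> ennreal t"
  proof (rule Liminf_le)
    have "(\<integral>\<^sup>+\<omega>. ennreal ((norm (\<Sum>i<n. X i \<omega>))\<^sup>2) \<partial>M) \<le> ennreal t" for n
    proof -
      have "(\<integral>\<^sup>+\<omega>. ennreal ((norm (\<Sum>i<n. X i \<omega>))\<^sup>2) \<partial>M) = ennreal (\<Sum>i<n. expectation (\<lambda>\<omega>. (norm (X i \<omega>))\<^sup>2))"
        using sum_square_int[of "{..<n}"] by (subst nn_integral_eq_integral) (auto simp: expectation_norm_sum)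
      also have "\<dots> \<le> ennreal t"
        using s by (intro ennreal_leI) (auto simp: sums_iff intro!: sum_le_suminf)
      finally show ?thesis .
    qed
    then show "\<forall>\<^sub>F n in sequentially. (\<integral>\<^sup>+\<omega>. ennreal ((norm (\<Sum>i<n. X i \<omega>))\<^sup>2) \<partial>M) \<le> ennreal t"
      by simp
  qed simp
  finally have le: "(\<integral>\<^sup>+\<omega>. ennreal ((norm (Y \<omega>))\<^sup>2) \<partial>M) \<le> ennreal t" .
  show i: "integrable M (\<lambda>\<omega>. (norm (Y \<omega>))\<^sup>2)"
  proof (rule integrableI_bounded)
    show "(\<integral>\<^sup>+\<omega>. ennreal (norm ((norm (Y \<omega>))\<^sup>2)) \<partial>M) < \<infinity>"
      using order_le_less_trans[OF le ennreal_less_top] by simp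
  qed simp
  have "ennreal (expectation (\<lambda>\<omega>. (norm (Y \<omega>))\<^sup>2)) \<le> ennreal t"
    using le nn_integral_eq_integral[OF i] by simp
  then show "expectation (\<lambda>\<omega>. (norm (Y \<omega>))\<^sup>2) \<le> t"
    using t by (simp add: ennreal_le_iff)
qed

section \<open>Lindeberg central limit theorem\<close>

text \<open>The smaller of a quadratic and a cubic remainder estimate; the minimum keeps the
  right-hand side integrable with second moments only.\<close>

lemma iexp_quadratic_approx: "cmod (iexp x - (1 + \<i> * x - x\<^sup>2 / 2)) \<le> x\<^sup>2 * min 1 \<bar>x\<bar>"
proof -
  have s: "(\<Sum>k\<le>2. (\<i> * complex_of_real x) ^ k / fact k) = 1 + \<i> * x - x\<^sup>2 / 2"
    by (simp add: numeral_2_eq_2 power2_eq_square) (simp add: field_simps flip: power2_eq_square)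
  have "cmod (iexp x - (1 + \<i> * x - x\<^sup>2 / 2)) \<le> \<bar>x\<bar> ^ 3 / 6"
    using iexp_approx1[of x 2] unfolding s by (simp add: fact_numeral eval_nat_numeral)
  moreover have "\<bar>x\<bar> ^ 3 / 6 \<le> x\<^sup>2 * \<bar>x\<bar>"
  proof -
    have "\<bar>x\<bar> ^ 3 = x\<^sup>2 * \<bar>x\<bar>" by (simp add: power3_eq_cube power2_eq_square)
    then show ?thesis by simp
  qed
  moreover have "cmod (iexp x - (1 + \<i> * x - x\<^sup>2 / 2)) \<le> x\<^sup>2"
    using iexp_approx2[of x 2] unfolding s by (simp add: fact_numeral)
  ultimately show ?thesis by (simp add: min_def)
qed

lemma exp_minus_bounds:
  fixes x :: real assumes "x \<ge> 0"
  shows "\<bar>exp (- x) - (1 - x)\<bar> \<le> x\<^sup>2"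
proof -
  have "exp (- x) \<le> inverse (1 + x)"
    using exp_ge_add_one_self[of x] assms by (simp add: exp_minus le_imp_inverse_le)
  also have "\<dots> \<le> 1 - x + x\<^sup>2"
  proof -
    have "1 \<le> (1 - x + x\<^sup>2) * (1 + x)" using assms by (simp add: algebra_simps power2_eq_square)
    then show ?thesis using assms by (simp add: inverse_eq_divide divide_le_eq)
  qed
  finally show ?thesis using exp_ge_add_one_self[of "- x"] by (simp add: abs_le_iff)
qed

text \<open>The characteristic function and the Gaussian value are both compared with 1 - v / 2. The
  second claim splits at |X| = \<delta>: it bounds a single variance by the Lindeberg term, from
  which uniform smallness of the summands follows.\<close>

lemma (in prob_space) char_normal_approx:
  fixes X :: "'a \<Rightarrow> real"
  assumes [measurable]: "X \<in> borel_measurable M" and X2: "integrable M (\<lambda>\<omega>. (X \<omega>)\<^sup>2)" and X0: "expectation X = 0"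
  defines "v \<equiv> expectation (\<lambda>\<omega>. (X \<omega>)\<^sup>2)" and "l \<equiv> expectation (\<lambda>\<omega>. (X \<omega>)\<^sup>2 * min 1 \<bar>X \<omega>\<bar>)"
  shows "cmod ((CLINT \<omega>|M. iexp (X \<omega>)) - exp (- v / 2)) \<le> l + v\<^sup>2"
    and "\<delta> > 0 \<Longrightarrow> \<delta> \<le> 1 \<Longrightarrow> v \<le> \<delta>\<^sup>2 + l / \<delta>"
proof -
  have X1: "integrable M X" by (rule square_integrable_imp_integrable) (simp_all add: X2)
  have v0: "v \<ge> 0" by (simp add: v_def)
  have iX: "integrable M (\<lambda>\<omega>. iexp (X \<omega>))"
    by (rule integrable_const_bound[where B = 1]) simp_all
  have lint: "integrable M (\<lambda>\<omega>. (X \<omega>)\<^sup>2 * min 1 \<bar>X \<omega>\<bar>)"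
    by (rule Bochner_Integration.integrable_bound[OF X2])
      (auto simp: abs_mult intro!: mult_left_le)
  have ints: "integrable M (\<lambda>\<omega>. 1 + \<i> * complex_of_real (X \<omega>) - complex_of_real ((X \<omega>)\<^sup>2) / 2)"
    using X1 X2 by (intro Bochner_Integration.integrable_diff Bochner_Integration.integrable_add
        integrable_const integrable_mult_right integrable_divide integrable_of_real)
  have e: "(CLINT \<omega>|M. 1 + \<i> * complex_of_real (X \<omega>) - complex_of_real ((X \<omega>)\<^sup>2) / 2) = 1 - v / 2"
  proof -
    have a: "integrable M (\<lambda>\<omega>. 1 + \<i> * complex_of_real (X \<omega>))"
      using X1 by (intro Bochner_Integration.integrable_add integrable_const integrable_mult_right integrable_of_real)
    have b: "integrable M (\<lambda>\<omega>. complex_of_real ((X \<omega>)\<^sup>2) / 2)"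
      using X2 by (intro integrable_divide integrable_of_real)
    have c: "integrable M (\<lambda>\<omega>. \<i> * complex_of_real (X \<omega>))"
      using X1 by (intro integrable_mult_right integrable_of_real)
    have d: "(CLINT \<omega>|M. complex_of_real ((X \<omega>)\<^sup>2) / 2) = v / 2"
      by (simp add: v_def del: of_real_power)
    show ?thesis
      unfolding Bochner_Integration.integral_diff[OF a b] Bochner_Integration.integral_add[OF integrable_const c] d
      by (simp add: X0 prob_space)
  qed
  have "cmod ((CLINT \<omega>|M. iexp (X \<omega>)) - (1 - v / 2)) =
    cmod (CLINT \<omega>|M. iexp (X \<omega>) - (1 + \<i> * complex_of_real (X \<omega>) - complex_of_real ((X \<omega>)\<^sup>2) / 2))"
    unfolding Bochner_Integration.integral_diff[OF iX ints] e by simp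
  also have "\<dots> \<le> (\<integral>\<omega>. cmod (iexp (X \<omega>) - (1 + \<i> * complex_of_real (X \<omega>) - complex_of_real ((X \<omega>)\<^sup>2) / 2)) \<partial>M)"
    by (rule integral_norm_bound)
  also have "\<dots> \<le> l"
    unfolding l_def
  proof (rule integral_mono[OF _ lint])
    show "integrable M (\<lambda>\<omega>. cmod (iexp (X \<omega>) - (1 + \<i> * complex_of_real (X \<omega>) - complex_of_real ((X \<omega>)\<^sup>2) / 2)))"
      by (intro integrable_norm Bochner_Integration.integrable_diff[OF iX ints])
    show "cmod (iexp (X \<omega>) - (1 + \<i> * complex_of_real (X \<omega>) - complex_of_real ((X \<omega>)\<^sup>2) / 2)) \<le>
      (X \<omega>)\<^sup>2 * min 1 \<bar>X \<omega>\<bar>" for \<omega>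
      using iexp_quadratic_approx[of "X \<omega>"] by simp
  qed
  finally have 1: "cmod ((CLINT \<omega>|M. iexp (X \<omega>)) - (1 - v / 2)) \<le> l" .
  have "cmod (exp (- v / 2) - (1 - v / 2)) \<le> v\<^sup>2"
  proof -
    have "cmod (complex_of_real (exp (- (v / 2)) - (1 - v / 2))) \<le> (v / 2)\<^sup>2"
      unfolding norm_of_real using v0 by (intro exp_minus_bounds) simp
    also have "\<dots> \<le> v\<^sup>2" by (simp add: power_divide)
    finally show ?thesis by simp
  qed
  then show "cmod ((CLINT \<omega>|M. iexp (X \<omega>)) - exp (- v / 2)) \<le> l + v\<^sup>2"
    using norm_triangle_ineq4[of "(CLINT \<omega>|M. iexp (X \<omega>)) - (1 - v / 2)" "exp (- v / 2) - (1 - v / 2)"] 1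
    by simp
  show "v \<le> \<delta>\<^sup>2 + l / \<delta>" if \<delta>: "\<delta> > 0" "\<delta> \<le> 1"
  proof -
    have "v \<le> expectation (\<lambda>\<omega>. \<delta>\<^sup>2 + (X \<omega>)\<^sup>2 * min 1 \<bar>X \<omega>\<bar> / \<delta>)"
      unfolding v_def
    proof (rule integral_mono[OF X2])
      show "integrable M (\<lambda>\<omega>. \<delta>\<^sup>2 + (X \<omega>)\<^sup>2 * min 1 \<bar>X \<omega>\<bar> / \<delta>)" using lint by simp
      fix \<omega>
      show "(X \<omega>)\<^sup>2 \<le> \<delta>\<^sup>2 + (X \<omega>)\<^sup>2 * min 1 \<bar>X \<omega>\<bar> / \<delta>"
      proof (cases "\<bar>X \<omega>\<bar> \<le> \<delta>")
        case True
        then have "(X \<omega>)\<^sup>2 \<le> \<delta>\<^sup>2" using \<delta> power_mono[of "\<bar>X \<omega>\<bar>" \<delta> 2] by simp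
        moreover have "(X \<omega>)\<^sup>2 * min 1 \<bar>X \<omega>\<bar> / \<delta> \<ge> 0" using \<delta> by simp
        ultimately show ?thesis by simp
      next
        case False
        then have "\<delta> \<le> min 1 \<bar>X \<omega>\<bar>" using \<delta> by simp
        then have "(X \<omega>)\<^sup>2 * \<delta> \<le> (X \<omega>)\<^sup>2 * min 1 \<bar>X \<omega>\<bar>" by (intro mult_left_mono) auto
        then have "(X \<omega>)\<^sup>2 \<le> (X \<omega>)\<^sup>2 * min 1 \<bar>X \<omega>\<bar> / \<delta>" using \<delta> by (simp add: pos_le_divide_eq)
        moreover have "\<delta>\<^sup>2 \<ge> 0" by simp
        ultimately show ?thesis by linarith
      qed
    qed
    also have "\<dots> = \<delta>\<^sup>2 + l / \<delta>" using lint by (simp add: l_def prob_space)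
    finally show ?thesis .
  qed
qed

text \<open>Comparing the product of characteristic functions with the Gaussian factors one by one
  leaves the sum of Lindeberg terms and squared variances; one factor of each square is at most
  \<delta>^2 + l / \<delta>. The bound does not depend on the number of factors and so survives the
  passage to the infinite sum.\<close>

lemma (in prob_space) char_infinite_sum_approx:
  fixes X :: "nat \<Rightarrow> 'a \<Rightarrow> real"
  assumes ind: "indep_vars (\<lambda>_. borel) X UNIV" and X0: "\<And>i. expectation (X i) = 0"
    and X2: "\<And>i. integrable M (\<lambda>\<omega>. (X i \<omega>)\<^sup>2)"
    and Y: "AE \<omega> in M. (\<lambda>i. X i \<omega>) sums Y \<omega>" and [measurable]: "Y \<in> borel_measurable M"
    and q: "(\<lambda>i. expectation (\<lambda>\<omega>. (X i \<omega>)\<^sup>2)) sums q"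
    and l: "(\<lambda>i. expectation (\<lambda>\<omega>. (X i \<omega>)\<^sup>2 * min 1 \<bar>X i \<omega>\<bar>)) sums l"
    and \<delta>: "\<delta> > 0" "\<delta> \<le> 1"
  shows "cmod ((CLINT \<omega>|M. iexp (Y \<omega>)) - exp (- q / 2)) \<le> l + q * (\<delta>\<^sup>2 + l / \<delta>)"
proof -
  have Xm[measurable]: "X i \<in> borel_measurable M" for i
    using ind by (auto simp: indep_vars_def)
  define v where "v i = expectation (\<lambda>\<omega>. (X i \<omega>)\<^sup>2)" for i
  define k where "k i = expectation (\<lambda>\<omega>. (X i \<omega>)\<^sup>2 * min 1 \<bar>X i \<omega>\<bar>)" for i
  have v0: "v i \<ge> 0" and k0: "k i \<ge> 0" for i by (auto simp: v_def k_def intro!: Bochner_Integration.integral_nonneg)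
  note q' = q[folded v_def] and l' = l[folded k_def]
  have kl: "k i \<le> l" for i
    using sum_le_suminf[of k "{i}"] l' k0 by (simp add: sums_iff)
  have l0: "l \<ge> 0" using k0[of 0] kl[of 0] by simp
  have vb: "v i \<le> \<delta>\<^sup>2 + l / \<delta>" for i
  proof -
    have "v i \<le> \<delta>\<^sup>2 + k i / \<delta>"
      using char_normal_approx(2)[OF Xm X2 X0 \<delta>] by (simp add: v_def k_def)
    also have "\<dots> \<le> \<delta>\<^sup>2 + l / \<delta>" using kl[of i] \<delta> by (simp add: divide_right_mono)
    finally show ?thesis .
  qed
  define \<phi> where "\<phi> i = (CLINT \<omega>|M. iexp (X i \<omega>))" for i
  have fin: "cmod ((CLINT \<omega>|M. iexp (\<Sum>i<J. X i \<omega>)) - exp (- (\<Sum>i<J. v i) / 2)) \<le> l + q * (\<delta>\<^sup>2 + l / \<delta>)" for J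
  proof -
    have "(CLINT \<omega>|M. iexp (\<Sum>i<J. X i \<omega>)) = (\<Prod>i<J. \<phi> i)"
    proof -
      have "indep_vars (\<lambda>_. borel) X {..<J}" by (rule indep_vars_subset[OF ind]) simp
      from char_distr_sum[OF this, of 1] show ?thesis
        unfolding char_def \<phi>_def by (simp add: integral_distr)
    qed
    moreover have "complex_of_real (exp (- (\<Sum>i<J. v i) / 2)) = (\<Prod>i<J. complex_of_real (exp (- v i / 2)))"
      by (simp add: sum_divide_distrib sum_negf[symmetric] exp_sum del: of_real_exp)
    moreover have "cmod ((\<Prod>i<J. \<phi> i) - (\<Prod>i<J. complex_of_real (exp (- v i / 2)))) \<le>
      (\<Sum>i<J. cmod (\<phi> i - complex_of_real (exp (- v i / 2))))"
    proof (rule norm_prod_diff)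
      show "cmod (\<phi> i) \<le> 1" for i
      proof -
        have "cmod (\<phi> i) \<le> (\<integral>\<omega>. cmod (iexp (X i \<omega>)) \<partial>M)" unfolding \<phi>_def by (rule integral_norm_bound)
        then show ?thesis by (simp add: prob_space)
      qed
      show "cmod (complex_of_real (exp (- v i / 2))) \<le> 1" for i
        using v0[of i] by (simp del: of_real_exp)
    qed
    moreover have "(\<Sum>i<J. cmod (\<phi> i - complex_of_real (exp (- v i / 2)))) \<le> (\<Sum>i<J. k i + v i * (\<delta>\<^sup>2 + l / \<delta>))"
    proof (rule sum_mono)
      fix i
      have "cmod (\<phi> i - complex_of_real (exp (- v i / 2))) \<le> k i + (v i)\<^sup>2"
        using char_normal_approx(1)[OF Xm X2 X0, of i] by (simp add: v_def k_def \<phi>_def)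
      also have "(v i)\<^sup>2 \<le> v i * (\<delta>\<^sup>2 + l / \<delta>)"
        unfolding power2_eq_square[of "v i"] by (intro mult_left_mono vb v0)
      finally show "cmod (\<phi> i - complex_of_real (exp (- v i / 2))) \<le> k i + v i * (\<delta>\<^sup>2 + l / \<delta>)" by simp
    qed
    moreover have "(\<Sum>i<J. k i + v i * (\<delta>\<^sup>2 + l / \<delta>)) \<le> l + q * (\<delta>\<^sup>2 + l / \<delta>)"
    proof -
      have "(\<Sum>i<J. k i) \<le> l" "(\<Sum>i<J. v i) \<le> q"
        using sum_le_suminf[of k "{..<J}"] sum_le_suminf[of v "{..<J}"] l' q' k0 v0 by (simp_all add: sums_iff)
      then show ?thesis
        unfolding sum.distrib sum_distrib_right[symmetric] using \<delta> l0 by (intro add_mono mult_right_mono) auto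
    qed
    ultimately show ?thesis by simp
  qed
  have "(\<lambda>J. CLINT \<omega>|M. iexp (\<Sum>i<J. X i \<omega>)) \<longlonglongrightarrow> (CLINT \<omega>|M. iexp (Y \<omega>))"
  proof (rule integral_dominated_convergence[where w = "\<lambda>_. 1"])
    show "AE \<omega> in M. (\<lambda>J. iexp (\<Sum>i<J. X i \<omega>)) \<longlonglongrightarrow> iexp (Y \<omega>)"
      using Y by eventually_elim (unfold sums_def, intro tendsto_intros)
  qed simp_all
  moreover have "(\<lambda>J. complex_of_real (exp (- (\<Sum>i<J. v i) / 2))) \<longlonglongrightarrow> complex_of_real (exp (- q / 2))"
    using q' unfolding sums_def by (intro tendsto_of_real tendsto_exp tendsto_divide tendsto_minus tendsto_const) simp_all
  ultimately have "(\<lambda>J. cmod ((CLINT \<omega>|M. iexp (\<Sum>i<J. X i \<omega>)) - exp (- (\<Sum>i<J. v i) / 2))) \<longlonglongrightarrow>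
    cmod ((CLINT \<omega>|M. iexp (Y \<omega>)) - exp (- q / 2))"
    by (intro tendsto_norm tendsto_diff)
  from LIMSEQ_le_const2[OF this] show ?thesis using fin by blast
qed

lemma (in prob_space) lindeberg_char_tendsto:
  fixes X :: "nat \<Rightarrow> nat \<Rightarrow> 'a \<Rightarrow> real"
  assumes ind: "\<And>n. indep_vars (\<lambda>_. borel) (X n) UNIV" and X0: "\<And>n i. expectation (X n i) = 0"
    and X2: "\<And>n i. integrable M (\<lambda>\<omega>. (X n i \<omega>)\<^sup>2)"
    and Y: "\<And>n. AE \<omega> in M. (\<lambda>i. X n i \<omega>) sums Y n \<omega>" and Ym: "\<And>n. Y n \<in> borel_measurable M"
    and q: "\<And>n. (\<lambda>i. expectation (\<lambda>\<omega>. (X n i \<omega>)\<^sup>2)) sums q n" "q \<longlonglongrightarrow> Q"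
    and l: "\<And>n. (\<lambda>i. expectation (\<lambda>\<omega>. (X n i \<omega>)\<^sup>2 * min 1 \<bar>X n i \<omega>\<bar>)) sums l n" "l \<longlonglongrightarrow> 0"
  shows "(\<lambda>n. CLINT \<omega>|M. iexp (Y n \<omega>)) \<longlonglongrightarrow> exp (- Q / 2)"
proof -
  have q0: "q n \<ge> 0" for n by (rule sums_le[OF _ sums_zero q(1)]) simp
  then have Q0: "Q \<ge> 0" using LIMSEQ_le_const[OF q(2), of 0] by blast
  have "(\<lambda>n. (CLINT \<omega>|M. iexp (Y n \<omega>)) - exp (- q n / 2)) \<longlonglongrightarrow> 0"
  proof (rule tendstoI)
    fix r :: real assume r: "r > 0"
    \<comment> \<open>Makes Q * \<delta>^2 at most r / 2, while the terms with l n vanish in the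
      limit; Q + 1 avoids a division by zero.\<close>
    define \<delta> where "\<delta> = min 1 (r / (2 * (Q + 1)))"
    have \<delta>: "\<delta> > 0" "\<delta> \<le> 1" using r Q0 by (auto simp: \<delta>_def)
    have "Q * \<delta>\<^sup>2 \<le> Q * \<delta>"
      using \<delta> Q0 by (intro mult_left_mono) (simp_all add: power2_eq_square mult_le_cancel_left1)
    also have "\<dots> \<le> (Q + 1) * (r / (2 * (Q + 1)))"
      using Q0 \<delta> by (intro mult_mono) (auto simp: \<delta>_def)
    also have "\<dots> = r / 2" using Q0 by (simp add: field_simps add_nonneg_eq_0_iff)
    also have "\<dots> < r" using r by simp
    finally have lt: "0 + Q * (\<delta>\<^sup>2 + 0 / \<delta>) < r" by simp
    have "(\<lambda>n. l n + q n * (\<delta>\<^sup>2 + l n / \<delta>)) \<longlonglongrightarrow> 0 + Q * (\<delta>\<^sup>2 + 0 / \<delta>)"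
      using \<delta> by (intro tendsto_intros q(2) l(2)) simp
    from order_tendstoD(2)[OF this lt]
    show "\<forall>\<^sub>F n in sequentially. dist ((CLINT \<omega>|M. iexp (Y n \<omega>)) - exp (- q n / 2)) 0 < r"
    proof eventually_elim
      case (elim n)
      then show ?case
        using char_infinite_sum_approx[OF ind X0 X2 Y Ym q(1) l(1) \<delta>, of n] by (simp add: dist_norm)
    qed
  qed
  moreover have "(\<lambda>n. complex_of_real (exp (- q n / 2))) \<longlonglongrightarrow> complex_of_real (exp (- Q / 2))"
    by (intro tendsto_of_real tendsto_exp tendsto_divide tendsto_minus tendsto_const q(2)) simp
  ultimately have "(\<lambda>n. ((CLINT \<omega>|M. iexp (Y n \<omega>)) - exp (- q n / 2)) + complex_of_real (exp (- q n / 2)))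
      \<longlonglongrightarrow> 0 + complex_of_real (exp (- Q / 2))"
    by (rule tendsto_add)
  then show ?thesis by simp
qed

text \<open>Convergence of the total variance to the trace of the limiting form replaces tightness: it bounds
  the second moments of the projections orthogonal to the first \<open>m\<close> basis vectors uniformly in \<open>n\<close>.\<close>

lemma hilbert_clt:
  fixes X :: "nat \<Rightarrow> nat \<Rightarrow> 'w \<Rightarrow> 'a::{real_inner, banach, second_countable_topology}"
    and B :: "'a \<Rightarrow> 'a \<Rightarrow> real"
  assumes cen: "\<And>n. indep_centered M (X n)"
    and Y: "\<And>n. AE \<omega> in M. (\<lambda>i. X n i \<omega>) sums Y n \<omega>" and Ym: "\<And>n. Y n \<in> borel_measurable M"
    and t: "\<And>n. (\<lambda>i. \<integral>\<omega>. (norm (X n i \<omega>))\<^sup>2 \<partial>M) sums t n" "t \<longlonglongrightarrow> \<tau>"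
    and q: "\<And>n x. (\<lambda>i. \<integral>\<omega>. (inner (X n i \<omega>) x)\<^sup>2 \<partial>M) sums q n x" "\<And>x. (\<lambda>n. q n x) \<longlonglongrightarrow> B x x"
    and l: "\<And>n x. (\<lambda>i. \<integral>\<omega>. (inner (X n i \<omega>) x)\<^sup>2 * min 1 \<bar>inner (X n i \<omega>) x\<bar> \<partial>M) sums l n x"
      "\<And>x. (\<lambda>n. l n x) \<longlonglongrightarrow> 0"
    and B: "bounded_bilinear B" "\<And>x y. B x y = B y x"
    and e: "orth_basis e" and tr: "(\<lambda>j. B (e j) (e j)) sums \<tau>"
  shows "\<exists>P. prob_space P \<and> sets P = sets borel \<and>
    (\<forall>x. (CLINT y|P. iexp (inner y x)) = exp (- B x x / 2)) \<and>
    integrable P (\<lambda>y. (norm y)\<^sup>2) \<and>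
    (\<forall>f :: 'a \<Rightarrow> real. continuous_on UNIV f \<and> bounded (range f) \<longrightarrow>
      (\<lambda>n. \<integral>\<omega>. f (Y n \<omega>) \<partial>M) \<longlonglongrightarrow> (\<integral>y. f y \<partial>P))"
proof -
  interpret M: prob_space M using cen[of 0] by (simp add: indep_centered_def)
  interpret B: bounded_bilinear B by fact
  note [measurable] = Ym
  have Xm[measurable]: "X n i \<in> borel_measurable M" for n i
    using indep_centered.X_meas[OF cen] .
  have q0: "q n x \<ge> 0" for n x by (rule sums_le[OF _ sums_zero q(1)]) simp
  then have B0: "B x x \<ge> 0" for x using LIMSEQ_le_const[OF q(2), of 0] by blast
  obtain P where P: "prob_space P" and Pb[measurable_cong]: "sets P = sets borel"
    and chP: "\<And>x. (CLINT y|P. iexp (inner y x)) = exp (- B x x / 2)"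
    and P2: "integrable P (\<lambda>y. (norm y)\<^sup>2)" "(\<integral>y. (norm y)\<^sup>2 \<partial>P) = \<tau>"
    using gaussian_exists[OF B B0 e tr] by blast
  interpret P: prob_space P by fact
  \<comment> \<open>Two kinds of images are needed: inner products with x, and residuals of
    \<open>proj_upto e m\<close>.\<close>
  have Xin: "indep_centered M (\<lambda>i \<omega>. T (X n i \<omega>))" if T: "bounded_linear T" for n and T :: "'a \<Rightarrow> 'c::{real_inner, banach, second_countable_topology}"
  proof -
    interpret X: indep_centered M "X n" by (rule cen)
    interpret T: bounded_linear T by (rule T)
    have Tm[measurable]: "T \<in> borel_measurable borel" by (rule borel_measurable_continuous_onI) (rule T.continuous_on[OF continuous_on_id])
    show ?thesis
    proof
      show "M.indep_vars (\<lambda>_. borel) (\<lambda>i \<omega>. T (X n i \<omega>)) UNIV"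
        by (rule M.indep_vars_compose2[OF X.indep]) simp
      show "M.expectation (\<lambda>\<omega>. T (X n i \<omega>)) = 0" for i
        using integral_bounded_linear[OF T X.X_int[of i]] by (simp add: X.centered T.zero)
      obtain K where K: "\<And>x. norm (T x) \<le> norm x * K" using T.bounded by blast
      show "integrable M (\<lambda>\<omega>. (norm (T (X n i \<omega>)))\<^sup>2)" for i
      proof (rule Bochner_Integration.integrable_bound)
        show "integrable M (\<lambda>\<omega>. (norm (X n i \<omega>))\<^sup>2 * K\<^sup>2)" using X.square_int by simp
        have "(norm (T x))\<^sup>2 \<le> (norm x)\<^sup>2 * K\<^sup>2" for x
          using power_mono[OF K[of x], of 2] by (simp add: power_mult_distrib)
        then show "AE \<omega> in M. norm ((norm (T (X n i \<omega>)))\<^sup>2) \<le> norm ((norm (X n i \<omega>))\<^sup>2 * K\<^sup>2)" by simp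
      qed simp
    qed
  qed
  have cf: "(\<lambda>n. CLINT \<omega>|M. iexp (inner (Y n \<omega>) x)) \<longlonglongrightarrow> (CLINT y|P. iexp (inner y x))" for x
    unfolding chP
  proof (rule M.lindeberg_char_tendsto[where X = "\<lambda>n i \<omega>. inner (X n i \<omega>) x" and q = "\<lambda>n. q n x"
        and l = "\<lambda>n. l n x"])
    have Xx: "indep_centered M (\<lambda>i \<omega>. inner (X n i \<omega>) x)" for n
      by (rule Xin) (rule bounded_linear_inner_left)
    show "M.indep_vars (\<lambda>_. borel) (\<lambda>i \<omega>. inner (X n i \<omega>) x) UNIV" for n
      by (rule indep_centered.indep[OF Xx])
    show "M.expectation (\<lambda>\<omega>. inner (X n i \<omega>) x) = 0" for n i
      by (rule indep_centered.centered[OF Xx])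
    show "integrable M (\<lambda>\<omega>. (inner (X n i \<omega>) x)\<^sup>2)" for n i
      using indep_centered.square_int[OF Xx] by simp
    show "AE \<omega> in M. (\<lambda>i. inner (X n i \<omega>) x) sums inner (Y n \<omega>) x" for n
      using Y[of n] by eventually_elim (rule bounded_linear.sums[OF bounded_linear_inner_left])
  qed (use q l in auto)
  have Y2: "integrable M (\<lambda>\<omega>. (norm (Y n \<omega>))\<^sup>2)" "(\<integral>\<omega>. (norm (Y n \<omega>))\<^sup>2 \<partial>M) \<le> t n" for n
    using indep_centered.second_moment_limit[OF cen t(1) Y Ym] by auto
  obtain C' where C': "\<And>n. norm (t n) \<le> C'"
    using convergent_imp_Bseq[OF convergentI[OF t(2)]] unfolding Bseq_def by blast
  define C where "C = max C' \<tau>"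
  have tail: "\<exists>m. (\<forall>\<^sub>F n in sequentially.
        (\<integral>\<omega>. (norm (Y n \<omega> - proj_upto e m (Y n \<omega>)))\<^sup>2 \<partial>M) < r) \<and>
        (\<integral>y. (norm (y - proj_upto e m y))\<^sup>2 \<partial>P) < r" if r: "r > 0" for r
  proof -
    have "(\<lambda>m. \<tau> - (\<Sum>j<m. B (e j) (e j))) \<longlonglongrightarrow> \<tau> - \<tau>"
      using tr unfolding sums_def by (intro tendsto_intros)
    then have "\<forall>\<^sub>F m in sequentially. \<tau> - (\<Sum>j<m. B (e j) (e j)) < r"
      using r by (intro order_tendstoD(2)) auto
    then obtain m where m: "\<tau> - (\<Sum>j<m. B (e j) (e j)) < r" by (auto simp: eventually_sequentially)
    \<comment> \<open>The residuals of row n have total variance t n minus the first m coordinate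
      variances. The limit is the tail of the trace, so one m works for all large n.\<close>
    have "(\<lambda>n. t n - (\<Sum>j<m. q n (e j))) \<longlonglongrightarrow> \<tau> - (\<Sum>j<m. B (e j) (e j))"
      by (intro tendsto_diff tendsto_sum t(2) q(2))
    from order_tendstoD(2)[OF this m]
    have "\<forall>\<^sub>F n in sequentially. (\<integral>\<omega>. (norm (Y n \<omega> - proj_upto e m (Y n \<omega>)))\<^sup>2 \<partial>M) < r"
    proof eventually_elim
      case (elim n)
      interpret X: indep_centered M "X n" by (rule cen)
      have pl: "bounded_linear (proj_upto e m)"
        unfolding proj_upto_def
        by (intro bounded_linear_sum bounded_linear_scaleR_const bounded_linear_inner_left)
      then have Tl: "bounded_linear (\<lambda>x. x - proj_upto e m x)"
        by (intro bounded_linear_sub bounded_linear_ident)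
      have i: "integrable M (\<lambda>\<omega>. (inner (X n i \<omega>) (e j))\<^sup>2)" for i j
        using indep_centered.square_int[OF Xin[OF bounded_linear_inner_left[of "e j"]], of n i] by simp
      have ev: "M.expectation (\<lambda>\<omega>. (norm (X n i \<omega> - proj_upto e m (X n i \<omega>)))\<^sup>2) =
        M.expectation (\<lambda>\<omega>. (norm (X n i \<omega>))\<^sup>2) - (\<Sum>j<m. M.expectation (\<lambda>\<omega>. (inner (X n i \<omega>) (e j))\<^sup>2))" for i
        unfolding norm_proj_upto_compl[OF e]
        using X.square_int i by (simp add: Bochner_Integration.integral_diff Bochner_Integration.integral_sum)
      have "(\<lambda>i. M.expectation (\<lambda>\<omega>. (norm (X n i \<omega> - proj_upto e m (X n i \<omega>)))\<^sup>2)) sums (t n - (\<Sum>j<m. q n (e j)))"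
        unfolding ev by (intro sums_diff sums_sum t(1) q(1))
      moreover have "AE \<omega> in M. (\<lambda>i. X n i \<omega> - proj_upto e m (X n i \<omega>)) sums (Y n \<omega> - proj_upto e m (Y n \<omega>))"
        using Y[of n] by eventually_elim (rule bounded_linear.sums[OF Tl])
      moreover have "(\<lambda>\<omega>. Y n \<omega> - proj_upto e m (Y n \<omega>)) \<in> borel_measurable M"
        unfolding proj_upto_def by measurable
      ultimately have "(\<integral>\<omega>. (norm (Y n \<omega> - proj_upto e m (Y n \<omega>)))\<^sup>2 \<partial>M) \<le> t n - (\<Sum>j<m. q n (e j))"
        by (rule indep_centered.second_moment_limit(2)[OF Xin[OF Tl]])
      then show ?case using elim by linarith
    qed
    moreover have "(\<integral>y. (norm (y - proj_upto e m y))\<^sup>2 \<partial>P) < r"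
    proof -
      have ch: "char (distr P borel (\<lambda>y. inner y x)) s = exp (- (s\<^sup>2 * B x x) / 2)" for s x
      proof -
        have "char (distr P borel (\<lambda>y. inner y x)) s = (CLINT y|P. iexp (inner y (s *\<^sub>R x)))"
          unfolding char_def by (subst integral_distr) auto
        then show ?thesis
          unfolding chP by (simp add: B.scaleR_left B.scaleR_right power2_eq_square mult.assoc)
      qed
      have mi: "(\<lambda>y. inner y x) \<in> borel_measurable P" for x by measurable
      note nv = P.normal_of_char_variance[OF mi B0 ch] and ni = P.normal_of_char_integrable_square[OF mi B0 ch]
      have "(\<integral>y. (norm (y - proj_upto e m y))\<^sup>2 \<partial>P) = \<tau> - (\<Sum>j<m. B (e j) (e j))"
        unfolding norm_proj_upto_compl[OF e]
        using P2 ni by (simp add: Bochner_Integration.integral_diff Bochner_Integration.integral_sum nv)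
      then show ?thesis using m by simp
    qed
    ultimately show ?thesis by blast
  qed
  have G: "(\<lambda>y. y) \<in> borel_measurable P" by measurable
  have conv: "(\<lambda>n. \<integral>\<omega>. f (Y n \<omega>) \<partial>M) \<longlonglongrightarrow> (\<integral>y. f y \<partial>P)"
    if f: "continuous_on UNIV f" "bounded (range f)" for f :: "'a \<Rightarrow> real"
  proof (rule integral_tendsto_of_lipschitz[OF M.prob_space_axioms P Ym G _ f])
    fix g :: "'a \<Rightarrow> real" and K
    assume g: "\<And>x y. \<bar>g x - g y\<bar> \<le> K * dist x y" "bounded (range g)"
    show "(\<lambda>n. \<integral>\<omega>. g (Y n \<omega>) \<partial>M) \<longlonglongrightarrow> (\<integral>y. g y \<partial>P)"
    proof (rule lipschitz_integral_tendsto_of_char[OF M.prob_space_axioms P Ym G e cf Y2(1) _ P2(1) _ tail g])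
      show "(\<integral>\<omega>. (norm (Y n \<omega>))\<^sup>2 \<partial>M) \<le> C" for n
        using Y2(2)[of n] C'[of n] by (auto simp: C_def abs_le_iff)
      show "(\<integral>y. (norm y)\<^sup>2 \<partial>P) \<le> C" by (simp add: C_def P2)
    qed
  qed
  show ?thesis
    by (intro exI[of _ P] conjI P Pb allI chP P2(1) impI conv) auto
qed

section \<open>Power sums and the limit kernel\<close>

lemma norm_of_real_powr: "x \<ge> 0 \<Longrightarrow> cmod (complex_of_real x powr z) = x powr Re z"
  by (subst norm_powr_real_powr) auto

lemma of_real_powr_exp: "x > 0 \<Longrightarrow> complex_of_real x powr z = exp (z * complex_of_real (ln x))"
  by (simp add: powr_def Ln_of_real)

lemma of_real_powr_mult: "x \<ge> 0 \<Longrightarrow> y \<ge> 0 \<Longrightarrow>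
  complex_of_real (x * y) powr z = complex_of_real x powr z * complex_of_real y powr z"
  by (cases "x = 0 \<or> y = 0") (auto simp: of_real_powr_exp ln_mult distrib_left exp_add simp del: of_real_mult)

lemma measurable_of_real_powr:
  assumes [measurable]: "f \<in> borel_measurable M" "g \<in> borel_measurable M" and f: "\<And>x. x \<in> space M \<Longrightarrow> f x \<ge> 0"
  shows "(\<lambda>x. complex_of_real (f x) powr g x) \<in> borel_measurable M"
proof -
  have "(\<lambda>x. if f x = 0 then 0 else exp (g x * complex_of_real (ln (f x)))) \<in> borel_measurable M"
    by measurable
  then show ?thesis
    by (rule measurable_cong[THEN iffD1, rotated]) (use f in \<open>auto simp: of_real_powr_exp order.strict_iff_order\<close>)
qed

lemma of_real_powr_tendsto:
  fixes f :: "nat \<Rightarrow> real"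
  assumes f: "f \<longlonglongrightarrow> \<beta>" "\<And>n. f n \<ge> 0" and z: "Re z > 0"
  shows "(\<lambda>n. complex_of_real (f n) powr z) \<longlonglongrightarrow> complex_of_real \<beta> powr z"
proof (cases "\<beta> = 0")
  case True
  have "(\<lambda>n. f n powr Re z) \<longlonglongrightarrow> 0"
    by (rule tendsto_zero_powrI[OF f(1)[unfolded True] tendsto_const]) (use f z in auto)
  then have "(\<lambda>n. complex_of_real (f n) powr z) \<longlonglongrightarrow> 0"
    by (intro tendsto_norm_zero_cancel[of "\<lambda>n. complex_of_real (f n) powr z"]) (simp add: norm_of_real_powr f(2))
  then show ?thesis using True by simp
next
  case False
  moreover have "\<beta> \<ge> 0" using LIMSEQ_le_const[OF f(1)] f(2) by blast
  ultimately have "\<beta> > 0" by simp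
  then show ?thesis by (intro tendsto_powr_complex tendsto_of_real f(1) tendsto_const) auto
qed

section \<open>Partial sums of complex powers and the kernels built from them\<close>

definition power_sum :: "complex \<Rightarrow> nat \<Rightarrow> complex"
  where "power_sum d p = (\<Sum>j<p. complex_of_real (real j + 1) powr (- d))"

text \<open>Each term is compared by the mean value theorem with an increment of x^(1-h) / (1-h);
  the first term is separate because the derivative is unbounded at 0.\<close>

lemma real_power_sum_le:
  fixes h :: real assumes h: "0 < h" "h < 1"
  shows "(\<Sum>j<n. (real j + 1) powr (- h)) \<le> real n powr (1 - h) / (1 - h)"
proof (induction n)
  case (Suc n)
  have "(1 - h) * (real n + 1) powr (- h) \<le> (real n + 1) powr (1 - h) - real n powr (1 - h)"
  proof (cases "n = 0")
    case False
    have "\<exists>z. real n < z \<and> z < real n + 1 \<and>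
        (real n + 1) powr (1 - h) - real n powr (1 - h) = (real n + 1 - real n) * ((1 - h) * z powr (- h))"
    proof (rule MVT2)
      fix x assume "real n \<le> x"
      then have "x > 0" using False by linarith
      then show "((\<lambda>x. x powr (1 - h)) has_real_derivative (1 - h) * x powr (- h)) (at x)"
        using has_real_derivative_powr[of x "1 - h"] by simp
    qed simp
    then obtain z where z: "real n < z" "z < real n + 1"
      "(real n + 1) powr (1 - h) - real n powr (1 - h) = (1 - h) * z powr (- h)" by auto
    have "(real n + 1) powr (- h) \<le> z powr (- h)"
      using z h by (intro powr_mono2') auto
    then show ?thesis using z(3) h by (simp add: mult_left_mono)
  qed (use h in simp)
  then have "(real n + 1) powr (- h) \<le> ((real n + 1) powr (1 - h) - real n powr (1 - h)) / (1 - h)"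
    using h by (simp add: pos_le_divide_eq mult.commute)
  then show ?case
    using Suc.IH by (simp add: diff_divide_distrib add.commute)
qed simp

text \<open>The term at j differs from the increment of the primitive over [j, j + 1] by
  O(j^(-h-1)), with h the real part of d, and this is summable. Boundedness of the accumulated error
  is enough, because it is later multiplied by n^(h-1).\<close>

lemma power_sum_asymp:
  assumes h: "0 < Re d" "Re d < 1"
  shows "\<exists>K. \<forall>p. cmod (power_sum d p - complex_of_real (real p) powr (1 - d) / (1 - d)) \<le> K"
proof -
  have d1: "1 - d \<noteq> 0" using h by auto
  define D where "D j = complex_of_real (real j + 1) powr (- d) -
    (complex_of_real (real j + 1) powr (1 - d) - complex_of_real (real j) powr (1 - d)) / (1 - d)" for j :: nat
  have E: "power_sum d p - complex_of_real (real p) powr (1 - d) / (1 - d) = (\<Sum>j<p. D j)" for p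
  proof (induction p)
    case (Suc p)
    then show ?case
      by (simp add: power_sum_def D_def diff_divide_distrib algebra_simps)
  qed (simp add: power_sum_def)
  have bound: "cmod (D j) \<le> cmod d * real j powr (- Re d - 1)" if j: "j \<ge> 1" for j
  proof -
    \<comment> \<open>The mean value theorem as an equality fails for complex values, so derivatives
      are bounded on this segment of the complex plane, which avoids the branch cut for j \<ge>
      1.\<close>
    define S where "S = closed_segment (complex_of_real (real j)) (complex_of_real (real j + 1))"
    have S: "\<exists>x. z = complex_of_real x \<and> real j \<le> x \<and> x \<le> real j + 1" if "z \<in> S" for z
    proof -
      have "S = complex_of_real ` closed_segment (real j) (real j + 1)"
        unfolding S_def by (rule closed_segment_of_real)
      then show ?thesis using that by (auto simp: closed_segment_eq_real_ivl)
    qed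
    have conv: "convex S" by (simp add: S_def)
    have ends: "complex_of_real (real j) \<in> S" "complex_of_real (real j + 1) \<in> S" by (auto simp: S_def)
    have pos: "z \<notin> \<real>\<^sub>\<le>\<^sub>0" if "z \<in> S" for z using S[OF that] j by (auto simp: complex_nonpos_Reals_iff)
    have g: "cmod (z powr (- d) - complex_of_real (real j + 1) powr (- d)) \<le> cmod d * real j powr (- Re d - 1)"
      if z: "z \<in> S" for z
    proof -
      have "cmod (z powr (- d) - complex_of_real (real j + 1) powr (- d)) \<le>
        cmod d * real j powr (- Re d - 1) * cmod (z - complex_of_real (real j + 1))"
      proof (rule field_differentiable_bound[OF conv _ _ z ends(2)])
        fix w assume w: "w \<in> S"
        show "((\<lambda>w. w powr (- d)) has_field_derivative (- d) * w powr (- d - 1)) (at w within S)"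
          by (rule has_field_derivative_at_within[OF has_field_derivative_powr[OF pos[OF w]]])
        obtain x where x: "w = complex_of_real x" "real j \<le> x" using S[OF w] by blast
        have "cmod (w powr (- d - 1)) = x powr (- Re d - 1)"
          using x by (simp add: norm_of_real_powr)
        also have "\<dots> \<le> real j powr (- Re d - 1)"
          using x j h by (intro powr_mono2') auto
        finally show "cmod (- d * w powr (- d - 1)) \<le> cmod d * real j powr (- Re d - 1)"
          by (simp add: norm_mult mult_left_mono)
      qed
      also have "\<dots> \<le> cmod d * real j powr (- Re d - 1) * 1"
      proof (rule mult_left_mono)
        obtain x where x: "z = complex_of_real x" "real j \<le> x" "x \<le> real j + 1" using S[OF z] by blast
        have "cmod (z - complex_of_real (real j + 1)) = \<bar>x - (real j + 1)\<bar>"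
          unfolding x(1) of_real_diff[symmetric] norm_of_real ..
        then show "cmod (z - complex_of_real (real j + 1)) \<le> 1" using x by simp
      qed simp
      finally show ?thesis by simp
    qed
    \<comment> \<open>The derivative of F is the deviation estimated in \<open>g\<close>, and
      \<open>D j\<close> is the increment of F over the segment.\<close>
    define F where "F z = z * complex_of_real (real j + 1) powr (- d) - z powr (1 - d) / (1 - d)" for z
    have "D j = F (complex_of_real (real j + 1)) - F (complex_of_real (real j))"
      unfolding D_def F_def diff_divide_distrib left_diff_distrib
    proof -
      have "c = (1 + a) * c - a * c" for a c :: complex by (simp add: algebra_simps)
      from this[of "complex_of_real (real j + 1) powr - d" "complex_of_real (real j)"]
      show "complex_of_real (real j + 1) powr - d -
        (complex_of_real (real j + 1) powr (1 - d) / (1 - d) - complex_of_real (real j) powr (1 - d) / (1 - d)) =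
        complex_of_real (real j + 1) * complex_of_real (real j + 1) powr - d - complex_of_real (real j + 1) powr (1 - d) / (1 - d) -
        (complex_of_real (real j) * complex_of_real (real j + 1) powr - d - complex_of_real (real j) powr (1 - d) / (1 - d))"
        by (simp add: add.commute distrib_right)
    qed
    also have "cmod \<dots> \<le> cmod d * real j powr (- Re d - 1) *
        cmod (complex_of_real (real j + 1) - complex_of_real (real j))"
    proof (rule field_differentiable_bound[OF conv _ _ ends(2) ends(1)])
      fix z assume z: "z \<in> S"
      show "(F has_field_derivative complex_of_real (real j + 1) powr (- d) - z powr (- d)) (at z within S)"
      proof -
        have "((\<lambda>z. z * complex_of_real (real j + 1) powr (- d) - z powr (1 - d) / (1 - d)) has_field_derivative
            1 * complex_of_real (real j + 1) powr (- d) - (1 - d) * z powr (1 - d - 1) / (1 - d)) (at z)"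
          by (intro DERIV_diff DERIV_cmult_right DERIV_ident DERIV_cdivide has_field_derivative_powr[OF pos[OF z]])
        then show ?thesis
          unfolding F_def using d1 by (simp add: has_field_derivative_at_within)
      qed
      show "cmod (complex_of_real (real j + 1) powr (- d) - z powr (- d)) \<le> cmod d * real j powr (- Re d - 1)"
        using g[OF z] by (simp add: norm_minus_commute)
    qed
    finally show ?thesis by simp
  qed
  have "summable (\<lambda>j. cmod d * real j powr (- Re d - 1))"
    using h by (intro summable_mult) (simp add: summable_real_powr_iff)
  then have "summable (\<lambda>j. cmod (D j))"
    by (rule summable_comparison_test'[of _ 1]) (simp add: bound)
  then have "cmod (\<Sum>j<p. D j) \<le> (\<Sum>j. cmod (D j))" for p
    by (intro order_trans[OF norm_sum sum_le_suminf]) auto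
  then show ?thesis unfolding E by blast
qed

text \<open>The factor n^(d-1) turns p^(1-d) into (p/n)^(1-d) exactly, and it sends the bounded
  remainder to 0 because the real part of d is below 1.\<close>

lemma power_sum_tendsto:
  fixes p :: "nat \<Rightarrow> nat"
  assumes h: "0 < Re d" "Re d < 1" and p: "(\<lambda>n. real (p n) / real n) \<longlonglongrightarrow> \<beta>"
  shows "(\<lambda>n. complex_of_real (real n) powr (d - 1) * power_sum d (p n)) \<longlonglongrightarrow> complex_of_real \<beta> powr (1 - d) / (1 - d)"
proof -
  obtain K where K: "\<And>p. cmod (power_sum d p - complex_of_real (real p) powr (1 - d) / (1 - d)) \<le> K"
    using power_sum_asymp[OF h] by blast
  define R where "R p = power_sum d p - complex_of_real (real p) powr (1 - d) / (1 - d)" for p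
  have 1: "(\<lambda>n. complex_of_real (real (p n) / real n) powr (1 - d) / (1 - d)) \<longlonglongrightarrow> complex_of_real \<beta> powr (1 - d) / (1 - d)"
    using h by (intro tendsto_divide of_real_powr_tendsto p tendsto_const) auto
  have 2: "(\<lambda>n. complex_of_real (real n) powr (d - 1) * R (p n)) \<longlonglongrightarrow> 0"
  proof (rule Lim_null_comparison)
    show "\<forall>\<^sub>F n in sequentially. cmod (complex_of_real (real n) powr (d - 1) * R (p n)) \<le> real n powr (Re d - 1) * K"
    proof (intro always_eventually allI)
      fix n
      show "cmod (complex_of_real (real n) powr (d - 1) * R (p n)) \<le> real n powr (Re d - 1) * K"
        unfolding norm_mult norm_of_real_powr[OF of_nat_0_le_iff] R_def
        using K[of "p n"] by (intro mult_mono) auto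
    qed
    have "(\<lambda>n. real n powr (Re d - 1)) \<longlonglongrightarrow> 0"
      using h by (intro tendsto_neg_powr filterlim_real_sequentially) simp
    then show "(\<lambda>n. real n powr (Re d - 1) * K) \<longlonglongrightarrow> 0" by (rule tendsto_mult_left_zero)
  qed
  have eq: "complex_of_real (real (p n) / real n) powr (1 - d) / (1 - d) + complex_of_real (real n) powr (d - 1) * R (p n)
      = complex_of_real (real n) powr (d - 1) * power_sum d (p n)" if n: "n > 0" for n
  proof -
    have "complex_of_real (real (p n)) powr (1 - d) = complex_of_real (real (p n) / real n * real n) powr (1 - d)"
      using n by simp
    also have "\<dots> = complex_of_real (real (p n) / real n) powr (1 - d) * complex_of_real (real n) powr (1 - d)"
      by (rule of_real_powr_mult) auto
    finally have "complex_of_real (real n) powr (d - 1) * complex_of_real (real (p n)) powr (1 - d) =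
      complex_of_real (real (p n) / real n) powr (1 - d) * (complex_of_real (real n) powr (1 - d) * complex_of_real (real n) powr (d - 1))"
      by (simp only: mult_ac)
    also have "complex_of_real (real n) powr (1 - d) * complex_of_real (real n) powr (d - 1) = 1"
      using n by (simp flip: powr_add)
    finally show ?thesis by (simp add: R_def right_diff_distrib)
  qed
  have "(\<lambda>n. complex_of_real (real (p n) / real n) powr (1 - d) / (1 - d) + complex_of_real (real n) powr (d - 1) * R (p n))
      \<longlonglongrightarrow> complex_of_real \<beta> powr (1 - d) / (1 - d) + 0"
    by (intro tendsto_add 1 2)
  moreover have "\<forall>\<^sub>F n in sequentially. complex_of_real (real (p n) / real n) powr (1 - d) / (1 - d) + complex_of_real (real n) powr (d - 1) * R (p n)
      = complex_of_real (real n) powr (d - 1) * power_sum d (p n)"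
    by (rule eventually_sequentiallyI[of 1]) (rule eq, simp)
  ultimately show ?thesis
    using Lim_transform_eventually by fastforce
qed

text \<open>The lower summation index is truncated subtraction, that is \<open>max 0 (i + 1 - n)\<close>.\<close>

definition step_coeff :: "nat \<Rightarrow> nat \<Rightarrow> complex \<Rightarrow> complex"
  where "step_coeff n i d = complex_of_real (real n) powr (d - 1) *
    (\<Sum>j=i + 1 - n..i. complex_of_real (real j + 1) powr (- d))"

definition step_kernel :: "nat \<Rightarrow> real \<Rightarrow> complex \<Rightarrow> complex"
  where "step_kernel n \<tau> d = (if \<tau> \<ge> 0 then step_coeff n (nat \<lfloor>real n * \<tau>\<rfloor>) d else 0)"

definition limit_kernel :: "real \<Rightarrow> complex \<Rightarrow> complex"
  where "limit_kernel \<tau> d = (if \<tau> \<ge> 0 then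
    complex_of_real \<tau> powr (1 - d) / (1 - d) - complex_of_real (max 0 (\<tau> - 1)) powr (1 - d) / (1 - d) else 0)"

text \<open>The cut at 2 keeps clear of the singularity of (\<tau>-1)^(-h) at 1. Up to 2, a window
  of at most n terms is bounded by the first n terms of the power sum; beyond 2, every term of the
  window is at most (n * (\<tau>-1))^(-h).\<close>

definition kernel_bound :: "real \<Rightarrow> real \<Rightarrow> real"
  where "kernel_bound \<tau> h = (if \<tau> < 0 then 0 else if \<tau> \<le> 2 then 1 / (1 - h) else (\<tau> - 1) powr (- h))"

lemma step_coeff_power_sum:
  "step_coeff n i d = complex_of_real (real n) powr (d - 1) * power_sum d (i + 1) -
    complex_of_real (real n) powr (d - 1) * power_sum d (i + 1 - n)"
proof -
  have "power_sum d (i + 1) = power_sum d (i + 1 - n) + (\<Sum>j=i + 1 - n..i. complex_of_real (real j + 1) powr (- d))"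
    unfolding power_sum_def
    using sum.atLeastLessThan_concat[of 0 "i + 1 - n" "i + 1" "\<lambda>j. complex_of_real (real j + 1) powr (- d)"]
    by (simp add: lessThan_atLeast0 atLeastLessThanSuc_atLeastAtMost)
  then show ?thesis by (simp add: step_coeff_def algebra_simps)
qed

lemma step_kernel_tendsto:
  assumes h: "0 < Re d" "Re d < 1"
  shows "(\<lambda>n. step_kernel n \<tau> d) \<longlonglongrightarrow> limit_kernel \<tau> d"
proof (cases "\<tau> \<ge> 0")
  case True
  define i where "i n = nat \<lfloor>real n * \<tau>\<rfloor>" for n
  have 1: "(\<lambda>n. real (i n + 1) / real n) \<longlonglongrightarrow> \<tau>"
  proof (rule tendsto_sandwich)
    have i: "real n * \<tau> \<le> real (i n + 1)" "real (i n + 1) \<le> real n * \<tau> + 1" for n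
      using True by (auto simp: i_def) linarith+
    show "\<forall>\<^sub>F n in sequentially. \<tau> \<le> real (i n + 1) / real n"
      using i(1) by (intro eventually_sequentiallyI[of 1]) (simp add: field_simps)
    show "\<forall>\<^sub>F n in sequentially. real (i n + 1) / real n \<le> \<tau> + 1 / real n"
      using i(2) by (intro eventually_sequentiallyI[of 1]) (simp add: field_simps)
    show "(\<lambda>n. \<tau> + 1 / real n) \<longlonglongrightarrow> \<tau>"
      using tendsto_add[OF tendsto_const lim_1_over_n] by simp
  qed simp
  \<comment> \<open>Truncated subtraction turns into the positive part of \<tau> - 1.\<close>
  have 2: "(\<lambda>n. real (i n + 1 - n) / real n) \<longlonglongrightarrow> max 0 (\<tau> - 1)"
  proof (rule Lim_transform_eventually)
    show "(\<lambda>n. max 0 (real (i n + 1) / real n - 1)) \<longlonglongrightarrow> max 0 (\<tau> - 1)"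
      by (intro tendsto_max tendsto_diff 1 tendsto_const)
    show "\<forall>\<^sub>F n in sequentially. max 0 (real (i n + 1) / real n - 1) = real (i n + 1 - n) / real n"
      by (intro eventually_sequentiallyI[of 1]) (auto simp: max_def of_nat_diff field_simps not_le)
  qed
  have "(\<lambda>n. step_coeff n (i n) d) \<longlonglongrightarrow> limit_kernel \<tau> d"
  proof -
    have lk: "limit_kernel \<tau> d = complex_of_real \<tau> powr (1 - d) / (1 - d) - complex_of_real (max 0 (\<tau> - 1)) powr (1 - d) / (1 - d)"
      using True by (simp add: limit_kernel_def)
    show ?thesis
      unfolding step_coeff_power_sum lk by (intro tendsto_diff power_sum_tendsto[OF h] 1 2)
  qed
  then show ?thesis using True by (simp add: step_kernel_def i_def)
qed (simp add: step_kernel_def limit_kernel_def)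

lemma step_kernel_bound:
  assumes h: "0 < Re d" "Re d < 1" and n: "n > 0"
  shows "cmod (step_kernel n \<tau> d) \<le> kernel_bound \<tau> (Re d)"
proof (cases "\<tau> \<ge> 0")
  case True
  define i where "i = nat \<lfloor>real n * \<tau>\<rfloor>"
  define h where "h = Re d"
  have hh: "0 < h" "h < 1" using h by (auto simp: h_def)
  have i: "real n * \<tau> < real i + 1" using True by (auto simp: i_def)
  have "cmod (step_coeff n i d) \<le> real n powr (h - 1) * (\<Sum>j=i + 1 - n..i. cmod (complex_of_real (real j + 1) powr (- d)))"
    unfolding step_coeff_def norm_mult norm_of_real_powr[OF of_nat_0_le_iff]
    by (intro mult_mono norm_sum) (simp_all add: h_def sum_nonneg)
  also have "(\<Sum>j=i + 1 - n..i. cmod (complex_of_real (real j + 1) powr (- d))) = (\<Sum>j=i + 1 - n..i. (real j + 1) powr (- h))"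
    by (intro sum.cong refl, subst norm_of_real_powr) (simp_all add: h_def)
  finally have st: "cmod (step_coeff n i d) \<le> real n powr (h - 1) * (\<Sum>j=i + 1 - n..i. (real j + 1) powr (- h))" .
  have card: "card {i + 1 - n..i} \<le> n" by simp
  show ?thesis
  proof (cases "\<tau> \<le> 2")
    case le: True
    \<comment> \<open>Shifting the window down to 0 only enlarges its terms, since they decrease in
      j.\<close>
    have "(\<Sum>j=i + 1 - n..i. (real j + 1) powr (- h)) \<le> (\<Sum>j<n. (real j + 1) powr (- h))"
    proof (rule sum_le_included[where i = "\<lambda>j. j + (i + 1 - n)"])
      show "\<forall>x\<in>{i + 1 - n..i}. \<exists>y\<in>{..<n}. y + (i + 1 - n) = x \<and> (real x + 1) powr (- h) \<le> (real y + 1) powr (- h)"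
      proof
        fix x assume x: "x \<in> {i + 1 - n..i}"
        then have "x - (i + 1 - n) < n" "x - (i + 1 - n) + (i + 1 - n) = x"
          using n by auto
        moreover have "(real x + 1) powr (- h) \<le> (real (x - (i + 1 - n)) + 1) powr (- h)"
          using hh by (intro powr_mono2') auto
        ultimately show "\<exists>y\<in>{..<n}. y + (i + 1 - n) = x \<and> (real x + 1) powr (- h) \<le> (real y + 1) powr (- h)"
          by blast
      qed
    qed auto
    also have "\<dots> \<le> real n powr (1 - h) / (1 - h)" by (rule real_power_sum_le[OF hh])
    finally have "cmod (step_coeff n i d) \<le> real n powr (h - 1) * (real n powr (1 - h) / (1 - h))"
      by (intro order_trans[OF st] mult_left_mono) simp_all
    also have "\<dots> = 1 / (1 - h)" using n by (simp flip: powr_add)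
    finally show ?thesis using True le by (simp add: step_kernel_def kernel_bound_def i_def h_def)
  next
    case False
    have "(\<Sum>j=i + 1 - n..i. (real j + 1) powr (- h)) \<le> (\<Sum>j=i + 1 - n..i. (real n * (\<tau> - 1)) powr (- h))"
    proof (rule sum_mono)
      fix j assume j: "j \<in> {i + 1 - n..i}"
      have "real n * (\<tau> - 1) \<le> real j + 1"
        using i j by (simp add: algebra_simps) linarith
      then show "(real j + 1) powr (- h) \<le> (real n * (\<tau> - 1)) powr (- h)"
        using hh n False by (intro powr_mono2') auto
    qed
    also have "\<dots> \<le> real n * (real n * (\<tau> - 1)) powr (- h)"
      using card by (simp del: card_atLeastAtMost add: mult_right_mono)
    finally have "cmod (step_coeff n i d) \<le> real n powr (h - 1) * (real n * (real n * (\<tau> - 1)) powr (- h))"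
      by (intro order_trans[OF st] mult_left_mono) simp_all
    also have "\<dots> = (real n powr (h - 1) * real n powr 1 * real n powr (- h)) * (\<tau> - 1) powr (- h)"
      using False n by (simp add: powr_mult)
    also have "real n powr (h - 1) * real n powr 1 * real n powr (- h) = 1"
      unfolding powr_add[symmetric] using n by simp
    finally show ?thesis using True False by (simp add: step_kernel_def kernel_bound_def i_def h_def)
  qed
qed (simp add: step_kernel_def kernel_bound_def)

lemma limit_kernel_bound:
  assumes h: "0 < Re d" "Re d < 1"
  shows "cmod (limit_kernel \<tau> d) \<le> kernel_bound \<tau> (Re d)"
proof (rule LIMSEQ_le_const2)
  show "(\<lambda>n. cmod (step_kernel n \<tau> d)) \<longlonglongrightarrow> cmod (limit_kernel \<tau> d)"
    by (intro tendsto_norm step_kernel_tendsto h)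
qed (use step_kernel_bound[OF h] in \<open>auto intro!: exI[of _ 1]\<close>)

text \<open>The interval [0, 2] contributes 2 / (1-h)^2, and the tail contributes the integral of
  (\<tau>-1)^(-2h) from 2 on; this is where h > 1/2 makes the kernel square integrable in
  time.\<close>

lemma nn_integral_kernel_bound:
  assumes h: "1/2 < h" "h < 1"
  shows "(\<integral>\<^sup>+\<tau>. ennreal ((kernel_bound \<tau> h)\<^sup>2) \<partial>lborel) = ennreal (2 / (1 - h)\<^sup>2 + 1 / (2 * h - 1))"
proof -
  have tail: "(\<integral>\<^sup>+\<tau>. ennreal ((\<tau> - 1) powr (- 2 * h)) * indicator {2..} \<tau> \<partial>lborel) =
    ennreal (0 - (- ((2 - 1) powr (1 - 2 * h) / (2 * h - 1))))"
  proof (rule nn_integral_FTC_atLeast[where a = 2 and T = 0 and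
        F = "\<lambda>x. - ((x - 1) powr (1 - 2 * h) / (2 * h - 1))" and f = "\<lambda>x. (x - 1) powr (- 2 * h)"])
    fix x :: real assume x: "2 \<le> x"
    have "((\<lambda>x. (x - 1) powr (1 - 2 * h)) has_real_derivative (1 - 2 * h) * (x - 1) powr (- 2 * h)) (at x)"
      using DERIV_fun_powr[of "\<lambda>x. x - 1" 1 x "1 - 2 * h"] x by (auto intro!: derivative_eq_intros)
    then have "((\<lambda>x. - ((x - 1) powr (1 - 2 * h) / (2 * h - 1))) has_real_derivative
        - ((1 - 2 * h) * (x - 1) powr (- 2 * h) / (2 * h - 1))) (at x)"
      by (intro DERIV_minus DERIV_cdivide)
    moreover have "- ((1 - 2 * h) * (x - 1) powr (- 2 * h) / (2 * h - 1)) = (x - 1) powr (- 2 * h)"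
      using h by (simp add: field_simps)
    ultimately show "((\<lambda>x. - ((x - 1) powr (1 - 2 * h) / (2 * h - 1))) has_real_derivative (x - 1) powr (- 2 * h)) (at x)"
      by simp
  next
    have "filterlim (\<lambda>x. x - 1 :: real) at_top at_top"
      by (rule filterlim_at_top_mono[OF filterlim_tendsto_add_at_top[OF tendsto_const[of "-1"] filterlim_ident]]) auto
    then have "((\<lambda>x. (x - 1) powr (1 - 2 * h)) \<longlongrightarrow> 0) at_top"
      using h by (intro tendsto_neg_powr) auto
    then have "((\<lambda>x. - ((x - 1) powr (1 - 2 * h) / (2 * h - 1))) \<longlongrightarrow> - (0 / (2 * h - 1))) at_top"
      using h by (intro tendsto_minus tendsto_divide tendsto_const) auto
    then show "((\<lambda>x. - ((x - 1) powr (1 - 2 * h) / (2 * h - 1))) \<longlongrightarrow> 0) at_top" by simp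
  qed auto
  have "(\<integral>\<^sup>+\<tau>. ennreal ((kernel_bound \<tau> h)\<^sup>2) \<partial>lborel) =
    (\<integral>\<^sup>+\<tau>. ennreal (1 / (1 - h)\<^sup>2) * indicator {0..2} \<tau> + ennreal ((\<tau> - 1) powr (- 2 * h)) * indicator {2..} \<tau> \<partial>lborel)"
  proof (rule nn_integral_cong_AE)
    have "AE \<tau> in lborel. \<tau> \<noteq> (2::real)" by (rule AE_lborel_singleton)
    then show "AE \<tau> in lborel. ennreal ((kernel_bound \<tau> h)\<^sup>2) =
      ennreal (1 / (1 - h)\<^sup>2) * indicator {0..2} \<tau> + ennreal ((\<tau> - 1) powr (- 2 * h)) * indicator {2..} \<tau>"
    proof eventually_elim
      case (elim \<tau>)
      then show ?case
        using h by (auto simp: kernel_bound_def indicator_def power_divide power2_eq_square simp flip: powr_add)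
    qed
  qed
  also have "\<dots> = ennreal (1 / (1 - h)\<^sup>2) * ennreal 2 + ennreal (1 / (2 * h - 1))"
    using tail by (subst nn_integral_add) (auto simp: nn_integral_cmult)
  also have "\<dots> = ennreal (2 / (1 - h)\<^sup>2 + 1 / (2 * h - 1))"
  proof -
    have "ennreal (1 / (1 - h)\<^sup>2) * ennreal 2 = ennreal (1 / (1 - h)\<^sup>2 * 2)"
      by (rule ennreal_mult'[symmetric]) simp
    moreover have "ennreal (1 / (1 - h)\<^sup>2 * 2) + ennreal (1 / (2 * h - 1)) = ennreal (1 / (1 - h)\<^sup>2 * 2 + 1 / (2 * h - 1))"
      by (rule ennreal_plus[symmetric]) (use h in simp_all)
    ultimately show ?thesis by simp
  qed
  finally show ?thesis .
qed

lemma step_kernel_measurable[measurable]: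
  assumes [measurable]: "f \<in> borel_measurable M" "g \<in> borel_measurable M"
  shows "(\<lambda>x. step_kernel n (f x) (g x)) \<in> borel_measurable M"
proof -
  have [measurable]: "(\<lambda>x. step_coeff n i (g x)) \<in> borel_measurable M" for i
    unfolding step_coeff_def
    by (intro borel_measurable_times borel_measurable_sum measurable_of_real_powr) auto
  have "(\<lambda>x. step_coeff n (nat \<lfloor>real n * f x\<rfloor>) (g x)) \<in> borel_measurable M"
    by (rule measurable_compose_countable[where f = "\<lambda>i x. step_coeff n i (g x)"]) measurable
  then show ?thesis unfolding step_kernel_def by measurable
qed

lemma limit_kernel_measurable[measurable]:
  assumes [measurable]: "f \<in> borel_measurable M" "g \<in> borel_measurable M"
  shows "(\<lambda>x. limit_kernel (f x) (g x)) \<in> borel_measurable M"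
proof -
  \<comment> \<open>Taking \<open>max 0 (f x)\<close> makes the base nonnegative everywhere, as
    \<open>measurable_of_real_powr\<close> demands.\<close>
  have "(\<lambda>x. if f x \<ge> 0 then complex_of_real (max 0 (f x)) powr (1 - g x) / (1 - g x) -
      complex_of_real (max 0 (f x - 1)) powr (1 - g x) / (1 - g x) else 0) \<in> borel_measurable M"
    by (intro measurable_If borel_measurable_diff borel_measurable_divide measurable_of_real_powr) auto
  then show ?thesis
    by (rule measurable_cong[THEN iffD1, rotated]) (auto simp: limit_kernel_def)
qed

lemma kernel_bound_measurable[measurable]:
  assumes [measurable]: "f \<in> borel_measurable M" "g \<in> borel_measurable M"
  shows "(\<lambda>x. kernel_bound (f x) (g x)) \<in> borel_measurable M"
  unfolding kernel_bound_def by measurable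

section \<open>The Beta integral\<close>

lemma borel_measurable_cnj_comp[measurable (raw)]:
  "f \<in> borel_measurable M \<Longrightarrow> (\<lambda>x. cnj (f x)) \<in> borel_measurable M"
  by (rule measurable_compose[OF _ borel_measurable_continuous_onI[OF continuous_on_cnj[OF continuous_on_id]]])

lemma has_bochner_integral_eqI:
  assumes "has_bochner_integral M f x" "\<And>y. f y = g y" "x = z"
  shows "has_bochner_integral M g z"
proof -
  have "f = g" using assms(2) by (rule ext)
  then show ?thesis using assms(1,3) by simp
qed

text \<open>Cut off at 0 so that translates and dilates of powers can be integrated over the whole
  line and all substitutions stay affine.\<close>

definition pos_powr :: "complex \<Rightarrow> real \<Rightarrow> complex"
  where "pos_powr z x = (if x > 0 then complex_of_real x powr z else 0)"

lemma pos_powr_measurable[measurable]: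
  assumes [measurable]: "f \<in> borel_measurable M" "g \<in> borel_measurable M"
  shows "(\<lambda>x. pos_powr (g x) (f x)) \<in> borel_measurable M"
proof -
  have "(\<lambda>x. if f x > 0 then complex_of_real (max 0 (f x)) powr (g x) else 0) \<in> borel_measurable M"
    by (intro measurable_If measurable_of_real_powr) auto
  then show ?thesis
    by (rule measurable_cong[THEN iffD1, rotated]) (auto simp: pos_powr_def)
qed

lemma pos_powr_mult_left: "c > 0 \<Longrightarrow> pos_powr z (c * x) = complex_of_real c powr z * pos_powr z x"
  using of_real_powr_mult[of c x z] by (simp add: pos_powr_def zero_less_mult_iff)

lemma cnj_pos_powr: "cnj (pos_powr z x) = pos_powr (cnj z) x"
  by (simp add: pos_powr_def cnj_powr)

lemma norm_pos_powr: "complex_of_real (cmod (pos_powr z x)) = pos_powr (Re z) x"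
  by (simp add: pos_powr_def norm_of_real_powr powr_of_real)

text \<open>Euler's integral for c = 1, followed by a dilation of the line by c.\<close>

lemma has_bochner_integral_Gamma_complex:
  assumes z: "Re z > 0" and c: "c > 0"
  shows "has_bochner_integral lborel (\<lambda>t. pos_powr (z - 1) t * exp (- (c * t)))
    (Gamma z * complex_of_real c powr (- z))"
proof -
  define f where "f t = pos_powr (z - 1) t * exp (- complex_of_real t)" for t
  have [measurable]: "f \<in> borel_measurable borel"
    unfolding f_def by measurable
  have eq: "f = (\<lambda>t. indicat_real {0<..} t *\<^sub>R (complex_of_real t powr (z - 1) / of_real (exp t)))"
    by (auto simp: f_def pos_powr_def fun_eq_iff indicator_def exp_minus exp_of_real divide_inverse)
  have "integrable lebesgue f"
    using absolutely_integrable_Gamma_integral'[OF z] unfolding eq set_integrable_def .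
  then have i: "integrable lborel f" by (simp add: integrable_completion)
  have "integral\<^sup>L lebesgue f = Gamma z"
    using set_lebesgue_integral_eq_integral(2)[OF absolutely_integrable_Gamma_integral'[OF z]]
      integral_unique[OF Gamma_integral_complex'[OF z]]
    unfolding eq set_lebesgue_integral_def by simp
  then have "integral\<^sup>L lborel f = Gamma z" by (simp add: integral_completion)
  with i have "has_bochner_integral lborel f (Gamma z)" by (simp add: has_bochner_integral_iff)
  then have "has_bochner_integral lborel (\<lambda>t. f (0 + c * t)) (Gamma z /\<^sub>R \<bar>c\<bar>)"
    using c by (subst (asm) lborel_has_bochner_integral_real_affine_iff[of c _ _ 0]) auto
  then have "has_bochner_integral lborel (\<lambda>t. complex_of_real c powr (1 - z) * f (c * t))
      (complex_of_real c powr (1 - z) * (Gamma z /\<^sub>R \<bar>c\<bar>))"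
    by (intro has_bochner_integral_mult_right) simp
  moreover have "complex_of_real c powr (1 - z) * f (c * t) = pos_powr (z - 1) t * exp (- (c * t))" for t
  proof -
    have "complex_of_real c powr (1 - z) * complex_of_real c powr (z - 1) = 1"
      using c by (simp flip: powr_add)
    then have u: "complex_of_real c powr (1 - z) * (complex_of_real c powr (z - 1) * u) = u" for u
      by (simp only: mult.assoc[symmetric] mult_1_left)
    have "exp (complex_of_real (- (c * t))) = complex_of_real (exp (- (c * t)))" by (rule exp_of_real)
    then have "exp (- complex_of_real (c * t)) = complex_of_real (exp (- (c * t)))" by simp
    then show ?thesis unfolding f_def pos_powr_mult_left[OF c] mult.assoc[of "complex_of_real c powr (z - 1)"] u
      by (simp only:)
  qed
  moreover have "complex_of_real c powr (1 - z) * (Gamma z /\<^sub>R \<bar>c\<bar>) = Gamma z * complex_of_real c powr (- z)"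
  proof -
    have "complex_of_real c powr (1 - z) = c * complex_of_real c powr (- z)"
      using c by (simp add: diff_conv_add_uminus powr_add del: add_uminus_conv_diff)
    then show ?thesis using c by (simp add: scaleR_conv_of_real)
  qed
  ultimately show ?thesis by (rule has_bochner_integral_eqI)
qed

text \<open>The classical double integral. Integrating H in x first gives Gamma a * t^(b-1) * exp
  (-t); integrating in t first gives Gamma (a + b) times the integrand of the claim. Comparing both
  orders leaves the quotient of Gamma functions.\<close>

lemma has_bochner_integral_Beta_complex:
  assumes a: "Re a > 0" and b: "Re b > 0"
  shows "has_bochner_integral lborel (\<lambda>x. pos_powr (a - 1) x * pos_powr (- a - b) (1 + x)) (Beta a b)"
proof -
  define H where "H = (\<lambda>(t, x). pos_powr (a - 1) x * pos_powr (a + b - 1) t * exp (- complex_of_real ((1 + x) * t)))"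
  have [measurable]: "H \<in> borel_measurable (lborel \<Otimes>\<^sub>M lborel)"
    unfolding H_def by measurable
  have Gx: "has_bochner_integral lborel (\<lambda>x. H (t, x)) (Gamma a * (pos_powr (b - 1) t * exp (- complex_of_real t)))"
    for t
  proof (cases "t > 0")
    case True
    have "has_bochner_integral lborel (\<lambda>x. (pos_powr (a + b - 1) t * exp (- complex_of_real t)) * (pos_powr (a - 1) x * exp (- (t * x))))
        ((pos_powr (a + b - 1) t * exp (- complex_of_real t)) * (Gamma a * complex_of_real t powr (- a)))"
      by (intro has_bochner_integral_mult_right has_bochner_integral_Gamma_complex a True)
    moreover have "(pos_powr (a + b - 1) t * exp (- complex_of_real t)) * (pos_powr (a - 1) x * exp (- (t * x))) = H (t, x)" for x
    proof -
      have "complex_of_real (exp (- (t * x))) = exp (complex_of_real (- (t * x)))"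
        by (rule exp_of_real[symmetric])
      then have "exp (- complex_of_real ((1 + x) * t)) = exp (- complex_of_real t) * complex_of_real (exp (- (t * x)))"
        by (simp add: exp_add[symmetric] algebra_simps)
      then show ?thesis by (simp only: H_def case_prod_conv mult_ac)
    qed
    moreover have "(pos_powr (a + b - 1) t * exp (- complex_of_real t)) * (Gamma a * complex_of_real t powr (- a)) =
      Gamma a * (pos_powr (b - 1) t * exp (- complex_of_real t))"
    proof -
      have "pos_powr (a + b - 1) t * complex_of_real t powr (- a) = pos_powr (b - 1) t"
        using True by (simp add: pos_powr_def powr_add[symmetric])
      from arg_cong[OF this, of "\<lambda>u. Gamma a * (u * exp (- complex_of_real t))"]
      show ?thesis by (simp only: mult_ac)
    qed
    ultimately show ?thesis by (rule has_bochner_integral_eqI)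
  next
    case False
    then show ?thesis by (simp add: H_def pos_powr_def has_bochner_integral_zero)
  qed
  have Gt: "has_bochner_integral lborel (\<lambda>t. H (t, x)) (Gamma (a + b) * (pos_powr (a - 1) x * pos_powr (- a - b) (1 + x)))"
    for x
  proof (cases "x > 0")
    case True
    have "has_bochner_integral lborel (\<lambda>t. pos_powr (a - 1) x * (pos_powr (a + b - 1) t * exp (- ((1 + x) * t))))
        (pos_powr (a - 1) x * (Gamma (a + b) * complex_of_real (1 + x) powr (- (a + b))))"
      using a b True by (intro has_bochner_integral_mult_right has_bochner_integral_Gamma_complex) auto
    moreover have "pos_powr (a - 1) x * (pos_powr (a + b - 1) t * exp (- ((1 + x) * t))) = H (t, x)" for t
      by (simp add: H_def exp_of_real[symmetric])
    moreover have "pos_powr (a - 1) x * (Gamma (a + b) * complex_of_real (1 + x) powr (- (a + b))) =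
        Gamma (a + b) * (pos_powr (a - 1) x * pos_powr (- a - b) (1 + x))"
      using True by (simp add: pos_powr_def)
    ultimately show ?thesis by (rule has_bochner_integral_eqI)
  next
    case False
    then show ?thesis by (simp add: H_def pos_powr_def has_bochner_integral_zero)
  qed
  have intH: "integrable (lborel \<Otimes>\<^sub>M lborel) H"
  proof (rule lborel_pair.Fubini_integrable)
    show "H \<in> borel_measurable (lborel \<Otimes>\<^sub>M lborel)" by measurable
    show "AE t in lborel. integrable lborel (\<lambda>x. H (t, x))"
      using Gx by (auto simp: has_bochner_integral_iff)
    \<comment> \<open>The modulus of H is the same integrand with exponents replaced by their real
      parts, so the Gamma formula for real parameters settles absolute integrability.\<close>
    have "has_bochner_integral lborel (\<lambda>x. norm (H (t, x))) (Gamma (Re a) * (cmod (pos_powr (b - 1) t) * exp (- t)))" for t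
    proof (cases "t > 0")
      case True
      have "has_bochner_integral lborel (\<lambda>x. Re (pos_powr (complex_of_real (Re a) - 1) x * exp (- (t * x))))
        (Re (Gamma (complex_of_real (Re a)) * complex_of_real t powr (- complex_of_real (Re a))))"
        by (rule has_bochner_integral_bounded_linear[OF bounded_linear_Re has_bochner_integral_Gamma_complex])
          (use a True in auto)
      then have "has_bochner_integral lborel (\<lambda>x. (cmod (pos_powr (a + b - 1) t) * exp (- t)) *
          Re (pos_powr (complex_of_real (Re a) - 1) x * exp (- (t * x))))
        ((cmod (pos_powr (a + b - 1) t) * exp (- t)) * Re (Gamma (complex_of_real (Re a)) * complex_of_real t powr (- complex_of_real (Re a))))"
        by (rule has_bochner_integral_mult_right)
      moreover have "(cmod (pos_powr (a + b - 1) t) * exp (- t)) * Re (pos_powr (complex_of_real (Re a) - 1) x * exp (- (t * x))) =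
          norm (H (t, x))" for x
      proof -
        have "pos_powr (complex_of_real (Re a) - 1) x = complex_of_real (cmod (pos_powr (a - 1) x))"
          unfolding norm_pos_powr by simp
        then have "Re (pos_powr (complex_of_real (Re a) - 1) x * exp (- (t * x))) = cmod (pos_powr (a - 1) x) * exp (- (t * x))"
          by (simp only: of_real_mult[symmetric] Re_complex_of_real)
        moreover have "norm (H (t, x)) = cmod (pos_powr (a - 1) x) * cmod (pos_powr (a + b - 1) t) * exp (- ((1 + x) * t))"
          by (simp add: H_def norm_mult)
        moreover have "exp (- ((1 + x) * t)) = exp (- t) * exp (- (t * x))"
          by (simp add: exp_add[symmetric] algebra_simps)
        ultimately show ?thesis by simp
      qed
      moreover have "(cmod (pos_powr (a + b - 1) t) * exp (- t)) * Re (Gamma (complex_of_real (Re a)) * complex_of_real t powr (- complex_of_real (Re a)))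
        = Gamma (Re a) * (cmod (pos_powr (b - 1) t) * exp (- t))"
      proof -
        have "complex_of_real t powr (- complex_of_real (Re a)) = complex_of_real (t powr (- Re a))"
          using True by (simp add: powr_of_real[symmetric])
        then have "Re (Gamma (complex_of_real (Re a)) * complex_of_real t powr (- complex_of_real (Re a))) = Gamma (Re a) * t powr (- Re a)"
          by (simp add: Gamma_complex_of_real)
        moreover have "cmod (pos_powr (a + b - 1) t) * t powr (- Re a) = cmod (pos_powr (b - 1) t)"
          using True by (simp add: pos_powr_def norm_of_real_powr flip: powr_add)
        ultimately show ?thesis by (simp add: mult_ac)
      qed
      ultimately show ?thesis by (rule has_bochner_integral_eqI)
    next
      case False
      then show ?thesis by (simp add: H_def pos_powr_def has_bochner_integral_zero)
    qed
    then have "(\<lambda>t. \<integral>x. norm (H (t, x)) \<partial>lborel) = (\<lambda>t. Gamma (Re a) * (cmod (pos_powr (b - 1) t) * exp (- t)))"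
      by (auto simp: has_bochner_integral_iff fun_eq_iff)
    moreover have "integrable lborel (\<lambda>t. cmod (pos_powr (b - 1) t * exp (- (1 * t))))"
      using has_bochner_integral_Gamma_complex[OF b, of 1] by (intro integrable_norm) (simp add: has_bochner_integral_iff)
    ultimately show "integrable lborel (\<lambda>t. \<integral>x. norm (H (t, x)) \<partial>lborel)"
      by (simp add: norm_mult)
  qed
  have int': "integrable (lborel \<Otimes>\<^sub>M lborel) (\<lambda>(t, x). H (t, x))" using intH by simp
  have 1: "(\<integral>t. (\<integral>x. H (t, x) \<partial>lborel) \<partial>lborel) = Gamma a * Gamma b"
  proof -
    have "(\<integral>t. (\<integral>x. H (t, x) \<partial>lborel) \<partial>lborel) = (\<integral>t. Gamma a * (pos_powr (b - 1) t * exp (- complex_of_real t)) \<partial>lborel)"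
      using Gx by (simp add: has_bochner_integral_iff)
    also have "\<dots> = Gamma a * Gamma b"
    proof -
      have "exp (- complex_of_real t) = complex_of_real (exp (- t))" for t
        using exp_of_real[of "- t", where ?'a = complex] by simp
      then show ?thesis
        using has_bochner_integral_Gamma_complex[OF b, of 1] by (simp add: has_bochner_integral_iff)
    qed
    finally show ?thesis .
  qed
  have G0: "Gamma (a + b) \<noteq> 0" using a b by (auto simp: Gamma_eq_zero_iff elim!: nonpos_Ints_cases dest!: arg_cong[of _ _ Re])
  have ix: "(\<lambda>x. \<integral>t. H (t, x) \<partial>lborel) = (\<lambda>x. Gamma (a + b) * (pos_powr (a - 1) x * pos_powr (- a - b) (1 + x)))"
    using Gt by (auto simp: has_bochner_integral_iff fun_eq_iff)
  have i: "integrable lborel (\<lambda>x. Gamma (a + b) * (pos_powr (a - 1) x * pos_powr (- a - b) (1 + x)))"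
    using lborel_pair.integrable_snd[OF int'] unfolding ix .
  have v: "(\<integral>x. Gamma (a + b) * (pos_powr (a - 1) x * pos_powr (- a - b) (1 + x)) \<partial>lborel) = Gamma a * Gamma b"
    using lborel_pair.Fubini_integral[OF int'] unfolding ix 1 .
  have "has_bochner_integral lborel (\<lambda>x. inverse (Gamma (a + b)) * (Gamma (a + b) * (pos_powr (a - 1) x * pos_powr (- a - b) (1 + x))))
      (inverse (Gamma (a + b)) * (Gamma a * Gamma b))"
    using i v by (intro has_bochner_integral_mult_right) (simp only: has_bochner_integral_iff)
  moreover have "inverse (Gamma (a + b)) * (Gamma (a + b) * u) = u" for u
    using G0 by (simp add: mult.assoc[symmetric])
  moreover have "inverse (Gamma (a + b)) * (Gamma a * Gamma b) = Beta a b"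
    by (simp add: Beta_def divide_inverse mult.commute)
  ultimately show ?thesis by (rule has_bochner_integral_eqI)
qed

section \<open>Covariance of the limit kernel\<close>

definition cov_coeff :: "complex \<Rightarrow> complex \<Rightarrow> complex"
  where "cov_coeff r s = Beta (1 - r) (r + cnj s - 1)"

text \<open>Dilation by z reduces to the shift 1: the powers contribute the exponent - (r + cnj s),
  and the change of variable adds 1.\<close>

lemma has_bochner_integral_shifted_powr_pos:
  assumes r: "Re r < 1" and rs: "1 < Re r + Re s" and z: "z > 0"
  shows "has_bochner_integral lborel (\<lambda>x. pos_powr (- r) x * cnj (pos_powr (- s) (x + z)))
    (complex_of_real z powr (1 - (r + cnj s)) * cov_coeff r s)"
proof -
  define f where "f x = pos_powr (- r) x * pos_powr (- cnj s) (1 + x)" for x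
  have "has_bochner_integral lborel f (cov_coeff r s)"
    using has_bochner_integral_Beta_complex[of "1 - r" "r + cnj s - 1"] r rs
    by (simp add: f_def[abs_def] cov_coeff_def)
  then have "has_bochner_integral lborel (\<lambda>x. f (0 + inverse z * x)) (cov_coeff r s /\<^sub>R \<bar>inverse z\<bar>)"
    using z by (subst (asm) lborel_has_bochner_integral_real_affine_iff[of "inverse z" _ _ 0]) auto
  then have "has_bochner_integral lborel (\<lambda>x. complex_of_real z powr (- (r + cnj s)) * f (inverse z * x))
      (complex_of_real z powr (- (r + cnj s)) * (cov_coeff r s /\<^sub>R \<bar>inverse z\<bar>))"
    by (intro has_bochner_integral_mult_right) simp
  moreover have "complex_of_real z powr (- (r + cnj s)) * f (inverse z * x) =
      pos_powr (- r) x * cnj (pos_powr (- s) (x + z))" for x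
  proof -
    have "pos_powr (- r) x = complex_of_real z powr (- r) * pos_powr (- r) (inverse z * x)"
      using pos_powr_mult_left[OF z, of "- r" "inverse z * x"] z by (simp add: mult.assoc[symmetric])
    moreover have "pos_powr (- cnj s) (x + z) = complex_of_real z powr (- cnj s) * pos_powr (- cnj s) (1 + inverse z * x)"
    proof -
      have "x + z = z * (1 + inverse z * x)" using z by (simp add: field_simps)
      then show ?thesis using pos_powr_mult_left[OF z] by metis
    qed
    moreover have "complex_of_real z powr (- (r + cnj s)) = complex_of_real z powr (- r) * complex_of_real z powr (- cnj s)"
      by (simp add: powr_add[symmetric])
    ultimately show ?thesis by (simp add: f_def cnj_pos_powr mult_ac)
  qed
  moreover have "complex_of_real z powr (- (r + cnj s)) * (cov_coeff r s /\<^sub>R \<bar>inverse z\<bar>) =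
      complex_of_real z powr (1 - (r + cnj s)) * cov_coeff r s"
  proof -
    have "complex_of_real z powr (1 - (r + cnj s)) = z * complex_of_real z powr (- (r + cnj s))"
      unfolding diff_conv_add_uminus powr_add using z by simp
    then show ?thesis using z by (simp add: scaleR_conv_of_real)
  qed
  ultimately show ?thesis by (rule has_bochner_integral_eqI)
qed

text \<open>Only one of the two truncated powers in the value is nonzero, according to which of v
  and w is larger. The second case is the conjugate of the first, with r and s as well as v and w
  exchanged.\<close>

lemma has_bochner_integral_shifted_powr:
  assumes r: "Re r < 1" "Re s < 1" and rs: "1 < Re r + Re s" and vw: "v \<noteq> w"
  shows "has_bochner_integral lborel (\<lambda>\<tau>. pos_powr (- r) (\<tau> - v) * cnj (pos_powr (- s) (\<tau> - w)))
    (pos_powr (1 - (r + cnj s)) (v - w) * cov_coeff r s + pos_powr (1 - (r + cnj s)) (w - v) * cnj (cov_coeff s r))"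
proof -
  have main: "has_bochner_integral lborel (\<lambda>\<tau>. pos_powr (- r) (\<tau> - v) * cnj (pos_powr (- s) (\<tau> - w)))
    (pos_powr (1 - (r + cnj s)) (v - w) * cov_coeff r s)"
    if vw: "w < v" and r: "Re r < 1" and rs: "1 < Re r + Re s" for r s v w
  proof -
    have "has_bochner_integral lborel (\<lambda>x. pos_powr (- r) x * cnj (pos_powr (- s) (x + (v - w))))
      (complex_of_real (v - w) powr (1 - (r + cnj s)) * cov_coeff r s)"
      using vw by (intro has_bochner_integral_shifted_powr_pos r rs) simp
    then have "has_bochner_integral lborel (\<lambda>\<tau>. pos_powr (- r) (- v + 1 * \<tau>) * cnj (pos_powr (- s) ((- v + 1 * \<tau>) + (v - w))))
      (complex_of_real (v - w) powr (1 - (r + cnj s)) * cov_coeff r s /\<^sub>R \<bar>1\<bar>)"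
      by (subst (asm) lborel_has_bochner_integral_real_affine_iff[of 1 _ _ "- v"]) auto
    then show ?thesis using vw by (simp add: pos_powr_def algebra_simps)
  qed
  show ?thesis
  proof (cases "w < v")
    case True
    then show ?thesis using main[OF True r(1) rs] by (simp add: pos_powr_def)
  next
    case False
    then have lt: "v < w" using vw by simp
    have "has_bochner_integral lborel (\<lambda>\<tau>. cnj (pos_powr (- s) (\<tau> - w) * cnj (pos_powr (- r) (\<tau> - v))))
      (cnj (pos_powr (1 - (s + cnj r)) (w - v) * cov_coeff s r))"
      by (intro has_bochner_integral_cnj main lt r) (use rs in simp)
    then show ?thesis using lt by (simp add: cnj_pos_powr mult.commute add.commute) (simp add: pos_powr_def)
  qed
qed

text \<open>For a = 0 the primitive need not be differentiable at the left endpoint, hence the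
  interior form of the fundamental theorem; absolute integrability comes from the real exponent Re
  z.\<close>

lemma has_bochner_integral_powr_interval:
  assumes z: "Re z > -1" and ab: "0 \<le> a" "a \<le> b"
  shows "has_bochner_integral lborel (\<lambda>y. indicator {a..b} y * pos_powr z y)
    ((complex_of_real b powr (z + 1) - complex_of_real a powr (z + 1)) / (z + 1))"
proof -
  have z1: "z + 1 \<noteq> 0" using z by (auto simp: complex_eq_iff)
  have hi: "((\<lambda>y. complex_of_real y powr z) has_integral
      (complex_of_real b powr (z + 1) / (z + 1) - complex_of_real a powr (z + 1) / (z + 1))) {a..b}"
    using z1 z ab
    by (intro fundamental_theorem_of_calculus_interior)
      (auto intro!: continuous_intros derivative_eq_intros has_vector_derivative_real_field)
  have hr: "(\<lambda>y. y powr Re z) integrable_on {a..b}"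
    by (rule integrable_on_subinterval[OF integrable_on_powr_from_0[of "Re z" b]]) (use z ab in auto)
  have "(\<lambda>y. complex_of_real y powr z) absolutely_integrable_on {a..b}"
    by (rule absolutely_integrable_integrable_bound[OF _ _ hr]) (use hi ab in \<open>auto simp: norm_of_real_powr\<close>)
  then have si: "set_integrable lebesgue {a..b} (\<lambda>y. complex_of_real y powr z)" .
  define f where "f y = indicator {a..b} y * pos_powr z y" for y
  have [measurable]: "f \<in> borel_measurable borel" unfolding f_def by measurable
  define g where "g y = indicat_real {a..b} y *\<^sub>R complex_of_real y powr z" for y
  have fg: "f y = g y" for y
    using ab by (auto simp: f_def g_def indicator_def pos_powr_def)
  then have "f = g" by (rule ext)
  have "integrable lebesgue f" using si unfolding set_integrable_def \<open>f = g\<close> g_def .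
  then have i: "integrable lborel f" by (simp add: integrable_completion)
  have "integral\<^sup>L lebesgue f = (complex_of_real b powr (z + 1) / (z + 1) - complex_of_real a powr (z + 1) / (z + 1))"
    using set_lebesgue_integral_eq_integral(2)[OF si] integral_unique[OF hi]
    unfolding set_lebesgue_integral_def \<open>f = g\<close> g_def by simp
  then have "integral\<^sup>L lborel f = (complex_of_real b powr (z + 1) / (z + 1) - complex_of_real a powr (z + 1) / (z + 1))"
    by (simp add: integral_completion)
  then show ?thesis using i by (simp add: has_bochner_integral_iff f_def[abs_def] diff_divide_distrib)
qed

lemma has_bochner_integral_limit_kernel:
  assumes d: "Re d < 1"
  shows "has_bochner_integral lborel (\<lambda>v. indicator {0..1} v * pos_powr (- d) (\<tau> - v)) (limit_kernel \<tau> d)"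
proof (cases "\<tau> \<ge> 0")
  case True
  have "has_bochner_integral lborel (\<lambda>y. indicator {max 0 (\<tau> - 1)..\<tau>} y * pos_powr (- d) y)
    ((complex_of_real \<tau> powr (- d + 1) - complex_of_real (max 0 (\<tau> - 1)) powr (- d + 1)) / (- d + 1))"
    using d True by (intro has_bochner_integral_powr_interval) auto
  then have "has_bochner_integral lborel (\<lambda>v. indicator {max 0 (\<tau> - 1)..\<tau>} (\<tau> + (- 1) * v) * pos_powr (- d) (\<tau> + (- 1) * v))
    (((complex_of_real \<tau> powr (- d + 1) - complex_of_real (max 0 (\<tau> - 1)) powr (- d + 1)) / (- d + 1)) /\<^sub>R \<bar>- 1\<bar>)"
    by (subst (asm) lborel_has_bochner_integral_real_affine_iff[of "- 1" _ _ \<tau>]) auto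
  moreover have "indicator {max 0 (\<tau> - 1)..\<tau>} (\<tau> + (- 1) * v) * pos_powr (- d) (\<tau> + (- 1) * v) =
      indicator {0..1} v * pos_powr (- d) (\<tau> - v)" for v
    by (auto simp: indicator_def pos_powr_def)
  moreover have "((complex_of_real \<tau> powr (- d + 1) - complex_of_real (max 0 (\<tau> - 1)) powr (- d + 1)) / (- d + 1)) /\<^sub>R \<bar>- 1\<bar>
      = limit_kernel \<tau> d"
    using True by (simp add: limit_kernel_def diff_divide_distrib add.commute)
  ultimately show ?thesis by (rule has_bochner_integral_eqI)
next
  case False
  then have "(\<lambda>v. indicator {0..1} v * pos_powr (- d) (\<tau> - v)) = (\<lambda>v. 0)"
    by (auto simp: fun_eq_iff indicator_def pos_powr_def)
  then show ?thesis using False by (simp add: limit_kernel_def has_bochner_integral_zero)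
qed

text \<open>The integral over w is again a limit kernel, with exponent D - 1, and for v \<le> 1 its
  subtracted power vanishes. The iterated formulas are proved for a free E because absolute
  integrability needs them at the real part of D as well.\<close>

lemma has_bochner_integral_unit_square:
  assumes D: "1 < Re D" "Re D < 2"
  shows "has_bochner_integral (lborel \<Otimes>\<^sub>M lborel)
    (\<lambda>(v, w). indicator {0..1} v * indicator {0..1} w * pos_powr (1 - D) (v - w)) (1 / ((2 - D) * (3 - D)))"
proof -
  have inner: "has_bochner_integral lborel (\<lambda>w. indicator {0..1} v * indicator {0..1} w * pos_powr (1 - E) (v - w))
    (indicator {0..1} v * (pos_powr (2 - E) v / (2 - E)))" if E: "1 < Re E" "Re E < 2" for v E
  proof -
    have "has_bochner_integral lborel (\<lambda>w. indicator {0..1} w * pos_powr (- (E - 1)) (v - w)) (limit_kernel v (E - 1))"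
      by (rule has_bochner_integral_limit_kernel) (use E in simp)
    then have "has_bochner_integral lborel (\<lambda>w. indicator {0..1} v * (indicator {0..1} w * pos_powr (- (E - 1)) (v - w)))
      (indicator {0..1} v * limit_kernel v (E - 1))"
      by (rule has_bochner_integral_mult_right)
    moreover have "indicator {0..1} v * (indicator {0..1} w * pos_powr (- (E - 1)) (v - w)) =
        indicator {0..1} v * indicator {0..1} w * pos_powr (1 - E) (v - w)" for w
      by (simp add: mult.assoc)
    moreover have "indicator {0..1} v * limit_kernel v (E - 1) = indicator {0..1} v * (pos_powr (2 - E) v / (2 - E))"
      by (auto simp: indicator_def limit_kernel_def pos_powr_def max_def)
    ultimately show ?thesis by (rule has_bochner_integral_eqI)
  qed
  have outer: "has_bochner_integral lborel (\<lambda>v. indicator {0..1} v * (pos_powr (2 - E) v / (2 - E))) (1 / ((2 - E) * (3 - E)))"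
    if E: "1 < Re E" "Re E < 2" for E
  proof -
    have "has_bochner_integral lborel (\<lambda>y. indicator {0..1} y * pos_powr (2 - E) y)
      ((complex_of_real 1 powr (2 - E + 1) - complex_of_real 0 powr (2 - E + 1)) / (2 - E + 1))"
      using E by (intro has_bochner_integral_powr_interval) auto
    then have "has_bochner_integral lborel (\<lambda>y. (indicator {0..1} y * pos_powr (2 - E) y) / (2 - E))
      (((complex_of_real 1 powr (2 - E + 1) - complex_of_real 0 powr (2 - E + 1)) / (2 - E + 1)) / (2 - E))"
      by (rule has_bochner_integral_divide)
    moreover have "(indicator {0..1} y * pos_powr (2 - E) y) / (2 - E) = indicator {0..1} y * (pos_powr (2 - E) y / (2 - E))" for y
      by simp
    moreover have "((complex_of_real 1 powr (2 - E + 1) - complex_of_real 0 powr (2 - E + 1)) / (2 - E + 1)) / (2 - E) =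
        1 / ((2 - E) * (3 - E))"
      by (simp add: mult.commute)
    ultimately show ?thesis by (rule has_bochner_integral_eqI)
  qed
  define F where "F E = (\<lambda>(v, w). indicator {0..1} v * indicator {0..1} w * pos_powr (1 - E) (v - w))" for E
  have [measurable]: "F E \<in> borel_measurable (lborel \<Otimes>\<^sub>M lborel)" for E
    unfolding F_def by measurable
  have int: "integrable (lborel \<Otimes>\<^sub>M lborel) (F D)"
  proof (rule lborel_pair.Fubini_integrable)
    show "F D \<in> borel_measurable (lborel \<Otimes>\<^sub>M lborel)" by measurable
    show "AE v in lborel. integrable lborel (\<lambda>w. F D (v, w))"
      using inner[OF D] by (auto simp: F_def has_bochner_integral_iff)
    have D': "1 < Re (complex_of_real (Re D))" "Re (complex_of_real (Re D)) < 2" using D by auto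
    have n: "norm (F D (v, w)) = Re (F (complex_of_real (Re D)) (v, w))" for v w
    proof -
      have "complex_of_real (norm (pos_powr (1 - D) (v - w))) = pos_powr (1 - complex_of_real (Re D)) (v - w)"
        unfolding norm_pos_powr by simp
      then have "norm (pos_powr (1 - D) (v - w)) = Re (pos_powr (1 - complex_of_real (Re D)) (v - w))"
        by (metis Re_complex_of_real)
      then show ?thesis by (auto simp: F_def indicator_def)
    qed
    have "has_bochner_integral lborel (\<lambda>w. norm (F D (v, w)))
      (Re (indicator {0..1} v * (pos_powr (2 - complex_of_real (Re D)) v / (2 - complex_of_real (Re D)))))" for v
      unfolding n using has_bochner_integral_bounded_linear[OF bounded_linear_Re inner[OF D']] by (simp add: F_def)
    then have "(\<lambda>v. \<integral>w. norm (F D (v, w)) \<partial>lborel) =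
      (\<lambda>v. Re (indicator {0..1} v * (pos_powr (2 - complex_of_real (Re D)) v / (2 - complex_of_real (Re D)))))"
      by (auto simp: has_bochner_integral_iff fun_eq_iff)
    then show "integrable lborel (\<lambda>v. \<integral>w. norm (F D (v, w)) \<partial>lborel)"
      using has_bochner_integral_bounded_linear[OF bounded_linear_Re outer[OF D']]
      by (simp only: has_bochner_integral_iff)
  qed
  have "integral\<^sup>L (lborel \<Otimes>\<^sub>M lborel) (F D) = (\<integral>v. (\<integral>w. F D (v, w) \<partial>lborel) \<partial>lborel)"
    by (rule lborel_pair.integral_fst'[OF int, symmetric])
  also have "\<dots> = (\<integral>v. indicator {0..1} v * (pos_powr (2 - D) v / (2 - D)) \<partial>lborel)"
    using inner[OF D] by (simp add: F_def has_bochner_integral_iff)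
  also have "\<dots> = 1 / ((2 - D) * (3 - D))"
    using outer[OF D] by (simp only: has_bochner_integral_iff)
  finally show ?thesis using int by (simp add: has_bochner_integral_iff F_def)
qed

text \<open>The limit kernel is an average of shifted powers; exchanging the integrals reduces its covariance
  to a Beta integral in the time variable and a power integral over the unit square.\<close>

lemma has_bochner_integral_limit_kernel_covariance:
  assumes r: "1/2 < Re r" "Re r < 1" and s: "1/2 < Re s" "Re s < 1"
  shows "has_bochner_integral lborel (\<lambda>\<tau>. limit_kernel \<tau> r * cnj (limit_kernel \<tau> s))
    ((cov_coeff r s + cnj (cov_coeff s r)) / ((2 - (r + cnj s)) * (3 - (r + cnj s))))"
proof -
  interpret Q: pair_sigma_finite "lborel \<Otimes>\<^sub>M lborel :: (real \<times> real) measure" "lborel :: real measure" ..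
  define h where "h r s = (\<lambda>q :: (real \<times> real) \<times> real. (indicator {0..1} (fst (fst q)) * pos_powr (- r) (snd q - fst (fst q))) *
    cnj (indicator {0..1} (snd (fst q)) * pos_powr (- s) (snd q - snd (fst q))))" for r s
  have [measurable]: "h r s \<in> borel_measurable ((lborel \<Otimes>\<^sub>M lborel) \<Otimes>\<^sub>M lborel)" for r s
    unfolding h_def by measurable
  define j where "j r s = (\<lambda>(v :: real, w :: real). indicator {0..1} v * indicator {0..1} w * pos_powr (1 - (r + cnj s)) (v - w) * cov_coeff r s +
    indicator {0..1} v * indicator {0..1} w * pos_powr (1 - (r + cnj s)) (w - v) * cnj (cov_coeff s r))" for r s
  \<comment> \<open>On the diagonal the two singularities coincide and the time integral diverges,
    as the real parts of r and s add up to more than 1; it is a null set for the outer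
    integral.\<close>
  have ne: "AE p in lborel \<Otimes>\<^sub>M lborel. fst p \<noteq> (snd p :: real)"
  proof (rule lborel_pair.AE_pair_measure)
    show "{x \<in> space (lborel \<Otimes>\<^sub>M lborel). fst x \<noteq> (snd x :: real)} \<in> sets (lborel \<Otimes>\<^sub>M lborel)" by measurable
    show "AE x in lborel. AE y in lborel. fst (x, y) \<noteq> (snd (x, y) :: real)"
    proof (rule AE_I2)
      fix x :: real
      show "AE y in lborel. fst (x, y) \<noteq> snd (x, y)" using AE_lborel_singleton[of x] by eventually_elim auto
    qed
  qed
  have hj: "has_bochner_integral lborel (\<lambda>\<tau>. h r s (p, \<tau>)) (j r s p)"
    if "fst p \<noteq> snd p" "1/2 < Re r" "Re r < 1" "1/2 < Re s" "Re s < 1" for r s p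
  proof -
    obtain v w where p: "p = (v, w)" by (cases p)
    have "has_bochner_integral lborel (\<lambda>\<tau>. (indicator {0..1} v * indicator {0..1} w) * (pos_powr (- r) (\<tau> - v) * cnj (pos_powr (- s) (\<tau> - w))))
      ((indicator {0..1} v * indicator {0..1} w) * (pos_powr (1 - (r + cnj s)) (v - w) * cov_coeff r s + pos_powr (1 - (r + cnj s)) (w - v) * cnj (cov_coeff s r)))"
      using that unfolding p by (intro has_bochner_integral_mult_right has_bochner_integral_shifted_powr) auto
    moreover have "cnj (indicator {0..1} w) = indicator {0..1} w" by (simp add: indicator_def)
    ultimately show ?thesis unfolding p h_def j_def by (simp add: algebra_simps)
  qed
  have jint: "has_bochner_integral (lborel \<Otimes>\<^sub>M lborel) (j r s)
      ((cov_coeff r s + cnj (cov_coeff s r)) / ((2 - (r + cnj s)) * (3 - (r + cnj s))))"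
    if "1/2 < Re r" "Re r < 1" "1/2 < Re s" "Re s < 1" for r s
  proof -
    let ?D = "r + cnj s"
    let ?g = "\<lambda>(v :: real, w :: real). indicator {0..1} v * indicator {0..1} w * pos_powr (1 - ?D) (v - w)"
    have g: "has_bochner_integral (lborel \<Otimes>\<^sub>M lborel) ?g (1 / ((2 - ?D) * (3 - ?D)))"
      by (rule has_bochner_integral_unit_square) (use that in auto)
    \<comment> \<open>Reflecting the unit square gives the term in w - v the same integral, so both
      Beta coefficients get the same denominator.\<close>
    have gs: "has_bochner_integral (lborel \<Otimes>\<^sub>M lborel) (\<lambda>(w, v). ?g (v, w)) (1 / ((2 - ?D) * (3 - ?D)))"
      using g lborel_pair.integrable_product_swap[of ?g] lborel_pair.integral_product_swap[of ?g] by (simp add: has_bochner_integral_iff)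
    have "has_bochner_integral (lborel \<Otimes>\<^sub>M lborel) (\<lambda>p. ?g p * cov_coeff r s + (\<lambda>(w, v). ?g (v, w)) p * cnj (cov_coeff s r))
      ((1 / ((2 - ?D) * (3 - ?D))) * cov_coeff r s + (1 / ((2 - ?D) * (3 - ?D))) * cnj (cov_coeff s r))"
      by (intro has_bochner_integral_add has_bochner_integral_mult_left g gs)
    moreover have "(\<lambda>p. ?g p * cov_coeff r s + (\<lambda>(w, v). ?g (v, w)) p * cnj (cov_coeff s r)) = j r s"
      by (auto simp: j_def fun_eq_iff mult_ac)
    moreover have "(1 / ((2 - ?D) * (3 - ?D))) * cov_coeff r s + (1 / ((2 - ?D) * (3 - ?D))) * cnj (cov_coeff s r) =
        (cov_coeff r s + cnj (cov_coeff s r)) / ((2 - ?D) * (3 - ?D))"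
      by (simp add: add_divide_distrib)
    ultimately show ?thesis by simp
  qed
  have int: "integrable ((lborel \<Otimes>\<^sub>M lborel) \<Otimes>\<^sub>M lborel) (h r s)"
  proof (rule Q.Fubini_integrable)
    show "h r s \<in> borel_measurable ((lborel \<Otimes>\<^sub>M lborel) \<Otimes>\<^sub>M lborel)" by measurable
    show "AE p in lborel \<Otimes>\<^sub>M lborel. integrable lborel (\<lambda>\<tau>. h r s (p, \<tau>))"
      using ne by eventually_elim (use hj r s in \<open>auto simp: has_bochner_integral_iff\<close>)
    \<comment> \<open>The modulus of the integrand is the integrand for real exponents, so the
      formulas themselves yield absolute integrability.\<close>
    let ?r = "complex_of_real (Re r)" and ?s = "complex_of_real (Re s)"
    have n: "norm (h r s (p, \<tau>)) = Re (h ?r ?s (p, \<tau>))" for p \<tau>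
    proof -
      obtain v w where p: "p = (v, w)" by (cases p)
      have e: "pos_powr (- complex_of_real (Re z)) x = complex_of_real (norm (pos_powr (- z) x))" for z x
        unfolding norm_pos_powr by simp
      show ?thesis
        unfolding p h_def by (simp add: e norm_mult indicator_def)
    qed
    have "AE p in lborel \<Otimes>\<^sub>M lborel. (\<integral>\<tau>. norm (h r s (p, \<tau>)) \<partial>lborel) = Re (j ?r ?s p)"
      using ne
    proof eventually_elim
      case (elim p)
      have "has_bochner_integral lborel (\<lambda>\<tau>. Re (h ?r ?s (p, \<tau>))) (Re (j ?r ?s p))"
        by (rule has_bochner_integral_bounded_linear[OF bounded_linear_Re hj[OF elim]]) (use r s in auto)
      then show ?case unfolding n by (simp add: has_bochner_integral_iff)
    qed
    moreover have "integrable (lborel \<Otimes>\<^sub>M lborel) (\<lambda>p. Re (j ?r ?s p))"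
      using has_bochner_integral_bounded_linear[OF bounded_linear_Re jint[of ?r ?s]] r s
      by (simp add: has_bochner_integral_iff)
    moreover have "(\<lambda>p. \<integral>\<tau>. norm (h r s (p, \<tau>)) \<partial>lborel) \<in> borel_measurable (lborel \<Otimes>\<^sub>M lborel)"
      by measurable
    ultimately show "integrable (lborel \<Otimes>\<^sub>M lborel) (\<lambda>p. \<integral>\<tau>. norm (h r s (p, \<tau>)) \<partial>lborel)"
      by (subst integrable_cong_AE[where g = "\<lambda>p. Re (j ?r ?s p)"]) auto
  qed
  then have int': "integrable ((lborel \<Otimes>\<^sub>M lborel) \<Otimes>\<^sub>M lborel) (\<lambda>(p, \<tau>). h r s (p, \<tau>))" by simp
  have inner: "(\<integral>p. h r s (p, \<tau>) \<partial>(lborel \<Otimes>\<^sub>M lborel)) = limit_kernel \<tau> r * cnj (limit_kernel \<tau> s)" for \<tau>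
  proof -
    have a: "has_bochner_integral lborel (\<lambda>v. indicator {0..1} v * pos_powr (- r) (\<tau> - v)) (limit_kernel \<tau> r)"
      by (rule has_bochner_integral_limit_kernel) (use r in simp)
    have b: "has_bochner_integral lborel (\<lambda>w. cnj (indicator {0..1} w * pos_powr (- s) (\<tau> - w))) (cnj (limit_kernel \<tau> s))"
      by (rule has_bochner_integral_cnj[OF has_bochner_integral_limit_kernel]) (use s in simp)
    have "integrable (lborel \<Otimes>\<^sub>M lborel) (\<lambda>p. h r s (p, \<tau>))"
    proof (rule lborel_pair.Fubini_integrable)
      show "(\<lambda>p. h r s (p, \<tau>)) \<in> borel_measurable (lborel \<Otimes>\<^sub>M lborel)" by measurable
      show "AE v in lborel. integrable lborel (\<lambda>w. h r s ((v, w), \<tau>))"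
        unfolding h_def using b by (auto simp: has_bochner_integral_iff)
      have "(\<lambda>v. \<integral>w. norm (h r s ((v, w), \<tau>)) \<partial>lborel) =
        (\<lambda>v. norm (indicator {0..1} v * pos_powr (- r) (\<tau> - v)) * (\<integral>w. norm (cnj (indicator {0..1} w * pos_powr (- s) (\<tau> - w))) \<partial>lborel))"
        unfolding h_def by (simp add: norm_mult)
      then show "integrable lborel (\<lambda>v. \<integral>w. norm (h r s ((v, w), \<tau>)) \<partial>lborel)"
        using a by (simp only: has_bochner_integral_iff) (intro integrable_mult_left integrable_norm, simp)
    qed
    from lborel_pair.integral_fst'[OF this]
    have "(\<integral>p. h r s (p, \<tau>) \<partial>(lborel \<Otimes>\<^sub>M lborel)) = (\<integral>v. \<integral>w. h r s ((v, w), \<tau>) \<partial>lborel \<partial>lborel)" by simp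
    also have "\<dots> = (\<integral>v. (indicator {0..1} v * pos_powr (- r) (\<tau> - v)) * cnj (limit_kernel \<tau> s) \<partial>lborel)"
      unfolding h_def using b by (simp only: fst_conv snd_conv integral_mult_right_zero has_bochner_integral_iff)
    also have "\<dots> = limit_kernel \<tau> r * cnj (limit_kernel \<tau> s)"
      using a by (simp only: integral_mult_left_zero has_bochner_integral_iff)
    finally show ?thesis .
  qed
  have "(\<integral>\<tau>. limit_kernel \<tau> r * cnj (limit_kernel \<tau> s) \<partial>lborel) = (\<integral>p. \<integral>\<tau>. h r s (p, \<tau>) \<partial>lborel \<partial>(lborel \<Otimes>\<^sub>M lborel))"
    using Q.Fubini_integral[OF int'] unfolding inner .
  also have "\<dots> = integral\<^sup>L (lborel \<Otimes>\<^sub>M lborel) (j r s)"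
  proof (rule integral_cong_AE)
    show "AE p in lborel \<Otimes>\<^sub>M lborel. (\<integral>\<tau>. h r s (p, \<tau>) \<partial>lborel) = j r s p"
      using ne by eventually_elim (use hj r s in \<open>auto simp: has_bochner_integral_iff\<close>)
    show "(\<lambda>p. \<integral>\<tau>. h r s (p, \<tau>) \<partial>lborel) \<in> borel_measurable (lborel \<Otimes>\<^sub>M lborel)" by measurable
    show "j r s \<in> borel_measurable (lborel \<Otimes>\<^sub>M lborel)" unfolding j_def by measurable
  qed
  finally show ?thesis
    using Q.integrable_snd[OF int'] jint[OF r s] unfolding inner by (simp add: has_bochner_integral_iff)
qed

section \<open>Operator powers in a unitary representation\<close>

lemma scaleC_zero_left: "0 *\<^sub>C x = 0" for x :: "'a::complex_hilbert"
  using scaleC_of_real[of 0 x] by simp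

lemma scaleC_minus_one: "(- 1) *\<^sub>C x = - x" for x :: "'a::complex_hilbert"
  using scaleC_of_real[of "- 1" x] by simp

lemma cinner_scaleC_right: "cinner x (c *\<^sub>C y) = cnj c * cinner x y"
  by (metis cinner_commute cinner_scaleC_left complex_cnj_mult)

text \<open>Carries continuity and moment computations from the real inner product over to the
  complex one.\<close>

lemma cinner_conv_inner: "cinner x y = complex_of_real (inner x y) + \<i> * complex_of_real (inner x (\<i> *\<^sub>C y))"
proof (rule complex_eqI)
  have "inner x (\<i> *\<^sub>C y) = Re (cnj \<i> * cinner x y)"
    unfolding Re_cinner[symmetric] cinner_scaleC_right ..
  also have "\<dots> = Im (cinner x y)" by simp
  finally show "Im (cinner x y) = Im (complex_of_real (inner x y) + \<i> * complex_of_real (inner x (\<i> *\<^sub>C y)))"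
    by simp
qed (simp add: Re_cinner)

lemma bounded_linear_cinner_left: "bounded_linear (\<lambda>x. cinner x y)"
  unfolding cinner_conv_inner[abs_def]
  by (intro bounded_linear_add bounded_linear_const_mult bounded_linear_compose[OF bounded_linear_of_real]
    bounded_linear_inner_left)

lemma cinner_diff_left: "cinner (x - y) z = cinner x z - cinner y z"
  using bounded_linear.linear[OF bounded_linear_cinner_left] by (rule linear_diff)

lemma cinner_ext:
  assumes "\<And>z. cinner x z = cinner y z"
  shows "x = y"
proof -
  have "cinner (x - y) (x - y) = 0"
    using assms by (simp add: cinner_diff_left)
  then show ?thesis by (simp add: cinner_self)
qed

lemma cinner_ext_right:
  assumes "\<And>z. cinner z x = cinner z y"
  shows "x = y"
  by (rule cinner_ext) (metis assms cinner_commute)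

text \<open>Multiplying x by a unimodular number makes the complex product real and nonnegative
  without changing the norm; then the real inequality applies.\<close>

lemma norm_cinner_le: "cmod (cinner x y) \<le> norm x * norm y"
proof (cases "cinner x y = 0")
  case False
  define c where "c = cnj (sgn (cinner x y))"
  have c: "cmod c = 1" using False by (simp add: c_def norm_sgn)
  have "complex_of_real (cmod (cinner x y)) = cinner (c *\<^sub>C x) y"
  proof -
    have "c * cinner x y = (cinner x y * cnj (cinner x y)) / cmod (cinner x y)"
      by (simp add: c_def sgn_eq mult.commute)
    also have "\<dots> = complex_of_real ((cmod (cinner x y))\<^sup>2) / cmod (cinner x y)"
      by (simp only: complex_norm_square)
    also have "\<dots> = cmod (cinner x y)" using False by (simp add: power2_eq_square)
    finally show ?thesis by (simp add: cinner_scaleC_left)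
  qed
  then have "cmod (cinner x y) = inner (c *\<^sub>C x) y"
    by (metis Re_cinner Re_complex_of_real)
  also have "\<dots> \<le> norm (c *\<^sub>C x) * norm y" by (rule norm_cauchy_schwarz)
  also have "norm (c *\<^sub>C x) = norm x"
  proof -
    have "cinner (c *\<^sub>C x) (c *\<^sub>C x) = c * cnj c * cinner x x"
      by (simp add: cinner_scaleC_left cinner_scaleC_right)
    also have "c * cnj c = 1" using c by (simp add: complex_norm_square[symmetric])
    finally have "(norm (c *\<^sub>C x))\<^sup>2 = (norm x)\<^sup>2" by (simp only: cinner_self mult_1_left of_real_eq_iff)
    then show ?thesis by simp
  qed
  finally show ?thesis .
qed simp

lemma L2_product_integrable:
  assumes "f \<in> L2 \<mu>" "g \<in> L2 \<mu>"
  shows "integrable \<mu> (\<lambda>s. f s * g s)" "integrable \<mu> (\<lambda>s. f s * cnj (g s))" "integrable \<mu> (\<lambda>s. cmod (f s) * cmod (g s))"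
proof -
  have [measurable]: "f \<in> borel_measurable \<mu>" "g \<in> borel_measurable \<mu>"
    and i: "integrable \<mu> (\<lambda>s. (cmod (f s))\<^sup>2)" "integrable \<mu> (\<lambda>s. (cmod (g s))\<^sup>2)"
    using assms by (auto simp: L2_def)
  have i2: "integrable \<mu> (\<lambda>s. (cmod (f s))\<^sup>2 + (cmod (g s))\<^sup>2)" using i by simp
  have le: "cmod a * cmod b \<le> (cmod a)\<^sup>2 + (cmod b)\<^sup>2" for a b
  proof -
    have "0 \<le> cmod a * cmod b" by simp
    then show ?thesis using sum_squares_bound[of "cmod a" "cmod b"] by linarith
  qed
  show "integrable \<mu> (\<lambda>s. cmod (f s) * cmod (g s))"
    by (rule Bochner_Integration.integrable_bound[OF i2]) (use le in \<open>auto simp: abs_mult\<close>)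
  show "integrable \<mu> (\<lambda>s. f s * g s)"
    by (rule Bochner_Integration.integrable_bound[OF i2]) (use le in \<open>auto simp: norm_mult\<close>)
  show "integrable \<mu> (\<lambda>s. f s * cnj (g s))"
    by (rule Bochner_Integration.integrable_bound[OF i2]) (use le in \<open>auto simp: norm_mult\<close>)
qed

locale unitary_rep =
  fixes \<mu> :: "'s measure" and U :: "'h::{complex_hilbert, second_countable_topology} \<Rightarrow> 's \<Rightarrow> complex"
  assumes unitary: "unitary_L2 \<mu> U"
begin

lemma U_L2: "U x \<in> L2 \<mu>"
  using unitary by (simp add: unitary_L2_def)

lemma U_measurable[measurable]: "U x \<in> borel_measurable \<mu>"
  using U_L2[of x] by (simp add: L2_def)

lemma U_square_integrable: "integrable \<mu> (\<lambda>s. (cmod (U x s))\<^sup>2)"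
  using U_L2[of x] by (simp add: L2_def)

lemma U_add: "AE s in \<mu>. U (x + y) s = U x s + U y s"
  using unitary by (simp add: unitary_L2_def)

lemma U_scaleC: "AE s in \<mu>. U (c *\<^sub>C x) s = c * U x s"
  using unitary by (simp add: unitary_L2_def)

lemma U_scaleR: "AE s in \<mu>. U (r *\<^sub>R x) s = complex_of_real r * U x s"
  using U_scaleC[of "complex_of_real r" x] by (simp add: scaleC_of_real)

lemma U_inner: "L2_inner \<mu> (U x) (U y) = cinner x y"
  using unitary by (simp add: unitary_L2_def)

lemma U_surj: "f \<in> L2 \<mu> \<Longrightarrow> \<exists>x. AE s in \<mu>. U x s = f s"
  using unitary by (simp add: unitary_L2_def)

lemma U_zero: "AE s in \<mu>. U 0 s = 0"
  using U_scaleC[of 0 0] by (simp add: scaleC_zero_left)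

lemma L2_inner_cong_AE:
  assumes "AE s in \<mu>. f s = g s" and [measurable]: "f \<in> borel_measurable \<mu>" "g \<in> borel_measurable \<mu>" "h \<in> borel_measurable \<mu>"
  shows "L2_inner \<mu> f h = L2_inner \<mu> g h" "L2_inner \<mu> h f = L2_inner \<mu> h g"
  unfolding L2_inner_def by (rule integral_cong_AE; use assms(1) in \<open>auto elim: eventually_mono\<close>)+

lemma U_cong_AE: "AE s in \<mu>. U x s = U y s \<Longrightarrow> x = y"
proof (rule cinner_ext)
  fix z assume "AE s in \<mu>. U x s = U y s"
  then have "L2_inner \<mu> (U x) (U z) = L2_inner \<mu> (U y) (U z)"
    by (rule L2_inner_cong_AE) measurable
  then show "cinner x z = cinner y z" by (simp add: U_inner)
qed

text \<open>Surjectivity of U allows any L2 function to be replaced by a vector of the Hilbert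
  space, where pairings and norms can be computed.\<close>

lemma L2_represent:
  assumes f: "f \<in> L2 \<mu>"
  obtains z where "AE s in \<mu>. U z s = f s" "\<And>x. L2_inner \<mu> f (U x) = cinner z x"
    "(\<integral>s. (cmod (f s))\<^sup>2 \<partial>\<mu>) = (norm z)\<^sup>2"
proof -
  have [measurable]: "f \<in> borel_measurable \<mu>" using f by (simp add: L2_def)
  obtain z where z: "AE s in \<mu>. U z s = f s" using U_surj[OF f] by blast
  have "L2_inner \<mu> f (U x) = cinner z x" for x
    using L2_inner_cong_AE(1)[OF z, of "U x"] by (simp add: U_inner)
  moreover have "complex_of_real (\<integral>s. (cmod (f s))\<^sup>2 \<partial>\<mu>) = complex_of_real ((norm z)\<^sup>2)"
  proof -
    have "complex_of_real (\<integral>s. (cmod (f s))\<^sup>2 \<partial>\<mu>) = L2_inner \<mu> f f"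
      unfolding L2_inner_def by (simp add: complex_norm_square[symmetric] flip: integral_complex_of_real)
    also have "\<dots> = L2_inner \<mu> (U z) (U z)"
      using L2_inner_cong_AE(1)[OF z, of f] L2_inner_cong_AE(2)[OF z, of "U z"] by simp
    finally show ?thesis by (simp add: U_inner cinner_self)
  qed
  ultimately show ?thesis using z that by (simp only: of_real_eq_iff)
qed

lemma U_eqI:
  assumes f: "f \<in> L2 \<mu>" and eq: "\<And>y. L2_inner \<mu> f (U y) = cinner x y"
  shows "AE s in \<mu>. U x s = f s"
proof -
  obtain z where z: "AE s in \<mu>. U z s = f s" "\<And>x. L2_inner \<mu> f (U x) = cinner z x"
    by (rule L2_represent[OF f]) blast
  have "x = z" by (rule cinner_ext) (use eq z(2) in simp)
  then show ?thesis using z(1) by simp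
qed

text \<open>The moduli of f and g are again in L2, hence represented by vectors whose inner product
  is the integral on the left.\<close>

lemma L2_cauchy_schwarz:
  assumes "f \<in> L2 \<mu>" "g \<in> L2 \<mu>"
  shows "(\<integral>s. cmod (f s) * cmod (g s) \<partial>\<mu>)\<^sup>2 \<le> (\<integral>s. (cmod (f s))\<^sup>2 \<partial>\<mu>) * (\<integral>s. (cmod (g s))\<^sup>2 \<partial>\<mu>)"
proof -
  define f' where "f' s = complex_of_real (cmod (f s))" for s
  define g' where "g' s = complex_of_real (cmod (g s))" for s
  have L: "f' \<in> L2 \<mu>" "g' \<in> L2 \<mu>" using assms by (auto simp: L2_def f'_def[abs_def] g'_def[abs_def])
  obtain z where z: "\<And>x. L2_inner \<mu> f' (U x) = cinner z x" "(\<integral>s. (cmod (f' s))\<^sup>2 \<partial>\<mu>) = (norm z)\<^sup>2"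
    by (rule L2_represent[OF L(1)]) blast
  obtain w where w: "AE s in \<mu>. U w s = g' s" "(\<integral>s. (cmod (g' s))\<^sup>2 \<partial>\<mu>) = (norm w)\<^sup>2"
    by (rule L2_represent[OF L(2)]) blast
  have "complex_of_real (\<integral>s. cmod (f s) * cmod (g s) \<partial>\<mu>) = L2_inner \<mu> f' g'"
    unfolding L2_inner_def f'_def g'_def by (simp flip: of_real_mult)
  also have "\<dots> = cinner z w"
    using L2_inner_cong_AE(2)[OF w(1), of f'] L z(1) by (simp add: L2_def)
  finally have "(cmod (complex_of_real (\<integral>s. cmod (f s) * cmod (g s) \<partial>\<mu>)))\<^sup>2 \<le> (norm z * norm w)\<^sup>2"
    by (simp only:) (intro power_mono norm_cinner_le norm_ge_zero)
  also have "(norm z * norm w)\<^sup>2 = (\<integral>s. (cmod (f s))\<^sup>2 \<partial>\<mu>) * (\<integral>s. (cmod (g s))\<^sup>2 \<partial>\<mu>)"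
    unfolding power_mult_distrib z(2)[symmetric] w(2)[symmetric] by (simp add: f'_def g'_def)
  finally show ?thesis by simp
qed

lemma L2_adjoint_eqI:
  assumes "\<And>y. L2_inner \<mu> (U y) f = cinner y x"
  shows "L2_adjoint \<mu> U f = x"
  unfolding L2_adjoint_def
proof (rule the_equality)
  show "\<forall>y. L2_inner \<mu> (U y) f = cinner y x" using assms by blast
  fix z assume "\<forall>y. L2_inner \<mu> (U y) f = cinner y z"
  then show "z = x" using assms by - (rule cinner_ext_right, simp)
qed

lemma L2_adjoint_U: "L2_adjoint \<mu> U (U x) = x"
  by (rule L2_adjoint_eqI) (rule U_inner)

text \<open>A relation rather than an equation with the adjoint of U: the exceptional null set may
  depend on x, because U only chooses representatives.\<close>

definition multiplier :: "('s \<Rightarrow> complex) \<Rightarrow> ('h \<Rightarrow>\<^sub>L 'h) \<Rightarrow> bool"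
  where "multiplier g T \<longleftrightarrow> (\<forall>x. AE s in \<mu>. U (T x) s = g s * U x s)"

lemma multiplierD: "multiplier g T \<Longrightarrow> AE s in \<mu>. U (T x) s = g s * U x s"
  by (simp add: multiplier_def)

lemma multiplier_id: "multiplier (\<lambda>_. 1) id_blinfun"
  by (simp add: multiplier_def)

lemma multiplier_compose:
  assumes "multiplier f S" "multiplier g T"
  shows "multiplier (\<lambda>s. f s * g s) (S o\<^sub>L T)"
  unfolding multiplier_def
proof
  fix x
  from multiplierD[OF assms(1), of "T x"] multiplierD[OF assms(2), of x]
  show "AE s in \<mu>. U ((S o\<^sub>L T) x) s = f s * g s * U x s"
    by eventually_elim simp
qed

lemma multiplier_add:
  assumes "multiplier f S" "multiplier g T"
  shows "multiplier (\<lambda>s. f s + g s) (S + T)"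
  unfolding multiplier_def
proof
  fix x
  from multiplierD[OF assms(1), of x] multiplierD[OF assms(2), of x] U_add[of "S x" "T x"]
  show "AE s in \<mu>. U ((S + T) x) s = (f s + g s) * U x s"
    by eventually_elim (simp add: blinfun.add_left distrib_right)
qed

lemma multiplier_scaleR:
  assumes "multiplier g T"
  shows "multiplier (\<lambda>s. complex_of_real r * g s) (r *\<^sub>R T)"
  unfolding multiplier_def
proof
  fix x
  from multiplierD[OF assms, of x] U_scaleR[of r "T x"]
  show "AE s in \<mu>. U ((r *\<^sub>R T) x) s = complex_of_real r * g s * U x s"
    by eventually_elim (simp add: blinfun.scaleR_left)
qed

lemma multiplier_zero: "multiplier (\<lambda>_. 0) 0"
  using U_zero by (simp add: multiplier_def)

lemma multiplier_sum:
  "finite A \<Longrightarrow> (\<And>i. i \<in> A \<Longrightarrow> multiplier (g i) (T i)) \<Longrightarrow> multiplier (\<lambda>s. \<Sum>i\<in>A. g i s) (\<Sum>i\<in>A. T i)"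
  by (induction A rule: finite_induct) (auto intro: multiplier_zero multiplier_add)

lemma multiplier_power:
  assumes "multiplier g T"
  shows "multiplier (\<lambda>s. g s ^ k) (((o\<^sub>L) T ^^ k) id_blinfun)"
proof (induction k)
  case 0
  show ?case using multiplier_id by simp
next
  case (Suc k)
  then show ?case using multiplier_compose[OF assms Suc.IH] by simp
qed

lemma multiplier_cong:
  assumes "multiplier g T" "\<And>s. s \<in> space \<mu> \<Longrightarrow> g s = g' s"
  shows "multiplier g' T"
  unfolding multiplier_def
proof
  fix x
  from multiplierD[OF assms(1), of x] AE_space
  show "AE s in \<mu>. U (T x) s = g' s * U x s" by eventually_elim (simp add: assms(2))
qed

lemma bounded_times_L2:
  assumes [measurable]: "g \<in> borel_measurable \<mu>" and K: "\<And>s. s \<in> space \<mu> \<Longrightarrow> cmod (g s) \<le> K" and f: "f \<in> L2 \<mu>"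
  shows "(\<lambda>s. g s * f s) \<in> L2 \<mu>"
proof -
  have [measurable]: "f \<in> borel_measurable \<mu>" and i: "integrable \<mu> (\<lambda>s. (cmod (f s))\<^sup>2)"
    using f by (auto simp: L2_def)
  have "integrable \<mu> (\<lambda>s. (cmod (g s * f s))\<^sup>2)"
  proof (rule Bochner_Integration.integrable_bound)
    show "integrable \<mu> (\<lambda>s. K\<^sup>2 * (cmod (f s))\<^sup>2)" using i by simp
    show "AE s in \<mu>. norm ((cmod (g s * f s))\<^sup>2) \<le> norm (K\<^sup>2 * (cmod (f s))\<^sup>2)"
    proof (rule AE_I2)
      fix s assume "s \<in> space \<mu>"
      then have "(cmod (g s))\<^sup>2 \<le> K\<^sup>2" using K by (intro power_mono) auto
      then show "norm ((cmod (g s * f s))\<^sup>2) \<le> norm (K\<^sup>2 * (cmod (f s))\<^sup>2)"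
        by (simp add: norm_mult power_mult_distrib mult_right_mono)
    qed
  qed simp
  then show ?thesis by (simp add: L2_def)
qed

text \<open>Convergence of the exponential series in operator norm gives no pointwise control of
  representatives. The identity is therefore tested weakly against every \<open>U y\<close>, where
  boundedness of g permits summation under the integral.\<close>

lemma multiplier_op_exp:
  assumes T: "multiplier g T" and [measurable]: "g \<in> borel_measurable \<mu>"
    and K: "\<And>s. s \<in> space \<mu> \<Longrightarrow> cmod (g s) \<le> K"
  shows "multiplier (\<lambda>s. exp (g s)) (op_exp T)"
  unfolding multiplier_def
proof
  fix x
  let ?P = "\<lambda>k. ((o\<^sub>L) T ^^ k) id_blinfun /\<^sub>R fact k"
  have nP: "norm (((o\<^sub>L) T ^^ k) id_blinfun) \<le> norm T ^ k" for k
  proof (induction k)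
    case 0
    show ?case by (simp add: norm_blinfun_id_le)
  next
    case (Suc k)
    have "norm (T o\<^sub>L ((o\<^sub>L) T ^^ k) id_blinfun) \<le> norm T * norm (((o\<^sub>L) T ^^ k) id_blinfun)"
      by (rule norm_blinfun_compose)
    also have "\<dots> \<le> norm T * norm T ^ k" by (intro mult_left_mono Suc.IH) simp
    finally show ?case by simp
  qed
  have sm: "summable ?P"
  proof (rule summable_comparison_test')
    show "summable (\<lambda>k. inverse (fact k) * norm T ^ k)" by (rule summable_exp)
    show "norm (?P k) \<le> inverse (fact k) * norm T ^ k" if "k \<ge> 0" for k
      using nP[of k] by (simp add: divide_inverse mult_left_mono)
  qed
  have op: "(\<lambda>k. ?P k) sums op_exp T" unfolding op_exp_def using sm by (rule summable_sums)
  have eL2: "(\<lambda>s. exp (g s) * U x s) \<in> L2 \<mu>"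
  proof (rule bounded_times_L2[OF _ _ U_L2])
    fix s assume "s \<in> space \<mu>"
    have "cmod (exp (g s)) \<le> exp (cmod (g s))" by (rule norm_exp)
    also have "\<dots> \<le> exp K" using K[OF \<open>s \<in> space \<mu>\<close>] by simp
    finally show "cmod (exp (g s)) \<le> exp K" .
  qed measurable
  show "AE s in \<mu>. U (op_exp T x) s = exp (g s) * U x s"
  proof (rule U_eqI[OF eL2])
    fix y
    let ?f = "\<lambda>k s. (g s ^ k /\<^sub>R fact k) * (U x s * cnj (U y s))"
    have pk: "AE s in \<mu>. U (?P k x) s = (g s ^ k /\<^sub>R fact k) * U x s" for k
      using multiplierD[OF multiplier_scaleR[OF multiplier_power[OF T], where r = "inverse (fact k)"]]
      by (simp add: scaleR_conv_of_real)
    have ik: "cinner (?P k x) y = integral\<^sup>L \<mu> (?f k)" for k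
    proof -
      have "cinner (?P k x) y = L2_inner \<mu> (U (?P k x)) (U y)" by (simp only: U_inner)
      also have "\<dots> = integral\<^sup>L \<mu> (?f k)"
        unfolding L2_inner_def
        by (rule integral_cong_AE) (use pk[of k] in \<open>auto elim!: eventually_mono\<close>)
      finally show ?thesis .
    qed
    have ixy: "integrable \<mu> (\<lambda>s. U x s * cnj (U y s))" by (rule L2_product_integrable) (rule U_L2)+
    have bd: "norm (?f k s) \<le> (K ^ k / fact k) * cmod (U x s * cnj (U y s))" if "s \<in> space \<mu>" for k s
    proof -
      have "norm (?f k s) = (cmod (g s) ^ k / fact k) * cmod (U x s * cnj (U y s))"
        by (simp add: norm_mult norm_power divide_inverse mult.commute[of "inverse _"])
      also have "\<dots> \<le> (K ^ k / fact k) * cmod (U x s * cnj (U y s))"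
        by (intro mult_right_mono divide_right_mono power_mono K[OF that]) auto
      finally show ?thesis .
    qed
    have ifk: "integrable \<mu> (?f k)" for k
    proof (rule Bochner_Integration.integrable_bound)
      show "integrable \<mu> (\<lambda>s. (K ^ k / fact k) * cmod (U x s * cnj (U y s)))" using ixy by (intro integrable_mult_right integrable_norm)
      show "AE s in \<mu>. norm (?f k s) \<le> norm ((K ^ k / fact k) * cmod (U x s * cnj (U y s)))"
      proof (rule AE_I2)
        fix s assume s: "s \<in> space \<mu>"
        show "norm (?f k s) \<le> norm ((K ^ k / fact k) * cmod (U x s * cnj (U y s)))"
          unfolding real_norm_def by (rule order_trans[OF bd[OF s] abs_ge_self])
      qed
    qed measurable
    have sexp: "summable (\<lambda>k. norm (g s ^ k /\<^sub>R fact k))" for s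
      using summable_norm_exp[of "g s"] by simp
    have 1: "(\<lambda>k. integral\<^sup>L \<mu> (?f k)) sums (\<integral>s. (\<Sum>k. ?f k s) \<partial>\<mu>)"
    proof (rule sums_integral[OF ifk])
      show "AE s in \<mu>. summable (\<lambda>k. norm (?f k s))"
      proof (rule AE_I2)
        fix s
        show "summable (\<lambda>k. norm (?f k s))"
          by (subst norm_mult) (rule summable_mult2[OF sexp])
      qed
      show "summable (\<lambda>k. \<integral>s. norm (?f k s) \<partial>\<mu>)"
      proof (rule summable_comparison_test')
        show "summable (\<lambda>k. (inverse (fact k) * K ^ k) * (\<integral>s. cmod (U x s * cnj (U y s)) \<partial>\<mu>))"
          by (intro summable_mult2 summable_exp)
        fix k :: nat assume "k \<ge> 0"
        have "(\<integral>s. norm (?f k s) \<partial>\<mu>) \<le> (\<integral>s. (K ^ k / fact k) * cmod (U x s * cnj (U y s)) \<partial>\<mu>)"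
          using ifk ixy by (intro integral_mono bd integrable_mult_right integrable_norm)
        also have "\<dots> = (inverse (fact k) * K ^ k) * (\<integral>s. cmod (U x s * cnj (U y s)) \<partial>\<mu>)"
          by (simp add: divide_inverse mult.commute)
        finally show "norm (\<integral>s. norm (?f k s) \<partial>\<mu>) \<le> (inverse (fact k) * K ^ k) * (\<integral>s. cmod (U x s * cnj (U y s)) \<partial>\<mu>)"
          by simp
      qed
    qed
    have 2: "(\<Sum>k. ?f k s) = exp (g s) * U x s * cnj (U y s)" for s
      unfolding exp_def
      using suminf_mult2[OF summable_norm_cancel[OF sexp[of s]], where c = "U x s * cnj (U y s)"]
      by (simp add: mult.assoc)
    have "(\<lambda>k. cinner (?P k x) y) sums cinner (op_exp T x) y"
      by (rule bounded_linear.sums[OF bounded_linear_compose[OF bounded_linear_cinner_left blinfun.bounded_linear_left] op])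
    then show "L2_inner \<mu> (\<lambda>s. exp (g s) * U x s) (U y) = cinner (op_exp T x) y"
      using 1 unfolding ik 2 L2_inner_def by (rule sums_unique2[rotated])
  qed
qed

lemma multiplier_op_powr:
  assumes T: "multiplier g T" and g: "g \<in> borel_measurable \<mu>"
    and K: "\<And>s. s \<in> space \<mu> \<Longrightarrow> cmod (g s) \<le> K" and a: "a > 0"
  shows "multiplier (\<lambda>s. complex_of_real a powr g s) (op_powr a T)"
proof -
  have "multiplier (\<lambda>s. exp (complex_of_real (ln a) * g s)) (op_exp (ln a *\<^sub>R T))"
  proof (rule multiplier_op_exp)
    show "multiplier (\<lambda>s. complex_of_real (ln a) * g s) (ln a *\<^sub>R T)" by (rule multiplier_scaleR[OF T])
    show "cmod (complex_of_real (ln a) * g s) \<le> \<bar>ln a\<bar> * K" if "s \<in> space \<mu>" for s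
      using K[OF that] by (simp add: norm_mult mult_left_mono)
  qed (use g in measurable)
  then show ?thesis
    using a by (simp add: op_powr_def of_real_powr_exp mult.commute)
qed

end

section \<open>Second moments of the normalized sums\<close>

text \<open>The cells [i/n, (i+1)/n) have length 1/n, which the factor n cancels. Summability of f
  comes out of the integrability of the step function instead of being assumed.\<close>

lemma step_function_sums:
  fixes f :: "nat \<Rightarrow> real"
  assumes f: "\<And>i. f i \<ge> 0" and n: "n > 0"
    and int: "integrable lborel (\<lambda>\<tau>. if \<tau> \<ge> 0 then real n * f (nat \<lfloor>real n * \<tau>\<rfloor>) else 0)"
  shows "f sums (\<integral>\<tau>. (if \<tau> \<ge> 0 then real n * f (nat \<lfloor>real n * \<tau>\<rfloor>) else 0) \<partial>lborel)"
proof -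
  let ?g = "\<lambda>\<tau>. if \<tau> \<ge> 0 then real n * f (nat \<lfloor>real n * \<tau>\<rfloor>) else 0"
  let ?I = "\<lambda>i :: nat. {real i / real n ..< (real i + 1) / real n}"
  have "ennreal (?g \<tau>) = (\<Sum>i. ennreal (real n * f i) * indicator (?I i) \<tau>)" for \<tau>
  proof -
    have mem: "\<tau> \<in> ?I i \<longleftrightarrow> \<tau> \<ge> 0 \<and> i = nat \<lfloor>real n * \<tau>\<rfloor>" for i
    proof -
      have "\<tau> \<in> ?I i \<longleftrightarrow> real i \<le> real n * \<tau> \<and> real n * \<tau> < real i + 1"
        using n by (auto simp: field_simps)
      also have "\<dots> \<longleftrightarrow> \<lfloor>real n * \<tau>\<rfloor> = int i" by (auto simp: floor_eq_iff)
      also have "\<dots> \<longleftrightarrow> \<tau> \<ge> 0 \<and> i = nat \<lfloor>real n * \<tau>\<rfloor>"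
      proof
        assume "\<lfloor>real n * \<tau>\<rfloor> = int i"
        moreover then have "0 \<le> \<lfloor>real n * \<tau>\<rfloor>" by simp
        then have "0 \<le> real n * \<tau>" by simp
        ultimately show "\<tau> \<ge> 0 \<and> i = nat \<lfloor>real n * \<tau>\<rfloor>" using n by (simp add: zero_le_mult_iff)
      qed simp
      finally show ?thesis .
    qed
    show ?thesis
    proof (cases "\<tau> \<ge> 0")
      case True
      have "(\<Sum>i. ennreal (real n * f i) * indicator (?I i) \<tau>) =
        (\<Sum>i\<in>{nat \<lfloor>real n * \<tau>\<rfloor>}. ennreal (real n * f i) * indicator (?I i) \<tau>)"
        by (rule suminf_finite) (use mem in \<open>auto simp: indicator_def\<close>)
      then show ?thesis using True mem[of "nat \<lfloor>real n * \<tau>\<rfloor>"] by simp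
    next
      case False
      then have "indicator (?I i) \<tau> = (0 :: ennreal)" for i using mem[of i] by (simp add: indicator_def)
      then show ?thesis using False by simp
    qed
  qed
  then have "(\<integral>\<^sup>+\<tau>. ennreal (?g \<tau>) \<partial>lborel) = (\<integral>\<^sup>+\<tau>. (\<Sum>i. ennreal (real n * f i) * indicator (?I i) \<tau>) \<partial>lborel)"
    by simp
  also have "\<dots> = (\<Sum>i. \<integral>\<^sup>+\<tau>. ennreal (real n * f i) * indicator (?I i) \<tau> \<partial>lborel)"
    by (rule nn_integral_suminf) measurable
  also have "\<dots> = (\<Sum>i. ennreal (f i))"
  proof (rule suminf_cong)
    fix i
    have le: "real i / real n \<le> (real i + 1) / real n" by (simp add: divide_right_mono)
    have "(\<integral>\<^sup>+\<tau>. ennreal (real n * f i) * indicator (?I i) \<tau> \<partial>lborel) = ennreal (real n * f i) * emeasure lborel (?I i)"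
      by (rule nn_integral_cmult_indicator) simp
    also have "emeasure lborel (?I i) = ennreal ((real i + 1) / real n - real i / real n)"
      using le by simp
    also have "(real i + 1) / real n - real i / real n = 1 / real n" by (simp add: diff_divide_distrib[symmetric])
    also have "ennreal (real n * f i) * ennreal (1 / real n) = ennreal (f i)"
      using n f by (simp add: ennreal_mult'[symmetric])
    finally show "(\<integral>\<^sup>+\<tau>. ennreal (real n * f i) * indicator (?I i) \<tau> \<partial>lborel) = ennreal (f i)" .
  qed
  finally have s: "(\<integral>\<^sup>+\<tau>. ennreal (?g \<tau>) \<partial>lborel) = (\<Sum>i. ennreal (f i))" .
  have g0: "?g \<tau> \<ge> 0" for \<tau> using f by simp
  have "(\<lambda>i. ennreal (f i)) sums (\<Sum>i. ennreal (f i))" by (rule summable_sums) simp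
  also have "(\<Sum>i. ennreal (f i)) = ennreal (\<integral>\<tau>. ?g \<tau> \<partial>lborel)"
    unfolding s[symmetric] by (rule nn_integral_eq_integral[OF int]) (use g0 in auto)
  finally show ?thesis
    using f g0 by (subst (asm) sums_ennreal) (auto intro!: Bochner_Integration.integral_nonneg)
qed

text \<open>The jointly measurable version u belongs to \<open>\<epsilon> 0\<close>; moments of the
  other innovations are reduced to that one by equality of laws.\<close>

locale spectral_process = unitary_rep \<mu> U + prob_space M
  for \<mu> :: "'s measure" and U :: "'h::{complex_hilbert, second_countable_topology} \<Rightarrow> 's \<Rightarrow> complex"
    and M :: "'w measure" +
  fixes N :: "'h \<Rightarrow>\<^sub>L 'h" and d :: "'s \<Rightarrow> complex" and \<epsilon> :: "int \<Rightarrow> 'w \<Rightarrow> 'h" and u :: "'w \<Rightarrow> 's \<Rightarrow> complex"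
  assumes sigma_finite_mu: "sigma_finite_measure \<mu>"
    and d_measurable[measurable]: "d \<in> borel_measurable \<mu>"
    and d_bounded: "\<exists>B. \<forall>s\<in>space \<mu>. cmod (d s) \<le> B"
    and N_spectral: "\<forall>f\<in>L2 \<mu>. AE s in \<mu>. U (N (L2_adjoint \<mu> U f)) s = d s * f s"
    and eps_indep: "indep_vars (\<lambda>_. borel) \<epsilon> UNIV"
    and eps_distr: "\<And>k. distr M borel (\<epsilon> k) = distr M borel (\<epsilon> 0)"
    and eps_centered: "expectation (\<epsilon> 0) = 0"
    and eps_square: "integrable M (\<lambda>\<omega>. (norm (\<epsilon> 0 \<omega>))\<^sup>2)"
    and u_version: "measurable_version M \<mu> (\<lambda>\<omega>. U (\<epsilon> 0 \<omega>)) u"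
    and d_range: "\<And>s. s \<in> space \<mu> \<Longrightarrow> 1/2 < Re (d s) \<and> Re (d s) < 1"
    and moment1: "integrable \<mu> (\<lambda>s. second_moment M u s / (1 - Re (d s))\<^sup>2)"
    and moment2: "integrable \<mu> (\<lambda>s. second_moment M u s / ((1 - Re (d s)) * (2 * Re (d s) - 1)))"
begin

sublocale mu: sigma_finite_measure \<mu> by (rule sigma_finite_mu)
sublocale tM: pair_sigma_finite "lborel :: real measure" M ..
sublocale tMmu: pair_sigma_finite "(lborel :: real measure) \<Otimes>\<^sub>M M" \<mu> ..
sublocale Mmu: pair_sigma_finite M \<mu> ..

text \<open>The index \<open>i\<close> of the \<open>n\<close>-th row of the array corresponds to the times \<open>\<tau>\<close> in \<open>[i/n, (i+1)/n)\<close>, and all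
  innovations have the law of \<open>\<epsilon> 0\<close>; so row sums of moments become integrals over pairs \<open>(\<tau>, \<omega>)\<close>.\<close>

abbreviation path_space :: "(real \<times> 'w) measure"
  where "path_space \<equiv> lborel \<Otimes>\<^sub>M M"

lemma u_measurable: "(\<lambda>p. u (fst p) (snd p)) \<in> borel_measurable (M \<Otimes>\<^sub>M \<mu>)"
  using u_version by (simp add: measurable_version_def case_prod_beta')

lemma u_measurable_comp[measurable (raw)]:
  assumes f: "f \<in> measurable A M" and g: "g \<in> measurable A \<mu>"
  shows "(\<lambda>x. u (f x) (g x)) \<in> borel_measurable A"
  using measurable_compose[OF measurable_Pair[OF f g] u_measurable] by simp

lemma eps_measurable[measurable]: "\<epsilon> k \<in> borel_measurable M"
  using eps_indep by (auto simp: indep_vars_def)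

lemma eps_moment_eq:
  fixes f :: "'h \<Rightarrow> real"
  assumes [measurable]: "f \<in> borel_measurable borel"
  shows "expectation (\<lambda>\<omega>. f (\<epsilon> k \<omega>)) = expectation (\<lambda>\<omega>. f (\<epsilon> 0 \<omega>))"
proof -
  have "expectation (\<lambda>\<omega>. f (\<epsilon> k \<omega>)) = integral\<^sup>L (distr M borel (\<epsilon> k)) f" by (simp add: integral_distr)
  also have "\<dots> = expectation (\<lambda>\<omega>. f (\<epsilon> 0 \<omega>))" unfolding eps_distr[of k] by (simp add: integral_distr)
  finally show ?thesis .
qed

lemma eps_square_integrable: "integrable M (\<lambda>\<omega>. (norm (\<epsilon> k \<omega>))\<^sup>2)"
proof -
  have m: "(\<lambda>x :: 'h. (norm x)\<^sup>2) \<in> borel_measurable borel" by measurable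
  show ?thesis
    using eps_square unfolding integrable_distr_eq[OF eps_measurable m, symmetric] eps_distr[of k] .
qed

lemma eps_integrable: "integrable M (\<epsilon> k)"
  by (rule integrable_of_norm_sq[OF eps_measurable eps_square_integrable])

lemma eps_expectation: "expectation (\<epsilon> k) = 0"
proof -
  have m: "(\<lambda>x :: 'h. x) \<in> borel_measurable borel" by simp
  have "expectation (\<epsilon> k) = (\<integral>x. x \<partial>distr M borel (\<epsilon> k))"
    by (rule integral_distr[OF eps_measurable m, symmetric])
  also have "\<dots> = expectation (\<epsilon> 0)"
    unfolding eps_distr[of k] by (rule integral_distr[OF eps_measurable m])
  finally show ?thesis by (simp add: eps_centered)
qed

lemma N_multiplier: "multiplier d N"
  unfolding multiplier_def
proof
  fix x
  show "AE s in \<mu>. U (N x) s = d s * U x s"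
    using N_spectral[rule_format, OF U_L2[of x]] by (simp add: L2_adjoint_U)
qed

lemma eps_version: "AE \<omega> in M. AE s in \<mu>. u \<omega> s = U (\<epsilon> 0 \<omega>) s"
  using u_version by (simp add: measurable_version_def)

text \<open>\<open>second_moment\<close> is a Bochner integral and would silently be 0 where it
  diverges. By Tonelli the double integral of the squared modulus of u is the second moment of the
  norm of \<open>\<epsilon> 0\<close>, so for almost every s the moment is genuine.\<close>

lemma AE_second_moment:
  "AE s in \<mu>. integrable M (\<lambda>\<omega>. (cmod (u \<omega> s))\<^sup>2) \<and> (\<integral>\<^sup>+\<omega>. ennreal ((cmod (u \<omega> s))\<^sup>2) \<partial>M) = ennreal (second_moment M u s)"
proof -
  have "AE \<omega> in M. (\<integral>\<^sup>+s. ennreal ((cmod (u \<omega> s))\<^sup>2) \<partial>\<mu>) = ennreal ((norm (\<epsilon> 0 \<omega>))\<^sup>2)"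
    using eps_version
  proof eventually_elim
    case (elim \<omega>)
    have "(\<integral>\<^sup>+s. ennreal ((cmod (u \<omega> s))\<^sup>2) \<partial>\<mu>) = (\<integral>\<^sup>+s. ennreal ((cmod (U (\<epsilon> 0 \<omega>) s))\<^sup>2) \<partial>\<mu>)"
      by (rule nn_integral_cong_AE) (use elim in \<open>auto elim: eventually_mono\<close>)
    also have "\<dots> = ennreal (\<integral>s. (cmod (U (\<epsilon> 0 \<omega>) s))\<^sup>2 \<partial>\<mu>)"
      by (rule nn_integral_eq_integral[OF U_square_integrable]) simp
    also have "(\<integral>s. (cmod (U (\<epsilon> 0 \<omega>) s))\<^sup>2 \<partial>\<mu>) = (norm (\<epsilon> 0 \<omega>))\<^sup>2"
    proof (rule L2_represent[OF U_L2[of "\<epsilon> 0 \<omega>"]])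
      fix z assume z: "AE s in \<mu>. U z s = U (\<epsilon> 0 \<omega>) s" "(\<integral>s. (cmod (U (\<epsilon> 0 \<omega>) s))\<^sup>2 \<partial>\<mu>) = (norm z)\<^sup>2"
      have "z = \<epsilon> 0 \<omega>" by (rule U_cong_AE[OF z(1)])
      then show ?thesis using z(2) by simp
    qed
    finally show ?case .
  qed
  then have "(\<integral>\<^sup>+\<omega>. \<integral>\<^sup>+s. ennreal ((cmod (u \<omega> s))\<^sup>2) \<partial>\<mu> \<partial>M) = (\<integral>\<^sup>+\<omega>. ennreal ((norm (\<epsilon> 0 \<omega>))\<^sup>2) \<partial>M)"
    by (rule nn_integral_cong_AE)
  also have "\<dots> = ennreal (expectation (\<lambda>\<omega>. (norm (\<epsilon> 0 \<omega>))\<^sup>2))"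
    by (rule nn_integral_eq_integral[OF eps_square]) simp
  finally have "(\<integral>\<^sup>+s. \<integral>\<^sup>+\<omega>. ennreal ((cmod (u \<omega> s))\<^sup>2) \<partial>M \<partial>\<mu>) \<noteq> \<infinity>"
    by (subst Mmu.Fubini') (auto simp: case_prod_beta')
  then have "AE s in \<mu>. (\<integral>\<^sup>+\<omega>. ennreal ((cmod (u \<omega> s))\<^sup>2) \<partial>M) \<noteq> \<infinity>"
    by (intro nn_integral_PInf_AE) (auto simp: case_prod_beta')
  then show ?thesis
    using AE_space
  proof eventually_elim
    case (elim s)
    have [measurable]: "(\<lambda>\<omega>. u \<omega> s) \<in> borel_measurable M"
      by (rule u_measurable_comp) (use elim in auto)
    have i: "integrable M (\<lambda>\<omega>. (cmod (u \<omega> s))\<^sup>2)"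
      by (rule integrableI_bounded) (use elim in \<open>auto simp: less_top\<close>)
    moreover have "(\<integral>\<^sup>+\<omega>. ennreal ((cmod (u \<omega> s))\<^sup>2) \<partial>M) = ennreal (\<integral>\<omega>. (cmod (u \<omega> s))\<^sup>2 \<partial>M)"
      by (rule nn_integral_eq_integral[OF i]) simp
    ultimately show ?case unfolding second_moment_def by (rule conjI)
  qed
qed

section \<open>The integrable envelope of all squared fields\<close>

definition envelope :: "real \<times> 'w \<Rightarrow> 's \<Rightarrow> real"
  where "envelope p s = (kernel_bound (fst p) (Re (d s)))\<^sup>2 * (cmod (u (snd p) s))\<^sup>2"

lemma envelope_measurable[measurable]:
  "(\<lambda>q. envelope (fst q) (snd q)) \<in> borel_measurable (path_space \<Otimes>\<^sub>M \<mu>)"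
  unfolding envelope_def by measurable

lemma envelope_nonneg: "envelope p s \<ge> 0"
  by (simp add: envelope_def)

text \<open>Tonelli with s fixed: the integral over time and probability is the squared norm of the
  kernel bound times the second moment, and the two integrability hypotheses control exactly such
  weights.\<close>

lemma envelope_integrable: "integrable (path_space \<Otimes>\<^sub>M \<mu>) (\<lambda>q. envelope (fst q) (snd q))"
proof (rule integrableI_bounded)
  let ?c = "\<lambda>s. 2 / (1 - Re (d s))\<^sup>2 + 1 / (2 * Re (d s) - 1)"
  have sm0: "second_moment M u s \<ge> 0" for s by (simp add: second_moment_def)
  have "(\<integral>\<^sup>+q. ennreal (norm (envelope (fst q) (snd q))) \<partial>(path_space \<Otimes>\<^sub>M \<mu>)) =
    (\<integral>\<^sup>+s. \<integral>\<^sup>+p. ennreal (envelope p s) \<partial>path_space \<partial>\<mu>)"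
    by (subst tMmu.nn_integral_snd[symmetric]) (auto simp: case_prod_beta' envelope_nonneg)
  also have "\<dots> = (\<integral>\<^sup>+s. ennreal (?c s * second_moment M u s) \<partial>\<mu>)"
  proof (rule nn_integral_cong_AE)
    show "AE s in \<mu>. (\<integral>\<^sup>+p. ennreal (envelope p s) \<partial>path_space) = ennreal (?c s * second_moment M u s)"
      using AE_second_moment AE_space
    proof eventually_elim
      case (elim s)
      have [measurable]: "(\<lambda>\<omega>. u \<omega> s) \<in> borel_measurable M"
        by (rule u_measurable_comp) (use elim in auto)
      have h: "1/2 < Re (d s)" "Re (d s) < 1" using d_range elim by auto
      have "(\<integral>\<^sup>+p. ennreal (envelope p s) \<partial>path_space) =
        (\<integral>\<^sup>+\<tau>. \<integral>\<^sup>+\<omega>. ennreal ((kernel_bound \<tau> (Re (d s)))\<^sup>2) * ennreal ((cmod (u \<omega> s))\<^sup>2) \<partial>M \<partial>lborel)"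
        unfolding envelope_def by (subst nn_integral_fst[symmetric]) (simp_all add: ennreal_mult')
      also have "\<dots> = (\<integral>\<^sup>+\<tau>. ennreal ((kernel_bound \<tau> (Re (d s)))\<^sup>2) * ennreal (second_moment M u s) \<partial>lborel)"
        using elim by (subst nn_integral_cmult) simp_all
      also have "\<dots> = ennreal (?c s) * ennreal (second_moment M u s)"
        by (subst nn_integral_multc) (simp_all add: nn_integral_kernel_bound[OF h])
      also have "\<dots> = ennreal (?c s * second_moment M u s)"
        using h sm0 by (subst ennreal_mult) auto
      finally show ?case .
    qed
  qed
  also have "\<dots> \<le> (\<integral>\<^sup>+s. ennreal (2 * (second_moment M u s / (1 - Re (d s))\<^sup>2) +
      second_moment M u s / ((1 - Re (d s)) * (2 * Re (d s) - 1))) \<partial>\<mu>)"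
  proof (rule nn_integral_mono)
    fix s assume "s \<in> space \<mu>"
    then have h: "1/2 < Re (d s)" "Re (d s) < 1" using d_range by auto
    \<comment> \<open>Since 1 - Re (d s) lies in (0, 1), dividing by it only increases the tail
      weight, which then matches the second hypothesis.\<close>
    have "1 / (2 * Re (d s) - 1) \<le> 1 / ((1 - Re (d s)) * (2 * Re (d s) - 1))"
      using h by (intro divide_left_mono) (auto simp: mult_le_cancel_right1)
    then have "1 / (2 * Re (d s) - 1) * second_moment M u s \<le> 1 / ((1 - Re (d s)) * (2 * Re (d s) - 1)) * second_moment M u s"
      by (intro mult_right_mono sm0)
    then show "ennreal (?c s * second_moment M u s) \<le> ennreal (2 * (second_moment M u s / (1 - Re (d s))\<^sup>2) +
      second_moment M u s / ((1 - Re (d s)) * (2 * Re (d s) - 1)))"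
      by (intro ennreal_leI) (simp add: distrib_right)
  qed
  also have "\<dots> < \<infinity>"
  proof -
    have "integrable \<mu> (\<lambda>s. 2 * (second_moment M u s / (1 - Re (d s))\<^sup>2) +
      second_moment M u s / ((1 - Re (d s)) * (2 * Re (d s) - 1)))"
      using moment1 moment2 by (intro Bochner_Integration.integrable_add integrable_mult_right)
    then have "(\<integral>\<^sup>+s. ennreal (norm (2 * (second_moment M u s / (1 - Re (d s))\<^sup>2) +
      second_moment M u s / ((1 - Re (d s)) * (2 * Re (d s) - 1)))) \<partial>\<mu>) < \<infinity>"
      by (simp add: integrable_iff_bounded)
    moreover have "(\<integral>\<^sup>+s. ennreal (2 * (second_moment M u s / (1 - Re (d s))\<^sup>2) +
      second_moment M u s / ((1 - Re (d s)) * (2 * Re (d s) - 1))) \<partial>\<mu>) \<le> (\<integral>\<^sup>+s. ennreal (norm (2 * (second_moment M u s / (1 - Re (d s))\<^sup>2) +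
      second_moment M u s / ((1 - Re (d s)) * (2 * Re (d s) - 1)))) \<partial>\<mu>)"
      by (intro nn_integral_mono ennreal_leI) simp
    ultimately show ?thesis by (rule order_le_less_trans[rotated])
  qed
  finally show "(\<integral>\<^sup>+q. ennreal (norm (envelope (fst q) (snd q))) \<partial>(path_space \<Otimes>\<^sub>M \<mu>)) < \<infinity>" .
qed measurable

definition envelope_mass :: "real \<times> 'w \<Rightarrow> real"
  where "envelope_mass p = (\<integral>s. envelope p s \<partial>\<mu>)"

text \<open>On these pairs the fields of all dominated kernels lie in L2 at once, so identities for
  coordinates hold for every test vector outside one null set.\<close>

definition regular_path :: "real \<times> 'w \<Rightarrow> bool"
  where "regular_path p \<longleftrightarrow> p \<in> space path_space \<and> integrable \<mu> (envelope p)"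

lemma AE_regular_path: "AE p in path_space. regular_path p"
  using tMmu.AE_integrable_fst'[OF envelope_integrable] AE_space
  by eventually_elim (simp add: regular_path_def eta_contract_eq)

lemma envelope_mass_integrable: "integrable path_space envelope_mass"
  using tMmu.integrable_fst'[OF envelope_integrable] by (simp add: envelope_mass_def[abs_def])

lemma envelope_mass_nonneg: "envelope_mass p \<ge> 0"
  by (simp add: envelope_mass_def envelope_nonneg)

text \<open>Covers the step kernels for n > 0 and their limit, so that each bound is proved once for
  all of them.\<close>

definition dominated_kernel :: "(real \<Rightarrow> complex \<Rightarrow> complex) \<Rightarrow> bool"
  where "dominated_kernel g \<longleftrightarrow> (\<lambda>(\<tau>, z). g \<tau> z) \<in> borel_measurable (borel \<Otimes>\<^sub>M borel) \<and>
    (\<forall>\<tau> z. 1/2 < Re z \<longrightarrow> Re z < 1 \<longrightarrow> cmod (g \<tau> z) \<le> kernel_bound \<tau> (Re z))"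

definition field :: "(real \<Rightarrow> complex \<Rightarrow> complex) \<Rightarrow> real \<times> 'w \<Rightarrow> 's \<Rightarrow> complex"
  where "field g p s = g (fst p) (d s) * u (snd p) s"

definition coord :: "(real \<Rightarrow> complex \<Rightarrow> complex) \<Rightarrow> 'h \<Rightarrow> real \<times> 'w \<Rightarrow> complex"
  where "coord g x p = L2_inner \<mu> (field g p) (U x)"

definition mass :: "(real \<Rightarrow> complex \<Rightarrow> complex) \<Rightarrow> real \<times> 'w \<Rightarrow> real"
  where "mass g p = (\<integral>s. (cmod (field g p s))\<^sup>2 \<partial>\<mu>)"

lemma dominated_step_kernel: "n > 0 \<Longrightarrow> dominated_kernel (step_kernel n)"
  unfolding dominated_kernel_def using step_kernel_bound[of _ n]
  by (auto simp: case_prod_beta' intro!: step_kernel_measurable)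

lemma dominated_limit_kernel: "dominated_kernel limit_kernel"
  unfolding dominated_kernel_def using limit_kernel_bound
  by (auto simp: case_prod_beta' intro!: limit_kernel_measurable)

lemma field_measurable:
  assumes "dominated_kernel g" and [measurable]: "f \<in> measurable A path_space" "k \<in> measurable A \<mu>"
  shows "(\<lambda>x. field g (f x) (k x)) \<in> borel_measurable A"
proof -
  have "(\<lambda>(\<tau>, z). g \<tau> z) \<in> borel_measurable (borel \<Otimes>\<^sub>M borel)"
    using assms(1) by (simp add: dominated_kernel_def)
  moreover have "(\<lambda>x. (fst (f x), d (k x))) \<in> measurable A (borel \<Otimes>\<^sub>M borel)"
  proof (rule measurable_Pair)
    show "(\<lambda>x. fst (f x)) \<in> borel_measurable A"
      using measurable_compose[OF assms(2) measurable_fst] by simp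
  qed measurable
  ultimately have [measurable]: "(\<lambda>x. g (fst (f x)) (d (k x))) \<in> borel_measurable A"
    using measurable_compose by fastforce
  show ?thesis unfolding field_def by measurable
qed

lemma field_measurable_s: "dominated_kernel g \<Longrightarrow> p \<in> space path_space \<Longrightarrow> field g p \<in> borel_measurable \<mu>"
  using field_measurable[of g "\<lambda>_. p" \<mu> "\<lambda>s. s"] by simp

lemma field_bound:
  assumes "dominated_kernel g" "s \<in> space \<mu>"
  shows "(cmod (field g p s))\<^sup>2 \<le> envelope p s"
  using assms d_range[of s] unfolding field_def envelope_def norm_mult power_mult_distrib dominated_kernel_def
  by (intro mult_right_mono power_mono) auto

lemma field_L2:
  assumes g: "dominated_kernel g" and p: "regular_path p"
  shows "field g p \<in> L2 \<mu>"
proof -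
  have [measurable]: "field g p \<in> borel_measurable \<mu>"
    using g p by (intro field_measurable_s) (auto simp: regular_path_def)
  have "integrable \<mu> (envelope p)" using p by (simp add: regular_path_def)
  then have "integrable \<mu> (\<lambda>s. (cmod (field g p s))\<^sup>2)"
    by (rule Bochner_Integration.integrable_bound) (auto simp: field_bound[OF g] envelope_nonneg)
  then show ?thesis by (simp add: L2_def)
qed

lemma mass_le_envelope:
  assumes g: "dominated_kernel g" and p: "regular_path p"
  shows "mass g p \<le> envelope_mass p"
  unfolding mass_def envelope_mass_def
  using p field_L2[OF g p] by (intro integral_mono field_bound[OF g]) (auto simp: regular_path_def L2_def)

lemma mass_nonneg: "mass g p \<ge> 0"
  by (simp add: mass_def)

text \<open>The field of a regular pair represents a vector z, and coordinates and mass are its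
  inner products and its squared norm. Bounds, Parseval and additivity in x thereby become facts
  about z.\<close>

lemma coord_represent:
  assumes g: "dominated_kernel g" and p: "regular_path p"
  obtains z where "\<And>x. coord g x p = cinner z x" "mass g p = (norm z)\<^sup>2"
proof (rule L2_represent[OF field_L2[OF g p]])
  fix z assume "\<And>x. L2_inner \<mu> (field g p) (U x) = cinner z x" "(\<integral>s. (cmod (field g p s))\<^sup>2 \<partial>\<mu>) = (norm z)\<^sup>2"
  then show thesis by (intro that[of z]) (simp_all add: coord_def mass_def)
qed

lemma coord_bound:
  assumes g: "dominated_kernel g" and p: "regular_path p"
  shows "(cmod (coord g x p))\<^sup>2 \<le> envelope_mass p * (norm x)\<^sup>2"
proof (rule coord_represent[OF g p])
  fix z assume z: "\<And>x. coord g x p = cinner z x" "mass g p = (norm z)\<^sup>2"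
  have "(cmod (coord g x p))\<^sup>2 \<le> (norm z * norm x)\<^sup>2"
    unfolding z(1) by (intro power_mono norm_cinner_le) simp
  also have "\<dots> = mass g p * (norm x)\<^sup>2" by (simp add: z(2) power_mult_distrib)
  also have "\<dots> \<le> envelope_mass p * (norm x)\<^sup>2"
    by (intro mult_right_mono mass_le_envelope[OF g p]) simp
  finally show ?thesis .
qed

lemma coord_parseval:
  assumes g: "dominated_kernel g" and p: "regular_path p" and e: "orth_basis e"
  shows "(\<lambda>j. (Re (coord g (e j) p))\<^sup>2) sums mass g p"
proof (rule coord_represent[OF g p])
  fix z assume z: "\<And>x. coord g x p = cinner z x" "mass g p = (norm z)\<^sup>2"
  show ?thesis unfolding z Re_cinner by (rule parseval[OF e])
qed

lemma coord_measurable: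
  assumes g: "dominated_kernel g"
  shows "coord g x \<in> borel_measurable path_space"
proof -
  have [measurable]: "(\<lambda>q. field g (fst q) (snd q)) \<in> borel_measurable (path_space \<Otimes>\<^sub>M \<mu>)"
    by (rule field_measurable[OF g]) measurable
  have "(\<lambda>p. \<integral>s. field g p s * cnj (U x s) \<partial>\<mu>) \<in> borel_measurable path_space"
    by (rule mu.borel_measurable_lebesgue_integral) (simp add: case_prod_beta')
  then show ?thesis by (simp add: coord_def[abs_def] L2_inner_def)
qed

lemma mass_measurable:
  assumes g: "dominated_kernel g"
  shows "mass g \<in> borel_measurable path_space"
proof -
  have [measurable]: "(\<lambda>q. field g (fst q) (snd q)) \<in> borel_measurable (path_space \<Otimes>\<^sub>M \<mu>)"
    by (rule field_measurable[OF g]) measurable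
  have "(\<lambda>p. \<integral>s. (cmod (field g p s))\<^sup>2 \<partial>\<mu>) \<in> borel_measurable path_space"
    by (rule mu.borel_measurable_lebesgue_integral) (simp add: case_prod_beta')
  then show ?thesis by (simp add: mass_def[abs_def])
qed

lemma mass_integrable:
  assumes g: "dominated_kernel g"
  shows "integrable path_space (mass g)"
proof (rule Bochner_Integration.integrable_bound[OF envelope_mass_integrable mass_measurable[OF g]])
  show "AE p in path_space. norm (mass g p) \<le> norm (envelope_mass p)"
    using AE_regular_path
    by eventually_elim (simp add: mass_nonneg envelope_mass_nonneg mass_le_envelope[OF g])
qed

lemma coord_product_le:
  assumes g: "dominated_kernel g" and p: "regular_path p"
  shows "cmod (coord g x p) * cmod (coord g y p) \<le> envelope_mass p * (norm x * norm y)"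
proof -
  have b: "cmod (coord g x p) \<le> sqrt (envelope_mass p) * norm x" for x
  proof (rule power2_le_imp_le)
    show "(cmod (coord g x p))\<^sup>2 \<le> (sqrt (envelope_mass p) * norm x)\<^sup>2"
      using coord_bound[OF g p, of x] envelope_mass_nonneg[of p] by (simp add: power_mult_distrib)
  qed (simp add: envelope_mass_nonneg)
  have "cmod (coord g x p) * cmod (coord g y p) \<le> (sqrt (envelope_mass p) * norm x) * (sqrt (envelope_mass p) * norm y)"
    by (intro mult_mono b) (auto simp: envelope_mass_nonneg)
  also have "\<dots> = (sqrt (envelope_mass p) * sqrt (envelope_mass p)) * (norm x * norm y)" by (simp only: mult_ac)
  finally show ?thesis by (simp add: envelope_mass_nonneg)
qed

text \<open>The general F serves both for products of real parts and for products of moduli.\<close>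

lemma coord_product_integrable:
  fixes F :: "complex \<Rightarrow> complex \<Rightarrow> 'b::{banach, second_countable_topology}"
  assumes g: "dominated_kernel g" and F: "\<And>a b. norm (F a b) \<le> cmod a * cmod b"
    and Fm: "(\<lambda>p. F (coord g x p) (coord g y p)) \<in> borel_measurable path_space"
  shows "integrable path_space (\<lambda>p. F (coord g x p) (coord g y p))"
proof (rule Bochner_Integration.integrable_bound[OF _ Fm])
  show "integrable path_space (\<lambda>p. envelope_mass p * (norm x * norm y))"
    using envelope_mass_integrable by simp
  show "AE p in path_space. norm (F (coord g x p) (coord g y p)) \<le> norm (envelope_mass p * (norm x * norm y))"
    using AE_regular_path
  proof eventually_elim
    case (elim p)
    have "norm (F (coord g x p) (coord g y p)) \<le> envelope_mass p * (norm x * norm y)"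
      by (rule order_trans[OF F coord_product_le[OF g elim]])
    then show ?case by simp
  qed
qed

lemma coord_Re_product_integrable:
  assumes g: "dominated_kernel g"
  shows "integrable path_space (\<lambda>p. Re (coord g x p) * Re (coord g y p))"
proof (rule coord_product_integrable[OF g, where F = "\<lambda>a b. Re a * Re b"])
  show "norm (Re a * Re b) \<le> cmod a * cmod b" for a b
    by (simp add: abs_mult mult_mono abs_Re_le_cmod)
  note [measurable] = coord_measurable[OF g]
  show "(\<lambda>p. Re (coord g x p) * Re (coord g y p)) \<in> borel_measurable path_space" by measurable
qed

section \<open>Dominated convergence of forms, Lindeberg terms and traces\<close>

lemma field_tendsto:
  assumes s: "s \<in> space \<mu>"
  shows "(\<lambda>n. field (step_kernel (Suc n)) p s) \<longlonglongrightarrow> field limit_kernel p s"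
  unfolding field_def using d_range[OF s]
  by (intro tendsto_mult tendsto_const LIMSEQ_Suc step_kernel_tendsto) auto

lemma coord_tendsto:
  assumes p: "regular_path p"
  shows "(\<lambda>n. coord (step_kernel (Suc n)) x p) \<longlonglongrightarrow> coord limit_kernel x p"
  unfolding coord_def L2_inner_def
proof (rule integral_dominated_convergence[where w = "\<lambda>s. envelope p s + (cmod (U x s))\<^sup>2"])
  have ps: "p \<in> space path_space" using p by (simp add: regular_path_def)
  have [measurable]: "field limit_kernel p \<in> borel_measurable \<mu>" "field (step_kernel (Suc n)) p \<in> borel_measurable \<mu>" for n
    by (intro field_measurable_s dominated_limit_kernel dominated_step_kernel ps; simp)+
  show "(\<lambda>s. field limit_kernel p s * cnj (U x s)) \<in> borel_measurable \<mu>"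
    "(\<lambda>s. field (step_kernel (Suc n)) p s * cnj (U x s)) \<in> borel_measurable \<mu>" for n by measurable
  show "integrable \<mu> (\<lambda>s. envelope p s + (cmod (U x s))\<^sup>2)"
    using p U_square_integrable by (auto simp: regular_path_def)
  show "AE s in \<mu>. (\<lambda>n. field (step_kernel (Suc n)) p s * cnj (U x s)) \<longlonglongrightarrow> field limit_kernel p s * cnj (U x s)"
    by (rule AE_I2) (intro tendsto_mult tendsto_const field_tendsto)
  show "AE s in \<mu>. norm (field (step_kernel (Suc n)) p s * cnj (U x s)) \<le> envelope p s + (cmod (U x s))\<^sup>2" for n
  proof (rule AE_I2)
    fix s assume s: "s \<in> space \<mu>"
    let ?a = "cmod (field (step_kernel (Suc n)) p s)" and ?b = "cmod (U x s)"
    have "0 \<le> ?a * ?b" by simp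
    then have "?a * ?b \<le> ?a\<^sup>2 + ?b\<^sup>2"
      using sum_squares_bound[of ?a ?b] by linarith
    also have "?a\<^sup>2 \<le> envelope p s" by (rule field_bound[OF dominated_step_kernel s]) simp
    finally show "norm (field (step_kernel (Suc n)) p s * cnj (U x s)) \<le> envelope p s + (cmod (U x s))\<^sup>2"
      by (simp add: norm_mult)
  qed
qed

lemma mass_tendsto:
  assumes p: "regular_path p"
  shows "(\<lambda>n. mass (step_kernel (Suc n)) p) \<longlonglongrightarrow> mass limit_kernel p"
  unfolding mass_def
proof (rule integral_dominated_convergence[where w = "envelope p"])
  have ps: "p \<in> space path_space" using p by (simp add: regular_path_def)
  have [measurable]: "field limit_kernel p \<in> borel_measurable \<mu>" "field (step_kernel (Suc n)) p \<in> borel_measurable \<mu>" for n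
    by (intro field_measurable_s dominated_limit_kernel dominated_step_kernel ps; simp)+
  show "(\<lambda>s. (cmod (field limit_kernel p s))\<^sup>2) \<in> borel_measurable \<mu>"
    "(\<lambda>s. (cmod (field (step_kernel (Suc n)) p s))\<^sup>2) \<in> borel_measurable \<mu>" for n by measurable
  show "integrable \<mu> (envelope p)" using p by (simp add: regular_path_def)
  show "AE s in \<mu>. (\<lambda>n. (cmod (field (step_kernel (Suc n)) p s))\<^sup>2) \<longlonglongrightarrow> (cmod (field limit_kernel p s))\<^sup>2"
    by (rule AE_I2) (intro tendsto_power tendsto_norm field_tendsto)
  show "AE s in \<mu>. norm ((cmod (field (step_kernel (Suc n)) p s))\<^sup>2) \<le> envelope p s" for n
    by (rule AE_I2) (simp add: field_bound[OF dominated_step_kernel])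
qed

text \<open>The real covariance form of the limit. Unlike the complex covariance it determines a
  centred Gaussian law, also one that is not circularly symmetric.\<close>

definition limit_form :: "'h \<Rightarrow> 'h \<Rightarrow> real"
  where "limit_form x y = (\<integral>p. Re (coord limit_kernel x p) * Re (coord limit_kernel y p) \<partial>path_space)"

definition total_mass :: real
  where "total_mass = (\<integral>p. mass limit_kernel p \<partial>path_space)"

lemma coord_Re_square_le:
  assumes g: "dominated_kernel g" and p: "regular_path p"
  shows "(Re (coord g x p))\<^sup>2 \<le> envelope_mass p * (norm x)\<^sup>2"
proof -
  have "(Re (coord g x p))\<^sup>2 \<le> (cmod (coord g x p))\<^sup>2"
    using power_mono[OF abs_Re_le_cmod[of "coord g x p"], of 2] by simp
  then show ?thesis using coord_bound[OF g p, of x] by simp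
qed

lemma form_tendsto:
  "(\<lambda>n. \<integral>p. (Re (coord (step_kernel (Suc n)) x p))\<^sup>2 \<partial>path_space) \<longlonglongrightarrow> limit_form x x"
  unfolding limit_form_def power2_eq_square[symmetric]
proof (rule integral_dominated_convergence[where w = "\<lambda>p. envelope_mass p * (norm x)\<^sup>2"])
  note [measurable] = coord_measurable[OF dominated_limit_kernel] coord_measurable[OF dominated_step_kernel]
  show "(\<lambda>p. (Re (coord limit_kernel x p))\<^sup>2) \<in> borel_measurable path_space"
    "(\<lambda>p. (Re (coord (step_kernel (Suc n)) x p))\<^sup>2) \<in> borel_measurable path_space" for n by measurable
  show "integrable path_space (\<lambda>p. envelope_mass p * (norm x)\<^sup>2)" using envelope_mass_integrable by simp
  show "AE p in path_space. (\<lambda>n. (Re (coord (step_kernel (Suc n)) x p))\<^sup>2) \<longlonglongrightarrow> (Re (coord limit_kernel x p))\<^sup>2"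
    using AE_regular_path by eventually_elim (intro tendsto_power tendsto_Re coord_tendsto)
  show "AE p in path_space. norm ((Re (coord (step_kernel (Suc n)) x p))\<^sup>2) \<le> envelope_mass p * (norm x)\<^sup>2" for n
    using AE_regular_path by eventually_elim (simp add: coord_Re_square_le[OF dominated_step_kernel])
qed

text \<open>Array entries carry a factor 1 / sqrt n against these coordinates, so the Lindeberg
  factor tends to 0 at every regular pair while the envelope dominates the whole integrand; second
  moments suffice.\<close>

lemma lindeberg_tendsto:
  "(\<lambda>n. \<integral>p. (Re (coord (step_kernel (Suc n)) x p))\<^sup>2 *
      min 1 (\<bar>Re (coord (step_kernel (Suc n)) x p)\<bar> / sqrt (real (Suc n))) \<partial>path_space) \<longlonglongrightarrow> 0"
proof -
  let ?c = "\<lambda>n p. Re (coord (step_kernel (Suc n)) x p)"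
  have "(\<lambda>n. \<integral>p. (?c n p)\<^sup>2 * min 1 (\<bar>?c n p\<bar> / sqrt (real (Suc n))) \<partial>path_space) \<longlonglongrightarrow> (\<integral>p. 0 \<partial>path_space)"
  proof (rule integral_dominated_convergence[where w = "\<lambda>p. envelope_mass p * (norm x)\<^sup>2"])
    note [measurable] = coord_measurable[OF dominated_step_kernel]
    show "(\<lambda>p. (?c n p)\<^sup>2 * min 1 (\<bar>?c n p\<bar> / sqrt (real (Suc n)))) \<in> borel_measurable path_space" for n by measurable
    show "integrable path_space (\<lambda>p. envelope_mass p * (norm x)\<^sup>2)" using envelope_mass_integrable by simp
    show "AE p in path_space. (\<lambda>n. (?c n p)\<^sup>2 * min 1 (\<bar>?c n p\<bar> / sqrt (real (Suc n)))) \<longlonglongrightarrow> 0"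
      using AE_regular_path
    proof eventually_elim
      case (elim p)
      have c: "(\<lambda>n. ?c n p) \<longlonglongrightarrow> Re (coord limit_kernel x p)" by (intro tendsto_Re coord_tendsto elim)
      have s: "filterlim (\<lambda>n. sqrt (real (Suc n))) at_top sequentially"
        by (intro filterlim_compose[OF sqrt_at_top] filterlim_compose[OF filterlim_real_sequentially] filterlim_Suc)
      have "(\<lambda>n. \<bar>?c n p\<bar> / sqrt (real (Suc n))) \<longlonglongrightarrow> 0"
        by (rule real_tendsto_divide_at_top[OF tendsto_rabs[OF c] s])
      then have "(\<lambda>n. (?c n p)\<^sup>2 * min 1 (\<bar>?c n p\<bar> / sqrt (real (Suc n)))) \<longlonglongrightarrow> (Re (coord limit_kernel x p))\<^sup>2 * min 1 0"
        by (intro tendsto_mult tendsto_power c tendsto_min tendsto_const)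
      then show ?case by simp
    qed
    show "AE p in path_space. norm ((?c n p)\<^sup>2 * min 1 (\<bar>?c n p\<bar> / sqrt (real (Suc n)))) \<le> envelope_mass p * (norm x)\<^sup>2" for n
      using AE_regular_path
    proof eventually_elim
      case (elim p)
      have "(?c n p)\<^sup>2 * min 1 (\<bar>?c n p\<bar> / sqrt (real (Suc n))) \<le> (?c n p)\<^sup>2"
        by (intro mult_left_le) auto
      also have "\<dots> \<le> envelope_mass p * (norm x)\<^sup>2" by (rule coord_Re_square_le[OF dominated_step_kernel elim]) simp
      finally show ?case by (simp add: abs_mult)
    qed
  qed simp
  then show ?thesis by simp
qed

lemma total_mass_tendsto: "(\<lambda>n. \<integral>p. mass (step_kernel (Suc n)) p \<partial>path_space) \<longlonglongrightarrow> total_mass"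
  unfolding total_mass_def
proof (rule integral_dominated_convergence[where w = envelope_mass])
  show "mass limit_kernel \<in> borel_measurable path_space" by (rule mass_measurable[OF dominated_limit_kernel])
  show "mass (step_kernel (Suc n)) \<in> borel_measurable path_space" for n by (rule mass_measurable[OF dominated_step_kernel]) simp
  show "integrable path_space envelope_mass" by (rule envelope_mass_integrable)
  show "AE p in path_space. (\<lambda>n. mass (step_kernel (Suc n)) p) \<longlonglongrightarrow> mass limit_kernel p"
    using AE_regular_path by eventually_elim (rule mass_tendsto)
  show "AE p in path_space. norm (mass (step_kernel (Suc n)) p) \<le> envelope_mass p" for n
    using AE_regular_path by eventually_elim (simp add: mass_nonneg mass_le_envelope[OF dominated_step_kernel])
qed

text \<open>Parseval inside the integral, with the envelope mass dominating the partial sums. It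
  identifies the trace of the limiting form with the limit of the total variances, the equality that
  prevents loss of mass.\<close>

lemma limit_form_trace:
  assumes e: "orth_basis e"
  shows "(\<lambda>j. limit_form (e j) (e j)) sums total_mass"
proof -
  have "(\<lambda>m. \<integral>p. (\<Sum>j<m. (Re (coord limit_kernel (e j) p))\<^sup>2) \<partial>path_space) \<longlonglongrightarrow> total_mass"
    unfolding total_mass_def
  proof (rule integral_dominated_convergence[where w = envelope_mass])
    note [measurable] = coord_measurable[OF dominated_limit_kernel]
    show "mass limit_kernel \<in> borel_measurable path_space" by (rule mass_measurable[OF dominated_limit_kernel])
    show "(\<lambda>p. \<Sum>j<m. (Re (coord limit_kernel (e j) p))\<^sup>2) \<in> borel_measurable path_space" for m by measurable
    show "integrable path_space envelope_mass" by (rule envelope_mass_integrable)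
    show "AE p in path_space. (\<lambda>m. \<Sum>j<m. (Re (coord limit_kernel (e j) p))\<^sup>2) \<longlonglongrightarrow> mass limit_kernel p"
      using AE_regular_path
      by eventually_elim (use coord_parseval[OF dominated_limit_kernel _ e] in \<open>simp add: sums_def\<close>)
    show "AE p in path_space. norm (\<Sum>j<m. (Re (coord limit_kernel (e j) p))\<^sup>2) \<le> envelope_mass p" for m
      using AE_regular_path
    proof eventually_elim
      case (elim p)
      have "(\<Sum>j<m. (Re (coord limit_kernel (e j) p))\<^sup>2) \<le> mass limit_kernel p"
        using coord_parseval[OF dominated_limit_kernel elim e] sum_le_suminf[of "\<lambda>j. (Re (coord limit_kernel (e j) p))\<^sup>2" "{..<m}"]
        by (simp add: sums_iff)
      then show ?case
        using mass_le_envelope[OF dominated_limit_kernel elim] by (simp add: sum_nonneg)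
    qed
  qed
  moreover have "(\<integral>p. (\<Sum>j<m. (Re (coord limit_kernel (e j) p))\<^sup>2) \<partial>path_space) = (\<Sum>j<m. limit_form (e j) (e j))" for m
    unfolding limit_form_def power2_eq_square
    by (rule Bochner_Integration.integral_sum) (rule coord_Re_product_integrable[OF dominated_limit_kernel])
  ultimately show ?thesis by (simp add: sums_def)
qed

lemma coord_add:
  assumes g: "dominated_kernel g" and p: "regular_path p"
  shows "coord g (x + y) p = coord g x p + coord g y p"
proof (rule coord_represent[OF g p])
  fix z assume z: "\<And>x. coord g x p = cinner z x"
  have "cinner z (x + y) = cinner z x + cinner z y"
    using cinner_commute[of z "x + y"] cinner_commute[of x z] cinner_commute[of y z]
    by (simp add: cinner_add_left)
  then show ?thesis by (simp add: z)
qed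

lemma coord_scaleC:
  assumes g: "dominated_kernel g" and p: "regular_path p"
  shows "coord g (c *\<^sub>C x) p = cnj c * coord g x p"
proof (rule coord_represent[OF g p])
  fix z assume z: "\<And>x. coord g x p = cinner z x"
  show ?thesis by (simp add: z cinner_scaleC_right)
qed

lemma limit_form_sym: "limit_form x y = limit_form y x"
  by (simp add: limit_form_def mult.commute)

lemma limit_form_bounded_bilinear: "bounded_bilinear limit_form"
proof
  note L = dominated_limit_kernel
  note [measurable] = coord_measurable[OF L]
  have add: "limit_form (a + a') b = limit_form a b + limit_form a' b" for a a' b
  proof -
    have "limit_form (a + a') b = (\<integral>p. Re (coord limit_kernel a p) * Re (coord limit_kernel b p) +
      Re (coord limit_kernel a' p) * Re (coord limit_kernel b p) \<partial>path_space)"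
      unfolding limit_form_def
    proof (rule integral_cong_AE)
      show "AE p in path_space. Re (coord limit_kernel (a + a') p) * Re (coord limit_kernel b p) =
        Re (coord limit_kernel a p) * Re (coord limit_kernel b p) + Re (coord limit_kernel a' p) * Re (coord limit_kernel b p)"
        using AE_regular_path by eventually_elim (simp add: coord_add[OF L] distrib_right)
    qed measurable
    then show ?thesis
      unfolding limit_form_def by (simp add: Bochner_Integration.integral_add coord_Re_product_integrable[OF L])
  qed
  have scale: "limit_form (r *\<^sub>R a) b = r *\<^sub>R limit_form a b" for r a b
  proof -
    have "limit_form (r *\<^sub>R a) b = (\<integral>p. r * (Re (coord limit_kernel a p) * Re (coord limit_kernel b p)) \<partial>path_space)"
      unfolding limit_form_def
    proof (rule integral_cong_AE)
      show "AE p in path_space. Re (coord limit_kernel (r *\<^sub>R a) p) * Re (coord limit_kernel b p) =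
        r * (Re (coord limit_kernel a p) * Re (coord limit_kernel b p))"
        using AE_regular_path by eventually_elim (simp add: scaleC_of_real[symmetric] coord_scaleC[OF L])
    qed measurable
    then show ?thesis unfolding limit_form_def by simp
  qed
  show "limit_form (a + a') b = limit_form a b + limit_form a' b" for a a' b by (rule add)
  show "limit_form a (b + b') = limit_form a b + limit_form a b'" for a b b'
    using add[of b b' a] by (simp add: limit_form_sym)
  show "limit_form (r *\<^sub>R a) b = r *\<^sub>R limit_form a b" for r a b by (rule scale)
  show "limit_form a (r *\<^sub>R b) = r *\<^sub>R limit_form a b" for r a b
    using scale[of r b a] by (simp add: limit_form_sym)
  show "\<exists>K. \<forall>a b. norm (limit_form a b) \<le> norm a * norm b * K"
  proof (intro exI allI)
    fix a b
    have "norm (limit_form a b) \<le> (\<integral>p. norm (Re (coord limit_kernel a p) * Re (coord limit_kernel b p)) \<partial>path_space)"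
      unfolding limit_form_def by (rule integral_norm_bound)
    also have "\<dots> \<le> (\<integral>p. envelope_mass p * (norm a * norm b) \<partial>path_space)"
    proof (rule integral_mono_AE)
      show "integrable path_space (\<lambda>p. norm (Re (coord limit_kernel a p) * Re (coord limit_kernel b p)))"
        by (intro integrable_norm coord_Re_product_integrable[OF L])
      show "integrable path_space (\<lambda>p. envelope_mass p * (norm a * norm b))" using envelope_mass_integrable by simp
      show "AE p in path_space. norm (Re (coord limit_kernel a p) * Re (coord limit_kernel b p)) \<le> envelope_mass p * (norm a * norm b)"
        using AE_regular_path
      proof eventually_elim
        case (elim p)
        have "norm (Re (coord limit_kernel a p) * Re (coord limit_kernel b p)) \<le> cmod (coord limit_kernel a p) * cmod (coord limit_kernel b p)"
          by (simp add: abs_mult mult_mono abs_Re_le_cmod)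
        then show ?case using coord_product_le[OF L elim, of a b] by linarith
      qed
    qed
    finally show "norm (limit_form a b) \<le> norm a * norm b * (\<integral>p. envelope_mass p \<partial>path_space)"
      by (simp add: mult.commute)
  qed
qed

end

section \<open>The triangular array\<close>

text \<open>The innovation at time n - i enters X_k through the coefficient j = i - (n - k), so for
  k = 1..n the index j runs from max 0 (i + 1 - n) to i. Cutting at i < I cuts the series for k at I
  - (n - k). This is a finite identity for each I, so convergence need not be absolute.\<close>

lemma shifted_sums_rearrange:
  fixes b :: "nat \<Rightarrow> int \<Rightarrow> 'a::real_normed_vector"
  assumes L: "\<And>k. k \<in> {1..n} \<Longrightarrow> (\<lambda>j. b j (int k - int j)) sums L k"
  shows "(\<lambda>i. \<Sum>j=i + 1 - n..i. b j (int n - int i)) sums (\<Sum>k=1..n. L k)"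
proof -
  have partial: "(\<Sum>i<I. \<Sum>j=i + 1 - n..i. b j (int n - int i)) = (\<Sum>k=1..n. \<Sum>j<I - (n - k). b j (int k - int j))" for I
  proof (induction I)
    case (Suc I)
    have "(\<Sum>j=I + 1 - n..I. b j (int n - int I)) = (\<Sum>k\<in>{k\<in>{1..n}. n - k \<le> I}. b (I - (n - k)) (int n - int I))"
      by (rule sum.reindex_bij_witness[where i = "\<lambda>k. I - (n - k)" and j = "\<lambda>j. n - (I - j)"]) auto
    also have "\<dots> = (\<Sum>k=1..n. if n - k \<le> I then b (I - (n - k)) (int n - int I) else 0)"
      by (rule sum.inter_filter) simp
    finally have new: "(\<Sum>j=I + 1 - n..I. b j (int n - int I)) = (\<Sum>k=1..n. if n - k \<le> I then b (I - (n - k)) (int n - int I) else 0)" .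
    have "(\<Sum>j<Suc I - (n - k). b j (int k - int j)) = (\<Sum>j<I - (n - k). b j (int k - int j)) +
      (if n - k \<le> I then b (I - (n - k)) (int n - int I) else 0)" if k: "k \<in> {1..n}" for k
    proof (cases "n - k \<le> I")
      case True
      then have "Suc I - (n - k) = Suc (I - (n - k))" by simp
      moreover have "int k - int (I - (n - k)) = int n - int I" using True k by auto
      ultimately show ?thesis using True by simp
    qed simp
    then have "(\<Sum>k=1..n. \<Sum>j<Suc I - (n - k). b j (int k - int j)) = (\<Sum>k=1..n. (\<Sum>j<I - (n - k). b j (int k - int j)) +
      (if n - k \<le> I then b (I - (n - k)) (int n - int I) else 0))"
      by (rule sum.cong[OF refl])
    then show ?case unfolding sum.lessThan_Suc Suc.IH new sum.distrib by simp
  qed simp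
  have "(\<lambda>I. \<Sum>k=1..n. \<Sum>j<I - (n - k). b j (int k - int j)) \<longlonglongrightarrow> (\<Sum>k=1..n. L k)"
  proof (rule tendsto_sum)
    fix k assume "k \<in> {1..n}"
    from L[OF this] have "(\<lambda>J. \<Sum>j<J. b j (int k - int j)) \<longlonglongrightarrow> L k" by (simp add: sums_def)
    then show "(\<lambda>I. \<Sum>j<I - (n - k). b j (int k - int j)) \<longlonglongrightarrow> L k"
      by (rule filterlim_compose) (rule filterlim_minus_const_nat_at_top)
  qed
  then show ?thesis by (simp only: sums_def partial)
qed

lemma blinfun_measurable[measurable]:
  fixes T :: "'a::real_normed_vector \<Rightarrow>\<^sub>L 'b::real_normed_vector"
  shows "blinfun_apply T \<in> borel_measurable borel"
  by (rule borel_measurable_continuous_onI) (rule linear_continuous_on[OF blinfun.bounded_linear_right])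

context spectral_process
begin

lemma U_norm: "(\<integral>s. (cmod (U z s))\<^sup>2 \<partial>\<mu>) = (norm z)\<^sup>2"
proof (rule L2_represent[OF U_L2[of z]])
  fix w assume w: "AE s in \<mu>. U w s = U z s" "(\<integral>s. (cmod (U z s))\<^sup>2 \<partial>\<mu>) = (norm w)\<^sup>2"
  have "w = z" by (rule U_cong_AE[OF w(1)])
  then show ?thesis using w(2) by simp
qed

definition coeff_op :: "nat \<Rightarrow> 'h \<Rightarrow>\<^sub>L 'h"
  where "coeff_op j = op_powr (real j + 1) (- N)"

definition norm_op :: "nat \<Rightarrow> 'h \<Rightarrow>\<^sub>L 'h"
  where "norm_op n = op_powr (real n) (- ((3/2) *\<^sub>R id_blinfun - N))"

definition array_op :: "nat \<Rightarrow> nat \<Rightarrow> 'h \<Rightarrow>\<^sub>L 'h"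
  where "array_op n i = norm_op n o\<^sub>L (\<Sum>j=i + 1 - n..i. coeff_op j)"

lemma multiplier_coeff_op: "multiplier (\<lambda>s. complex_of_real (real j + 1) powr (- d s)) (coeff_op j)"
proof -
  obtain B where B: "\<And>s. s \<in> space \<mu> \<Longrightarrow> cmod (d s) \<le> B" using d_bounded by blast
  have "multiplier (\<lambda>s. complex_of_real (- 1) * d s) ((- 1) *\<^sub>R N)"
    by (rule multiplier_scaleR[OF N_multiplier])
  then have m: "multiplier (\<lambda>s. - d s) (- N)" by simp
  show ?thesis
    unfolding coeff_op_def by (rule multiplier_op_powr[OF m, where K = B]) (use B in auto)
qed

lemma multiplier_norm_op:
  assumes n: "n > 0"
  shows "multiplier (\<lambda>s. complex_of_real (real n) powr (d s - 3/2)) (norm_op n)"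
proof -
  obtain B where B: "\<And>s. s \<in> space \<mu> \<Longrightarrow> cmod (d s) \<le> B" using d_bounded by blast
  have "multiplier (\<lambda>s. complex_of_real (- (3/2)) * 1 + d s) ((- (3/2)) *\<^sub>R id_blinfun + N)"
    by (intro multiplier_add multiplier_scaleR multiplier_id N_multiplier)
  moreover have "(- (3/2)) *\<^sub>R id_blinfun + N = - ((3/2) *\<^sub>R id_blinfun - N)" by simp
  moreover have "(\<lambda>s. complex_of_real (- (3/2)) * 1 + d s) = (\<lambda>s. d s - 3/2)" by (simp add: fun_eq_iff)
  ultimately have m: "multiplier (\<lambda>s. d s - 3/2) (- ((3/2) *\<^sub>R id_blinfun - N))" by simp
  have "cmod (d s - 3/2) \<le> B + 3/2" if "s \<in> space \<mu>" for s
    using norm_triangle_ineq4[of "d s" "3/2"] B[OF that] by simp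
  then show ?thesis
    unfolding norm_op_def by (intro multiplier_op_powr[OF m, where K = "B + 3/2"]) (use n in auto)
qed

text \<open>The exponent d - 3/2 splits into - 1/2, the central limit scaling, and d - 1, which is
  absorbed in \<open>step_coeff\<close>.\<close>

lemma multiplier_array_op:
  assumes n: "n > 0"
  shows "multiplier (\<lambda>s. complex_of_real (1 / sqrt (real n)) * step_coeff n i (d s)) (array_op n i)"
proof (rule multiplier_cong)
  show "multiplier (\<lambda>s. complex_of_real (real n) powr (d s - 3/2) *
      (\<Sum>j=i + 1 - n..i. complex_of_real (real j + 1) powr (- d s))) (array_op n i)"
    unfolding array_op_def by (intro multiplier_compose multiplier_norm_op n multiplier_sum multiplier_coeff_op) simp
  fix s
  have "complex_of_real (real n) powr (d s - 3/2) = complex_of_real (real n) powr (- (1/2) + (d s - 1))"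
    by simp
  also have "\<dots> = complex_of_real (real n) powr (- (1/2)) * complex_of_real (real n) powr (d s - 1)"
    by (rule powr_add)
  also have "complex_of_real (real n) powr (- (1/2)) = complex_of_real (real n powr (- (1/2)))"
    using powr_of_real[of "real n" "- (1/2)"] by simp
  also have "real n powr (- (1/2)) = 1 / sqrt (real n)"
    using powr_minus_divide[of "real n" "1/2"] powr_half_sqrt[of "real n"] by simp
  finally show "complex_of_real (real n) powr (d s - 3/2) * (\<Sum>j=i + 1 - n..i. complex_of_real (real j + 1) powr (- d s)) =
      complex_of_real (1 / sqrt (real n)) * step_coeff n i (d s)"
    by (simp only: step_coeff_def mult.assoc)
qed

text \<open>Identifies the coefficients of the process with the row n = 1, so that square
  summability of the defining series is a case of the bound for rows.\<close>

lemma array_op_one: "array_op 1 i x = coeff_op i x"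
proof (rule U_cong_AE)
  have "multiplier (\<lambda>s. complex_of_real (1 / sqrt (real 1)) * step_coeff 1 i (d s)) (array_op 1 i)"
    by (rule multiplier_array_op) simp
  from multiplierD[OF this, of x] multiplierD[OF multiplier_coeff_op[of i], of x]
  show "AE s in \<mu>. U (array_op 1 i x) s = U (coeff_op i x) s"
    by eventually_elim (simp add: step_coeff_def)
qed

text \<open>On the cell of index i the field of the step kernel represents sqrt n times the i-th
  array operator applied to \<open>\<epsilon> 0\<close>. In second moments this factor is undone by
  the cell length 1/n.\<close>

lemma step_field_represent:
  assumes n: "n > 0" and \<tau>: "\<tau> \<ge> 0"
  shows "AE \<omega> in M. (\<forall>x. coord (step_kernel n) x (\<tau>, \<omega>) =
      cinner (sqrt (real n) *\<^sub>R array_op n (nat \<lfloor>real n * \<tau>\<rfloor>) (\<epsilon> 0 \<omega>)) x) \<and>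
    mass (step_kernel n) (\<tau>, \<omega>) = real n * (norm (array_op n (nat \<lfloor>real n * \<tau>\<rfloor>) (\<epsilon> 0 \<omega>)))\<^sup>2"
  using eps_version AE_space
proof eventually_elim
  case (elim \<omega>)
  let ?i = "nat \<lfloor>real n * \<tau>\<rfloor>"
  define z where "z = sqrt (real n) *\<^sub>R array_op n ?i (\<epsilon> 0 \<omega>)"
  have [measurable]: "field (step_kernel n) (\<tau>, \<omega>) \<in> borel_measurable \<mu>"
    using elim by (intro field_measurable_s dominated_step_kernel n) (simp add: space_pair_measure)
  from elim(1) multiplierD[OF multiplier_array_op[OF n, of ?i], of "\<epsilon> 0 \<omega>"]
    U_scaleR[of "sqrt (real n)" "array_op n ?i (\<epsilon> 0 \<omega>)"]
  have z: "AE s in \<mu>. field (step_kernel n) (\<tau>, \<omega>) s = U z s"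
  proof eventually_elim
    case (elim s)
    have "complex_of_real (sqrt (real n)) * complex_of_real (1 / sqrt (real n)) = 1"
      using n by (simp flip: of_real_mult)
    then have "U z s = step_coeff n ?i (d s) * u \<omega> s"
      unfolding z_def elim(3) elim(2) elim(1)[symmetric] mult.assoc[symmetric] by (simp only: mult_1_left)
    then show ?case using \<tau> by (simp add: field_def step_kernel_def)
  qed
  have "coord (step_kernel n) x (\<tau>, \<omega>) = cinner z x" for x
    unfolding coord_def using L2_inner_cong_AE(1)[OF z, of "U x"] by (simp add: U_inner)
  moreover have "mass (step_kernel n) (\<tau>, \<omega>) = (norm z)\<^sup>2"
  proof -
    have "mass (step_kernel n) (\<tau>, \<omega>) = (\<integral>s. (cmod (U z s))\<^sup>2 \<partial>\<mu>)"
      unfolding mass_def by (rule integral_cong_AE) (use z in \<open>auto elim!: eventually_mono\<close>)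
    then show ?thesis by (simp add: U_norm)
  qed
  ultimately show ?case unfolding z_def by (simp add: power_mult_distrib)
qed

lemma step_field_negative:
  assumes "\<tau> < 0"
  shows "coord (step_kernel n) x (\<tau>, \<omega>) = 0" "mass (step_kernel n) (\<tau>, \<omega>) = 0"
  using assms by (simp_all add: coord_def mass_def field_def step_kernel_def L2_inner_def)

text \<open>Common source of three row sums: \<Phi> is the squared norm, the squared coordinate or
  the Lindeberg term of an entry, and \<Psi> is its counterpart on \<open>path_space\<close>.
  Averaging \<Psi> over \<omega> leaves a step function of time.\<close>

lemma array_moment_sums:
  fixes \<Phi> :: "'h \<Rightarrow> real"
  assumes n: "n > 0" and [measurable]: "\<Phi> \<in> borel_measurable borel" and \<Phi>: "\<And>z. \<Phi> z \<ge> 0"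
    and int: "integrable path_space \<Psi>" and neg: "\<And>\<tau> \<omega>. \<tau> < 0 \<Longrightarrow> \<Psi> (\<tau>, \<omega>) = 0"
    and eq: "\<And>\<tau>. \<tau> \<ge> 0 \<Longrightarrow> AE \<omega> in M. \<Psi> (\<tau>, \<omega>) = real n * \<Phi> (array_op n (nat \<lfloor>real n * \<tau>\<rfloor>) (\<epsilon> 0 \<omega>))"
  shows "(\<lambda>i. expectation (\<lambda>\<omega>. \<Phi> (array_op n i (\<epsilon> (int n - int i) \<omega>)))) sums (\<integral>p. \<Psi> p \<partial>path_space)"
proof -
  define \<phi> where "\<phi> i = expectation (\<lambda>\<omega>. \<Phi> (array_op n i (\<epsilon> 0 \<omega>)))" for i
  have \<phi>: "expectation (\<lambda>\<omega>. \<Phi> (array_op n i (\<epsilon> (int n - int i) \<omega>))) = \<phi> i" for i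
    unfolding \<phi>_def by (rule eps_moment_eq[of "\<lambda>z. \<Phi> (array_op n i z)"]) measurable
  have [measurable]: "\<Psi> \<in> borel_measurable path_space" using int by simp
  have inner: "(\<integral>\<omega>. \<Psi> (\<tau>, \<omega>) \<partial>M) = (if \<tau> \<ge> 0 then real n * \<phi> (nat \<lfloor>real n * \<tau>\<rfloor>) else 0)" for \<tau>
  proof (cases "\<tau> \<ge> 0")
    case True
    have "(\<integral>\<omega>. \<Psi> (\<tau>, \<omega>) \<partial>M) = expectation (\<lambda>\<omega>. real n * \<Phi> (array_op n (nat \<lfloor>real n * \<tau>\<rfloor>) (\<epsilon> 0 \<omega>)))"
      by (rule integral_cong_AE) (use eq[OF True] in auto)
    then show ?thesis using True by (simp add: \<phi>_def)
  qed (simp add: neg)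
  have "\<phi> sums (\<integral>\<tau>. (if \<tau> \<ge> 0 then real n * \<phi> (nat \<lfloor>real n * \<tau>\<rfloor>) else 0) \<partial>lborel)"
  proof (rule step_function_sums[OF _ n])
    show "\<phi> i \<ge> 0" for i unfolding \<phi>_def by (intro Bochner_Integration.integral_nonneg \<Phi>)
    show "integrable lborel (\<lambda>\<tau>. if \<tau> \<ge> 0 then real n * \<phi> (nat \<lfloor>real n * \<tau>\<rfloor>) else 0)"
      using tM.integrable_fst'[OF int] unfolding inner .
  qed
  then show ?thesis
    using tM.integral_fst'[OF int] unfolding inner \<phi> by simp
qed

definition array :: "nat \<Rightarrow> nat \<Rightarrow> 'w \<Rightarrow> 'h"
  where "array n i \<omega> = array_op n i (\<epsilon> (int n - int i) \<omega>)"

lemma op_eps_integrable: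
  fixes T :: "'h \<Rightarrow>\<^sub>L 'h"
  shows "integrable M (\<lambda>\<omega>. (norm (T (\<epsilon> k \<omega>)))\<^sup>2)"
proof (rule Bochner_Integration.integrable_bound)
  show "integrable M (\<lambda>\<omega>. (norm T)\<^sup>2 * (norm (\<epsilon> k \<omega>))\<^sup>2)" using eps_square_integrable by simp
  have "(norm (T x))\<^sup>2 \<le> (norm T)\<^sup>2 * (norm x)\<^sup>2" for x
    using power_mono[OF norm_blinfun[of T x], of 2] by (simp add: power_mult_distrib)
  then show "AE \<omega> in M. norm ((norm (T (\<epsilon> k \<omega>)))\<^sup>2) \<le> norm ((norm T)\<^sup>2 * (norm (\<epsilon> k \<omega>))\<^sup>2)" by simp
qed measurable

lemma indep_centered_transform:
  fixes T :: "nat \<Rightarrow> 'h \<Rightarrow>\<^sub>L 'h"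
  shows "indep_centered M (\<lambda>i \<omega>. T i (\<epsilon> (k - int i) \<omega>))"
proof
  have "indep_vars (\<lambda>_. borel) (\<lambda>i. \<epsilon> (k - int i)) UNIV"
    by (rule indep_vars_inj[OF eps_indep]) (auto simp: inj_on_def)
  then show "indep_vars (\<lambda>_. borel) (\<lambda>i \<omega>. T i (\<epsilon> (k - int i) \<omega>)) UNIV"
    by (rule indep_vars_compose2) measurable
  show "expectation (\<lambda>\<omega>. T i (\<epsilon> (k - int i) \<omega>)) = 0" for i
    using integral_bounded_linear[OF blinfun.bounded_linear_right eps_integrable, of "T i" "k - int i"]
    by (simp add: eps_expectation blinfun.zero_right)
  show "integrable M (\<lambda>\<omega>. (norm (T i (\<epsilon> (k - int i) \<omega>)))\<^sup>2)" for i
    by (rule op_eps_integrable)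
qed

lemma array_indep_centered: "indep_centered M (array n)"
  unfolding array_def[abs_def] by (rule indep_centered_transform)

lemma array_norm_sums:
  assumes n: "n > 0"
  shows "(\<lambda>i. expectation (\<lambda>\<omega>. (norm (array n i \<omega>))\<^sup>2)) sums (\<integral>p. mass (step_kernel n) p \<partial>path_space)"
  unfolding array_def
proof (rule array_moment_sums[OF n])
  show "integrable path_space (mass (step_kernel n))" by (rule mass_integrable[OF dominated_step_kernel[OF n]])
  show "AE \<omega> in M. mass (step_kernel n) (\<tau>, \<omega>) = real n * (norm (array_op n (nat \<lfloor>real n * \<tau>\<rfloor>) (\<epsilon> 0 \<omega>)))\<^sup>2"
    if "\<tau> \<ge> 0" for \<tau>
    using step_field_represent[OF n that] by eventually_elim simp
qed (auto simp: step_field_negative)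

lemma array_inner_sums:
  assumes n: "n > 0"
  shows "(\<lambda>i. expectation (\<lambda>\<omega>. (inner (array n i \<omega>) x)\<^sup>2)) sums (\<integral>p. (Re (coord (step_kernel n) x p))\<^sup>2 \<partial>path_space)"
  unfolding array_def
proof (rule array_moment_sums[OF n])
  show "integrable path_space (\<lambda>p. (Re (coord (step_kernel n) x p))\<^sup>2)"
    unfolding power2_eq_square by (rule coord_Re_product_integrable[OF dominated_step_kernel[OF n]])
  show "AE \<omega> in M. (Re (coord (step_kernel n) x (\<tau>, \<omega>)))\<^sup>2 =
      real n * (inner (array_op n (nat \<lfloor>real n * \<tau>\<rfloor>) (\<epsilon> 0 \<omega>)) x)\<^sup>2" if "\<tau> \<ge> 0" for \<tau>
    using step_field_represent[OF n that] by eventually_elim (simp add: Re_cinner power_mult_distrib)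
qed (auto simp: step_field_negative)

lemma array_lindeberg_sums:
  assumes n: "n > 0"
  shows "(\<lambda>i. expectation (\<lambda>\<omega>. (inner (array n i \<omega>) x)\<^sup>2 * min 1 \<bar>inner (array n i \<omega>) x\<bar>)) sums
    (\<integral>p. (Re (coord (step_kernel n) x p))\<^sup>2 * min 1 (\<bar>Re (coord (step_kernel n) x p)\<bar> / sqrt (real n)) \<partial>path_space)"
  unfolding array_def
proof (rule array_moment_sums[OF n])
  note [measurable] = coord_measurable[OF dominated_step_kernel[OF n]]
  show "integrable path_space (\<lambda>p. (Re (coord (step_kernel n) x p))\<^sup>2 * min 1 (\<bar>Re (coord (step_kernel n) x p)\<bar> / sqrt (real n)))"
  proof (rule Bochner_Integration.integrable_bound)
    show "integrable path_space (\<lambda>p. (Re (coord (step_kernel n) x p))\<^sup>2)"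
      unfolding power2_eq_square by (rule coord_Re_product_integrable[OF dominated_step_kernel[OF n]])
    show "AE p in path_space. norm ((Re (coord (step_kernel n) x p))\<^sup>2 * min 1 (\<bar>Re (coord (step_kernel n) x p)\<bar> / sqrt (real n)))
      \<le> norm ((Re (coord (step_kernel n) x p))\<^sup>2)"
      by (rule AE_I2) (simp add: abs_mult mult_left_le)
  qed measurable
  show "AE \<omega> in M. (Re (coord (step_kernel n) x (\<tau>, \<omega>)))\<^sup>2 * min 1 (\<bar>Re (coord (step_kernel n) x (\<tau>, \<omega>))\<bar> / sqrt (real n)) =
      real n * ((inner (array_op n (nat \<lfloor>real n * \<tau>\<rfloor>) (\<epsilon> 0 \<omega>)) x)\<^sup>2 * min 1 \<bar>inner (array_op n (nat \<lfloor>real n * \<tau>\<rfloor>) (\<epsilon> 0 \<omega>)) x\<bar>)"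
    if "\<tau> \<ge> 0" for \<tau>
    using step_field_represent[OF n that]
    by eventually_elim (use n in \<open>simp add: Re_cinner power_mult_distrib abs_mult\<close>)
qed (auto simp: step_field_negative)

text \<open>\<open>lin_process\<close> is an infinite sum whose value is unspecified where it
  diverges; here it becomes the true limit for all k outside one null set. The variances of its
  terms are those of row 1, hence summable.\<close>

lemma AE_lin_process_summable:
  "AE \<omega> in M. \<forall>k. (\<lambda>j. coeff_op j (\<epsilon> (k - int j) \<omega>)) sums lin_process N \<epsilon> k \<omega>"
  unfolding AE_all_countable
proof
  fix k
  interpret C: indep_centered M "\<lambda>j \<omega>. coeff_op j (\<epsilon> (k - int j) \<omega>)"
    by (rule indep_centered_transform)
  have "expectation (\<lambda>\<omega>. (norm (coeff_op j (\<epsilon> l \<omega>)))\<^sup>2) = expectation (\<lambda>\<omega>. (norm (array 1 j \<omega>))\<^sup>2)" for j l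
  proof -
    have "expectation (\<lambda>\<omega>. (norm (coeff_op j (\<epsilon> l \<omega>)))\<^sup>2) = expectation (\<lambda>\<omega>. (norm (coeff_op j (\<epsilon> 0 \<omega>)))\<^sup>2)" for l
      by (rule eps_moment_eq) measurable
    from this[of l] this[of "1 - int j"] show ?thesis by (simp add: array_def array_op_one[simplified])
  qed
  then have "summable (\<lambda>j. expectation (\<lambda>\<omega>. (norm (coeff_op j (\<epsilon> (k - int j) \<omega>)))\<^sup>2))"
    using array_norm_sums[of 1] by (simp add: sums_iff)
  from C.AE_summable[OF this]
  show "AE \<omega> in M. (\<lambda>j. coeff_op j (\<epsilon> (k - int j) \<omega>)) sums lin_process N \<epsilon> k \<omega>"
    by eventually_elim (simp add: lin_process_def coeff_op_def summable_sums)
qed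

lemma array_sums: "AE \<omega> in M. \<forall>n. (\<lambda>i. array n i \<omega>) sums norm_op n (partial_sum N \<epsilon> n \<omega>)"
  using AE_lin_process_summable
proof eventually_elim
  case (elim \<omega>)
  show ?case
  proof
    fix n
    have "(\<lambda>i. \<Sum>j=i + 1 - n..i. coeff_op j (\<epsilon> (int n - int i) \<omega>)) sums (\<Sum>k=1..n. lin_process N \<epsilon> (int k) \<omega>)"
      by (rule shifted_sums_rearrange[where b = "\<lambda>j l. coeff_op j (\<epsilon> l \<omega>)"]) (use elim in blast)
    from bounded_linear.sums[OF blinfun.bounded_linear_right this, of "norm_op n"]
    show "(\<lambda>i. array n i \<omega>) sums norm_op n (partial_sum N \<epsilon> n \<omega>)"
      by (simp add: array_def array_op_def partial_sum_def blinfun.sum_left)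
  qed
qed

lemma normed_partial_sum_measurable: "(\<lambda>\<omega>. norm_op n (partial_sum N \<epsilon> n \<omega>)) \<in> borel_measurable M"
proof -
  have [measurable]: "lin_process N \<epsilon> k \<in> borel_measurable M" for k
    unfolding lin_process_def[abs_def] suminf_eq_lim by (rule borel_measurable_lim_metric) measurable
  show ?thesis unfolding partial_sum_def by measurable
qed

lemma array_clt:
  "\<exists>P. prob_space P \<and> sets P = sets borel \<and>
    (\<forall>x. (CLINT y|P. iexp (inner y x)) = exp (- limit_form x x / 2)) \<and>
    integrable P (\<lambda>y. (norm y)\<^sup>2) \<and>
    (\<forall>f :: 'h \<Rightarrow> real. continuous_on UNIV f \<and> bounded (range f) \<longrightarrow>
      (\<lambda>n. \<integral>\<omega>. f (norm_op n (partial_sum N \<epsilon> n \<omega>)) \<partial>M) \<longlonglongrightarrow> (\<integral>y. f y \<partial>P))"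
proof -
  obtain e :: "nat \<Rightarrow> 'h" where e: "orth_basis e" using orth_basis_exists by blast
  \<comment> \<open>The rows start at n = 1, because the facts on rows require n > 0; the shift is
    undone at the end.\<close>
  have "\<exists>P. prob_space P \<and> sets P = sets borel \<and>
    (\<forall>x. (CLINT y|P. iexp (inner y x)) = exp (- limit_form x x / 2)) \<and>
    integrable P (\<lambda>y. (norm y)\<^sup>2) \<and>
    (\<forall>f :: 'h \<Rightarrow> real. continuous_on UNIV f \<and> bounded (range f) \<longrightarrow>
      (\<lambda>n. \<integral>\<omega>. f (norm_op (Suc n) (partial_sum N \<epsilon> (Suc n) \<omega>)) \<partial>M) \<longlonglongrightarrow> (\<integral>y. f y \<partial>P))"
  proof (rule hilbert_clt[where X = "\<lambda>n. array (Suc n)" and B = limit_form and \<tau> = total_mass and e = e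
        and Y = "\<lambda>n \<omega>. norm_op (Suc n) (partial_sum N \<epsilon> (Suc n) \<omega>)"
        and t = "\<lambda>n. \<integral>p. mass (step_kernel (Suc n)) p \<partial>path_space"
        and q = "\<lambda>n x. \<integral>p. (Re (coord (step_kernel (Suc n)) x p))\<^sup>2 \<partial>path_space"
        and l = "\<lambda>n x. \<integral>p. (Re (coord (step_kernel (Suc n)) x p))\<^sup>2 *
          min 1 (\<bar>Re (coord (step_kernel (Suc n)) x p)\<bar> / sqrt (real (Suc n))) \<partial>path_space"])
    show "indep_centered M (array (Suc n))" for n by (rule array_indep_centered)
    show "AE \<omega> in M. (\<lambda>i. array (Suc n) i \<omega>) sums norm_op (Suc n) (partial_sum N \<epsilon> (Suc n) \<omega>)" for n
      using array_sums by eventually_elim blast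
    show "(\<lambda>\<omega>. norm_op (Suc n) (partial_sum N \<epsilon> (Suc n) \<omega>)) \<in> borel_measurable M" for n
      by (rule normed_partial_sum_measurable)
    show "(\<lambda>i. \<integral>\<omega>. (norm (array (Suc n) i \<omega>))\<^sup>2 \<partial>M) sums (\<integral>p. mass (step_kernel (Suc n)) p \<partial>path_space)" for n
      by (rule array_norm_sums) simp
    show "(\<lambda>n. \<integral>p. mass (step_kernel (Suc n)) p \<partial>path_space) \<longlonglongrightarrow> total_mass" by (rule total_mass_tendsto)
    show "(\<lambda>i. \<integral>\<omega>. (inner (array (Suc n) i \<omega>) x)\<^sup>2 \<partial>M) sums (\<integral>p. (Re (coord (step_kernel (Suc n)) x p))\<^sup>2 \<partial>path_space)" for n x
      by (rule array_inner_sums) simp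
    show "(\<lambda>n. \<integral>p. (Re (coord (step_kernel (Suc n)) x p))\<^sup>2 \<partial>path_space) \<longlonglongrightarrow> limit_form x x" for x
      by (rule form_tendsto)
    show "(\<lambda>i. \<integral>\<omega>. (inner (array (Suc n) i \<omega>) x)\<^sup>2 * min 1 \<bar>inner (array (Suc n) i \<omega>) x\<bar> \<partial>M) sums
      (\<integral>p. (Re (coord (step_kernel (Suc n)) x p))\<^sup>2 * min 1 (\<bar>Re (coord (step_kernel (Suc n)) x p)\<bar> / sqrt (real (Suc n))) \<partial>path_space)" for n x
      by (rule array_lindeberg_sums) simp
    show "(\<lambda>n. \<integral>p. (Re (coord (step_kernel (Suc n)) x p))\<^sup>2 *
      min 1 (\<bar>Re (coord (step_kernel (Suc n)) x p)\<bar> / sqrt (real (Suc n))) \<partial>path_space) \<longlonglongrightarrow> 0" for x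
      by (rule lindeberg_tendsto)
    show "bounded_bilinear limit_form" by (rule limit_form_bounded_bilinear)
    show "limit_form x y = limit_form y x" for x y by (rule limit_form_sym)
    show "orth_basis e" by (rule e)
    show "(\<lambda>j. limit_form (e j) (e j)) sums total_mass" by (rule limit_form_trace[OF e])
  qed
  then show ?thesis
    by (elim exE conjE) (intro exI conjI allI impI; (assumption | (rule LIMSEQ_imp_Suc, blast) | blast))
qed

section \<open>Covariance operator of the limit\<close>

text \<open>If z is the vector represented by the limit field, the integrand is
  \<open>cinner x z * cinner z y\<close>, in line with the convention for covariance
  operators.\<close>

definition cov :: "'h \<Rightarrow> 'h \<Rightarrow> complex"
  where "cov x y = (\<integral>p. cnj (coord limit_kernel x p) * coord limit_kernel y p \<partial>path_space)"

lemma coord_Im: "regular_path p \<Longrightarrow> Im (coord limit_kernel x p) = Re (coord limit_kernel (\<i> *\<^sub>C x) p)"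
  by (simp add: coord_scaleC[OF dominated_limit_kernel])

text \<open>By conjugate linearity the imaginary part of a coordinate at x is the real part of the
  coordinate at \<i> times x, so the complex product expands into four real ones.\<close>

lemma cov_conv_limit_form:
  "cov x y = complex_of_real (limit_form x y + limit_form (\<i> *\<^sub>C x) (\<i> *\<^sub>C y)) +
    \<i> * complex_of_real (limit_form x (\<i> *\<^sub>C y) - limit_form (\<i> *\<^sub>C x) y)"
proof -
  let ?R = "\<lambda>x p. Re (coord limit_kernel x p)"
  note L = dominated_limit_kernel
  note [measurable] = coord_measurable[OF L]
  note i = coord_Re_product_integrable[OF L]
  have "cov x y = (\<integral>p. complex_of_real (?R x p * ?R y p + ?R (\<i> *\<^sub>C x) p * ?R (\<i> *\<^sub>C y) p) +
      \<i> * complex_of_real (?R x p * ?R (\<i> *\<^sub>C y) p - ?R (\<i> *\<^sub>C x) p * ?R y p) \<partial>path_space)"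
    unfolding cov_def
  proof (rule integral_cong_AE)
    show "AE p in path_space. cnj (coord limit_kernel x p) * coord limit_kernel y p =
      complex_of_real (?R x p * ?R y p + ?R (\<i> *\<^sub>C x) p * ?R (\<i> *\<^sub>C y) p) +
      \<i> * complex_of_real (?R x p * ?R (\<i> *\<^sub>C y) p - ?R (\<i> *\<^sub>C x) p * ?R y p)"
      using AE_regular_path by eventually_elim (simp add: coord_Im[symmetric] complex_eq_iff)
  qed measurable
  also have "\<dots> = complex_of_real (\<integral>p. ?R x p * ?R y p + ?R (\<i> *\<^sub>C x) p * ?R (\<i> *\<^sub>C y) p \<partial>path_space) +
    \<i> * complex_of_real (\<integral>p. ?R x p * ?R (\<i> *\<^sub>C y) p - ?R (\<i> *\<^sub>C x) p * ?R y p \<partial>path_space)"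
  proof -
    have a: "integrable path_space (\<lambda>p. complex_of_real (?R x p * ?R y p + ?R (\<i> *\<^sub>C x) p * ?R (\<i> *\<^sub>C y) p))"
      by (intro integrable_of_real Bochner_Integration.integrable_add i)
    have b: "integrable path_space (\<lambda>p. \<i> * complex_of_real (?R x p * ?R (\<i> *\<^sub>C y) p - ?R (\<i> *\<^sub>C x) p * ?R y p))"
      by (intro integrable_mult_right integrable_of_real Bochner_Integration.integrable_diff i)
    show ?thesis
      unfolding Bochner_Integration.integral_add[OF a b] integral_mult_right_zero integral_complex_of_real ..
  qed
  also have "\<dots> = complex_of_real (limit_form x y + limit_form (\<i> *\<^sub>C x) (\<i> *\<^sub>C y)) +
    \<i> * complex_of_real (limit_form x (\<i> *\<^sub>C y) - limit_form (\<i> *\<^sub>C x) y)"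
    unfolding limit_form_def
    by (simp only: Bochner_Integration.integral_add[OF i i] Bochner_Integration.integral_diff[OF i i])
  finally show ?thesis .
qed

lemma norm_ii_scaleC: "norm (\<i> *\<^sub>C x) = norm x" for x :: 'h
proof -
  have "cinner (\<i> *\<^sub>C x) (\<i> *\<^sub>C x) = cinner x x"
    by (simp add: cinner_scaleC_left cinner_scaleC_right)
  then have "(norm (\<i> *\<^sub>C x))\<^sup>2 = (norm x)\<^sup>2" by (simp only: cinner_self of_real_eq_iff)
  then show ?thesis by simp
qed

lemma bounded_linear_ii: "bounded_linear (\<lambda>x :: 'h. \<i> *\<^sub>C x)"
proof (rule bounded_linear_intro)
  show "\<i> *\<^sub>C (x + y) = \<i> *\<^sub>C x + \<i> *\<^sub>C y" for x y :: 'h by (rule scaleC_add_right)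
  show "\<i> *\<^sub>C (r *\<^sub>R x) = r *\<^sub>R (\<i> *\<^sub>C x)" for r and x :: 'h
    by (simp add: scaleC_of_real[symmetric] scaleC_scaleC mult.commute)
  show "norm (\<i> *\<^sub>C x) \<le> norm x * 1" for x :: 'h by (simp add: norm_ii_scaleC)
qed

text \<open>Riesz gives c from the real part. The imaginary part follows because a complex-linear
  functional is determined by the values of its real part at x and at \<i> times x.\<close>

lemma cov_represent: "\<exists>c. \<forall>x. cov x y = cinner x c"
proof -
  interpret B: bounded_bilinear limit_form by (rule limit_form_bounded_bilinear)
  have "bounded_linear (\<lambda>x. limit_form x y + limit_form (\<i> *\<^sub>C x) (\<i> *\<^sub>C y))"
    by (intro bounded_linear_add B.bounded_linear_left bounded_linear_compose[OF B.bounded_linear_left bounded_linear_ii])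
  from riesz_representation[OF this] obtain c
    where c: "\<And>x. limit_form x y + limit_form (\<i> *\<^sub>C x) (\<i> *\<^sub>C y) = inner x c" by blast
  have "cov x y = cinner x c" for x
  proof -
    have ii: "\<i> *\<^sub>C \<i> *\<^sub>C x = - x" by (simp add: scaleC_scaleC scaleC_minus_one)
    have "inner (\<i> *\<^sub>C x) c = Re (\<i> * cinner x c)"
      unfolding Re_cinner[symmetric] cinner_scaleC_left ..
    then have "Im (cinner x c) = - inner (\<i> *\<^sub>C x) c" by simp
    also have "\<dots> = limit_form x (\<i> *\<^sub>C y) - limit_form (\<i> *\<^sub>C x) y"
      unfolding c[symmetric] ii by (simp add: B.minus_left)
    finally show ?thesis
      unfolding cov_conv_limit_form c by (simp add: complex_eq_iff Re_cinner)
  qed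
  then show ?thesis by blast
qed

section \<open>Identification of the Beta kernel\<close>

definition cov_kernel :: "'s \<Rightarrow> 's \<Rightarrow> complex"
  where "cov_kernel r s = (c_coeff d r s + cnj (c_coeff d s r)) / ((2 - dsum d r s) * (3 - dsum d r s))"

lemma cov_kernel_integral:
  assumes "r \<in> space \<mu>" "s \<in> space \<mu>"
  shows "has_bochner_integral lborel (\<lambda>\<tau>. limit_kernel \<tau> (d r) * cnj (limit_kernel \<tau> (d s))) (cov_kernel r s)"
  using has_bochner_integral_limit_kernel_covariance[of "d r" "d s"] d_range[OF assms(1)] d_range[OF assms(2)]
  by (simp add: cov_kernel_def c_coeff_def cov_coeff_def dsum_def)

definition cov_image :: "'h \<Rightarrow> 's \<Rightarrow> complex"
  where "cov_image y r = (\<integral>s. cov_kernel r s * cross_moment M u r s * U y s \<partial>\<mu>)"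

lemma limit_covariance_eq: "limit_covariance M \<mu> U d u y = L2_adjoint \<mu> U (cov_image y)"
  by (simp add: limit_covariance_def cov_image_def[abs_def] cov_kernel_def)

text \<open>Beta coefficients and cross moments are replaced by the integrals over \<tau> and
  \<omega> that they equal, whose dependence on (r, s) is measurable.\<close>

lemma cov_image_measurable: "cov_image y \<in> borel_measurable \<mu>"
proof -
  have m1: "(\<lambda>q. \<integral>\<tau>. limit_kernel \<tau> (d (fst q)) * cnj (limit_kernel \<tau> (d (snd q))) \<partial>lborel) \<in> borel_measurable (\<mu> \<Otimes>\<^sub>M \<mu>)"
    by (rule lborel.borel_measurable_lebesgue_integral) (simp add: case_prod_beta', measurable)
  have m2: "(\<lambda>q. \<integral>\<omega>. u \<omega> (fst q) * cnj (u \<omega> (snd q)) \<partial>M) \<in> borel_measurable (\<mu> \<Otimes>\<^sub>M \<mu>)"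
    by (rule borel_measurable_lebesgue_integral) (simp add: case_prod_beta', measurable)
  have "(\<lambda>r. \<integral>s. (\<integral>\<tau>. limit_kernel \<tau> (d r) * cnj (limit_kernel \<tau> (d s)) \<partial>lborel) *
      (\<integral>\<omega>. u \<omega> r * cnj (u \<omega> s) \<partial>M) * U y s \<partial>\<mu>) \<in> borel_measurable \<mu>"
  proof (rule mu.borel_measurable_lebesgue_integral)
    note [measurable] = m1 m2
    show "(\<lambda>(r, s). (\<integral>\<tau>. limit_kernel \<tau> (d r) * cnj (limit_kernel \<tau> (d s)) \<partial>lborel) *
      (\<integral>\<omega>. u \<omega> r * cnj (u \<omega> s) \<partial>M) * U y s) \<in> borel_measurable (\<mu> \<Otimes>\<^sub>M \<mu>)"
      unfolding case_prod_beta' by measurable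
  qed
  then show ?thesis
  proof (rule measurable_cong[THEN iffD1, rotated])
    fix r assume r: "r \<in> space \<mu>"
    show "(\<integral>s. (\<integral>\<tau>. limit_kernel \<tau> (d r) * cnj (limit_kernel \<tau> (d s)) \<partial>lborel) *
      (\<integral>\<omega>. u \<omega> r * cnj (u \<omega> s) \<partial>M) * U y s \<partial>\<mu>) = cov_image y r"
      unfolding cov_image_def cross_moment_def
      by (rule Bochner_Integration.integral_cong) (use cov_kernel_integral[OF r] in \<open>auto simp: has_bochner_integral_iff\<close>)
  qed
qed

lemma path_product_integral:
  fixes f :: "real \<Rightarrow> complex" and g :: "'w \<Rightarrow> complex"
  assumes f: "integrable lborel f" and g: "integrable M g"
  shows "(\<integral>p. f (fst p) * g (snd p) \<partial>path_space) = (\<integral>\<tau>. f \<tau> \<partial>lborel) * (\<integral>\<omega>. g \<omega> \<partial>M)"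
proof -
  have [measurable]: "f \<in> borel_measurable borel" "g \<in> borel_measurable M" using f g by auto
  have "integrable path_space (\<lambda>p. f (fst p) * g (snd p))"
  proof (rule tM.Fubini_integrable)
    show "integrable lborel (\<lambda>\<tau>. \<integral>\<omega>. norm (f (fst (\<tau>, \<omega>)) * g (snd (\<tau>, \<omega>))) \<partial>M)"
      using f by (simp add: norm_mult)
    show "AE \<tau> in lborel. integrable M (\<lambda>\<omega>. f (fst (\<tau>, \<omega>)) * g (snd (\<tau>, \<omega>)))" using g by simp
  qed measurable
  from tM.integral_fst'[OF this] show ?thesis by simp
qed

abbreviation lfield :: "real \<times> 'w \<Rightarrow> 's \<Rightarrow> complex"
  where "lfield \<equiv> field limit_kernel"

abbreviation lcoord :: "'h \<Rightarrow> real \<times> 'w \<Rightarrow> complex"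
  where "lcoord \<equiv> coord limit_kernel"

lemma lfield_measurable[measurable (raw)]:
  "f \<in> measurable A path_space \<Longrightarrow> k \<in> measurable A \<mu> \<Longrightarrow> (\<lambda>x. lfield (f x) (k x)) \<in> borel_measurable A"
  by (rule field_measurable[OF dominated_limit_kernel])

lemma lcoord_measurable[measurable (raw)]:
  "f \<in> measurable A path_space \<Longrightarrow> (\<lambda>x. lcoord y (f x)) \<in> borel_measurable A"
  by (rule measurable_compose[OF _ coord_measurable[OF dominated_limit_kernel]])

lemma field_U_integral_le:
  assumes p: "regular_path p"
  shows "(\<integral>s. cmod (lfield p s) * cmod (U x s) \<partial>\<mu>) \<le> sqrt (envelope_mass p) * norm x"
proof (rule power2_le_imp_le)
  have "(\<integral>s. cmod (lfield p s) * cmod (U x s) \<partial>\<mu>)\<^sup>2 \<le> (\<integral>s. (cmod (lfield p s))\<^sup>2 \<partial>\<mu>) * (\<integral>s. (cmod (U x s))\<^sup>2 \<partial>\<mu>)"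
    by (rule L2_cauchy_schwarz[OF field_L2[OF dominated_limit_kernel p] U_L2])
  also have "\<dots> = mass limit_kernel p * (norm x)\<^sup>2" by (simp add: mass_def U_norm)
  also have "\<dots> \<le> envelope_mass p * (norm x)\<^sup>2"
    by (intro mult_right_mono mass_le_envelope[OF dominated_limit_kernel p]) simp
  finally show "(\<integral>s. cmod (lfield p s) * cmod (U x s) \<partial>\<mu>)\<^sup>2 \<le> (sqrt (envelope_mass p) * norm x)\<^sup>2"
    by (simp add: power_mult_distrib envelope_mass_nonneg)
qed (simp add: envelope_mass_nonneg)

text \<open>Serves twice: with w the field at a fixed r, and with w a coordinate. Cauchy-Schwarz in
  s bounds the inner integral by the root of the envelope mass, so square integrability of w is what
  Fubini needs.\<close>

lemma field_fubini:
  fixes w :: "real \<times> 'w \<Rightarrow> complex"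
  assumes w[measurable]: "w \<in> borel_measurable path_space" and w2: "integrable path_space (\<lambda>p. (cmod (w p))\<^sup>2)"
  shows "(\<integral>s. U x s * (\<integral>p. w p * cnj (lfield p s) \<partial>path_space) \<partial>\<mu>) = (\<integral>p. w p * cnj (lcoord x p) \<partial>path_space)"
proof -
  define H where "H p s = w p * cnj (lfield p s) * U x s" for p s
  have Hm[measurable]: "(\<lambda>q. H (fst q) (snd q)) \<in> borel_measurable (path_space \<Otimes>\<^sub>M \<mu>)"
    unfolding H_def by measurable
  have inner_int: "integrable \<mu> (\<lambda>s. lfield p s * cnj (U x s))" "integrable \<mu> (\<lambda>s. cmod (lfield p s) * cmod (U x s))"
    if "regular_path p" for p
    by (intro L2_product_integrable field_L2 dominated_limit_kernel that U_L2)+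
  have hc: "cnj (lfield p s) * U x s = cnj (lfield p s * cnj (U x s))" for p s by simp
  have int: "integrable (path_space \<Otimes>\<^sub>M \<mu>) (\<lambda>q. H (fst q) (snd q))"
  proof (rule tMmu.Fubini_integrable)
    show "AE p in path_space. integrable \<mu> (\<lambda>s. H (fst (p, s)) (snd (p, s)))"
      using AE_regular_path
    proof eventually_elim
      case (elim p)
      show ?case
        unfolding H_def mult.assoc hc fst_conv snd_conv by (intro integrable_mult_right integrable_cnj inner_int elim)
    qed
    show "integrable path_space (\<lambda>p. \<integral>s. norm (H (fst (p, s)) (snd (p, s))) \<partial>\<mu>)"
    proof (rule Bochner_Integration.integrable_bound)
      show "integrable path_space (\<lambda>p. (cmod (w p))\<^sup>2 + envelope_mass p * (norm x)\<^sup>2)"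
        using w2 envelope_mass_integrable by simp
      have "(\<lambda>p. \<integral>s. norm (H p s) \<partial>\<mu>) \<in> borel_measurable path_space"
        by (rule mu.borel_measurable_lebesgue_integral) (simp add: case_prod_beta')
      then show "(\<lambda>p. \<integral>s. norm (H (fst (p, s)) (snd (p, s))) \<partial>\<mu>) \<in> borel_measurable path_space" by simp
      show "AE p in path_space. norm (\<integral>s. norm (H (fst (p, s)) (snd (p, s))) \<partial>\<mu>) \<le> norm ((cmod (w p))\<^sup>2 + envelope_mass p * (norm x)\<^sup>2)"
        using AE_regular_path
      proof eventually_elim
        case (elim p)
        have "(\<integral>s. norm (H p s) \<partial>\<mu>) = cmod (w p) * (\<integral>s. cmod (lfield p s) * cmod (U x s) \<partial>\<mu>)"
          by (simp add: H_def norm_mult mult.assoc)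
        also have "\<dots> \<le> cmod (w p) * (sqrt (envelope_mass p) * norm x)"
          by (intro mult_left_mono field_U_integral_le elim) simp
        also have "\<dots> \<le> (cmod (w p))\<^sup>2 + (sqrt (envelope_mass p) * norm x)\<^sup>2"
        proof -
          have "0 \<le> cmod (w p) * (sqrt (envelope_mass p) * norm x)" by (simp add: envelope_mass_nonneg)
          then show ?thesis using sum_squares_bound[of "cmod (w p)" "sqrt (envelope_mass p) * norm x"] by linarith
        qed
        also have "\<dots> = (cmod (w p))\<^sup>2 + envelope_mass p * (norm x)\<^sup>2"
          by (simp add: power_mult_distrib envelope_mass_nonneg)
        finally have le: "(\<integral>s. norm (H p s) \<partial>\<mu>) \<le> (cmod (w p))\<^sup>2 + envelope_mass p * (norm x)\<^sup>2" .
        have "0 \<le> (\<integral>s. norm (H p s) \<partial>\<mu>)" by simp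
        then show ?case using le by simp
      qed
    qed
  qed measurable
  then have int': "integrable (path_space \<Otimes>\<^sub>M \<mu>) (\<lambda>(p, s). H p s)" by (simp add: case_prod_beta')
  have "(\<integral>s. U x s * (\<integral>p. w p * cnj (lfield p s) \<partial>path_space) \<partial>\<mu>) = (\<integral>s. (\<integral>p. H p s \<partial>path_space) \<partial>\<mu>)"
    by (simp add: H_def mult.commute[of "U x _"])
  also have "\<dots> = (\<integral>p. (\<integral>s. H p s \<partial>\<mu>) \<partial>path_space)"
    by (rule tMmu.Fubini_integral[OF int'])
  also have "\<dots> = (\<integral>p. w p * cnj (lcoord x p) \<partial>path_space)"
  proof (rule Bochner_Integration.integral_cong)
    fix p
    have "(\<integral>s. H p s \<partial>\<mu>) = w p * (\<integral>s. cnj (lfield p s * cnj (U x s)) \<partial>\<mu>)"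
      unfolding H_def mult.assoc hc by simp
    also have "(\<integral>s. cnj (lfield p s * cnj (U x s)) \<partial>\<mu>) = cnj (lcoord x p)"
      unfolding coord_def L2_inner_def by (rule Bochner_Integration.integral_cnj)
    finally show "(\<integral>s. H p s \<partial>\<mu>) = w p * cnj (lcoord x p)" .
  qed simp
  finally show ?thesis .
qed

lemma AE_field_square_integrable: "AE r in \<mu>. integrable path_space (\<lambda>p. (cmod (lfield p r))\<^sup>2)"
proof -
  have "integrable (path_space \<Otimes>\<^sub>M \<mu>) (\<lambda>q. (cmod (lfield (fst q) (snd q)))\<^sup>2)"
  proof (rule Bochner_Integration.integrable_bound[OF envelope_integrable])
    show "AE q in path_space \<Otimes>\<^sub>M \<mu>. norm ((cmod (lfield (fst q) (snd q)))\<^sup>2) \<le> norm (envelope (fst q) (snd q))"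
      using field_bound[OF dominated_limit_kernel]
      by (intro AE_I2) (auto simp: space_pair_measure envelope_nonneg)
  qed measurable
  then have "integrable (path_space \<Otimes>\<^sub>M \<mu>) (\<lambda>(p, r). (cmod (lfield p r))\<^sup>2)" by (simp add: case_prod_beta')
  then show ?thesis by (rule tMmu.AE_integrable_snd)
qed

lemma AE_u_measurable: "AE s in \<mu>. (\<lambda>\<omega>. u \<omega> s) \<in> borel_measurable M"
  using AE_space by eventually_elim (rule u_measurable_comp; simp)

text \<open>On the product of time and probability, the mixed moment of the limit field at r and s
  factors into \<open>cov_kernel\<close> and \<open>cross_moment\<close>. Exchanging the integrals
  then turns the kernel operator into a path integral.\<close>

lemma cov_image_AE: "AE r in \<mu>. cov_image y r = (\<integral>p. lfield p r * cnj (lcoord y p) \<partial>path_space)"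
  using AE_field_square_integrable AE_second_moment AE_space AE_u_measurable
proof eventually_elim
  case (elim r)
  note ur[measurable] = elim(4)
  have [measurable]: "(\<lambda>p. lfield p r) \<in> borel_measurable path_space"
    by (rule lfield_measurable) (use elim in auto)
  have "(\<integral>p. lfield p r * cnj (lcoord y p) \<partial>path_space) = (\<integral>s. U y s * (\<integral>p. lfield p r * cnj (lfield p s) \<partial>path_space) \<partial>\<mu>)"
    by (rule field_fubini[symmetric]) (use elim in auto)
  also have "\<dots> = cov_image y r"
    unfolding cov_image_def
  proof (rule integral_cong_AE)
    show "AE s in \<mu>. U y s * (\<integral>p. lfield p r * cnj (lfield p s) \<partial>path_space) = cov_kernel r s * cross_moment M u r s * U y s"
      using AE_second_moment AE_space AE_u_measurable
    proof eventually_elim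
      case (elim s)
      note us[measurable] = elim(3)
      have ir: "integrable M (\<lambda>\<omega>. (cmod (u \<omega> r))\<^sup>2)" using \<open>integrable M (\<lambda>\<omega>. (cmod (u \<omega> r))\<^sup>2) \<and> _\<close> by blast
      have iu: "integrable M (\<lambda>\<omega>. u \<omega> r * cnj (u \<omega> s))"
        by (rule L2_product_integrable) (use ir elim in \<open>auto simp: L2_def\<close>)
      have K: "has_bochner_integral lborel (\<lambda>\<tau>. limit_kernel \<tau> (d r) * cnj (limit_kernel \<tau> (d s))) (cov_kernel r s)"
        using \<open>r \<in> space \<mu>\<close> elim by (intro cov_kernel_integral) auto
      have "(\<integral>p. lfield p r * cnj (lfield p s) \<partial>path_space) =
        (\<integral>p. (limit_kernel (fst p) (d r) * cnj (limit_kernel (fst p) (d s))) * (u (snd p) r * cnj (u (snd p) s)) \<partial>path_space)"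
        by (rule Bochner_Integration.integral_cong) (simp_all add: field_def mult_ac)
      also have "\<dots> = cov_kernel r s * cross_moment M u r s"
        using path_product_integral[OF _ iu, of "\<lambda>\<tau>. limit_kernel \<tau> (d r) * cnj (limit_kernel \<tau> (d s))"] K
        by (simp add: has_bochner_integral_iff cross_moment_def)
      finally show ?case by (simp add: mult.commute)
    qed
    have r: "r \<in> space \<mu>" by fact
    have "(\<lambda>s. \<integral>p. lfield p r * cnj (lfield p s) \<partial>path_space) \<in> borel_measurable \<mu>"
    proof (rule tM.borel_measurable_lebesgue_integral)
      show "(\<lambda>(s, p). lfield p r * cnj (lfield p s)) \<in> borel_measurable (\<mu> \<Otimes>\<^sub>M path_space)"
        unfolding case_prod_beta'
        by (intro borel_measurable_times borel_measurable_cnj_comp lfield_measurable measurable_const[OF r] measurable_snd measurable_fst)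
    qed
    then show "(\<lambda>s. U y s * (\<integral>p. lfield p r * cnj (lfield p s) \<partial>path_space)) \<in> borel_measurable \<mu>" by measurable
    have m1: "(\<lambda>s. \<integral>\<tau>. limit_kernel \<tau> (d r) * cnj (limit_kernel \<tau> (d s)) \<partial>lborel) \<in> borel_measurable \<mu>"
      by (rule lborel.borel_measurable_lebesgue_integral) (simp add: case_prod_beta', measurable)
    have "cov_kernel r \<in> borel_measurable \<mu>"
      by (rule measurable_cong[THEN iffD1, OF _ m1]) (use cov_kernel_integral[OF r] in \<open>simp add: has_bochner_integral_iff\<close>)
    moreover have "(\<lambda>s. cross_moment M u r s) \<in> borel_measurable \<mu>"
      unfolding cross_moment_def
      by (rule borel_measurable_lebesgue_integral)
        (unfold case_prod_beta', intro borel_measurable_times borel_measurable_cnj_comp u_measurable_comp measurable_const[OF r] measurable_snd measurable_fst)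
    ultimately show "(\<lambda>s. cov_kernel r s * cross_moment M u r s * U y s) \<in> borel_measurable \<mu>" by measurable
  qed
  finally show ?case ..
qed

text \<open>\<open>L2_adjoint\<close> is a definite description, so a representing vector has to be
  exhibited. \<open>cov_represent\<close> supplies it, once Fubini has identified the pairing of
  \<open>U x\<close> with \<open>cov_image y\<close> as \<open>cov x y\<close>.\<close>

lemma cinner_limit_covariance: "cinner x (limit_covariance M \<mu> U d u y) = cov x y"
proof -
  obtain c where c: "\<And>x. cov x y = cinner x c" using cov_represent by blast
  have "L2_inner \<mu> (U x) (cov_image y) = cov x y" for x
  proof -
    have w2: "integrable path_space (\<lambda>p. (cmod (lcoord y p))\<^sup>2)"
      unfolding power2_eq_square
      by (rule coord_product_integrable[OF dominated_limit_kernel, where F = "\<lambda>a b. cmod a * cmod b"]) (auto, measurable)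
    have [measurable]: "cov_image y \<in> borel_measurable \<mu>" by (rule cov_image_measurable)
    have [measurable]: "(\<lambda>s. \<integral>p. lcoord y p * cnj (lfield p s) \<partial>path_space) \<in> borel_measurable \<mu>"
    proof (rule tM.borel_measurable_lebesgue_integral)
      show "(\<lambda>(s, p). lcoord y p * cnj (lfield p s)) \<in> borel_measurable (\<mu> \<Otimes>\<^sub>M path_space)"
        unfolding case_prod_beta' by measurable
    qed
    have "L2_inner \<mu> (U x) (cov_image y) = (\<integral>s. U x s * (\<integral>p. lcoord y p * cnj (lfield p s) \<partial>path_space) \<partial>\<mu>)"
      unfolding L2_inner_def
    proof (rule integral_cong_AE)
      show "AE s in \<mu>. U x s * cnj (cov_image y s) = U x s * (\<integral>p. lcoord y p * cnj (lfield p s) \<partial>path_space)"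
        using cov_image_AE[of y]
      proof eventually_elim
        case (elim s)
        have "cnj (cov_image y s) = (\<integral>p. cnj (lfield p s * cnj (lcoord y p)) \<partial>path_space)"
          unfolding elim by (rule Bochner_Integration.integral_cnj[symmetric])
        then show ?case by (simp add: mult.commute)
      qed
    qed measurable
    also have "\<dots> = (\<integral>p. lcoord y p * cnj (lcoord x p) \<partial>path_space)"
      by (rule field_fubini[OF _ w2]) measurable
    also have "\<dots> = cov x y" by (simp add: cov_def mult.commute)
    finally show ?thesis .
  qed
  then have "L2_adjoint \<mu> U (cov_image y) = c"
    by (intro L2_adjoint_eqI) (simp add: c)
  then show ?thesis by (simp add: limit_covariance_eq c)
qed

section \<open>The Gaussian limit law in complex terms\<close>

context
  fixes P :: "'h measure"
  assumes P: "prob_space P" and Pb[measurable_cong]: "sets P = sets borel"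
    and chP: "\<And>x. (CLINT y|P. iexp (inner y x)) = exp (- limit_form x x / 2)"
    and P2: "integrable P (\<lambda>y. (norm y)\<^sup>2)"
begin

interpretation P: prob_space P by (rule P)

interpretation B: bounded_bilinear limit_form by (rule limit_form_bounded_bilinear)

lemma limit_form_nonneg: "limit_form x x \<ge> 0"
  unfolding limit_form_def by (intro Bochner_Integration.integral_nonneg) simp

lemma char_inner: "char (distr P borel (\<lambda>y. inner y x)) t = exp (- (t\<^sup>2 * limit_form x x) / 2)"
proof -
  have "char (distr P borel (\<lambda>y. inner y x)) t = (CLINT y|P. iexp (inner y (t *\<^sub>R x)))"
    unfolding char_def by (subst integral_distr) auto
  then show ?thesis
    unfolding chP by (simp add: B.scaleR_left B.scaleR_right power2_eq_square mult.assoc)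
qed

lemma inner_measurable_P: "(\<lambda>y. inner y x) \<in> borel_measurable P"
  by measurable

lemmas inner_normal = P.normal_of_char[OF inner_measurable_P limit_form_nonneg char_inner]

lemma inner_gaussian: "real_gaussian P (\<lambda>y. inner y x)"
  unfolding real_gaussian_def
proof (intro conjI inner_measurable_P)
  show "\<exists>m \<sigma>. (\<sigma> > 0 \<and> distr P borel (\<lambda>y. inner y x) = density lborel (normal_density m \<sigma>))
         \<or> distr P borel (\<lambda>y. inner y x) = return borel m"
  proof (cases "limit_form x x = 0")
    case True
    then show ?thesis using inner_normal(1)[of x] by auto
  next
    case False
    then have "sqrt (limit_form x x) > 0" using limit_form_nonneg[of x] by simp
    moreover have "distr P borel (\<lambda>y. inner y x) = density lborel (normal_density 0 (sqrt (limit_form x x)))"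
      using inner_normal(1)[of x] False by simp
    ultimately show ?thesis by blast
  qed
qed

lemma limit_hilbert_gaussian: "hilbert_gaussian P (\<lambda>y. y)"
  unfolding hilbert_gaussian_def complex_gaussian_def
proof (intro conjI allI impI)
  show "(\<lambda>y. y) \<in> borel_measurable P" by measurable
  fix f :: "'h \<Rightarrow>\<^sub>L complex" and a b :: real
  \<comment> \<open>Any real combination of real and imaginary part is a bounded real-linear
    functional, hence an inner product with some x, whose law is known.\<close>
  have "bounded_linear (\<lambda>y. a * Re (f y) + b * Im (f y))"
    by (intro bounded_linear_add bounded_linear_const_mult bounded_linear_compose[OF bounded_linear_Re]
      bounded_linear_compose[OF bounded_linear_Im] blinfun.bounded_linear_right)
  from riesz_representation[OF this] obtain x where "\<And>y. a * Re (f y) + b * Im (f y) = inner y x" by blast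
  then show "real_gaussian P (\<lambda>y. a * Re (f y) + b * Im (f y))" using inner_gaussian[of x] by simp
qed

lemma limit_integrable: "integrable P (\<lambda>y. y)"
  by (rule P.integrable_of_norm_sq[OF _ P2]) measurable

lemma limit_expectation: "P.expectation (\<lambda>y. y) = 0"
proof -
  have "inner (P.expectation (\<lambda>y. y)) x = 0" for x
  proof -
    have "inner (P.expectation (\<lambda>y. y)) x = P.expectation (\<lambda>y. inner y x)"
      by (rule integral_inner_left[symmetric]) (use limit_integrable in simp)
    then show ?thesis using inner_normal(3)[of x] by simp
  qed
  then show ?thesis using inner_eq_zero_iff by blast
qed

text \<open>Polarisation reduces mixed moments to the variances known from the characteristic
  function.\<close>

lemma limit_inner_product:
  "integrable P (\<lambda>y. inner y a * inner y b)" "P.expectation (\<lambda>y. inner y a * inner y b) = limit_form a b"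
proof -
  have e: "inner y a * inner y b = ((inner y (a + b))\<^sup>2 - (inner y a)\<^sup>2 - (inner y b)\<^sup>2) / 2" for y
    by (simp add: inner_add_right power2_sum)
  show "integrable P (\<lambda>y. inner y a * inner y b)"
    unfolding e by (intro integrable_divide Bochner_Integration.integrable_diff inner_normal(4))
  have "P.expectation (\<lambda>y. inner y a * inner y b) = (limit_form (a + b) (a + b) - limit_form a a - limit_form b b) / 2"
    unfolding e
    by (simp add: Bochner_Integration.integral_diff inner_normal(4) inner_normal(5))
  also have "\<dots> = limit_form a b"
    by (simp add: B.add_left B.add_right limit_form_sym[of b a])
  finally show "P.expectation (\<lambda>y. inner y a * inner y b) = limit_form a b" .
qed

text \<open>The product of the two complex inner products expands into the same four real products
  as the integrand of \<open>cov\<close>, so both agree term by term.\<close>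

lemma limit_has_covariance: "has_covariance_operator P (\<lambda>y. y) (limit_covariance M \<mu> U d u)"
  unfolding has_covariance_operator_def cinner_limit_covariance
proof (intro allI)
  fix x y :: 'h
  let ?I = "\<lambda>a z. inner z a" and ?ix = "\<i> *\<^sub>C x" and ?iy = "\<i> *\<^sub>C y"
  note i = limit_inner_product(1) and v = limit_inner_product(2)
  have eq: "cinner x z * cinner z y = complex_of_real (?I x z * ?I y z + ?I ?ix z * ?I ?iy z) +
      \<i> * complex_of_real (?I x z * ?I ?iy z - ?I ?ix z * ?I y z)" for z
  proof -
    have "cinner x z = complex_of_real (?I x z) - \<i> * complex_of_real (?I ?ix z)"
      by (subst cinner_commute) (simp add: cinner_conv_inner[of z x])
    then show ?thesis
      unfolding cinner_conv_inner[of z y] by (simp add: complex_eq_iff)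
  qed
  have a: "integrable P (\<lambda>z. complex_of_real (?I x z * ?I y z + ?I ?ix z * ?I ?iy z))"
    by (intro integrable_of_real Bochner_Integration.integrable_add i)
  have b: "integrable P (\<lambda>z. \<i> * complex_of_real (?I x z * ?I ?iy z - ?I ?ix z * ?I y z))"
    by (intro integrable_mult_right integrable_of_real Bochner_Integration.integrable_diff i)
  have "(\<integral>z. cinner x z * cinner z y \<partial>P) = complex_of_real (\<integral>z. ?I x z * ?I y z + ?I ?ix z * ?I ?iy z \<partial>P) +
    \<i> * complex_of_real (\<integral>z. ?I x z * ?I ?iy z - ?I ?ix z * ?I y z \<partial>P)"
    unfolding eq Bochner_Integration.integral_add[OF a b] integral_mult_right_zero integral_complex_of_real ..
  also have "\<dots> = cov x y"
    unfolding cov_conv_limit_form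
    by (simp only: Bochner_Integration.integral_add[OF i i] Bochner_Integration.integral_diff[OF i i] v)
  finally show "integrable P (\<lambda>z. cinner x z * cinner z y) \<and> (\<integral>z. cinner x z * cinner z y \<partial>P) = cov x y"
    unfolding eq using Bochner_Integration.integrable_add[OF a b] by simp
qed

end

text \<open>The limit is realised as the identity map on the Hilbert space equipped with its own
  law.\<close>

lemma normalized_sum_clt:
  "\<exists>(P :: 'h measure) (G :: 'h \<Rightarrow> 'h).
    prob_space P \<and> hilbert_gaussian P G \<and>
    integrable P G \<and> prob_space.expectation P G = 0 \<and>
    has_covariance_operator P G (limit_covariance M \<mu> U d u) \<and>
    converges_in_distribution M
      (\<lambda>n \<omega>. op_powr (real n) (- ((3/2) *\<^sub>R id_blinfun - N)) (partial_sum N \<epsilon> n \<omega>)) P G"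
proof -
  obtain P where P: "prob_space P" and Pb: "sets P = sets borel"
    and chP: "\<And>x. (CLINT y|P. iexp (inner y x)) = exp (- limit_form x x / 2)"
    and P2: "integrable P (\<lambda>y. (norm y)\<^sup>2)"
    and conv: "\<And>f :: 'h \<Rightarrow> real. continuous_on UNIV f \<and> bounded (range f) \<Longrightarrow>
      (\<lambda>n. \<integral>\<omega>. f (norm_op n (partial_sum N \<epsilon> n \<omega>)) \<partial>M) \<longlonglongrightarrow> (\<integral>y. f y \<partial>P)"
    using array_clt by blast
  note facts = P Pb chP P2
  have "converges_in_distribution M (\<lambda>n \<omega>. norm_op n (partial_sum N \<epsilon> n \<omega>)) P (\<lambda>y. y)"
    unfolding converges_in_distribution_def
    using normed_partial_sum_measurable conv Pb by (auto cong: measurable_cong_sets)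
  then show ?thesis
    unfolding norm_op_def
    by (intro exI[of _ P] exI[of _ "\<lambda>y. y"] conjI P limit_hilbert_gaussian[OF facts] limit_integrable[OF facts]
      limit_expectation[OF facts] limit_has_covariance[OF facts])
qed

end

theorem theorem2p1:
  fixes N :: "'h::{complex_hilbert, second_countable_topology} \<Rightarrow>\<^sub>L 'h"
    and \<mu> :: "'s measure" and U :: "'h \<Rightarrow> 's \<Rightarrow> complex" and d :: "'s \<Rightarrow> complex"
    and M :: "'w measure" and \<epsilon> :: "int \<Rightarrow> 'w \<Rightarrow> 'h" and u :: "'w \<Rightarrow> 's \<Rightarrow> complex"
  assumes "normal_op N"
    and "spectral_representation \<mu> U d N"
    and "prob_space M"
    and "prob_space.indep_vars M (\<lambda>_. borel) \<epsilon> UNIV"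
    and "\<And>k. distr M borel (\<epsilon> k) = distr M borel (\<epsilon> 0)"
    and "prob_space.expectation M (\<epsilon> 0) = 0"
    and "integrable M (\<lambda>\<omega>. (norm (\<epsilon> 0 \<omega>))\<^sup>2)"
    and "measurable_version M \<mu> (\<lambda>\<omega>. U (\<epsilon> 0 \<omega>)) u"
    and "\<And>s. s \<in> space \<mu> \<Longrightarrow> 1/2 < Re (d s) \<and> Re (d s) < 1"
    and "integrable \<mu> (\<lambda>s. second_moment M u s / (1 - Re (d s))\<^sup>2)"
    and "integrable \<mu> (\<lambda>s. second_moment M u s / ((1 - Re (d s)) * (2 * Re (d s) - 1)))"
  shows "\<exists>(P :: 'h measure) (G :: 'h \<Rightarrow> 'h).
    prob_space P \<and> hilbert_gaussian P G \<and>
    integrable P G \<and> prob_space.expectation P G = 0 \<and>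
    has_covariance_operator P G (limit_covariance M \<mu> U d u) \<and>
    converges_in_distribution M
      (\<lambda>n \<omega>. op_powr (real n) (- ((3/2) *\<^sub>R id_blinfun - N)) (partial_sum N \<epsilon> n \<omega>)) P G"
proof -
  have "spectral_process \<mu> U M N d \<epsilon> u"
    using assms(2) by (intro spectral_process.intro unitary_rep.intro spectral_process_axioms.intro assms(3-))
      (auto simp: spectral_representation_def)
  then show ?thesis by (rule spectral_process.normalized_sum_clt)
qed

end
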